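(* Let $\underline{C}$ be a triangulated category endowed with a weight structure $w$ and let $\underline{C}'$ be an idempotent extension of $\underline{C}$. I.1. Assume that $w'$ is an extension of $w$ to $\underline{C}'$. Then $\underline{C}'_{w'\le 0}$ (resp. $\underline{C}'_{w'\ge 0}$, $\underline{C}'_{w'=0}$) is the retraction-closure of $\underline{C}_{w\le 0}$ (resp. $\underline{C}_{w\ge 0}$, $\underline{C}_{w=0}$) in $\underline{C}'$. I.2. An extension of $w$ to $\underline{C}'$ exists if and only if $\underline{C}'$ is strongly generated by $\operatorname{Obj}\underline{C}\cup C_1\cup C_2$ for some class $C_1$ of $\underline{C}'$-retracts of objects of $\underline{C}^+$ and some class $C_2$ of $\underline{C}'$-retracts of objects of $\underline{C}^-$. II.1. An extension $w'$ of $w$ to $\underline{C}'$ is bounded below (resp. above) if and only if $w$ is. II.2. Assume that $w$ is either bounded below or bounded above. Then $w$ extends to any idempotent extension of $\underline{C}$. III.1. We have $\operatorname{Kar}^w_{\min}(\underline{C})\subset\operatorname{Kar}^w_{\max}(\underline{C})$, and these categories, when equipped with the unique extensions of $w$ to them, are weight-Karoubian extensions of $\underline{C}$. III.2. If $(\underline{C}',w')$ is a weight-Karoubian extension of $(\underline{C},w)$, then the heart $\underline{Hw}'$ is equivalent to the idempotent completion of the heart $\underline{Hw}$. III.3. If $w$ extends to $\underline{C}'$, then there exists a fully faithful exact functor from $\underline{C}'$ into $\operatorname{Kar}^w_{\max}(\underline{C})$; this functor is weight-exact with respect to the corresponding extended weight structures. III.4. If $\underline{C}'$ (with an extension $w'$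 of $w$) is a weight-Karoubian extension of $\underline{C}$, then there exists a fully faithful weight-exact functor $\operatorname{Kar}^w_{\min}(\underline{C})\to\underline{C}'$.
   Context: $X$ is a retract of $Y$ if $\operatorname{id}_X$ factors through $Y$. A class of objects is retraction-closed in a category if it contains all retracts of its elements; the retraction-closure is the smallest retraction-closed class containing a given one. $D\perp E$ means that there are no non-zero morphisms from any $X\in D$ to any $Y\in E$. A weight structure $w$ on a triangulated category $\underline{C}$ is a pair of classes $\underline{C}_{w\le 0},\underline{C}_{w\ge 0}\subset \operatorname{Obj}\underline{C}$ such that: (i) both are retraction-closed in $\underline{C}$; (ii) $\underline{C}_{w\le 0}\subset \underline{C}_{w\le 0}[1]$ and $\underline{C}_{w\ge 0}[1]\subset \underline{C}_{w\ge 0}$; (iii) $\underline{C}_{w\le 0}\perp \underline{C}_{w\ge 0}[1]$; (iv) for every $M\in\operatorname{Obj}\underline{C}$ there is a distinguished triangle $X\to M\to Y\to X[1]$ with $X\in \underline{C}_{w\le 0}$ and $Y\in \underline{C}_{w\ge 0}[1]$. Put $\underline{C}_{w\ge i}=\underline{C}_{w\ge 0}[i]$, $\underline{C}_{w\le i}=\underline{C}_{w\le 0}[i]$, $\underline{C}_{w=0}=\underline{C}_{w\ge 0}\cap\underline{C}_{w\le 0}$. The heart $\underline{Hw}$ is the full subcategory with object class $\underline{C}_{w=0}$. Let $\underline{C}^-$ (resp. $\underline{C}^+$) be the full subcategory of $\underline{C}$ with object class $\bigcup_{i\in\mathbb{Z}}\underline{C}_{w\le i}$ (resp. $\bigcup_{i\in\mathbb{Z}}\underline{C}_{w\ge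 i}$); these are retraction-closed triangulated subcategories. $w$ is bounded above (resp. below) if $\underline{C}^-=\underline{C}$ (resp. $\underline{C}^+=\underline{C}$). An exact functor $F:(\underline{C},w)\to(\underline{C}',w')$ is weight-exact if $F(\underline{C}_{w\le 0})\subset \underline{C}'_{w'\le 0}$ and $F(\underline{C}_{w\ge 0})\subset \underline{C}'_{w'\ge 0}$. $\operatorname{Kar}(\underline{B})$ is the idempotent completion of an additive category $\underline{B}$; for triangulated $\underline{C}$, $\operatorname{Kar}(\underline{C})$ carries a natural triangulated structure for which $\underline{C}\to\operatorname{Kar}(\underline{C})$ is exact. A triangulated category $\underline{C}'$ is an idempotent extension of $\underline{C}$ if it contains $\underline{C}$ (as a full triangulated subcategory) and there is a fully faithful exact functor $\underline{C}'\to\operatorname{Kar}(\underline{C})$; equivalently, every object of $\underline{C}'$ is a retract of some object of $\underline{C}$. An extension of $w$ to $\underline{C}'$ is a weight structure $w'$ on $\underline{C}'$ such that the embedding $\underline{C}\to\underline{C}'$ is weight-exact; $w$ extends to $\underline{C}'$ if such $w'$ exists. $(\underline{C}',w')$ is weight-Karoubian if its heart $\underline{Hw}'$ is idempotent complete; it is a weight-Karoubian extension of $(\underline{C},w)$ if moreover $\underline{C}'$ is an idempotent extension of $\underline{C}$ and $w'$ is an extension of $w$. For a class $D$ of objects of a triangulated category $\underline{D}$, $\langle D\rangle_{\underline{D}}$ is the smallest full strict (isomorphism-closed) triangulated subcategory of $\underline{D}$ containing $D$; $D$ strongly generates $\langle D\rangle_{\underline{D}}$. Define $\operatorname{Kar}^w_{\min}(\underline{C})=\langle\operatorname{Obj}\underline{C}\cup\operatorname{Obj}\operatorname{Kar}(\underline{Hw})\rangle_{\operatorname{Kar}(\underline{C})}$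 and $\operatorname{Kar}^w_{\max}(\underline{C})=\langle\operatorname{Obj}\operatorname{Kar}(\underline{C}^-)\cup\operatorname{Obj}\operatorname{Kar}(\underline{C}^+)\rangle_{\operatorname{Kar}(\underline{C})}$. *)

theory Defs
  imports "HOL-Algebra.Group"
begin

section \<open>Additive categories\<close>

text \<open>
  A category has a carrier set of objects and a carrier set of arrows, each arrow having a unique
  source and target; \<open>g \<cdot> f\<close> is "first \<open>f\<close>, then \<open>g\<close>". Values outside the carriers are irrelevant.
\<close>

record ('o, 'm) acat =
  Obj :: "'o set"
  Arr :: "'m set"
  src :: "'m \<Rightarrow> 'o"
  tgt :: "'m \<Rightarrow> 'o"
  ident :: "'o \<Rightarrow> 'm"
  cmp :: "'m \<Rightarrow> 'm \<Rightarrow> 'm"  (infixl "\<cdot>\<index>" 70)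
  zeroarr :: "'o \<Rightarrow> 'o \<Rightarrow> 'm"
  addarr :: "'m \<Rightarrow> 'm \<Rightarrow> 'm"

definition homs :: "('o, 'm, 'z) acat_scheme \<Rightarrow> 'o \<Rightarrow> 'o \<Rightarrow> 'm set" where
  "homs C X Y = {f \<in> Arr C. src C f = X \<and> tgt C f = Y}"

definition hom_group :: "('o, 'm, 'z) acat_scheme \<Rightarrow> 'o \<Rightarrow> 'o \<Rightarrow> 'm monoid" where
  "hom_group C X Y = \<lparr>carrier = homs C X Y, mult = addarr C, one = zeroarr C X Y\<rparr>"

definition negarr :: "('o, 'm, 'z) acat_scheme \<Rightarrow> 'm \<Rightarrow> 'm" where
  "negarr C f = m_inv (hom_group C (src C f) (tgt C f)) f"

locale category =
  fixes C :: "('o, 'm, 'z) acat_scheme" (structure)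
  assumes src_in: "f \<in> Arr C \<Longrightarrow> src C f \<in> Obj C"
    and tgt_in: "f \<in> Arr C \<Longrightarrow> tgt C f \<in> Obj C"
    and ident_in: "X \<in> Obj C \<Longrightarrow> ident C X \<in> homs C X X"
    and cmp_in: "f \<in> homs C X Y \<Longrightarrow> g \<in> homs C Y Z \<Longrightarrow> g \<cdot> f \<in> homs C X Z"
    and ident_left: "f \<in> homs C X Y \<Longrightarrow> ident C Y \<cdot> f = f"
    and ident_right: "f \<in> homs C X Y \<Longrightarrow> f \<cdot> ident C X = f"
    and cmp_assoc: "f \<in> homs C W X \<Longrightarrow> g \<in> homs C X Y \<Longrightarrow> h \<in> homs C Y Z
      \<Longrightarrow> h \<cdot> (g \<cdot> f) = (h \<cdot> g) \<cdot> f"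

definition zero_object :: "('o, 'm, 'z) acat_scheme \<Rightarrow> 'o \<Rightarrow> bool" where
  "zero_object C Z \<longleftrightarrow> Z \<in> Obj C \<and> ident C Z = zeroarr C Z Z"

locale additive_category = category +
  assumes hom_comm_group:
      "X \<in> Obj C \<Longrightarrow> Y \<in> Obj C \<Longrightarrow> comm_group (hom_group C X Y)"
    and cmp_add_left: "f \<in> homs C X Y \<Longrightarrow> g \<in> homs C Y Z \<Longrightarrow> g' \<in> homs C Y Z
      \<Longrightarrow> addarr C g g' \<cdot> f = addarr C (g \<cdot> f) (g' \<cdot> f)"
    and cmp_add_right: "f \<in> homs C X Y \<Longrightarrow> f' \<in> homs C X Y \<Longrightarrow> g \<in> homs C Y Z
      \<Longrightarrow> g \<cdot> addarr C f f' = addarr C (g \<cdot> f) (g \<cdot> f')"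
    and zero_object_exists: "\<exists>Z. zero_object C Z"
    and biproduct_exists: "X \<in> Obj C \<Longrightarrow> Y \<in> Obj C \<Longrightarrow>
      \<exists>S \<in> Obj C. \<exists>i \<in> homs C X S. \<exists>j \<in> homs C Y S. \<exists>p \<in> homs C S X. \<exists>q \<in> homs C S Y.
        p \<cdot> i = ident C X \<and> q \<cdot> j = ident C Y \<and> p \<cdot> j = zeroarr C Y X \<and> q \<cdot> i = zeroarr C X Y
        \<and> addarr C (i \<cdot> p) (j \<cdot> q) = ident C S"

definition iso_arr :: "('o, 'm, 'z) acat_scheme \<Rightarrow> 'o \<Rightarrow> 'o \<Rightarrow> 'm \<Rightarrow> bool" where
  "iso_arr C X Y f \<longleftrightarrow> f \<in> homs C X Y
     \<and> (\<exists>g \<in> homs C Y X. g \<cdot>\<^bsub>C\<^esub> f = ident C X \<and> f \<cdot>\<^bsub>C\<^esub> g = ident C Y)"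

definition isomorphic :: "('o, 'm, 'z) acat_scheme \<Rightarrow> 'o \<Rightarrow> 'o \<Rightarrow> bool" where
  "isomorphic C X Y \<longleftrightarrow> (\<exists>f. iso_arr C X Y f)"

definition retract :: "('o, 'm, 'z) acat_scheme \<Rightarrow> 'o \<Rightarrow> 'o \<Rightarrow> bool" where
  "retract C X Y \<longleftrightarrow> (\<exists>i \<in> homs C X Y. \<exists>r \<in> homs C Y X. r \<cdot>\<^bsub>C\<^esub> i = ident C X)"

definition retraction_closed :: "('o, 'm, 'z) acat_scheme \<Rightarrow> 'o set \<Rightarrow> bool" where
  "retraction_closed C D \<longleftrightarrow> (\<forall>X \<in> Obj C. \<forall>Y \<in> D. retract C X Y \<longrightarrow> X \<in> D)"

definition retraction_closure :: "('o, 'm, 'z) acat_scheme \<Rightarrow> 'o set \<Rightarrow> 'o set" where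
  "retraction_closure C D = \<Inter>{E. E \<subseteq> Obj C \<and> retraction_closed C E \<and> D \<subseteq> E}"

definition orthogonal :: "('o, 'm, 'z) acat_scheme \<Rightarrow> 'o set \<Rightarrow> 'o set \<Rightarrow> bool" where
  "orthogonal C D E \<longleftrightarrow> (\<forall>X \<in> D. \<forall>Y \<in> E. \<forall>f \<in> homs C X Y. f = zeroarr C X Y)"

definition idempotent_complete :: "('o, 'm, 'z) acat_scheme \<Rightarrow> bool" where
  "idempotent_complete C \<longleftrightarrow> (\<forall>X \<in> Obj C. \<forall>p \<in> homs C X X. p \<cdot>\<^bsub>C\<^esub> p = p \<longrightarrow>
     (\<exists>Y \<in> Obj C. \<exists>i \<in> homs C Y X. \<exists>r \<in> homs C X Y.
        r \<cdot>\<^bsub>C\<^esub> i = ident C Y \<and> i \<cdot>\<^bsub>C\<^esub> r = p))"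

definition full_sub :: "('o, 'm, 'z) acat_scheme \<Rightarrow> 'o set \<Rightarrow> ('o, 'm) acat" where
  "full_sub C S = \<lparr>Obj = S, Arr = {f \<in> Arr C. src C f \<in> S \<and> tgt C f \<in> S},
     src = src C, tgt = tgt C, ident = ident C, cmp = cmp C,
     zeroarr = zeroarr C, addarr = addarr C\<rparr>"


section \<open>Functors\<close>

record ('o, 'm, 'p, 'n) func =
  fobj :: "'o \<Rightarrow> 'p"
  fmor :: "'m \<Rightarrow> 'n"

definition id_func :: "('o, 'm, 'o, 'm) func" where
  "id_func = \<lparr>fobj = (\<lambda>X. X), fmor = (\<lambda>f. f)\<rparr>"

definition comp_func ::
  "('p, 'n, 'q, 'k) func \<Rightarrow> ('o, 'm, 'p, 'n) func \<Rightarrow> ('o, 'm, 'q, 'k) func" where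
  "comp_func G F = \<lparr>fobj = fobj G \<circ> fobj F, fmor = fmor G \<circ> fmor F\<rparr>"

definition additive_functor ::
  "('o, 'm, 'y) acat_scheme \<Rightarrow> ('p, 'n, 'z) acat_scheme \<Rightarrow> ('o, 'm, 'p, 'n) func \<Rightarrow> bool" where
  "additive_functor C D F \<longleftrightarrow>
     (\<forall>X \<in> Obj C. fobj F X \<in> Obj D)
   \<and> (\<forall>X \<in> Obj C. \<forall>Y \<in> Obj C. \<forall>f \<in> homs C X Y. fmor F f \<in> homs D (fobj F X) (fobj F Y))
   \<and> (\<forall>X \<in> Obj C. fmor F (ident C X) = ident D (fobj F X))
   \<and> (\<forall>X \<in> Obj C. \<forall>Y \<in> Obj C. \<forall>Z \<in> Obj C. \<forall>f \<in> homs C X Y. \<forall>g \<in> homs C Y Z.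
        fmor F (g \<cdot>\<^bsub>C\<^esub> f) = fmor F g \<cdot>\<^bsub>D\<^esub> fmor F f)
   \<and> (\<forall>X \<in> Obj C. \<forall>Y \<in> Obj C. \<forall>f \<in> homs C X Y. \<forall>g \<in> homs C X Y.
        fmor F (addarr C f g) = addarr D (fmor F f) (fmor F g))"

definition fully_faithful ::
  "('o, 'm, 'y) acat_scheme \<Rightarrow> ('p, 'n, 'z) acat_scheme \<Rightarrow> ('o, 'm, 'p, 'n) func \<Rightarrow> bool" where
  "fully_faithful C D F \<longleftrightarrow> (\<forall>X \<in> Obj C. \<forall>Y \<in> Obj C.
     bij_betw (fmor F) (homs C X Y) (homs D (fobj F X) (fobj F Y)))"

definition natural_iso ::
  "('o, 'm, 'y) acat_scheme \<Rightarrow> ('p, 'n, 'z) acat_scheme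
     \<Rightarrow> ('o, 'm, 'p, 'n) func \<Rightarrow> ('o, 'm, 'p, 'n) func \<Rightarrow> ('o \<Rightarrow> 'n) \<Rightarrow> bool" where
  "natural_iso C D F G \<eta> \<longleftrightarrow>
     (\<forall>X \<in> Obj C. iso_arr D (fobj F X) (fobj G X) (\<eta> X))
   \<and> (\<forall>X \<in> Obj C. \<forall>Y \<in> Obj C. \<forall>f \<in> homs C X Y. \<eta> Y \<cdot>\<^bsub>D\<^esub> fmor F f = fmor G f \<cdot>\<^bsub>D\<^esub> \<eta> X)"

definition naturally_isomorphic ::
  "('o, 'm, 'y) acat_scheme \<Rightarrow> ('p, 'n, 'z) acat_scheme
     \<Rightarrow> ('o, 'm, 'p, 'n) func \<Rightarrow> ('o, 'm, 'p, 'n) func \<Rightarrow> bool" where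
  "naturally_isomorphic C D F G \<longleftrightarrow> (\<exists>\<eta>. natural_iso C D F G \<eta>)"

definition equivalent_categories ::
  "('o, 'm, 'y) acat_scheme \<Rightarrow> ('p, 'n, 'z) acat_scheme \<Rightarrow> bool" where
  "equivalent_categories C D \<longleftrightarrow> (\<exists>F G. additive_functor C D F \<and> additive_functor D C G
     \<and> naturally_isomorphic C C (comp_func G F) id_func
     \<and> naturally_isomorphic D D (comp_func F G) id_func)"


section \<open>Triangulated categories\<close>

text \<open>
  The translation is a strict action of the integers: \<open>shO C n X\<close> is \<open>X[n]\<close> and \<open>shM C n f\<close> is
  \<open>f[n]\<close>. This is the same as giving the automorphism \<open>[1]\<close>. A candidate triangle
  \<open>X \<rightarrow> Y \<rightarrow> Z \<rightarrow> X[1]\<close> is recorded as the triple of its arrows.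
\<close>

record ('o, 'm) scat = "('o, 'm) acat" +
  shO :: "int \<Rightarrow> 'o \<Rightarrow> 'o"
  shM :: "int \<Rightarrow> 'm \<Rightarrow> 'm"

record ('o, 'm) tcat = "('o, 'm) scat" +
  Dist :: "('m \<times> 'm \<times> 'm) set"

definition shift_func :: "('o, 'm, 'z) scat_scheme \<Rightarrow> int \<Rightarrow> ('o, 'm, 'o, 'm) func" where
  "shift_func C n = \<lparr>fobj = shO C n, fmor = shM C n\<rparr>"

definition candidate_triangle :: "('o, 'm, 'z) scat_scheme \<Rightarrow> 'm \<times> 'm \<times> 'm \<Rightarrow> bool" where
  "candidate_triangle C = (\<lambda>(f, g, h). f \<in> Arr C \<and> g \<in> Arr C \<and> h \<in> Arr C
     \<and> src C g = tgt C f \<and> src C h = tgt C g \<and> tgt C h = shO C 1 (src C f))"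

definition triangle_map ::
  "('o, 'm, 'z) scat_scheme \<Rightarrow> 'm \<times> 'm \<times> 'm \<Rightarrow> 'm \<times> 'm \<times> 'm \<Rightarrow> 'm \<times> 'm \<times> 'm \<Rightarrow> bool" where
  "triangle_map C = (\<lambda>(f, g, h) (f', g', h') (a, b, c).
     a \<in> homs C (src C f) (src C f') \<and> b \<in> homs C (src C g) (src C g')
   \<and> c \<in> homs C (src C h) (src C h')
   \<and> b \<cdot>\<^bsub>C\<^esub> f = f' \<cdot>\<^bsub>C\<^esub> a \<and> c \<cdot>\<^bsub>C\<^esub> g = g' \<cdot>\<^bsub>C\<^esub> b \<and> shM C 1 a \<cdot>\<^bsub>C\<^esub> h = h' \<cdot>\<^bsub>C\<^esub> c)"

locale triangulated_category = additive_category C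
  for C :: "('o, 'm, 'z) tcat_scheme" (structure) +
  assumes shift_functor: "additive_functor C C (shift_func C n)"
    and shO_0: "X \<in> Obj C \<Longrightarrow> shO C 0 X = X"
    and shM_0: "f \<in> Arr C \<Longrightarrow> shM C 0 f = f"
    and shO_add: "X \<in> Obj C \<Longrightarrow> shO C (m + n) X = shO C m (shO C n X)"
    and shM_add: "f \<in> Arr C \<Longrightarrow> shM C (m + n) f = shM C m (shM C n f)"
    and dist_candidate: "T \<in> Dist C \<Longrightarrow> candidate_triangle C T"
    and TR1_iso: "\<lbrakk>T \<in> Dist C; candidate_triangle C T'; triangle_map C T T' (a, b, c);
        iso_arr C (src C a) (tgt C a) a; iso_arr C (src C b) (tgt C b) b;
        iso_arr C (src C c) (tgt C c) c\<rbrakk> \<Longrightarrow> T' \<in> Dist C"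
    and TR1_ident: "X \<in> Obj C \<Longrightarrow> zero_object C Z
        \<Longrightarrow> (ident C X, zeroarr C X Z, zeroarr C Z (shO C 1 X)) \<in> Dist C"
    and TR1_cone: "f \<in> Arr C \<Longrightarrow> \<exists>g h. (f, g, h) \<in> Dist C"
    and TR2: "candidate_triangle C (f, g, h)
        \<Longrightarrow> (f, g, h) \<in> Dist C \<longleftrightarrow> (g, h, negarr C (shM C 1 f)) \<in> Dist C"
    and TR3: "\<lbrakk>(f, g, h) \<in> Dist C; (f', g', h') \<in> Dist C;
        a \<in> homs C (src C f) (src C f'); b \<in> homs C (tgt C f) (tgt C f'); b \<cdot> f = f' \<cdot> a\<rbrakk>
        \<Longrightarrow> \<exists>c. triangle_map C (f, g, h) (f', g', h') (a, b, c)"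
    and TR4: "\<lbrakk>(f, i, j) \<in> Dist C; (g, k, l) \<in> Dist C; src C g = tgt C f;
        (g \<cdot> f, r, s) \<in> Dist C\<rbrakk>
        \<Longrightarrow> \<exists>u \<in> homs C (tgt C i) (tgt C r). \<exists>v \<in> homs C (tgt C r) (tgt C k).
              (u, v, shM C 1 i \<cdot> l) \<in> Dist C
            \<and> u \<cdot> i = r \<cdot> g \<and> s \<cdot> u = j \<and> v \<cdot> r = k \<and> l \<cdot> v = shM C 1 f \<cdot> s"

text \<open>
  Exactness asks for a natural isomorphism \<open>F(X[1]) \<cong> F(X)[1]\<close>, not for strict compatibility.
\<close>

definition exact_functor ::
  "('o, 'm, 'y) tcat_scheme \<Rightarrow> ('p, 'n, 'z) tcat_scheme \<Rightarrow> ('o, 'm, 'p, 'n) func \<Rightarrow> bool" where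
  "exact_functor C D F \<longleftrightarrow> additive_functor C D F
     \<and> (\<exists>\<phi>. natural_iso C D (comp_func F (shift_func C 1)) (comp_func (shift_func D 1) F) \<phi>
          \<and> (\<forall>(f, g, h) \<in> Dist C. (fmor F f, fmor F g, \<phi> (src C f) \<cdot>\<^bsub>D\<^esub> fmor F h) \<in> Dist D))"

definition strict_triangulated_subclass :: "('o, 'm, 'z) tcat_scheme \<Rightarrow> 'o set \<Rightarrow> bool" where
  "strict_triangulated_subclass C S \<longleftrightarrow> S \<subseteq> Obj C
     \<and> (\<forall>Z. zero_object C Z \<longrightarrow> Z \<in> S)
     \<and> (\<forall>X \<in> S. \<forall>Y. isomorphic C X Y \<longrightarrow> Y \<in> S)
     \<and> (\<forall>X \<in> S. \<forall>n. shO C n X \<in> S)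
     \<and> (\<forall>(f, g, h) \<in> Dist C. src C f \<in> S \<and> tgt C f \<in> S \<longrightarrow> tgt C g \<in> S)"

definition strongly_generated :: "('o, 'm, 'z) tcat_scheme \<Rightarrow> 'o set \<Rightarrow> 'o set" where
  "strongly_generated C D = \<Inter>{S. strict_triangulated_subclass C S \<and> D \<subseteq> S}"

definition tri_sub :: "('o, 'm) tcat \<Rightarrow> 'o set \<Rightarrow> ('o, 'm) tcat" where
  "tri_sub C S = (let A = {f \<in> Arr C. src C f \<in> S \<and> tgt C f \<in> S} in
     C\<lparr>Obj := S, Arr := A, Dist := {(f, g, h) \<in> Dist C. f \<in> A \<and> g \<in> A \<and> h \<in> A}\<rparr>)"


section \<open>Idempotent completions\<close>

text \<open>
  Objects of \<open>kar C\<close> are pairs \<open>(X, p)\<close> with \<open>p\<close> an idempotent endomorphism of \<open>X\<close>; an arrow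
  \<open>(X, p) \<rightarrow> (Y, q)\<close> is an arrow \<open>f : X \<rightarrow> Y\<close> with \<open>q \<cdot> f \<cdot> p = f\<close>, stored together with its
  source and target.
\<close>

definition kar :: "('o, 'm, 'z) acat_scheme \<Rightarrow> ('o \<times> 'm, ('o \<times> 'm) \<times> 'm \<times> ('o \<times> 'm)) acat" where
  "kar C = (let K = {(X, p). X \<in> Obj C \<and> p \<in> homs C X X \<and> p \<cdot>\<^bsub>C\<^esub> p = p} in
    \<lparr>Obj = K,
     Arr = {(A, f, B). A \<in> K \<and> B \<in> K \<and> f \<in> homs C (fst A) (fst B)
                     \<and> snd B \<cdot>\<^bsub>C\<^esub> f \<cdot>\<^bsub>C\<^esub> snd A = f},
     src = (\<lambda>(A, f, B). A),
     tgt = (\<lambda>(A, f, B). B),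
     ident = (\<lambda>A. (A, snd A, A)),
     cmp = (\<lambda>(B', g, D) (A, f, B). (A, g \<cdot>\<^bsub>C\<^esub> f, D)),
     zeroarr = (\<lambda>A B. (A, zeroarr C (fst A) (fst B), B)),
     addarr = (\<lambda>(A, f, B) (A', f', B'). (A, addarr C f f', B))\<rparr>)"

definition kar_emb ::
  "('o, 'm, 'z) acat_scheme \<Rightarrow> ('o, 'm, 'o \<times> 'm, ('o \<times> 'm) \<times> 'm \<times> ('o \<times> 'm)) func" where
  "kar_emb C = \<lparr>fobj = (\<lambda>X. (X, ident C X)),
     fmor = (\<lambda>f. ((src C f, ident C (src C f)), f, (tgt C f, ident C (tgt C f))))\<rparr>"

definition kar_shift ::
  "('o, 'm, 'z) scat_scheme \<Rightarrow> ('o \<times> 'm, ('o \<times> 'm) \<times> 'm \<times> ('o \<times> 'm)) scat" where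
  "kar_shift C = (let s = (\<lambda>n (X, p). (shO C n X, shM C n p)) in
     acat.extend (kar C) (scat.fields s (\<lambda>n (A, f, B). (s n A, shM C n f, s n B))))"

text \<open>
  Following Balmer and Schlichting, the distinguished triangles of the idempotent completion are
  the retracts of the images of distinguished triangles of \<open>C\<close>.
\<close>

definition tri_kar ::
  "('o, 'm, 'z) tcat_scheme \<Rightarrow> ('o \<times> 'm, ('o \<times> 'm) \<times> 'm \<times> ('o \<times> 'm)) tcat" where
  "tri_kar C = (let K = kar_shift C; J = fmor (kar_emb C) in
     scat.extend K (tcat.fields
       {T. candidate_triangle K T \<and>
          (\<exists>(f, g, h) \<in> Dist C. \<exists>i i' i'' r r' r''.
              triangle_map K T (J f, J g, J h) (i, i', i'')
            \<and> triangle_map K (J f, J g, J h) T (r, r', r'')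
            \<and> r \<cdot>\<^bsub>K\<^esub> i = ident K (src K i)
            \<and> r' \<cdot>\<^bsub>K\<^esub> i' = ident K (src K i')
            \<and> r'' \<cdot>\<^bsub>K\<^esub> i'' = ident K (src K i''))}))"

text \<open>
  \<open>C\<close> is contained in \<open>C'\<close> by means of a fully faithful exact functor \<open>J\<close>. The comparison functor
  \<open>C' \<rightarrow> Kar C\<close> has to be compatible with the two embeddings of \<open>C\<close>; without this it would not
  force the objects of \<open>C'\<close> to be retracts of objects of \<open>C\<close>.
\<close>

definition idempotent_extension ::
  "('o, 'm) tcat \<Rightarrow> ('p, 'n) tcat \<Rightarrow> ('o, 'm, 'p, 'n) func \<Rightarrow> bool" where
  "idempotent_extension C C' J \<longleftrightarrow>
     triangulated_category C \<and> triangulated_category C'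
   \<and> exact_functor C C' J \<and> fully_faithful C C' J
   \<and> (\<exists>G. exact_functor C' (tri_kar C) G \<and> fully_faithful C' (tri_kar C) G
        \<and> naturally_isomorphic C (tri_kar C) (comp_func G J) (kar_emb C))"


section \<open>Weight structures\<close>

record 'o weight =
  wle0 :: "'o set"
  wge0 :: "'o set"

definition weight_structure :: "('o, 'm) tcat \<Rightarrow> 'o weight \<Rightarrow> bool" where
  "weight_structure C w \<longleftrightarrow>
     wle0 w \<subseteq> Obj C \<and> wge0 w \<subseteq> Obj C
   \<and> retraction_closed C (wle0 w) \<and> retraction_closed C (wge0 w)
   \<and> wle0 w \<subseteq> shO C 1 ` wle0 w \<and> shO C 1 ` wge0 w \<subseteq> wge0 w
   \<and> orthogonal C (wle0 w) (shO C 1 ` wge0 w)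
   \<and> (\<forall>M \<in> Obj C. \<exists>(f, g, h) \<in> Dist C.
        tgt C f = M \<and> src C f \<in> wle0 w \<and> tgt C g \<in> shO C 1 ` wge0 w)"

definition wle :: "('o, 'm) tcat \<Rightarrow> 'o weight \<Rightarrow> int \<Rightarrow> 'o set" where
  "wle C w i = shO C i ` wle0 w"

definition wge :: "('o, 'm) tcat \<Rightarrow> 'o weight \<Rightarrow> int \<Rightarrow> 'o set" where
  "wge C w i = shO C i ` wge0 w"

definition weq0 :: "'o weight \<Rightarrow> 'o set" where
  "weq0 w = wge0 w \<inter> wle0 w"

definition heart :: "('o, 'm) tcat \<Rightarrow> 'o weight \<Rightarrow> ('o, 'm) acat" where
  "heart C w = full_sub C (weq0 w)"

definition cat_minus :: "('o, 'm) tcat \<Rightarrow> 'o weight \<Rightarrow> ('o, 'm) tcat" where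
  "cat_minus C w = tri_sub C (\<Union>i. wle C w i)"

definition cat_plus :: "('o, 'm) tcat \<Rightarrow> 'o weight \<Rightarrow> ('o, 'm) tcat" where
  "cat_plus C w = tri_sub C (\<Union>i. wge C w i)"

definition bounded_above :: "('o, 'm) tcat \<Rightarrow> 'o weight \<Rightarrow> bool" where
  "bounded_above C w \<longleftrightarrow> Obj (cat_minus C w) = Obj C"

definition bounded_below :: "('o, 'm) tcat \<Rightarrow> 'o weight \<Rightarrow> bool" where
  "bounded_below C w \<longleftrightarrow> Obj (cat_plus C w) = Obj C"

definition weight_exact ::
  "('o, 'm) tcat \<Rightarrow> 'o weight \<Rightarrow> ('p, 'n) tcat \<Rightarrow> 'p weight \<Rightarrow> ('o, 'm, 'p, 'n) func \<Rightarrow> bool" where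
  "weight_exact C w C' w' F \<longleftrightarrow> exact_functor C C' F
     \<and> fobj F ` wle0 w \<subseteq> wle0 w' \<and> fobj F ` wge0 w \<subseteq> wge0 w'"

definition weight_extension ::
  "('o, 'm) tcat \<Rightarrow> 'o weight \<Rightarrow> ('p, 'n) tcat \<Rightarrow> 'p weight \<Rightarrow> ('o, 'm, 'p, 'n) func \<Rightarrow> bool" where
  "weight_extension C w C' w' J \<longleftrightarrow> weight_structure C' w' \<and> weight_exact C w C' w' J"

definition weight_karoubian :: "('o, 'm) tcat \<Rightarrow> 'o weight \<Rightarrow> bool" where
  "weight_karoubian C w \<longleftrightarrow> idempotent_complete (heart C w)"

definition weight_karoubian_extension ::
  "('o, 'm) tcat \<Rightarrow> 'o weight \<Rightarrow> ('p, 'n) tcat \<Rightarrow> 'p weight \<Rightarrow> ('o, 'm, 'p, 'n) func \<Rightarrow> bool" where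
  "weight_karoubian_extension C w C' w' J \<longleftrightarrow> weight_karoubian C' w'
     \<and> idempotent_extension C C' J \<and> weight_extension C w C' w' J"

text \<open>
  The idempotent completion of a full subcategory of \<open>C\<close> is literally a full subcategory of
  \<open>tri_kar C\<close>, so its objects can be used there directly.
\<close>

definition kar_w_min ::
  "('o, 'm) tcat \<Rightarrow> 'o weight \<Rightarrow> ('o \<times> 'm, ('o \<times> 'm) \<times> 'm \<times> ('o \<times> 'm)) tcat" where
  "kar_w_min C w = tri_sub (tri_kar C)
     (strongly_generated (tri_kar C) (fobj (kar_emb C) ` Obj C \<union> Obj (kar (heart C w))))"

definition kar_w_max ::
  "('o, 'm) tcat \<Rightarrow> 'o weight \<Rightarrow> ('o \<times> 'm, ('o \<times> 'm) \<times> 'm \<times> ('o \<times> 'm)) tcat" where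
  "kar_w_max C w = tri_sub (tri_kar C)
     (strongly_generated (tri_kar C)
        (Obj (kar (cat_minus C w)) \<union> Obj (kar (cat_plus C w))))"

end

theory Submission
  imports Defs
begin

text \<open>
  Orthogonality and weight decompositions of objects of \<open>C\<close> force the classes of an extension to be
  the retraction-closures of the images of those of \<open>w\<close>. Conversely, these closures are always
  orthogonal, so only weight decompositions can be missing; the objects all of whose translates
  have one form a strict triangulated subclass. A retract \<open>M\<close> of \<open>N\<close> with \<open>N\<close> bounded on one side
  belongs to it: the cone of the complementary idempotent of \<open>N\<close> is \<open>M \<oplus> M[1]\<close>, and hence \<open>M\<close> is
  an extension of \<open>M[2]\<close>, which has larger weights, by an object of \<open>C\<close>.

  The constructions inside the idempotent completion need its triangulated structure, where only
  the octahedral axiom is difficult. One extends the given maps by zero to maps of \<open>C\<close>, takes an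
  octahedron there and makes it respect the direct summands by means of unipotent automorphisms.
\<close>

text \<open>The cone of \<open>1 - i \<cdot> r\<close> is \<open>M \<oplus> M[1]\<close> because,
  where \<open>N\<close> splits as \<open>M \<oplus> M'\<close>, this arrow is \<open>0\<close> on
  \<open>M\<close> and the identity on \<open>M'\<close>, so only the cone of
  \<open>0 : M -> M\<close> survives. The triangle \<open>M[1] -> cone -> M\<close>, rotated, is the
  origin of the translation by 2. As the arrow lives on \<open>N\<close>, its cone comes from
  \<open>C\<close>, where decompositions exist. For an unbounded \<open>N\<close> the iteration has
  no end, whence the role of \<open>C^+\<close> and \<open>C^-\<close> in the criterion. The heart
  is not settled by the two closures: an object of weight 0 is a retract of one object of weight at
  most 0 and of another one of weight at least 0, and a single object of the heart has to be found
  by decomposing once more. The embedding \<open>J\<close> is not an inclusion and commutes with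
  translations only up to isomorphism; classes closed under retracts absorb this. Extensions are
  compared with \<open>kar_w_max\<close> and \<open>kar_w_min\<close> inside
  \<open>tri_kar C\<close> by means of the functor \<open>G\<close>; the functor out of
  \<open>kar_w_min\<close> is an inverse of \<open>G\<close> on a part of its essential
  image.\<close>

lemma homs_iff [simp]: "f \<in> homs C X Y \<longleftrightarrow> f \<in> Arr C \<and> src C f = X \<and> tgt C f = Y"
  by (auto simp: homs_def)

section \<open>Categories: isomorphisms, retracts and retraction-closures\<close>

context category
begin

lemma src_Obj [simp]: "f \<in> Arr C \<Longrightarrow> src C f \<in> Obj C"
  and tgt_Obj [simp]: "f \<in> Arr C \<Longrightarrow> tgt C f \<in> Obj C"
  by (simp_all add: src_in tgt_in)

lemma homs_Obj: assumes "f \<in> homs C X Y" shows "X \<in> Obj C" "Y \<in> Obj C"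
  using assms by auto

lemma ident_simps [simp]:
  assumes "X \<in> Obj C"
  shows "ident C X \<in> Arr C" "src C (ident C X) = X" "tgt C (ident C X) = X"
  using ident_in[OF assms] by auto

lemma cmp_simps [simp]:
  assumes "f \<in> Arr C" "g \<in> Arr C" "src C g = tgt C f"
  shows "g \<cdot> f \<in> Arr C" "src C (g \<cdot> f) = src C f" "tgt C (g \<cdot> f) = tgt C g"
  using cmp_in[of f "src C f" "tgt C f" g "tgt C g"] assms by auto

lemma assoc [simp]:
  assumes "f \<in> Arr C" "g \<in> Arr C" "h \<in> Arr C" "src C g = tgt C f" "src C h = tgt C g"
  shows "(h \<cdot> g) \<cdot> f = h \<cdot> (g \<cdot> f)"
  using cmp_assoc[of f "src C f" "tgt C f" g "tgt C g" h "tgt C h"] assms by auto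

lemma id_left [simp]: "f \<in> Arr C \<Longrightarrow> tgt C f = Y \<Longrightarrow> ident C Y \<cdot> f = f"
  using ident_left[of f "src C f" Y] by auto

lemma id_right [simp]: "f \<in> Arr C \<Longrightarrow> src C f = X \<Longrightarrow> f \<cdot> ident C X = f"
  using ident_right[of f X "tgt C f"] by auto

text \<open>Composites are normalised to the right, so an equation for \<open>g \<cdot> f\<close> no
  longer matches once another arrow precedes \<open>f\<close>. This rule carries the equation into
  such composites; calculations below often hand an equation to the simplifier both bare and with
  \<open>THEN cmp_ext\<close>.\<close>

lemma cmp_ext:
  assumes "g \<cdot> f = h" "f \<in> Arr C" "g \<in> Arr C" "src C g = tgt C f" "k \<in> Arr C" "tgt C k = src C f"
  shows "g \<cdot> (f \<cdot> k) = h \<cdot> k"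
  using assms by (metis assoc)

lemma iso_arrI:
  assumes "f \<in> homs C X Y" "g \<in> homs C Y X" "g \<cdot> f = ident C X" "f \<cdot> g = ident C Y"
  shows "iso_arr C X Y f"
  unfolding iso_arr_def using assms by blast

lemma iso_arr_inverse:
  assumes "iso_arr C X Y f"
  obtains g where "g \<in> homs C Y X" "g \<cdot> f = ident C X" "f \<cdot> g = ident C Y" "iso_arr C Y X g"
  using assms unfolding iso_arr_def by blast

lemma iso_arr_homs: "iso_arr C X Y f \<Longrightarrow> f \<in> homs C X Y"
  unfolding iso_arr_def by blast

lemma iso_arr_ident: "X \<in> Obj C \<Longrightarrow> iso_arr C X X (ident C X)"
  by (rule iso_arrI[where g = "ident C X"]) auto

lemma iso_arr_cmp:
  assumes "iso_arr C X Y f" "iso_arr C Y Z g"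
  shows "iso_arr C X Z (g \<cdot> f)"
proof -
  obtain f' where f': "f' \<in> homs C Y X" "f' \<cdot> f = ident C X" "f \<cdot> f' = ident C Y"
    using assms(1) unfolding iso_arr_def by blast
  obtain g' where g': "g' \<in> homs C Z Y" "g' \<cdot> g = ident C Y" "g \<cdot> g' = ident C Z"
    using assms(2) unfolding iso_arr_def by blast
  note fg = iso_arr_homs[OF assms(1)] iso_arr_homs[OF assms(2)]
  show ?thesis
    by (rule iso_arrI[where g = "f' \<cdot> g'"])
      (use f' g' fg in \<open>auto simp: cmp_ext[OF f'(2)] cmp_ext[OF f'(3)] cmp_ext[OF g'(2)] cmp_ext[OF g'(3)]\<close>)
qed

text \<open>Inverting \<open>g \<cdot> f\<close> gives a left inverse \<open>a \<cdot> g\<close> of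
  \<open>f\<close>, inverting \<open>f \<cdot> g\<close> gives a right inverse
  \<open>g \<cdot> b\<close>, and a left and a right inverse always agree.\<close>

lemma iso_arr_if_both_composites_iso:
  assumes "f \<in> homs C X Y" "g \<in> homs C Y X"
    and "iso_arr C X X (g \<cdot> f)" "iso_arr C Y Y (f \<cdot> g)"
  shows "iso_arr C X Y f"
proof -
  obtain a where a: "a \<in> homs C X X" "a \<cdot> (g \<cdot> f) = ident C X"
    using assms(3) unfolding iso_arr_def by blast
  obtain b where b: "b \<in> homs C Y Y" "(f \<cdot> g) \<cdot> b = ident C Y"
    using assms(4) unfolding iso_arr_def by blast
  have fb: "f \<cdot> (g \<cdot> b) = ident C Y" using b assms(1,2) by simp
  have "a \<cdot> g = (a \<cdot> g) \<cdot> (f \<cdot> (g \<cdot> b))" using a assms(1,2) by (simp only: fb) simp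
  also have "\<dots> = (a \<cdot> (g \<cdot> f)) \<cdot> (g \<cdot> b)" using a(1) b(1) assms(1,2) by simp
  also have "\<dots> = g \<cdot> b" using a b(1) assms(1,2) homs_Obj[OF a(1)] by simp
  finally have eq: "a \<cdot> g = g \<cdot> b" .
  show ?thesis
    by (rule iso_arrI[where g = "g \<cdot> b"]) (use a b eq assms(1,2) fb in \<open>auto simp flip: eq\<close>)
qed

lemma isomorphic_refl: "X \<in> Obj C \<Longrightarrow> isomorphic C X X"
  unfolding isomorphic_def using iso_arr_ident by blast

lemma isomorphic_sym: "isomorphic C X Y \<Longrightarrow> isomorphic C Y X"
  unfolding isomorphic_def by (metis iso_arr_inverse)

lemma isomorphic_trans: "isomorphic C X Y \<Longrightarrow> isomorphic C Y Z \<Longrightarrow> isomorphic C X Z"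
  unfolding isomorphic_def by (metis iso_arr_cmp)

lemma isomorphic_Obj: "isomorphic C X Y \<Longrightarrow> X \<in> Obj C" "isomorphic C X Y \<Longrightarrow> Y \<in> Obj C"
  unfolding isomorphic_def iso_arr_def by (metis homs_Obj(1), metis homs_Obj(2))

lemma retractI:
  "i \<in> homs C X Y \<Longrightarrow> r \<in> homs C Y X \<Longrightarrow> r \<cdot> i = ident C X \<Longrightarrow> retract C X Y"
  unfolding retract_def by blast

lemma retractE:
  assumes "retract C X Y"
  obtains i r where "i \<in> homs C X Y" "r \<in> homs C Y X" "r \<cdot> i = ident C X"
  using assms unfolding retract_def by blast

lemma isomorphic_retract: "isomorphic C X Y \<Longrightarrow> retract C X Y"
  unfolding isomorphic_def iso_arr_def retract_def by blast

lemma retract_Obj: "retract C X Y \<Longrightarrow> X \<in> Obj C" "retract C X Y \<Longrightarrow> Y \<in> Obj C"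
  by (metis homs_Obj(1) retractE, metis homs_Obj(2) retractE)

lemma retract_refl: "X \<in> Obj C \<Longrightarrow> retract C X X"
  by (intro isomorphic_retract isomorphic_refl)

lemma retract_trans:
  assumes "retract C X Y" "retract C Y Z"
  shows "retract C X Z"
proof -
  obtain i r where ir: "i \<in> homs C X Y" "r \<in> homs C Y X" "r \<cdot> i = ident C X"
    using assms(1) by (rule retractE)
  obtain j s where js: "j \<in> homs C Y Z" "s \<in> homs C Z Y" "s \<cdot> j = ident C Y"
    using assms(2) by (rule retractE)
  show ?thesis
    by (rule retractI[where i = "j \<cdot> i" and r = "r \<cdot> s"]) (use ir js in \<open>auto simp: cmp_ext[OF js(3)]\<close>)
qed

text \<open>A retract of a retract is a retract, so a single round of adjoining retracts already
  gives a closed class.\<close>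

lemma retraction_closure_eq:
  assumes "D \<subseteq> Obj C"
  shows "retraction_closure C D = {X. \<exists>Y\<in>D. retract C X Y}"
proof
  have "retraction_closed C {X. \<exists>Y\<in>D. retract C X Y}"
    unfolding retraction_closed_def using retract_trans by blast
  moreover have "{X. \<exists>Y\<in>D. retract C X Y} \<subseteq> Obj C" using retract_Obj(1) by blast
  moreover have "D \<subseteq> {X. \<exists>Y\<in>D. retract C X Y}" using assms retract_refl by blast
  ultimately show "retraction_closure C D \<subseteq> {X. \<exists>Y\<in>D. retract C X Y}"
    unfolding retraction_closure_def by blast
  show "{X. \<exists>Y\<in>D. retract C X Y} \<subseteq> retraction_closure C D"
    unfolding retraction_closure_def retraction_closed_def using retract_Obj(1) by blast
qed

end

section \<open>Calculus of sums, negatives and zero arrows in additive categories\<close>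

context additive_category
begin

abbreviation plus (infixl "\<oplus>" 65) where "f \<oplus> g \<equiv> addarr C f g"
abbreviation neg ("\<ominus> _" [81] 80) where "\<ominus> f \<equiv> negarr C f"

lemma hom_group_simps [simp]:
  "carrier (hom_group C X Y) = homs C X Y"
  "mult (hom_group C X Y) = addarr C"
  "one (hom_group C X Y) = zeroarr C X Y"
  by (simp_all add: hom_group_def)

lemma hom_grp: "f \<in> Arr C \<Longrightarrow> comm_group (hom_group C (src C f) (tgt C f))"
  using hom_comm_group by simp

lemma zero_simps [simp]:
  assumes "X \<in> Obj C" "Y \<in> Obj C"
  shows "zeroarr C X Y \<in> Arr C" "src C (zeroarr C X Y) = X" "tgt C (zeroarr C X Y) = Y"
  using monoid.one_closed[OF group.is_monoid[OF comm_group.axioms(2)[OF hom_comm_group[OF assms]]]]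
  by auto

lemma add_simps [simp]:
  assumes "f \<in> Arr C" "g \<in> Arr C" "src C f = src C g" "tgt C f = tgt C g"
  shows "f \<oplus> g \<in> Arr C" "src C (f \<oplus> g) = src C g" "tgt C (f \<oplus> g) = tgt C g"
  using monoid.m_closed[OF group.is_monoid[OF comm_group.axioms(2)[OF hom_grp[OF assms(2)]]], of f g] assms
  by auto

lemma add_assoc [simp]:
  assumes "f \<in> Arr C" "g \<in> Arr C" "h \<in> Arr C" "src C f = src C g" "tgt C f = tgt C g"
    "src C g = src C h" "tgt C g = tgt C h"
  shows "(f \<oplus> g) \<oplus> h = f \<oplus> (g \<oplus> h)"
  using monoid.m_assoc[OF group.is_monoid[OF comm_group.axioms(2)[OF hom_grp[OF assms(3)]]], of f g h] assms
  by auto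

lemma add_comm:
  assumes "f \<in> Arr C" "g \<in> Arr C" "src C f = src C g" "tgt C f = tgt C g"
  shows "f \<oplus> g = g \<oplus> f"
  using comm_monoid.m_comm[OF comm_group.axioms(1)[OF hom_grp[OF assms(2)]], of f g] assms
  by auto

lemma add_lcomm:
  assumes "f \<in> Arr C" "g \<in> Arr C" "h \<in> Arr C" "src C f = src C g" "tgt C f = tgt C g"
    "src C g = src C h" "tgt C g = tgt C h"
  shows "f \<oplus> (g \<oplus> h) = g \<oplus> (f \<oplus> h)"
  using assms by (metis add_assoc add_comm)

lemma neg_simps [simp]:
  assumes "f \<in> Arr C"
  shows "\<ominus> f \<in> Arr C" "src C (\<ominus> f) = src C f" "tgt C (\<ominus> f) = tgt C f"
  using group.inv_closed[OF comm_group.axioms(2)[OF hom_grp[OF assms]], of f] assms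
  by (auto simp: negarr_def)

lemma zero_add [simp]:
  assumes "f \<in> Arr C" "src C f = X" "tgt C f = Y"
  shows "zeroarr C X Y \<oplus> f = f" "f \<oplus> zeroarr C X Y = f"
  using monoid.l_one[OF group.is_monoid[OF comm_group.axioms(2)[OF hom_grp[OF assms(1)]]], of f]
    monoid.r_one[OF group.is_monoid[OF comm_group.axioms(2)[OF hom_grp[OF assms(1)]]], of f] assms
  by auto

lemma neg_add_zero [simp]:
  assumes "f \<in> Arr C"
  shows "\<ominus> f \<oplus> f = zeroarr C (src C f) (tgt C f)" "f \<oplus> \<ominus> f = zeroarr C (src C f) (tgt C f)"
  using group.l_inv[OF comm_group.axioms(2)[OF hom_grp[OF assms]], of f]
    group.r_inv[OF comm_group.axioms(2)[OF hom_grp[OF assms]], of f] assms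
  by (auto simp: negarr_def)

lemma neg_add_cancel [simp]:
  assumes "f \<in> Arr C" "k \<in> Arr C" "src C f = src C k" "tgt C f = tgt C k"
  shows "\<ominus> f \<oplus> (f \<oplus> k) = k" "f \<oplus> (\<ominus> f \<oplus> k) = k"
  using assms by (simp_all add: add_assoc[symmetric] del: add_assoc)

lemma add_left_cancel:
  assumes "f \<in> Arr C" "g \<in> Arr C" "h \<in> Arr C" "src C f = src C g" "tgt C f = tgt C g"
    "src C f = src C h" "tgt C f = tgt C h" "f \<oplus> g = f \<oplus> h"
  shows "g = h"
  using assms by (metis neg_add_cancel(1))

lemma neg_unique:
  assumes "f \<in> Arr C" "g \<in> Arr C" "src C f = src C g" "tgt C f = tgt C g"
    "f \<oplus> g = zeroarr C (src C g) (tgt C g)"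
  shows "\<ominus> f = g"
  by (rule add_left_cancel[of f]) (use assms in auto)

lemma neg_neg [simp]: "f \<in> Arr C \<Longrightarrow> \<ominus> (\<ominus> f) = f"
  by (rule neg_unique) auto

lemma neg_zero [simp]: "X \<in> Obj C \<Longrightarrow> Y \<in> Obj C \<Longrightarrow> \<ominus> zeroarr C X Y = zeroarr C X Y"
  by (rule neg_unique) auto

lemma neg_plus [simp]:
  assumes "f \<in> Arr C" "g \<in> Arr C" "src C f = src C g" "tgt C f = tgt C g"
  shows "\<ominus> (f \<oplus> g) = \<ominus> f \<oplus> \<ominus> g"
  by (rule neg_unique) (use assms in \<open>auto simp: add_lcomm\<close>)

text \<open>This is how images of zero arrows under additive operations are recognised: bilinearity
  makes them equal to their own double.\<close>

lemma idem_zero: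
  assumes "f \<in> Arr C" "f \<oplus> f = f" "src C f = X" "tgt C f = Y"
  shows "f = zeroarr C X Y"
  by (rule add_left_cancel[of f]) (use assms in auto)

lemma cmp_add [simp]:
  assumes "f \<in> Arr C" "f' \<in> Arr C" "g \<in> Arr C" "src C f = src C f'" "tgt C f = tgt C f'"
    "src C g = tgt C f'"
  shows "g \<cdot> (f \<oplus> f') = g \<cdot> f \<oplus> g \<cdot> f'"
  using cmp_add_right[of f "src C f" "tgt C f" f' g "tgt C g"] assms by auto

lemma add_cmp [simp]:
  assumes "f \<in> Arr C" "g' \<in> Arr C" "g \<in> Arr C" "src C g = src C g'" "tgt C g = tgt C g'"
    "src C g' = tgt C f"
  shows "(g \<oplus> g') \<cdot> f = g \<cdot> f \<oplus> g' \<cdot> f"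
  using cmp_add_left[of f "src C f" "tgt C f" g "tgt C g" g'] assms by auto

lemma cmp_zero [simp]:
  assumes "g \<in> Arr C" "X \<in> Obj C" "src C g = Y"
  shows "g \<cdot> zeroarr C X Y = zeroarr C X (tgt C g)"
proof (rule idem_zero)
  have Y: "Y \<in> Obj C" using assms by auto
  show "g \<cdot> zeroarr C X Y \<oplus> g \<cdot> zeroarr C X Y = g \<cdot> zeroarr C X Y"
    using assms Y by (simp flip: cmp_add)
qed (use assms in auto)

lemma zero_cmp [simp]:
  assumes "f \<in> Arr C" "Y \<in> Obj C" "tgt C f = X"
  shows "zeroarr C X Y \<cdot> f = zeroarr C (src C f) Y"
proof (rule idem_zero)
  have X: "X \<in> Obj C" using assms by auto
  show "zeroarr C X Y \<cdot> f \<oplus> zeroarr C X Y \<cdot> f = zeroarr C X Y \<cdot> f"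
    using assms X by (simp flip: add_cmp)
qed (use assms in auto)

lemma cmp_neg [simp]:
  assumes "f \<in> Arr C" "g \<in> Arr C" "src C g = tgt C f"
  shows "g \<cdot> \<ominus> f = \<ominus> (g \<cdot> f)"
  by (rule neg_unique[symmetric]) (use assms in \<open>auto simp flip: cmp_add\<close>)

lemma neg_cmp [simp]:
  assumes "f \<in> Arr C" "g \<in> Arr C" "src C g = tgt C f"
  shows "\<ominus> g \<cdot> f = \<ominus> (g \<cdot> f)"
  by (rule neg_unique[symmetric]) (use assms in \<open>auto simp flip: add_cmp\<close>)

lemma eq_iff_diff_zero:
  assumes "f \<in> Arr C" "g \<in> Arr C" "src C f = src C g" "tgt C f = tgt C g"
  shows "f = g \<longleftrightarrow> f \<oplus> \<ominus> g = zeroarr C (src C g) (tgt C g)"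
proof
  assume "f \<oplus> \<ominus> g = zeroarr C (src C g) (tgt C g)"
  then have "\<ominus> g \<oplus> f = \<ominus> g \<oplus> g" using assms by (simp add: add_comm)
  then show "f = g" using assms by (intro add_left_cancel[of "\<ominus> g" f g]) auto
qed (use assms in auto)

lemma neg_eq_zero:
  assumes "f \<in> homs C X Y" "\<ominus> f = zeroarr C X Y" shows "f = zeroarr C X Y"
  using assms by (metis homs_Obj homs_iff neg_neg neg_zero)

lemma zero_object_Obj: "zero_object C Z \<Longrightarrow> Z \<in> Obj C"
  by (simp add: zero_object_def)

lemma zero_object_hom:
  assumes "zero_object C Z"
  shows "f \<in> homs C Z X \<Longrightarrow> f = zeroarr C Z X" "f \<in> homs C X Z \<Longrightarrow> f = zeroarr C X Z"
proof -
  have Z: "Z \<in> Obj C" "ident C Z = zeroarr C Z Z" using assms by (auto simp: zero_object_def)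
  show "f = zeroarr C Z X" if f: "f \<in> homs C Z X"
  proof -
    have "f = f \<cdot> ident C Z" using f by simp
    then show ?thesis using f Z by (simp add: Z(2) del: id_right)
  qed
  show "f = zeroarr C X Z" if f: "f \<in> homs C X Z"
  proof -
    have "f = ident C Z \<cdot> f" using f by simp
    then show ?thesis using f Z by (simp add: Z(2) del: id_left)
  qed
qed

lemma zero_object_iso:
  assumes "zero_object C Z" "zero_object C Z'"
  shows "iso_arr C Z Z' (zeroarr C Z Z')"
proof -
  note Z = assms[THEN zero_object_Obj]
  have "zeroarr C Z' Z \<cdot> zeroarr C Z Z' = ident C Z" "zeroarr C Z Z' \<cdot> zeroarr C Z' Z = ident C Z'"
    using assms Z unfolding zero_object_def by simp_all
  then show ?thesis by (intro iso_arrI[where g = "zeroarr C Z' Z"]) (use Z in auto)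
qed

end

text \<open>All four arrows are parameters, because splitting a triangle has to produce a biproduct
  with a prescribed inclusion and a prescribed projection.\<close>

definition biprod :: "('o, 'm, 'z) acat_scheme \<Rightarrow> 'o \<Rightarrow> 'o \<Rightarrow> 'o \<Rightarrow> 'm \<Rightarrow> 'm \<Rightarrow> 'm \<Rightarrow> 'm \<Rightarrow> bool" where
  "biprod C S X Y i j p q \<longleftrightarrow> i \<in> homs C X S \<and> j \<in> homs C Y S \<and> p \<in> homs C S X \<and> q \<in> homs C S Y
     \<and> p \<cdot>\<^bsub>C\<^esub> i = ident C X \<and> q \<cdot>\<^bsub>C\<^esub> j = ident C Y \<and> p \<cdot>\<^bsub>C\<^esub> j = zeroarr C Y X \<and> q \<cdot>\<^bsub>C\<^esub> i = zeroarr C X Y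
     \<and> addarr C (i \<cdot>\<^bsub>C\<^esub> p) (j \<cdot>\<^bsub>C\<^esub> q) = ident C S"

lemma full_sub_simps [simp]:
  "Obj (full_sub C S) = S" "Arr (full_sub C S) = {f \<in> Arr C. src C f \<in> S \<and> tgt C f \<in> S}"
  "src (full_sub C S) = src C" "tgt (full_sub C S) = tgt C" "ident (full_sub C S) = ident C"
  "cmp (full_sub C S) = cmp C" "zeroarr (full_sub C S) = zeroarr C" "addarr (full_sub C S) = addarr C"
  by (simp_all add: full_sub_def)

lemma homs_full_sub: "X \<in> S \<Longrightarrow> Y \<in> S \<Longrightarrow> homs (full_sub C S) X Y = homs C X Y"
  by (auto simp: homs_def)

text \<open>The additive axioms read only the fields of \<open>acat\<close>. Hence additivity passes
  from \<open>kar C\<close> to \<open>tri_kar C\<close> and from \<open>full_sub\<close> to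
  \<open>tri_sub\<close>, records which differ only in further fields.\<close>

lemma additive_category_truncate: "additive_category (acat.truncate C) \<longleftrightarrow> additive_category C"
  by (simp add: additive_category_def category_def additive_category_axioms_def homs_def hom_group_def
      zero_object_def acat.defs)

lemma (in category) iso_arr_inverses:
  assumes "\<And>K. K \<in> S \<Longrightarrow> iso_arr C (u K) (v K) (\<eta> K)"
  obtains \<eta>' where "\<And>K. K \<in> S \<Longrightarrow> iso_arr C (v K) (u K) (\<eta>' K)"
    "\<And>K. K \<in> S \<Longrightarrow> \<eta>' K \<cdot> \<eta> K = ident C (u K)" "\<And>K. K \<in> S \<Longrightarrow> \<eta> K \<cdot> \<eta>' K = ident C (v K)"
proof -
  have "\<exists>g. K \<in> S \<longrightarrow> iso_arr C (v K) (u K) g \<and> g \<cdot> \<eta> K = ident C (u K) \<and> \<eta> K \<cdot> g = ident C (v K)" for K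
  proof (cases "K \<in> S")
    case True
    show ?thesis by (rule iso_arr_inverse[OF assms[OF True]]) blast
  qed blast
  then have "\<exists>\<eta>'. \<forall>K. K \<in> S \<longrightarrow> iso_arr C (v K) (u K) (\<eta>' K) \<and> \<eta>' K \<cdot> \<eta> K = ident C (u K) \<and> \<eta> K \<cdot> \<eta>' K = ident C (v K)"
    by (intro choice allI)
  then show thesis using that by blast
qed

lemma (in category) full_sub_category: "S \<subseteq> Obj C \<Longrightarrow> category (full_sub C S)"
  by (intro category.intro) auto

lemma (in additive_category) biprod_exists:
  assumes "X \<in> Obj C" "Y \<in> Obj C"
  obtains S i j p q where "biprod C S X Y i j p q"
  using biproduct_exists[OF assms] unfolding biprod_def by blast

lemma (in additive_category) full_sub_additive:
  assumes S: "S \<subseteq> Obj C" and z: "\<exists>Z \<in> S. zero_object C Z"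
    and b: "\<And>X Y U i j p q. X \<in> S \<Longrightarrow> Y \<in> S \<Longrightarrow> biprod C U X Y i j p q \<Longrightarrow> U \<in> S"
  shows "additive_category (full_sub C S)"
proof (intro additive_category.intro full_sub_category[OF S] additive_category_axioms.intro)
  show "\<exists>Z. zero_object (full_sub C S) Z" using z unfolding zero_object_def by auto
  show "comm_group (hom_group (full_sub C S) X Y)" if "X \<in> Obj (full_sub C S)" "Y \<in> Obj (full_sub C S)" for X Y
    using that hom_comm_group S by (auto simp: hom_group_def homs_full_sub)
  fix X Y assume XY: "X \<in> Obj (full_sub C S)" "Y \<in> Obj (full_sub C S)"
  have "X \<in> Obj C" "Y \<in> Obj C" using XY S by auto
  then obtain U i j p q where u: "biprod C U X Y i j p q" by (rule biprod_exists)
  have "U \<in> S" by (rule b[OF _ _ u]) (use XY in simp_all)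
  then show "\<exists>U\<in>Obj (full_sub C S). \<exists>i\<in>homs (full_sub C S) X U. \<exists>j\<in>homs (full_sub C S) Y U.
      \<exists>p\<in>homs (full_sub C S) U X. \<exists>q\<in>homs (full_sub C S) U Y.
     p \<cdot>\<^bsub>full_sub C S\<^esub> i = ident (full_sub C S) X \<and> q \<cdot>\<^bsub>full_sub C S\<^esub> j = ident (full_sub C S) Y
     \<and> p \<cdot>\<^bsub>full_sub C S\<^esub> j = zeroarr (full_sub C S) Y X \<and> q \<cdot>\<^bsub>full_sub C S\<^esub> i = zeroarr (full_sub C S) X Y
     \<and> addarr (full_sub C S) (i \<cdot>\<^bsub>full_sub C S\<^esub> p) (j \<cdot>\<^bsub>full_sub C S\<^esub> q) = ident (full_sub C S) U"
    using u XY unfolding biprod_def by (intro bexI[of _ U] bexI[of _ i] bexI[of _ j] bexI[of _ p] bexI[of _ q]) auto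
qed auto

section \<open>Additive functors\<close>

locale add_functor = A: additive_category A + B: additive_category B
  for A :: "('o, 'm, 'y) acat_scheme" and B :: "('p, 'n, 'z) acat_scheme" +
  fixes F :: "('o, 'm, 'p, 'n) func"
  assumes additive: "additive_functor A B F"
begin

lemma fobj_Obj [simp]: "X \<in> Obj A \<Longrightarrow> fobj F X \<in> Obj B"
  using additive unfolding additive_functor_def by blast

lemma fmor_simps [simp]:
  assumes "f \<in> Arr A"
  shows "fmor F f \<in> Arr B" "src B (fmor F f) = fobj F (src A f)" "tgt B (fmor F f) = fobj F (tgt A f)"
proof -
  have "\<forall>X\<in>Obj A. \<forall>Y\<in>Obj A. \<forall>f\<in>homs A X Y. fmor F f \<in> homs B (fobj F X) (fobj F Y)"
    using additive unfolding additive_functor_def by blast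
  then have "fmor F f \<in> homs B (fobj F (src A f)) (fobj F (tgt A f))"
    using assms A.src_Obj A.tgt_Obj homs_iff by metis
  then show "fmor F f \<in> Arr B" "src B (fmor F f) = fobj F (src A f)" "tgt B (fmor F f) = fobj F (tgt A f)"
    by auto
qed

lemma fmor_ident [simp]: "X \<in> Obj A \<Longrightarrow> fmor F (ident A X) = ident B (fobj F X)"
  using additive unfolding additive_functor_def by blast

lemma fmor_cmp [simp]:
  assumes "f \<in> Arr A" "g \<in> Arr A" "src A g = tgt A f"
  shows "fmor F (g \<cdot>\<^bsub>A\<^esub> f) = fmor F g \<cdot>\<^bsub>B\<^esub> fmor F f"
proof -
  have "\<forall>X\<in>Obj A. \<forall>Y\<in>Obj A. \<forall>Z\<in>Obj A. \<forall>f\<in>homs A X Y. \<forall>g\<in>homs A Y Z.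
      fmor F (g \<cdot>\<^bsub>A\<^esub> f) = fmor F g \<cdot>\<^bsub>B\<^esub> fmor F f"
    using additive unfolding additive_functor_def by blast
  then show ?thesis using assms A.src_Obj A.tgt_Obj homs_iff by metis
qed

lemma fmor_add [simp]:
  assumes "f \<in> Arr A" "g \<in> Arr A" "src A f = src A g" "tgt A f = tgt A g"
  shows "fmor F (addarr A f g) = addarr B (fmor F f) (fmor F g)"
proof -
  have "\<forall>X\<in>Obj A. \<forall>Y\<in>Obj A. \<forall>f\<in>homs A X Y. \<forall>g\<in>homs A X Y.
      fmor F (addarr A f g) = addarr B (fmor F f) (fmor F g)"
    using additive unfolding additive_functor_def by blast
  then show ?thesis using assms A.src_Obj A.tgt_Obj homs_iff by metis
qed

lemma fmor_zero [simp]: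
  assumes "X \<in> Obj A" "Y \<in> Obj A"
  shows "fmor F (zeroarr A X Y) = zeroarr B (fobj F X) (fobj F Y)"
  by (rule B.idem_zero) (use assms in \<open>simp_all flip: fmor_add\<close>)

lemma fmor_neg [simp]:
  assumes "f \<in> Arr A"
  shows "fmor F (negarr A f) = negarr B (fmor F f)"
  by (rule B.neg_unique[symmetric]) (use assms in \<open>simp_all flip: fmor_add\<close>)

lemma iso: "iso_arr A X Y f \<Longrightarrow> iso_arr B (fobj F X) (fobj F Y) (fmor F f)"
proof -
  assume i: "iso_arr A X Y f"
  obtain g where g: "g \<in> homs A Y X" "g \<cdot>\<^bsub>A\<^esub> f = ident A X" "f \<cdot>\<^bsub>A\<^esub> g = ident A Y"
    using i unfolding iso_arr_def by blast
  note f = A.iso_arr_homs[OF i]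
  show ?thesis
    by (rule B.iso_arrI[where g = "fmor F g"]) (use f g A.homs_Obj[OF f] in \<open>auto simp flip: fmor_cmp\<close>)
qed

lemma retract: "retract A X Y \<Longrightarrow> retract B (fobj F X) (fobj F Y)"
proof -
  assume "retract A X Y"
  then obtain i r where ir: "i \<in> homs A X Y" "r \<in> homs A Y X" "r \<cdot>\<^bsub>A\<^esub> i = ident A X"
    by (rule A.retractE)
  show ?thesis
    by (rule B.retractI[where i = "fmor F i" and r = "fmor F r"])
      (use ir A.homs_Obj[OF ir(1)] in \<open>auto simp flip: fmor_cmp\<close>)
qed

lemma isomorphic: "isomorphic A X Y \<Longrightarrow> isomorphic B (fobj F X) (fobj F Y)"
  unfolding isomorphic_def using iso by blast

lemma zero_object: "zero_object A Z \<Longrightarrow> zero_object B (fobj F Z)"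
  unfolding zero_object_def by (metis fmor_ident fmor_zero fobj_Obj)

end

section \<open>Triangles\<close>

text \<open>The axioms are layered because the idempotent completion acquires them in stages:
  retracts of triangles are handled with the translation alone, and the octahedron is then obtained
  with tools valid in \<open>pretriangulated\<close>, which has every axiom but TR4.\<close>

locale shift_category = additive_category C
  for C :: "('o, 'm, 'z) scat_scheme" (structure) +
  assumes shift_functor: "additive_functor C C (shift_func C n)"
    and shO_0: "X \<in> Obj C \<Longrightarrow> shO C 0 X = X"
    and shM_0: "f \<in> Arr C \<Longrightarrow> shM C 0 f = f"
    and shO_add: "X \<in> Obj C \<Longrightarrow> shO C (m + n) X = shO C m (shO C n X)"
    and shM_add: "f \<in> Arr C \<Longrightarrow> shM C (m + n) f = shM C m (shM C n f)"

locale pretriangulated = shift_category C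
  for C :: "('o, 'm, 'z) tcat_scheme" (structure) +
  assumes dist_candidate: "T \<in> Dist C \<Longrightarrow> candidate_triangle C T"
    and TR1_iso: "\<lbrakk>T \<in> Dist C; candidate_triangle C T'; triangle_map C T T' (a, b, c);
        iso_arr C (src C a) (tgt C a) a; iso_arr C (src C b) (tgt C b) b;
        iso_arr C (src C c) (tgt C c) c\<rbrakk> \<Longrightarrow> T' \<in> Dist C"
    and TR1_ident: "X \<in> Obj C \<Longrightarrow> zero_object C Z
        \<Longrightarrow> (ident C X, zeroarr C X Z, zeroarr C Z (shO C 1 X)) \<in> Dist C"
    and TR1_cone: "f \<in> Arr C \<Longrightarrow> \<exists>g h. (f, g, h) \<in> Dist C"
    and TR2: "candidate_triangle C (f, g, h)
        \<Longrightarrow> (f, g, h) \<in> Dist C \<longleftrightarrow> (g, h, negarr C (shM C 1 f)) \<in> Dist C"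
    and TR3: "\<lbrakk>(f, g, h) \<in> Dist C; (f', g', h') \<in> Dist C;
        a \<in> homs C (src C f) (src C f'); b \<in> homs C (tgt C f) (tgt C f'); b \<cdot> f = f' \<cdot> a\<rbrakk>
        \<Longrightarrow> \<exists>c. triangle_map C (f, g, h) (f', g', h') (a, b, c)"

sublocale triangulated_category \<subseteq> pretriangulated
  using shift_functor shO_0 shM_0 shO_add shM_add dist_candidate TR1_iso TR1_ident TR1_cone TR2 TR3
  by (intro pretriangulated.intro shift_category.intro shift_category_axioms.intro pretriangulated_axioms.intro
      additive_category_axioms) blast+

text \<open>Membership in \<open>Dist\<close> leaves the vertices implicit; with the vertices as
  parameters, all typing conditions of a triangle are available as rewrite rules.\<close>

definition dtri :: "('o, 'm, 'z) tcat_scheme \<Rightarrow> 'o \<Rightarrow> 'o \<Rightarrow> 'o \<Rightarrow> 'm \<Rightarrow> 'm \<Rightarrow> 'm \<Rightarrow> bool" where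
  "dtri C X Y Z f g h \<longleftrightarrow> (f, g, h) \<in> Dist C \<and> f \<in> homs C X Y \<and> g \<in> homs C Y Z \<and> h \<in> homs C Z (shO C 1 X)"

lemma dtri_candidate: "dtri C X Y Z f g h \<Longrightarrow> candidate_triangle C (f, g, h)"
  by (simp add: dtri_def candidate_triangle_def)

text \<open>In the usual notation for extensions this is \<open>B \<in> A * D\<close>. Arguments
  about classes of objects need only the existence of the triangle, and forgetting its arrows
  disposes of all signs.\<close>

definition ext :: "('o, 'm, 'z) tcat_scheme \<Rightarrow> 'o \<Rightarrow> 'o \<Rightarrow> 'o \<Rightarrow> bool" where
  "ext C A B D \<longleftrightarrow> (\<exists>f g h. dtri C A B D f g h)"

context shift_category
begin

lemma shift_af: "add_functor C C (shift_func C n)"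
  by unfold_locales (rule shift_functor)

lemma shO_Obj [simp]: "X \<in> Obj C \<Longrightarrow> shO C n X \<in> Obj C"
  using add_functor.fobj_Obj[OF shift_af, of X n] by (simp add: shift_func_def)

lemma shM_simps [simp]:
  assumes "f \<in> Arr C"
  shows "shM C n f \<in> Arr C" "src C (shM C n f) = shO C n (src C f)" "tgt C (shM C n f) = shO C n (tgt C f)"
  using add_functor.fmor_simps[OF shift_af assms, of n] by (simp_all add: shift_func_def)

lemma shM_ident [simp]: "X \<in> Obj C \<Longrightarrow> shM C n (ident C X) = ident C (shO C n X)"
  using add_functor.fmor_ident[OF shift_af, of X n] by (simp add: shift_func_def)

lemma shM_cmp [simp]:
  "\<lbrakk>f \<in> Arr C; g \<in> Arr C; src C g = tgt C f\<rbrakk> \<Longrightarrow> shM C n (g \<cdot> f) = shM C n g \<cdot> shM C n f"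
  using add_functor.fmor_cmp[OF shift_af, of f g n] by (simp add: shift_func_def)

lemma shM_plus [simp]:
  "\<lbrakk>f \<in> Arr C; g \<in> Arr C; src C f = src C g; tgt C f = tgt C g\<rbrakk> \<Longrightarrow> shM C n (f \<oplus> g) = shM C n f \<oplus> shM C n g"
  using add_functor.fmor_add[OF shift_af, of f g n] by (simp add: shift_func_def)

lemma shM_zero [simp]:
  "X \<in> Obj C \<Longrightarrow> Y \<in> Obj C \<Longrightarrow> shM C n (zeroarr C X Y) = zeroarr C (shO C n X) (shO C n Y)"
  using add_functor.fmor_zero[OF shift_af, of X Y n] by (simp add: shift_func_def)

lemma shM_neg [simp]: "f \<in> Arr C \<Longrightarrow> shM C n (\<ominus> f) = \<ominus> (shM C n f)"
  using add_functor.fmor_neg[OF shift_af, of f n] by (simp add: shift_func_def)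

lemma shO_shO [simp]: "X \<in> Obj C \<Longrightarrow> shO C m (shO C n X) = shO C (m + n) X"
  and shM_shM [simp]: "f \<in> Arr C \<Longrightarrow> shM C m (shM C n f) = shM C (m + n) f"
  and shO_zero [simp]: "X \<in> Obj C \<Longrightarrow> shO C 0 X = X"
  and shM_zero' [simp]: "f \<in> Arr C \<Longrightarrow> shM C 0 f = f"
  by (simp_all add: shO_add shM_add shO_0 shM_0)

lemma iso_shift: "iso_arr C X Y f \<Longrightarrow> iso_arr C (shO C n X) (shO C n Y) (shM C n f)"
  using add_functor.iso[OF shift_af, of X Y f n] by (simp add: shift_func_def)

lemma isomorphic_shift: "isomorphic C X Y \<Longrightarrow> isomorphic C (shO C n X) (shO C n Y)"
  unfolding isomorphic_def using iso_shift by blast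

lemma retract_shift: "retract C X Y \<Longrightarrow> retract C (shO C n X) (shO C n Y)"
  using add_functor.retract[OF shift_af, of X Y n] by (simp add: shift_func_def)

lemma zero_object_shift: "zero_object C Z \<Longrightarrow> zero_object C (shO C n Z)"
  using add_functor.zero_object[OF shift_af, of Z n] by (simp add: shift_func_def)

lemma shM_inject:
  assumes "shM C n f = shM C n g" "f \<in> Arr C" "g \<in> Arr C"
  shows "f = g"
proof -
  have "shM C (- n) (shM C n f) = shM C (- n) (shM C n g)" using assms(1) by simp
  then show ?thesis using assms(2,3) by simp
qed

lemma triangle_map_cmp:
  assumes "candidate_triangle C T" "candidate_triangle C T'" "candidate_triangle C T''"
    and "triangle_map C T T' (a, b, c)" "triangle_map C T' T'' (a', b', c')"
  shows "triangle_map C T T'' (a' \<cdot> a, b' \<cdot> b, c' \<cdot> c)"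
proof -
  obtain f g h where T: "T = (f, g, h)" by (metis prod_cases3)
  obtain f' g' h' where T': "T' = (f', g', h')" by (metis prod_cases3)
  obtain f'' g'' h'' where T'': "T'' = (f'', g'', h'')" by (metis prod_cases3)
  have m: "a \<in> homs C (src C f) (src C f')" "b \<in> homs C (src C g) (src C g')" "c \<in> homs C (src C h) (src C h')"
    "a' \<in> homs C (src C f') (src C f'')" "b' \<in> homs C (src C g') (src C g'')" "c' \<in> homs C (src C h') (src C h'')"
    and e: "b \<cdot> f = f' \<cdot> a" "c \<cdot> g = g' \<cdot> b" "shM C 1 a \<cdot> h = h' \<cdot> c"
    and e': "b' \<cdot> f' = f'' \<cdot> a'" "c' \<cdot> g' = g'' \<cdot> b'" "shM C 1 a' \<cdot> h' = h'' \<cdot> c'"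
    using assms(4,5) unfolding T T' T'' triangle_map_def by auto
  have cand: "f \<in> Arr C" "g \<in> Arr C" "h \<in> Arr C" "src C g = tgt C f" "src C h = tgt C g" "tgt C h = shO C 1 (src C f)"
    "f' \<in> Arr C" "g' \<in> Arr C" "h' \<in> Arr C" "src C g' = tgt C f'" "src C h' = tgt C g'" "tgt C h' = shO C 1 (src C f')"
    "f'' \<in> Arr C" "g'' \<in> Arr C" "h'' \<in> Arr C" "src C g'' = tgt C f''" "src C h'' = tgt C g''" "tgt C h'' = shO C 1 (src C f'')"
    using assms(1-3) unfolding T T' T'' candidate_triangle_def by auto
  show ?thesis unfolding T T'' triangle_map_def
    using m cand by (simp add: e e' e'[THEN cmp_ext])
qed

text \<open>Two of the three squares are unchanged by rotation. The remaining one is translated and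
  negated, and both operations are injective on arrows.\<close>

lemma triangle_map_rot:
  assumes "candidate_triangle C (f, g, h)" "candidate_triangle C (f', g', h')"
    and a: "a \<in> homs C (src C f) (src C f')"
  shows "triangle_map C (g, h, \<ominus> shM C 1 f) (g', h', \<ominus> shM C 1 f') (b, c, shM C 1 a)
    \<longleftrightarrow> triangle_map C (f, g, h) (f', g', h') (a, b, c)"
proof -
  have c: "f \<in> Arr C" "g \<in> Arr C" "h \<in> Arr C" "src C g = tgt C f" "src C h = tgt C g" "tgt C h = shO C 1 (src C f)"
    "f' \<in> Arr C" "g' \<in> Arr C" "h' \<in> Arr C" "src C g' = tgt C f'" "src C h' = tgt C g'" "tgt C h' = shO C 1 (src C f')"
    using assms(1,2) unfolding candidate_triangle_def by auto
  have "shM C 1 b \<cdot> (\<ominus> shM C 1 f) = (\<ominus> shM C 1 f') \<cdot> shM C 1 a \<longleftrightarrow> b \<cdot> f = f' \<cdot> a"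
    if b: "b \<in> homs C (tgt C f) (tgt C f')"
  proof
    assume "shM C 1 b \<cdot> (\<ominus> shM C 1 f) = (\<ominus> shM C 1 f') \<cdot> shM C 1 a"
    then have "\<ominus> shM C 1 (b \<cdot> f) = \<ominus> shM C 1 (f' \<cdot> a)" using a b c by simp
    then have "\<ominus> (\<ominus> shM C 1 (b \<cdot> f)) = \<ominus> (\<ominus> shM C 1 (f' \<cdot> a))" by (simp only:)
    then have "shM C 1 (b \<cdot> f) = shM C 1 (f' \<cdot> a)" using a b c by (simp del: shM_cmp)
    then show "b \<cdot> f = f' \<cdot> a" using a b c by - (rule shM_inject[of 1], auto)
  next
    assume "b \<cdot> f = f' \<cdot> a"
    then have "\<ominus> shM C 1 (b \<cdot> f) = \<ominus> shM C 1 (f' \<cdot> a)" by simp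
    then show "shM C 1 b \<cdot> (\<ominus> shM C 1 f) = (\<ominus> shM C 1 f') \<cdot> shM C 1 a" using a b c by simp
  qed
  then show ?thesis using a c unfolding triangle_map_def by auto
qed

end

context pretriangulated
begin

lemma dist_dtri:
  "(f, g, h) \<in> Dist C \<Longrightarrow> dtri C (src C f) (tgt C f) (tgt C g) f g h"
  using dist_candidate[of "(f, g, h)"] by (auto simp: dtri_def candidate_triangle_def)

lemma dtri_homs:
  assumes "dtri C X Y Z f g h"
  shows "f \<in> homs C X Y" "g \<in> homs C Y Z" "h \<in> homs C Z (shO C 1 X)" "(f, g, h) \<in> Dist C"
  using assms by (auto simp: dtri_def)

lemma dtri_Obj:
  assumes "dtri C X Y Z f g h"
  shows "X \<in> Obj C" "Y \<in> Obj C" "Z \<in> Obj C"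
  using dtri_homs[OF assms] by auto

lemma cone:
  assumes "f \<in> homs C X Y"
  obtains Z g h where "dtri C X Y Z f g h"
  using TR1_cone[of f] assms dist_dtri by (metis homs_iff)

lemma rot:
  assumes "dtri C X Y Z f g h"
  shows "dtri C Y Z (shO C 1 X) g h (\<ominus> shM C 1 f)"
  using TR2[of f g h] dtri_homs[OF assms] by (auto simp: dtri_def candidate_triangle_def)

text \<open>Rotating \<open>(- h[-1], f, g)\<close> forward gives the third arrow
  \<open>- (- h[-1])[1] = h\<close>, so TR2 can be read backwards.\<close>

lemma rot_back:
  assumes "dtri C X Y Z f g h"
  shows "dtri C (shO C (- 1) Z) X Y (\<ominus> shM C (- 1) h) f g"
  using TR2[of "\<ominus> shM C (- 1) h" f g] dtri_homs[OF assms] dtri_Obj[OF assms]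
  by (auto simp: dtri_def candidate_triangle_def)

lemma fill:
  assumes "dtri C X Y Z f g h" "dtri C X' Y' Z' f' g' h'"
    and "a \<in> homs C X X'" "b \<in> homs C Y Y'" "b \<cdot> f = f' \<cdot> a"
  obtains c where "c \<in> homs C Z Z'" "c \<cdot> g = g' \<cdot> b" "shM C 1 a \<cdot> h = h' \<cdot> c"
  using TR3[of f g h f' g' h' a b] dtri_homs[OF assms(1)] dtri_homs[OF assms(2)] assms(3-)
  by (auto simp: triangle_map_def)

lemma dtri_iso:
  assumes "dtri C X Y Z f g h"
    and "f' \<in> homs C X' Y'" "g' \<in> homs C Y' Z'" "h' \<in> homs C Z' (shO C 1 X')"
    and "iso_arr C X X' a" "iso_arr C Y Y' b" "iso_arr C Z Z' c"
    and "b \<cdot> f = f' \<cdot> a" "c \<cdot> g = g' \<cdot> b" "shM C 1 a \<cdot> h = h' \<cdot> c"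
  shows "dtri C X' Y' Z' f' g' h'"
  using TR1_iso[of "(f, g, h)" "(f', g', h')" a b c] dtri_homs[OF assms(1)] assms(2-)
    assms(5-7)[THEN iso_arr_homs]
  by (auto simp: triangle_map_def candidate_triangle_def dtri_def)

lemma dtri_ident:
  assumes "X \<in> Obj C" "zero_object C Z"
  shows "dtri C X X Z (ident C X) (zeroarr C X Z) (zeroarr C Z (shO C 1 X))"
  using TR1_ident[OF assms] assms zero_object_Obj[OF assms(2)] by (auto simp: dtri_def)

lemma dtri_ident':
  assumes "X \<in> Obj C" "zero_object C Z"
  shows "dtri C Z X X (zeroarr C Z X) (ident C X) (zeroarr C X (shO C 1 Z))"
  using rot_back[OF dtri_ident[OF assms(1) zero_object_shift[OF assms(2), of 1]]] assms
    zero_object_Obj[OF assms(2)] by simp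

text \<open>The triangle \<open>X = X -> 0\<close> maps to the given one by the identity and
  \<open>f\<close>. The third component starts at \<open>0\<close>, and its square exhibits
  \<open>g \<cdot> f\<close> as an arrow factoring through \<open>0\<close>.\<close>

lemma cmp12:
  assumes "dtri C X Y Z f g h" shows "g \<cdot> f = zeroarr C X Z"
proof -
  obtain O' where O: "zero_object C O'" using zero_object_exists by blast
  note t = dtri_homs[OF assms] dtri_Obj[OF assms] zero_object_Obj[OF O]
  obtain c where "c \<in> homs C O' Z" "c \<cdot> zeroarr C X O' = g \<cdot> f"
    by (rule fill[OF dtri_ident[OF t(5) O] assms, of "ident C X" f]) (use t in auto)
  then show ?thesis using t by simp
qed

lemma cmp23: "dtri C X Y Z f g h \<Longrightarrow> h \<cdot> g = zeroarr C Y (shO C 1 X)"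
  by (rule cmp12[OF rot])

lemma cmp31: assumes "dtri C X Y Z f g h" shows "shM C 1 f \<cdot> h = zeroarr C Z (shO C 1 Y)"
  using cmp12[OF rot[OF rot[OF assms]]] dtri_homs[OF assms] dtri_Obj[OF assms]
  by - (rule neg_eq_zero, auto)

text \<open>The rules named \<open>colift\<close> and \<open>lift\<close> express exactness of Hom
  out of and into a triangle. The digit tells the vertex at which \<open>x\<close> starts or ends: 2
  for \<open>Y\<close>, 3 for \<open>Z\<close>, 1 for \<open>X[1]\<close> and 0 for
  \<open>X\<close>. Here the triangle is mapped to the one with vertices \<open>0\<close>,
  \<open>W\<close>, \<open>W\<close>, and the third component is the factorisation.\<close>

lemma colift2:
  assumes t: "dtri C X Y Z f g h" and x: "x \<in> homs C Y W" and "x \<cdot> f = zeroarr C X W"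
  obtains y where "y \<in> homs C Z W" "y \<cdot> g = x"
proof -
  obtain O' where O: "zero_object C O'" using zero_object_exists by blast
  note t' = dtri_homs[OF t] dtri_Obj[OF t] zero_object_Obj[OF O] homs_Obj[OF x]
  obtain c where "c \<in> homs C Z W" "c \<cdot> g = ident C W \<cdot> x"
    by (rule fill[OF t dtri_ident'[OF t'(10) O], of "zeroarr C X O'" x]) (use t' assms(3) x in auto)
  then show thesis using that x by simp
qed

lemma colift3:
  assumes "dtri C X Y Z f g h" "x \<in> homs C Z W" "x \<cdot> g = zeroarr C Y W"
  obtains y where "y \<in> homs C (shO C 1 X) W" "y \<cdot> h = x"
  using colift2[OF rot[OF assms(1)] assms(2,3)] by blast

lemma colift1:
  assumes t: "dtri C X Y Z f g h" and x: "x \<in> homs C (shO C 1 X) W" "x \<cdot> h = zeroarr C Z W"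
  obtains y where "y \<in> homs C (shO C 1 Y) W" "y \<cdot> shM C 1 f = x"
proof -
  obtain y where y: "y \<in> homs C (shO C 1 Y) W" "y \<cdot> (\<ominus> shM C 1 f) = x"
    using colift2[OF rot[OF rot[OF t]] x] by blast
  note t' = dtri_homs[OF t]
  show thesis by (rule that[of "\<ominus> y"]) (use y t' in auto)
qed

text \<open>TR3 produces only a third component, whereas the arrow wanted here is a first one. Both
  triangles are therefore rotated once; the filler is the translate of the required arrow, and the
  two signs cancel.\<close>

lemma lift2:
  assumes t: "dtri C X Y Z f g h" and x: "x \<in> homs C W Y" and "g \<cdot> x = zeroarr C W Z"
  obtains y where "y \<in> homs C W X" "f \<cdot> y = x"
proof -
  obtain O' where O: "zero_object C O'" using zero_object_exists by blast
  note t' = dtri_homs[OF t] dtri_Obj[OF t] zero_object_Obj[OF O] homs_Obj[OF x]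
  obtain c where c: "c \<in> homs C (shO C 1 W) (shO C 1 X)"
    "shM C 1 x \<cdot> (\<ominus> shM C 1 (ident C W)) = (\<ominus> shM C 1 f) \<cdot> c"
    by (rule fill[OF rot[OF dtri_ident[OF t'(9) O]] rot[OF t], of x "zeroarr C O' Z"])
      (use t' assms(3) x in auto)
  have "\<ominus> shM C 1 x = \<ominus> (shM C 1 f \<cdot> c)" using c x t' by simp
  then have eq: "shM C 1 x = shM C 1 f \<cdot> c"
    using c(1) x t' by (metis cmp_simps(1) homs_iff neg_neg shM_simps)
  have "shM C 1 x = shM C 1 (f \<cdot> shM C (- 1) c)" using c(1) x t' eq by simp
  then have "x = f \<cdot> shM C (- 1) c" using c(1) x t' by - (rule shM_inject[of 1], auto)
  then show thesis by (intro that[of "shM C (- 1) c"]) (use c t' in auto)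
qed

lemma lift3:
  assumes "dtri C X Y Z f g h" "x \<in> homs C W Z" "h \<cdot> x = zeroarr C W (shO C 1 X)"
  obtains y where "y \<in> homs C W Y" "g \<cdot> y = x"
  using lift2[OF rot[OF assms(1)] assms(2,3)] by blast

lemma lift1:
  assumes t: "dtri C X Y Z f g h" and x: "x \<in> homs C W (shO C 1 X)" "shM C 1 f \<cdot> x = zeroarr C W (shO C 1 Y)"
  obtains y where "y \<in> homs C W Z" "h \<cdot> y = x"
  using lift2[OF rot[OF rot[OF t]] x(1)] x(2) dtri_homs[OF t] dtri_Obj[OF t] x(1) homs_Obj[OF x(1)] by auto

lemma lift0:
  assumes t: "dtri C X Y Z f g h" and x: "x \<in> homs C W X" "f \<cdot> x = zeroarr C W Y"
  obtains y where "y \<in> homs C W (shO C (- 1) Z)" "shM C (- 1) h \<cdot> y = x"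
proof -
  obtain y where y: "y \<in> homs C W (shO C (- 1) Z)" "(\<ominus> shM C (- 1) h) \<cdot> y = x"
    by (rule lift2[OF rot_back[OF t] x(1)]) (use x in auto)
  note t' = dtri_homs[OF t]
  show thesis by (rule that[of "\<ominus> y"]) (use y t' dtri_Obj[OF t] in auto)
qed

lemma iso_unipotent:
  assumes n: "n \<in> homs C Z Z" "n \<cdot> n = zeroarr C Z Z"
  shows "iso_arr C Z Z (ident C Z \<oplus> n)"
  by (rule iso_arrI[where g = "ident C Z \<oplus> \<ominus> n"]) (use n homs_Obj[OF n(1)] in auto)

text \<open>The difference \<open>n = c - 1\<close> vanishes after \<open>g\<close>, so it factors
  as \<open>m \<cdot> h\<close>, and \<open>h \<cdot> n = 0\<close> then gives
  \<open>n \<cdot> n = 0\<close>. Hence \<open>c = 1 + n\<close> is unipotent.\<close>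

lemma triangle_endo_iso:
  assumes t: "dtri C X Y Z f g h"
    and c: "c \<in> homs C Z Z" "c \<cdot> g = g" "h \<cdot> c = h"
  shows "iso_arr C Z Z c"
proof -
  note t' = dtri_homs[OF t] dtri_Obj[OF t]
  define n where "n = \<ominus> ident C Z \<oplus> c"
  have n: "n \<in> homs C Z Z" "n \<cdot> g = zeroarr C Y Z" "h \<cdot> n = zeroarr C Z (shO C 1 X)"
    unfolding n_def using t' c by auto
  obtain m where m: "m \<in> homs C (shO C 1 X) Z" "m \<cdot> h = n"
    using colift3[OF t n(1,2)] by blast
  have "n \<cdot> n = (m \<cdot> h) \<cdot> n" by (simp only: m(2))
  also have "\<dots> = zeroarr C Z Z" using m(1) n t' by simp
  finally have "iso_arr C Z Z (ident C Z \<oplus> n)" by (intro iso_unipotent n)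
  moreover have "ident C Z \<oplus> n = c" unfolding n_def using c t' by simp
  ultimately show ?thesis by simp
qed

text \<open>The inverses of \<open>a\<close> and \<open>b\<close> extend to some \<open>c'\<close>
  in the opposite direction. It need not be inverse to \<open>c\<close>, but both composites are
  endomorphisms of a triangle which are the identity on two vertices, hence isomorphisms.\<close>

lemma five_lemma:
  assumes t: "dtri C X Y Z f g h" and u: "dtri C X' Y' Z' f' g' h'"
    and a: "iso_arr C X X' a" and b: "iso_arr C Y Y' b" and c: "c \<in> homs C Z Z'"
    and eq: "b \<cdot> f = f' \<cdot> a" "c \<cdot> g = g' \<cdot> b" "shM C 1 a \<cdot> h = h' \<cdot> c"
  shows "iso_arr C Z Z' c"
proof -
  note t' = dtri_homs[OF t] dtri_Obj[OF t] dtri_homs[OF u] dtri_Obj[OF u]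
    iso_arr_homs[OF a] iso_arr_homs[OF b] c
  obtain a' where a': "a' \<in> homs C X' X" "a' \<cdot> a = ident C X" "a \<cdot> a' = ident C X'"
    using a unfolding iso_arr_def by blast
  obtain b' where b': "b' \<in> homs C Y' Y" "b' \<cdot> b = ident C Y" "b \<cdot> b' = ident C Y'"
    using b unfolding iso_arr_def by blast
  have "b' \<cdot> f' = b' \<cdot> ((f' \<cdot> a) \<cdot> a')" using t' a' by simp
  also have "\<dots> = b' \<cdot> (b \<cdot> (f \<cdot> a'))" using t' a' b' by (simp flip: eq)
  also have "\<dots> = f \<cdot> a'" using t' a' b' by (simp add: cmp_ext[OF b'(2)])
  finally have "b' \<cdot> f' = f \<cdot> a'" .
  then obtain c' where c': "c' \<in> homs C Z' Z" "c' \<cdot> g' = g \<cdot> b'" "shM C 1 a' \<cdot> h' = h \<cdot> c'"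
    using fill[OF u t a'(1) b'(1)] by blast
  have s: "shM C 1 a' \<cdot> shM C 1 a = ident C (shO C 1 X)" "shM C 1 a \<cdot> shM C 1 a' = ident C (shO C 1 X')"
    using a' t' by (simp_all flip: shM_cmp)
  have "iso_arr C Z Z (c' \<cdot> c)"
  proof (rule triangle_endo_iso[OF t])
    show "(c' \<cdot> c) \<cdot> g = g" using t' c' b' by (simp add: eq cmp_ext[OF c'(2)])
    have "h \<cdot> (c' \<cdot> c) = shM C 1 a' \<cdot> (h' \<cdot> c)"
      using t' c'(1) a'(1) by (simp add: cmp_ext[OF c'(3)[symmetric]])
    also have "\<dots> = h" using t' a'(1) c by (simp add: cmp_ext[OF s(1)] flip: eq)
    finally show "h \<cdot> (c' \<cdot> c) = h" .
  qed (use t' c' in auto)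
  moreover have "iso_arr C Z' Z' (c \<cdot> c')"
  proof (rule triangle_endo_iso[OF u])
    show "(c \<cdot> c') \<cdot> g' = g'" using t' c' b' by (simp add: cmp_ext[OF eq(2)])
    have "h' \<cdot> (c \<cdot> c') = shM C 1 a \<cdot> (h \<cdot> c')"
      using t' c'(1) by (simp add: cmp_ext[OF eq(3)[symmetric]])
    also have "\<dots> = h'" using t' a'(1) c'(1) by (simp add: cmp_ext[OF s(2)] flip: c'(3))
    finally show "h' \<cdot> (c \<cdot> c') = h'" .
  qed (use t' c' in auto)
  ultimately show ?thesis by (intro iso_arr_if_both_composites_iso[OF c c'(1)])
qed

lemma cone_unique:
  assumes t: "dtri C X Y Z f g h" and u: "dtri C X Y Z' f g' h'"
  obtains c where "iso_arr C Z Z' c" "c \<cdot> g = g'" "h' \<cdot> c = h"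
proof -
  note t' = dtri_homs[OF t] dtri_Obj[OF t] dtri_homs[OF u] dtri_Obj[OF u]
  obtain c where c: "c \<in> homs C Z Z'" "c \<cdot> g = g' \<cdot> ident C Y" "shM C 1 (ident C X) \<cdot> h = h' \<cdot> c"
    by (rule fill[OF t u, of "ident C X" "ident C Y"]) (use t' in auto)
  have "iso_arr C Z Z' c"
    by (rule five_lemma[OF t u iso_arr_ident iso_arr_ident c(1) _ c(2,3)]) (use t' in auto)
  with that c t' show thesis by simp
qed

section \<open>Extensions as a relation between objects, and split triangles\<close>

lemma ext_Obj: assumes "ext C A B D" shows "A \<in> Obj C" "B \<in> Obj C" "D \<in> Obj C"
  using assms dtri_Obj unfolding ext_def by metis+

lemma extI: "dtri C A B D f g h \<Longrightarrow> ext C A B D"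
  unfolding ext_def by blast

lemma ext_rot: "ext C A B D \<Longrightarrow> ext C B D (shO C 1 A)"
  unfolding ext_def using rot by blast

lemma ext_rot_back: "ext C A B D \<Longrightarrow> ext C (shO C (- 1) D) A B"
  unfolding ext_def using rot_back by blast

text \<open>Three rotations translate a triangle up to the signs of its arrows, and
  \<open>ext\<close> does not see signs.\<close>

lemma ext_shift: "ext C A B D \<Longrightarrow> ext C (shO C n A) (shO C n B) (shO C n D)"
proof (induction n rule: int_induct[where k = 0])
  case base
  then show ?case using ext_Obj[OF base] by simp
next
  case (step1 i)
  have "ext C (shO C 1 (shO C i A)) (shO C 1 (shO C i B)) (shO C 1 (shO C i D))"
    by (intro ext_rot step1.IH step1.prems)
  then show ?case using ext_Obj[OF step1.prems] by (simp add: add.commute)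
next
  case (step2 i)
  have "ext C (shO C (- 1) (shO C i A)) (shO C (- 1) (shO C i B)) (shO C (- 1) (shO C i D))"
    by (intro ext_rot_back step2.IH step2.prems)
  then show ?case using ext_Obj[OF step2.prems] by simp
qed

lemma ext_iso_mid:
  assumes "ext C A B D" "isomorphic C B B'" shows "ext C A B' D"
proof -
  obtain f g h where t: "dtri C A B D f g h" using assms(1) unfolding ext_def by blast
  obtain b where b: "iso_arr C B B' b" using assms(2) unfolding isomorphic_def by blast
  obtain b' where b': "b' \<in> homs C B' B" "b' \<cdot> b = ident C B" "b \<cdot> b' = ident C B'"
    using b unfolding iso_arr_def by blast
  note t' = dtri_homs[OF t] dtri_Obj[OF t] iso_arr_homs[OF b]
  show ?thesis
    by (rule extI, rule dtri_iso[OF t, where a = "ident C A" and b = b and c = "ident C D"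
          and f' = "b \<cdot> f" and g' = "g \<cdot> b'" and h' = h])
      (use t' b b' in \<open>auto intro: iso_arr_ident\<close>)
qed

lemma ext_iso_right:
  assumes "ext C A B D" "isomorphic C D D'" shows "ext C A B D'"
proof -
  have "ext C (shO C (- 1) B) (shO C (- 1) D) A"
    using ext_rot_back[OF ext_rot_back[OF assms(1)]] by simp
  then have "ext C (shO C (- 1) B) (shO C (- 1) D') A"
    by (rule ext_iso_mid) (intro isomorphic_shift assms)
  then show ?thesis
    using ext_rot[OF ext_rot] ext_Obj[OF assms(1)] isomorphic_Obj[OF assms(2)]
    by (metis (no_types, lifting) add.right_inverse ext_rot shO_shO shO_zero)
qed

lemma ext_zero_left: "X \<in> Obj C \<Longrightarrow> zero_object C Z \<Longrightarrow> ext C Z X X"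
  using dtri_ident' extI by blast

lemma ext_zero_right: "X \<in> Obj C \<Longrightarrow> zero_object C Z \<Longrightarrow> ext C X X Z"
  using dtri_ident extI by blast

text \<open>As \<open>p\<close> is a retraction of \<open>i\<close>, the last arrow \<open>k\<close>
  of the cone of \<open>i\<close> satisfies \<open>k = p[1] \<cdot> i[1] \<cdot> k = 0\<close>. The
  map from the cone to \<open>Y\<close> induced by \<open>q\<close> is then invertible, with inverse
  \<open>c \<cdot> j\<close>.\<close>

lemma dtri_biprod:
  assumes "biprod C S X Y i j p q"
  shows "dtri C X S Y i q (zeroarr C Y (shO C 1 X))"
proof -
  have b: "i \<in> homs C X S" "j \<in> homs C Y S" "p \<in> homs C S X" "q \<in> homs C S Y"
    "p \<cdot> i = ident C X" "q \<cdot> j = ident C Y" "p \<cdot> j = zeroarr C Y X" "q \<cdot> i = zeroarr C X Y"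
    "i \<cdot> p \<oplus> j \<cdot> q = ident C S"
    using assms unfolding biprod_def by auto
  obtain Z c k where t: "dtri C X S Z i c k" using cone[OF b(1)] by blast
  note t' = dtri_homs[OF t] dtri_Obj[OF t] homs_Obj[OF b(2)]
  have "k = shM C 1 (p \<cdot> i) \<cdot> k" using t' b(5) by simp
  also have "\<dots> = shM C 1 p \<cdot> (shM C 1 i \<cdot> k)" using t' b(1-4) by simp
  also have "\<dots> = zeroarr C Z (shO C 1 X)" using t' b(1-4) cmp31[OF t] by simp
  finally have k: "k = zeroarr C Z (shO C 1 X)" .
  obtain y where y: "y \<in> homs C Z Y" "y \<cdot> c = q" using colift2[OF t b(4,8)] by blast
  have cj: "c \<cdot> (j \<cdot> q) = c"
  proof -
    have "c = c \<cdot> (i \<cdot> p \<oplus> j \<cdot> q)" using b(9) t' by simp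
    also have "\<dots> = c \<cdot> (j \<cdot> q)" using t' b(1-4) cmp12[OF t] by (simp add: cmp_ext[OF cmp12[OF t]])
    finally show ?thesis by simp
  qed
  \<comment> \<open>An arrow which vanishes on \<open>c\<close> factors through \<open>k\<close>,
    and \<open>k = 0\<close>; so \<open>c \<cdot> j \<cdot> y\<close> is the identity.\<close>
  have m0: "(c \<cdot> (j \<cdot> y) \<oplus> \<ominus> ident C Z) \<cdot> c = zeroarr C S Z"
    using t' b(1-4) y cj by simp
  obtain m where m: "m \<in> homs C (shO C 1 X) Z" "m \<cdot> k = c \<cdot> (j \<cdot> y) \<oplus> \<ominus> ident C Z"
    by (rule colift3[OF t _ m0]) (use t' b(1-4) y in auto)
  have "c \<cdot> (j \<cdot> y) \<oplus> \<ominus> ident C Z = zeroarr C Z Z" unfolding m(2)[symmetric] k using m t' by simp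
  then have cy: "c \<cdot> (j \<cdot> y) = ident C Z"
    using t' b(1-4) y by (subst eq_iff_diff_zero) auto
  have yiso: "iso_arr C Z Y y"
    by (rule iso_arrI[where g = "c \<cdot> j"]) (use t' b y cy in \<open>auto simp: cmp_ext[OF y(2)]\<close>)
  show ?thesis
    by (rule dtri_iso[OF t, where a = "ident C X" and b = "ident C S" and c = y])
      (use t' b y yiso k in \<open>auto intro: iso_arr_ident\<close>)
qed

lemma biprod_swap: "biprod C S X Y i j p q \<Longrightarrow> biprod C S Y X j i q p"
  unfolding biprod_def using add_comm by auto

text \<open>Since \<open>h = 0\<close>, the identity of \<open>Z\<close> lifts to a section
  \<open>s\<close> of \<open>g\<close>, and \<open>1 - s \<cdot> g\<close> lifts along
  \<open>f\<close> to \<open>r\<close>. The remaining identities hold after composing with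
  \<open>f\<close>, which can be cancelled because any arrow killed by \<open>f\<close> factors
  through \<open>h[-1] = 0\<close>.\<close>

lemma split_biprod:
  assumes t: "dtri C X Y Z f g h" and h: "h = zeroarr C Z (shO C 1 X)"
  obtains s r where "biprod C Y X Z f s r g"
proof -
  note t' = dtri_homs[OF t] dtri_Obj[OF t]
  obtain s where s: "s \<in> homs C Z Y" "g \<cdot> s = ident C Z"
    by (rule lift3[OF t, of "ident C Z" Z]) (use t' h in auto)
  have e: "g \<cdot> (ident C Y \<oplus> \<ominus> (s \<cdot> g)) = zeroarr C Y Z"
    using t' s by (simp add: cmp_ext[OF s(2)])
  obtain r where r: "r \<in> homs C Y X" "f \<cdot> r = ident C Y \<oplus> \<ominus> (s \<cdot> g)"
    by (rule lift2[OF t _ e]) (use t' s in auto)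
  have inj: "x = zeroarr C W X" if x: "x \<in> homs C W X" "f \<cdot> x = zeroarr C W Y" for x W
  proof -
    obtain y where "y \<in> homs C W (shO C (- 1) Z)" "shM C (- 1) h \<cdot> y = x" using lift0[OF t x] by blast
    then show ?thesis using t' x homs_Obj[OF x(1)] unfolding h by auto
  qed
  have rf: "r \<cdot> f = ident C X"
  proof -
    have "f \<cdot> (r \<cdot> f \<oplus> \<ominus> ident C X) = zeroarr C X Y"
      using t' s r by (simp add: cmp_ext[OF r(2)] cmp12[OF t])
    then have "r \<cdot> f \<oplus> \<ominus> ident C X = zeroarr C X X" using t' r by (intro inj) auto
    then show ?thesis using t' r by (subst eq_iff_diff_zero) auto
  qed
  have rs: "r \<cdot> s = zeroarr C Z X"
    using t' s r by (intro inj) (auto simp: cmp_ext[OF r(2)])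
  have "biprod C Y X Z f s r g"
    unfolding biprod_def using t' s r rf rs cmp12[OF t] by auto
  then show thesis by (rule that)
qed

text \<open>The connecting arrow vanishes, so the middle object is a biproduct, and a biproduct is
  an extension in either order. Orthogonality enters the existence of decompositions through this
  rule.\<close>

lemma ext_swap:
  assumes "ext C X Y Z" "\<forall>f\<in>homs C Z (shO C 1 X). f = zeroarr C Z (shO C 1 X)"
  shows "ext C Z Y X"
proof -
  obtain f g h where t: "dtri C X Y Z f g h" using assms(1) unfolding ext_def by blast
  then have "h = zeroarr C Z (shO C 1 X)" using assms(2) dtri_homs(3)[OF t] by blast
  then obtain s r where "biprod C Y X Z f s r g" using split_biprod[OF t] by blast
  then show ?thesis using dtri_biprod[OF biprod_swap] extI by blast
qed

lemma ext_hom_zero_left: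
  assumes "ext C A B D" "\<forall>f\<in>homs C A W. f = zeroarr C A W" "\<forall>f\<in>homs C D W. f = zeroarr C D W"
  shows "\<forall>f\<in>homs C B W. f = zeroarr C B W"
proof
  fix x assume x: "x \<in> homs C B W"
  obtain f g h where t: "dtri C A B D f g h" using assms(1) unfolding ext_def by blast
  note t' = dtri_homs[OF t] dtri_Obj[OF t] x homs_Obj[OF x]
  have "x \<cdot> f = zeroarr C A W" using t' by (intro assms(2)[rule_format]) auto
  then obtain y where y: "y \<in> homs C D W" "y \<cdot> g = x" using colift2[OF t x] by blast
  then have "y = zeroarr C D W" using assms(3) by blast
  then show "x = zeroarr C B W" using y t' by auto
qed

lemma ext_hom_zero_right:
  assumes "ext C A B D" "\<forall>f\<in>homs C W A. f = zeroarr C W A" "\<forall>f\<in>homs C W D. f = zeroarr C W D"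
  shows "\<forall>f\<in>homs C W B. f = zeroarr C W B"
proof
  fix x assume x: "x \<in> homs C W B"
  obtain f g h where t: "dtri C A B D f g h" using assms(1) unfolding ext_def by blast
  note t' = dtri_homs[OF t] dtri_Obj[OF t] x homs_Obj[OF x]
  have "g \<cdot> x = zeroarr C W D" using t' by (intro assms(3)[rule_format]) auto
  then obtain y where y: "y \<in> homs C W A" "f \<cdot> y = x" using lift2[OF t x] by blast
  then have "y = zeroarr C W A" using assms(2) by blast
  then show "x = zeroarr C W B" using y t' by auto
qed

end

context pretriangulated
begin

text \<open>
  The cone of the idempotent complementary to \<open>i \<cdot> r\<close> is the biproduct of the retract \<open>M\<close> and its
  translate, although \<open>M\<close> need not have a complement in \<open>N\<close>.
\<close>

lemma cone_complementary_idempotent: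
  assumes i: "i \<in> homs C M N" and r: "r \<in> homs C N M" and ri: "r \<cdot> i = ident C M"
    and t: "dtri C N N Q (ident C N \<oplus> \<ominus> (i \<cdot> r)) a b"
  obtains j s q where "biprod C Q M (shO C 1 M) (a \<cdot> i) j s q"
proof -
  note h = i r dtri_homs[OF t] dtri_Obj[OF t] homs_Obj[OF i]
  let ?e = "ident C N \<oplus> \<ominus> (i \<cdot> r)"
  let ?i = "shM C 1 i" and ?r = "shM C 1 r"
  have ri1: "?r \<cdot> ?i = ident C (shO C 1 M)" using h ri by (simp flip: shM_cmp)
  \<comment> \<open>Since \<open>r\<close> annihilates \<open>1 - i \<cdot> r\<close>, it extends to
    the cone; this is the projection onto the summand \<open>M\<close>.\<close>
  obtain s where s: "s \<in> homs C Q M" "s \<cdot> a = r"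
    by (rule colift2[OF t r]) (use h ri in \<open>simp add: cmp_ext[OF ri]\<close>)
  \<comment> \<open>The translate of \<open>1 - i \<cdot> r\<close> annihilates
    \<open>i[1] \<cdot> r[1]\<close>, which therefore lifts to the cone; restricted to
    \<open>M[1]\<close> this is a first candidate \<open>u\<close> for the second inclusion.\<close>
  obtain t' where t': "t' \<in> homs C (shO C 1 N) Q" "b \<cdot> t' = ?i \<cdot> ?r"
    by (rule lift1[OF t, of "?i \<cdot> ?r" "shO C 1 N"]) (use h in \<open>simp_all add: cmp_ext[OF ri1]\<close>)
  define e1 where "e1 = a \<cdot> i"
  define u where "u = t' \<cdot> ?i"
  \<comment> \<open>The component of \<open>u\<close> along \<open>e1\<close> is removed in order to
    get \<open>s \<cdot> e2 = 0\<close>.\<close>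
  define e2 where "e2 = u \<oplus> \<ominus> (e1 \<cdot> (s \<cdot> u))"
  define q where "q = ?r \<cdot> b"
  have ba: "b \<cdot> a = zeroarr C N (shO C 1 N)" by (rule cmp23[OF t])
  have T: "e1 \<in> homs C M Q" "u \<in> homs C (shO C 1 M) Q" "e2 \<in> homs C (shO C 1 M) Q"
    "q \<in> homs C Q (shO C 1 M)"
    unfolding e1_def e2_def q_def u_def using h s(1) t'(1) by simp_all
  have bu: "b \<cdot> u = ?i" unfolding u_def using h t'(1) by (simp add: cmp_ext[OF t'(2)] ri1)
  have be1: "b \<cdot> e1 = zeroarr C M (shO C 1 N)" unfolding e1_def using h by (simp add: cmp_ext[OF ba])
  have se1: "s \<cdot> e1 = ident C M" unfolding e1_def using h s(1) by (simp add: cmp_ext[OF s(2)] ri)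
  have be2: "b \<cdot> e2 = ?i" unfolding e2_def using h T(1,2) s(1) by (simp add: bu cmp_ext[OF be1])
  have se2: "s \<cdot> e2 = zeroarr C (shO C 1 M) M"
    unfolding e2_def using h T(1,2) s(1) by (simp add: cmp_ext[OF se1])
  have qe1: "q \<cdot> e1 = zeroarr C M (shO C 1 M)" unfolding q_def using h T(1) by (simp add: be1)
  have qe2: "q \<cdot> e2 = ident C (shO C 1 M)" unfolding q_def using h T(3) by (simp add: be2 ri1)
  \<comment> \<open>The defect of the two projections. From \<open>d \<cdot> a = 0\<close> and
    \<open>b \<cdot> d = 0\<close> it follows that \<open>d\<close> factors over \<open>b\<close>
    and that \<open>d \<cdot> d = 0\<close>. On the other hand \<open>d\<close> kills
    \<open>e1\<close> and \<open>e2\<close>, so \<open>d \<cdot> d = d\<close>; hence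
    \<open>d = 0\<close>.\<close>
  define d where "d = ident C Q \<oplus> (\<ominus> (e1 \<cdot> s) \<oplus> \<ominus> (e2 \<cdot> q))"
  have dT: "d \<in> homs C Q Q" unfolding d_def using h T s(1) by simp
  have qa: "q \<cdot> a = zeroarr C N (shO C 1 M)" unfolding q_def using h by (simp add: ba)
  have ae: "a \<cdot> ?e = zeroarr C N Q" by (rule cmp12[OF t])
  have "d \<cdot> a = zeroarr C N Q"
  proof -
    have "d \<cdot> a = a \<cdot> ?e" unfolding d_def using h T s(1) by (simp add: s(2) qa) (simp add: e1_def h)
    then show ?thesis by (simp only: ae)
  qed
  then obtain d' where d': "d' \<in> homs C (shO C 1 N) Q" "d' \<cdot> b = d" using colift3[OF t dT] by blast
  have "b \<cdot> d = zeroarr C Q (shO C 1 N)"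
  proof -
    have "b \<cdot> d = shM C 1 ?e \<cdot> b"
      unfolding d_def using h T s(1) by (simp add: cmp_ext[OF be1] cmp_ext[OF be2]) (simp add: q_def h)
    then show ?thesis by (simp only: cmp31[OF t])
  qed
  then have "(d' \<cdot> b) \<cdot> d = zeroarr C Q Q" using d'(1) dT h by simp
  then have dd: "d \<cdot> d = zeroarr C Q Q" by (simp only: d'(2))
  have de1: "d \<cdot> e1 = zeroarr C M Q" unfolding d_def using h T s(1) by (simp add: se1 qe1)
  have de2: "d \<cdot> e2 = zeroarr C (shO C 1 M) Q" unfolding d_def using h T s(1) by (simp add: se2 qe2)
  have "d \<cdot> d = d \<cdot> (ident C Q \<oplus> (\<ominus> (e1 \<cdot> s) \<oplus> \<ominus> (e2 \<cdot> q)))" by (simp only: d_def)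
  also have "\<dots> = d" using h T s(1) dT by (simp add: cmp_ext[OF de1] cmp_ext[OF de2])
  finally have d0: "d = zeroarr C Q Q" using dd by simp
  have "e1 \<cdot> s \<oplus> e2 \<cdot> q = (e1 \<cdot> s \<oplus> e2 \<cdot> q) \<oplus> d" using h T s(1) d0 by simp
  also have "\<dots> = ident C Q" unfolding d_def using h T s(1) by (simp add: add_lcomm add_comm)
  finally have sum: "e1 \<cdot> s \<oplus> e2 \<cdot> q = ident C Q" .
  have "biprod C Q M (shO C 1 M) e1 e2 s q"
    unfolding biprod_def using T s(1) se1 qe2 se2 qe1 sum by simp
  then show thesis unfolding e1_def by (rule that)
qed

text \<open>Both statements are the split triangle \<open>M[1] -> Q -> M\<close>: rotated forward it
  ends in \<open>M[2]\<close>, rotated backward and translated by -1 it begins with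
  \<open>M[-2]\<close>. The first serves retracts of objects bounded below, the second those of
  objects bounded above.\<close>

lemma retract_ext_of_cone:
  assumes i: "i \<in> homs C M N" and r: "r \<in> homs C N M" and ri: "r \<cdot> i = ident C M"
    and t: "dtri C N N Q (ident C N \<oplus> \<ominus> (i \<cdot> r)) a b"
  shows "ext C Q M (shO C 2 M)" "ext C (shO C (- 2) M) M (shO C (- 1) Q)"
proof -
  obtain j s q where "biprod C Q M (shO C 1 M) (a \<cdot> i) j s q"
    by (rule cone_complementary_idempotent[OF i r ri t])
  then have e: "ext C (shO C 1 M) Q M" using dtri_biprod[OF biprod_swap] extI by blast
  note M = homs_Obj(1)[OF i] dtri_Obj(3)[OF t]
  show "ext C Q M (shO C 2 M)" using ext_rot[OF e] M by simp
  show "ext C (shO C (- 2) M) M (shO C (- 1) Q)" using ext_shift[OF ext_rot_back[OF e], of "- 1"] M by simp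
qed

end

section \<open>Extensions and strict triangulated subclasses\<close>

context triangulated_category
begin

lemma octahedron:
  assumes "dtri C X Y A f i j" "dtri C Y Z B g k l" "dtri C X Z D (g \<cdot> f) r s"
  obtains u v where "dtri C A D B u v (shM C 1 i \<cdot> l)"
    "u \<cdot> i = r \<cdot> g" "s \<cdot> u = j" "v \<cdot> r = k" "l \<cdot> v = shM C 1 f \<cdot> s"
proof -
  note t = dtri_homs[OF assms(1)] dtri_homs[OF assms(2)] dtri_homs[OF assms(3)]
  have "\<exists>u\<in>homs C (tgt C i) (tgt C r). \<exists>v\<in>homs C (tgt C r) (tgt C k).
              (u, v, shM C 1 i \<cdot> l) \<in> Dist C
            \<and> u \<cdot> i = r \<cdot> g \<and> s \<cdot> u = j \<and> v \<cdot> r = k \<and> l \<cdot> v = shM C 1 f \<cdot> s"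
    by (rule TR4[OF t(4,8) _ t(12)]) (use t in auto)
  then obtain u v where uv: "u \<in> homs C A D" "v \<in> homs C D B" "(u, v, shM C 1 i \<cdot> l) \<in> Dist C"
    "u \<cdot> i = r \<cdot> g" "s \<cdot> u = j" "v \<cdot> r = k" "l \<cdot> v = shM C 1 f \<cdot> s"
    using t(2,6,10) by (auto simp: Bex_def)
  then have "dtri C A D B u v (shM C 1 i \<cdot> l)" using t unfolding dtri_def by auto
  with uv that show thesis by blast
qed

text \<open>The octahedral axiom with its arrows forgotten: \<open>(A * B) * D\<close> is contained
  in \<open>A * (B * D)\<close>.\<close>

lemma ext_assoc1:
  assumes "ext C A E B" "ext C E M D"
  obtains F where "ext C B F D" "ext C A M F"
proof -
  obtain f i j where t: "dtri C A E B f i j" using assms(1) unfolding ext_def by blast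
  obtain g k l where u: "dtri C E M D g k l" using assms(2) unfolding ext_def by blast
  have "g \<cdot> f \<in> homs C A M" using dtri_homs[OF t] dtri_homs[OF u] by simp
  then obtain F r s where v: "dtri C A M F (g \<cdot> f) r s" using cone by blast
  obtain u' v' where "dtri C B F D u' v' (shM C 1 i \<cdot> l)" using octahedron[OF t u v] by blast
  then show thesis using that extI v by blast
qed

text \<open>The opposite inclusion follows from the same axiom after one rotation of both triangles,
  which presents \<open>D\<close> as built from \<open>M\<close>, \<open>A[1]\<close> and
  \<open>B[1]\<close>. The object \<open>G\<close> found there is the translate of the required
  \<open>E\<close>.\<close>

lemma ext_assoc2:
  assumes "ext C A M F" "ext C B F D"
  obtains E where "ext C A E B" "ext C E M D"
proof -
  note Ob = ext_Obj[OF assms(1)] ext_Obj[OF assms(2)]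
  obtain G where G: "ext C (shO C 1 A) G (shO C 1 B)" "ext C M D G"
    using ext_assoc1[OF ext_rot[OF assms(1)] ext_rot[OF assms(2)]] by blast
  have "ext C A (shO C (- 1) G) B" using ext_shift[OF G(1), of "- 1"] Ob by simp
  then show thesis using ext_rot_back[OF G(2)] that by blast
qed

text \<open>
  With \<open>M1 = A1 * B1\<close> and \<open>M2 = A2 * B2\<close>, associativity turns \<open>M1 * M2\<close> into
  \<open>A1 * (B1 * A2) * B2\<close>, and orthogonality allows to interchange \<open>B1\<close> and \<open>A2\<close>.
\<close>

lemma decomposable_ext:
  assumes P: "\<And>A B D. A \<in> P \<Longrightarrow> D \<in> P \<Longrightarrow> ext C A B D \<Longrightarrow> B \<in> P"
    and Q: "\<And>A B D. A \<in> Q \<Longrightarrow> D \<in> Q \<Longrightarrow> ext C A B D \<Longrightarrow> B \<in> Q"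
    and orth: "\<And>X Y f. X \<in> P \<Longrightarrow> Y \<in> Q \<Longrightarrow> f \<in> homs C X (shO C 1 Y) \<Longrightarrow> f = zeroarr C X (shO C 1 Y)"
    and M: "ext C M1 M M2"
    and M1: "\<exists>A\<in>P. \<exists>B\<in>Q. ext C A M1 B" and M2: "\<exists>A\<in>P. \<exists>B\<in>Q. ext C A M2 B"
  shows "\<exists>A\<in>P. \<exists>B\<in>Q. ext C A M B"
proof -
  obtain A1 B1 where 1: "A1 \<in> P" "B1 \<in> Q" "ext C A1 M1 B1" using M1 by blast
  obtain A2 B2 where 2: "A2 \<in> P" "B2 \<in> Q" "ext C A2 M2 B2" using M2 by blast
  obtain F where F: "ext C B1 F M2" "ext C A1 M F" using ext_assoc1[OF 1(3) M] by blast
  obtain E where E: "ext C B1 E A2" "ext C E F B2" using ext_assoc2[OF F(1) 2(3)] by blast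
  have "ext C A2 E B1" by (rule ext_swap[OF E(1)]) (use orth 1 2 in blast)
  then obtain G where G: "ext C B1 G B2" "ext C A2 F G" using ext_assoc1 E(2) by blast
  obtain H where H: "ext C A1 H A2" "ext C H M G" using ext_assoc2[OF F(2) G(2)] by blast
  show ?thesis using P[OF 1(1) 2(1) H(1)] Q[OF 1(2) 2(2) G(1)] H(2) by blast
qed

text \<open>The definition asks for closure under cones, and the middle object is the cone of an
  arrow \<open>D[-1] -> A\<close>.\<close>

lemma strict_ext_closed:
  assumes S: "strict_triangulated_subclass C S" and "ext C A B D" "A \<in> S" "D \<in> S"
  shows "B \<in> S"
proof -
  obtain f g h where t: "dtri C (shO C (- 1) D) A B f g h"
    using ext_rot_back[OF assms(2)] unfolding ext_def by blast
  have "shO C (- 1) D \<in> S" using S assms(4) unfolding strict_triangulated_subclass_def by blast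
  moreover have "\<forall>(f, g, h)\<in>Dist C. src C f \<in> S \<and> tgt C f \<in> S \<longrightarrow> tgt C g \<in> S"
    using S unfolding strict_triangulated_subclass_def by blast
  then have "src C f \<in> S \<and> tgt C f \<in> S \<longrightarrow> tgt C g \<in> S" using dtri_homs(4)[OF t] by blast
  ultimately show ?thesis using assms(3) dtri_homs[OF t] by auto
qed

lemma strict_subclassI:
  assumes "S \<subseteq> Obj C" "\<And>Z. zero_object C Z \<Longrightarrow> Z \<in> S"
    "\<And>X Y. X \<in> S \<Longrightarrow> isomorphic C X Y \<Longrightarrow> Y \<in> S" "\<And>X n. X \<in> S \<Longrightarrow> shO C n X \<in> S"
    "\<And>A B D. ext C A B D \<Longrightarrow> A \<in> S \<Longrightarrow> D \<in> S \<Longrightarrow> B \<in> S"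
  shows "strict_triangulated_subclass C S"
proof -
  have "tgt C g \<in> S" if "(f, g, h) \<in> Dist C" "src C f \<in> S" "tgt C f \<in> S" for f g h
    using assms(5)[OF extI[OF rot[OF dist_dtri[OF that(1)]]]] that(2,3) assms(4) by blast
  then show ?thesis using assms(1-4) unfolding strict_triangulated_subclass_def by blast
qed

lemma strict_UNIV: "strict_triangulated_subclass C (Obj C)"
  by (rule strict_subclassI) (auto dest: zero_object_Obj isomorphic_Obj(2) ext_Obj(2))

lemma strongly_generated_subclass:
  assumes "D \<subseteq> Obj C"
  shows "strict_triangulated_subclass C (strongly_generated C D)" "D \<subseteq> strongly_generated C D"
proof -
  show "D \<subseteq> strongly_generated C D" unfolding strongly_generated_def by blast
  show "strict_triangulated_subclass C (strongly_generated C D)"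
  proof (rule strict_subclassI)
    show "strongly_generated C D \<subseteq> Obj C"
      unfolding strongly_generated_def using strict_UNIV assms by blast
    fix A B E assume e: "ext C A B E" "A \<in> strongly_generated C D" "E \<in> strongly_generated C D"
    show "B \<in> strongly_generated C D"
      using e(2,3) strict_ext_closed[OF _ e(1)] unfolding strongly_generated_def by blast
  qed (unfold strongly_generated_def strict_triangulated_subclass_def, blast+)
qed

lemma strongly_generated_least:
  "strict_triangulated_subclass C S \<Longrightarrow> D \<subseteq> S \<Longrightarrow> strongly_generated C D \<subseteq> S"
  unfolding strongly_generated_def by blast

end

section \<open>Full triangulated subcategories\<close>

locale triangulated_subclass = triangulated_category C for C :: "('o, 'm) tcat" (structure) +
  fixes S assumes strict: "strict_triangulated_subclass C S"
begin

abbreviation T where "T \<equiv> tri_sub C S"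

lemma S_Obj [simp]: "X \<in> S \<Longrightarrow> X \<in> Obj C"
  and S_zero: "zero_object C Z \<Longrightarrow> Z \<in> S"
  and S_iso: "X \<in> S \<Longrightarrow> isomorphic C X Y \<Longrightarrow> Y \<in> S"
  and S_shift [simp]: "X \<in> S \<Longrightarrow> shO C n X \<in> S"
  using strict unfolding strict_triangulated_subclass_def by blast+

lemma S_ext: "ext C A B D \<Longrightarrow> A \<in> S \<Longrightarrow> D \<in> S \<Longrightarrow> B \<in> S"
  by (rule strict_ext_closed[OF strict])

lemma S_cone: "ext C A B D \<Longrightarrow> A \<in> S \<Longrightarrow> B \<in> S \<Longrightarrow> D \<in> S"
  using S_ext[OF ext_rot] by simp

lemma T_simps [simp]:
  "Obj T = S" "Arr T = {f \<in> Arr C. src C f \<in> S \<and> tgt C f \<in> S}" "src T = src C" "tgt T = tgt C"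
  "ident T = ident C" "cmp T = cmp C" "zeroarr T = zeroarr C" "addarr T = addarr C"
  "shO T = shO C" "shM T = shM C"
  by (simp_all add: tri_sub_def Let_def)

lemma T_Dist [simp]: "(f, g, h) \<in> Dist T \<longleftrightarrow> (f, g, h) \<in> Dist C \<and> f \<in> Arr T \<and> g \<in> Arr T \<and> h \<in> Arr T"
  by (auto simp: tri_sub_def Let_def)

lemma T_homs: "X \<in> S \<Longrightarrow> Y \<in> S \<Longrightarrow> homs T X Y = homs C X Y"
  by (auto simp: homs_def)

lemma T_hom_group: "X \<in> S \<Longrightarrow> Y \<in> S \<Longrightarrow> hom_group T X Y = hom_group C X Y"
  by (simp add: hom_group_def T_homs)

lemma T_neg [simp]: "src C f \<in> S \<Longrightarrow> tgt C f \<in> S \<Longrightarrow> negarr T f = negarr C f"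
  by (simp add: negarr_def T_hom_group)

lemma T_zero_object: "zero_object T Z \<longleftrightarrow> zero_object C Z"
  using S_zero unfolding zero_object_def by auto

lemma T_iso: "iso_arr T X Y f \<longleftrightarrow> X \<in> S \<and> Y \<in> S \<and> iso_arr C X Y f"
  by (auto simp: iso_arr_def)

lemma T_isomorphic: "isomorphic T X Y \<longleftrightarrow> X \<in> S \<and> isomorphic C X Y"
  using S_iso by (auto simp: isomorphic_def T_iso)

lemma T_retract: "X \<in> S \<Longrightarrow> Y \<in> S \<Longrightarrow> retract T X Y \<longleftrightarrow> retract C X Y"
  by (simp add: retract_def T_homs)

lemma T_candidate: "candidate_triangle T (f, g, h) \<longleftrightarrow> candidate_triangle C (f, g, h) \<and> f \<in> Arr T \<and> g \<in> Arr T"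
  by (auto simp: candidate_triangle_def)

lemma T_map: "triangle_map T (f, g, h) (f', g', h') (a, b, c) \<longleftrightarrow> triangle_map C (f, g, h) (f', g', h') (a, b, c)
   \<and> a \<in> Arr T \<and> b \<in> Arr T \<and> c \<in> Arr T"
  by (auto simp: triangle_map_def)

lemma T_additive: "additive_category T"
proof -
  have "additive_category (full_sub C S)"
    by (rule full_sub_additive) (use zero_object_exists S_zero S_ext[OF extI[OF dtri_biprod]] in auto)
  moreover have "acat.truncate T = full_sub C S"
    by (simp add: tri_sub_def full_sub_def Let_def acat.defs)
  ultimately show ?thesis using additive_category_truncate[of T] by simp
qed

text \<open>Fullness makes every arrow supplied by TR3 or TR4 available in the subcategory, since
  its ends are vertices of given triangles. A new object appears only in TR1, and it is a
  cone.\<close>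

lemma T_triangulated: "triangulated_category T"
proof -
  interpret T: additive_category T by (rule T_additive)
  show ?thesis
  proof unfold_locales
    show "additive_functor T T (shift_func T n)" for n
      by (auto simp: additive_functor_def shift_func_def)
    show "candidate_triangle T t" if "t \<in> Dist T" for t
      using that dist_candidate by (cases t) (auto simp: T_candidate)
    show "t' \<in> Dist T" if "t \<in> Dist T" "candidate_triangle T t'" "triangle_map T t t' (a, b, c)"
      "iso_arr T (src T a) (tgt T a) a" "iso_arr T (src T b) (tgt T b) b" "iso_arr T (src T c) (tgt T c) c"
      for t t' a b c
    proof -
      obtain f g h f' g' h' where tt: "t = (f, g, h)" "t' = (f', g', h')" by (metis prod_cases3)
      have "t' \<in> Dist C"
        by (rule TR1_iso[of t t' a b c]) (use that in \<open>auto simp: tt T_candidate T_map T_iso simp del: homs_iff\<close>)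
      then show ?thesis using that(2) by (auto simp: tt T_candidate candidate_triangle_def)
    qed
    show "(ident T X, zeroarr T X Z, zeroarr T Z (shO T 1 X)) \<in> Dist T"
      if "X \<in> Obj T" "zero_object T Z" for X Z
      using that TR1_ident[of X Z] S_zero[of Z] by (simp add: T_zero_object)
    show "\<exists>g h. (f, g, h) \<in> Dist T" if "f \<in> Arr T" for f
    proof -
      have "f \<in> homs C (src C f) (tgt C f)" using that by simp
      then obtain Z g h where t: "dtri C (src C f) (tgt C f) Z f g h" by (rule cone)
      then have "Z \<in> S" using S_cone[OF extI] that by auto
      then show ?thesis using that dtri_homs[OF t] by (intro exI[of _ g] exI[of _ h]) auto
    qed
    show "((f, g, h) \<in> Dist T) = ((g, h, negarr T (shM T 1 f)) \<in> Dist T)"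
      if "candidate_triangle T (f, g, h)" for f g h
      using that TR2[of f g h] by (auto simp: T_candidate candidate_triangle_def)
    show "\<exists>c. triangle_map T (f, g, h) (f', g', h') (a, b, c)"
      if "(f, g, h) \<in> Dist T" "(f', g', h') \<in> Dist T" "a \<in> homs T (src T f) (src T f')"
        "b \<in> homs T (tgt T f) (tgt T f')" "b \<cdot>\<^bsub>T\<^esub> f = f' \<cdot>\<^bsub>T\<^esub> a" for f g h f' g' h' a b
      using that TR3[of f g h f' g' h' a b] by (auto simp: triangle_map_def)
    show "\<exists>u\<in>homs T (tgt T i) (tgt T r). \<exists>v\<in>homs T (tgt T r) (tgt T k).
              (u, v, shM T 1 i \<cdot>\<^bsub>T\<^esub> l) \<in> Dist T
            \<and> u \<cdot>\<^bsub>T\<^esub> i = r \<cdot>\<^bsub>T\<^esub> g \<and> s \<cdot>\<^bsub>T\<^esub> u = j \<and> v \<cdot>\<^bsub>T\<^esub> r = k \<and> l \<cdot>\<^bsub>T\<^esub> v = shM T 1 f \<cdot>\<^bsub>T\<^esub> s"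
      if t: "(f, i, j) \<in> Dist T" "(g, k, l) \<in> Dist T" "src T g = tgt T f" "(g \<cdot>\<^bsub>T\<^esub> f, r, s) \<in> Dist T"
      for f i j g k l r s
    proof -
      have tC: "(f, i, j) \<in> Dist C" "(g, k, l) \<in> Dist C" "src C g = tgt C f" "(g \<cdot> f, r, s) \<in> Dist C"
        using t by simp_all
      have ST: "src C i \<in> S" "tgt C i \<in> S" "tgt C r \<in> S" "tgt C k \<in> S" using t by simp_all
      obtain u v where uv: "u \<in> homs C (tgt C i) (tgt C r)" "v \<in> homs C (tgt C r) (tgt C k)"
         "(u, v, shM C 1 i \<cdot> l) \<in> Dist C"
         "u \<cdot> i = r \<cdot> g \<and> s \<cdot> u = j \<and> v \<cdot> r = k \<and> l \<cdot> v = shM C 1 f \<cdot> s"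
        using TR4[OF tC] by blast
      have "u \<in> Arr T" "v \<in> Arr T" using uv(1,2) ST by simp_all
      moreover have "shM C 1 i \<cdot> l \<in> homs C (tgt C v) (shO C 1 (src C u))"
        using dtri_homs(3)[OF dist_dtri[OF uv(3)]] .
      then have "shM C 1 i \<cdot> l \<in> Arr T" using uv(1,2) ST by simp
      ultimately show ?thesis
        by (intro bexI[of _ u] bexI[of _ v]) (use uv ST in \<open>simp_all add: T_homs del: homs_iff T_simps(2)\<close>)
    qed
  qed auto
qed

lemma T_dtri: "dtri T A B D f g h \<longleftrightarrow> A \<in> S \<and> B \<in> S \<and> dtri C A B D f g h"
proof
  assume "A \<in> S \<and> B \<in> S \<and> dtri C A B D f g h"
  then show "dtri T A B D f g h" using S_cone[OF extI] by (auto simp: dtri_def)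
qed (auto simp: dtri_def)

lemma T_ext: "ext T A B D \<longleftrightarrow> A \<in> S \<and> B \<in> S \<and> ext C A B D"
  by (auto simp: ext_def T_dtri)

text \<open>Generation does not depend on the ambient category: \<open>S\<close> is closed under
  isomorphisms and extensions in \<open>C\<close>, so a class which is strict and triangulated
  inside \<open>S\<close> is so in \<open>C\<close>.\<close>

lemma T_generated:
  assumes "S = strongly_generated C D" "D \<subseteq> Obj C"
  shows "strongly_generated T D = S"
proof
  interpret T: triangulated_category T by (rule T_triangulated)
  have D: "D \<subseteq> S" using strongly_generated_subclass[OF assms(2)] assms(1) by simp
  show "strongly_generated T D \<subseteq> S"
    using T.strongly_generated_least[OF T.strict_UNIV] D by simp
  have "strict_triangulated_subclass C (strongly_generated T D)"
  proof -
    have st: "strict_triangulated_subclass T (strongly_generated T D)"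
      using T.strongly_generated_subclass(1) D by simp
    interpret R: triangulated_subclass T "strongly_generated T D"
      by unfold_locales (rule st)
    have sub: "strongly_generated T D \<subseteq> S" using R.S_Obj by auto
    show ?thesis
    proof (rule strict_subclassI)
      show "Y \<in> strongly_generated T D" if "X \<in> strongly_generated T D" "isomorphic C X Y" for X Y
        using that R.S_iso sub by (auto simp: T_isomorphic)
      show "shO C n X \<in> strongly_generated T D" if "X \<in> strongly_generated T D" for X n
        using that R.S_shift by simp
      show "Z \<in> strongly_generated T D" if "zero_object C Z" for Z
        using that R.S_zero by (simp add: T_zero_object)
      show "B \<in> strongly_generated T D"
        if "ext C A B E" "A \<in> strongly_generated T D" "E \<in> strongly_generated T D" for A B E
        using that R.S_ext sub S_ext[OF that(1)] by (auto simp: T_ext)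
    qed (use sub in auto)
  qed
  moreover have "D \<subseteq> strongly_generated T D" using T.strongly_generated_subclass(2) D by simp
  ultimately show "S \<subseteq> strongly_generated T D"
    unfolding assms(1) by (intro strongly_generated_least)
qed

end

section \<open>Octahedra of direct summands\<close>

context pretriangulated
begin

text \<open>The fillers \<open>a\<close> and \<open>p\<close> need not form a retraction, but
  \<open>p \<cdot> a\<close> fixes \<open>i\<close> and \<open>j\<close> and hence is an
  automorphism. Its inverse \<open>c\<close> also fixes them, so replacing \<open>p\<close> by
  \<open>c \<cdot> p\<close> corrects the composite without disturbing any square.\<close>

lemma triangle_retract:
  assumes t: "dtri C X Y A f i j" and t0: "dtri C X0 Y0 A0 f0 i0 j0"
    and x: "\<iota>x \<in> homs C X X0" "\<pi>x \<in> homs C X0 X" "\<pi>x \<cdot> \<iota>x = ident C X"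
    and y: "\<iota>y \<in> homs C Y Y0" "\<pi>y \<in> homs C Y0 Y" "\<pi>y \<cdot> \<iota>y = ident C Y"
    and sq: "\<iota>y \<cdot> f = f0 \<cdot> \<iota>x" "\<pi>y \<cdot> f0 = f \<cdot> \<pi>x"
  obtains \<iota>a \<pi>a where "\<iota>a \<in> homs C A A0" "\<pi>a \<in> homs C A0 A" "\<pi>a \<cdot> \<iota>a = ident C A"
    "\<iota>a \<cdot> i = i0 \<cdot> \<iota>y" "\<pi>a \<cdot> i0 = i \<cdot> \<pi>y"
    "shM C 1 \<iota>x \<cdot> j = j0 \<cdot> \<iota>a" "shM C 1 \<pi>x \<cdot> j0 = j \<cdot> \<pi>a"
proof -
  note h = dtri_homs[OF t] dtri_homs[OF t0] dtri_Obj[OF t] dtri_Obj[OF t0] x(1,2) y(1,2)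
  obtain a where a: "a \<in> homs C A A0" "a \<cdot> i = i0 \<cdot> \<iota>y" "shM C 1 \<iota>x \<cdot> j = j0 \<cdot> a"
    using fill[OF t t0 x(1) y(1) sq(1)] by blast
  obtain p where p: "p \<in> homs C A0 A" "p \<cdot> i0 = i \<cdot> \<pi>y" "shM C 1 \<pi>x \<cdot> j0 = j \<cdot> p"
    using fill[OF t0 t x(2) y(2) sq(2)] by blast
  have s1: "shM C 1 \<pi>x \<cdot> shM C 1 \<iota>x = ident C (shO C 1 X)" using h x(3) by (simp flip: shM_cmp)
  have pai: "(p \<cdot> a) \<cdot> i = i" using h a(1) p(1) by (simp add: a(2) cmp_ext[OF p(2)] y(3))
  have jpa: "j \<cdot> (p \<cdot> a) = j"
  proof -
    have "j \<cdot> (p \<cdot> a) = shM C 1 \<pi>x \<cdot> (shM C 1 \<iota>x \<cdot> j)"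
      using h a(1) p(1) by (simp add: a(3) cmp_ext[OF p(3)[symmetric]])
    also have "\<dots> = j" using h by (simp add: cmp_ext[OF s1])
    finally show ?thesis .
  qed
  have "iso_arr C A A (p \<cdot> a)"
    by (rule triangle_endo_iso[OF t _ pai jpa]) (use h a(1) p(1) in simp)
  then obtain c where c: "c \<in> homs C A A" "c \<cdot> (p \<cdot> a) = ident C A" "(p \<cdot> a) \<cdot> c = ident C A"
    unfolding iso_arr_def by blast
  have ci: "c \<cdot> i = i"
  proof -
    have "c \<cdot> i = c \<cdot> ((p \<cdot> a) \<cdot> i)" by (simp only: pai)
    also have "\<dots> = (c \<cdot> (p \<cdot> a)) \<cdot> i" using h a(1) p(1) c(1) by simp
    finally show ?thesis using h by (simp add: c(2))
  qed
  have jc: "j \<cdot> c = j"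
  proof -
    have "j \<cdot> c = (j \<cdot> (p \<cdot> a)) \<cdot> c" by (simp only: jpa)
    also have "\<dots> = j \<cdot> ((p \<cdot> a) \<cdot> c)" using h a(1) p(1) c(1) by simp
    finally show ?thesis using h by (simp only: c(3)) simp
  qed
  show thesis
  proof (rule that[of a "c \<cdot> p"])
    show "(c \<cdot> p) \<cdot> i0 = i \<cdot> \<pi>y" using h p(1) c(1) by (simp add: p(2) cmp_ext[OF ci])
    show "shM C 1 \<pi>x \<cdot> j0 = j \<cdot> (c \<cdot> p)" using h p(1) c(1) by (simp add: p(3) cmp_ext[OF jc])
    show "(c \<cdot> p) \<cdot> a = ident C A" using h p(1) c a(1) by simp
  qed (use a p c in simp_all)
qed

text \<open>
  The two missing maps \<open>u\<close>, \<open>v\<close> of an octahedron need not respect a decomposition of the other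
  maps. If \<open>f\<close> and \<open>g\<close> vanish on one of the summands, then the off-diagonal parts of \<open>u\<close> and \<open>v\<close>
  can be removed by unipotent automorphisms \<open>1 - r \<cdot> \<lambda> \<cdot> s\<close> and \<open>1 - k \<cdot> \<tau> \<cdot> l\<close> of the cones
  which are compatible with all the other data.
\<close>

lemma octahedron_diagonal:
  assumes tf: "dtri C X Y A f i j" and tg: "dtri C Y Z B g k l" and th: "dtri C X Z D (g \<cdot> f) r s"
    and to: "dtri C A D B u v (shM C 1 i \<cdot> l)"
    and oct: "u \<cdot> i = r \<cdot> g" "s \<cdot> u = j" "v \<cdot> r = k" "l \<cdot> v = shM C 1 f \<cdot> s"
    and eT: "ex \<in> homs C X X" "ey \<in> homs C Y Y" "ez \<in> homs C Z Z"
      "ea \<in> homs C A A" "eb \<in> homs C B B" "ed \<in> homs C D D"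
    and idem: "ex \<cdot> ex = ex" "ey \<cdot> ey = ey" "ez \<cdot> ez = ez" "ea \<cdot> ea = ea" "eb \<cdot> eb = eb" "ed \<cdot> ed = ed"
    and com: "ea \<cdot> i = i \<cdot> ey" "shM C 1 ex \<cdot> j = j \<cdot> ea" "eb \<cdot> k = k \<cdot> ez" "shM C 1 ey \<cdot> l = l \<cdot> eb"
      "ed \<cdot> r = r \<cdot> ez" "shM C 1 ex \<cdot> s = s \<cdot> ed"
    and fe: "f \<cdot> ex = f" "ey \<cdot> f = f" "g \<cdot> ey = g" "ez \<cdot> g = g"
  obtains u' v' where "dtri C A D B u' v' (shM C 1 i \<cdot> l)"
    "u' \<cdot> i = r \<cdot> g" "s \<cdot> u' = j" "v' \<cdot> r = k" "l \<cdot> v' = shM C 1 f \<cdot> s"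
    "ed \<cdot> u' = u' \<cdot> ea" "eb \<cdot> v' = v' \<cdot> ed"
proof -
  note h = dtri_homs(1-3)[OF tf] dtri_homs(1-3)[OF tg] dtri_homs(1-3)[OF th] dtri_homs(1-2)[OF to]
    dtri_Obj[OF tf] dtri_Obj[OF tg] dtri_Obj[OF th] eT
  define ex1 where "ex1 = shM C 1 ex"
  define ey1 where "ey1 = shM C 1 ey"
  define f1 where "f1 = shM C 1 f"
  \<comment> \<open>These are the complementary idempotents. The assumptions \<open>fe\<close> say
    that \<open>f\<close> and \<open>g\<close> are supported on the summands cut out by the
    \<open>e\<close>-idempotents and vanish on the complementary ones.\<close>
  define cx where "cx = ident C X \<oplus> \<ominus> ex"
  define cy where "cy = ident C Y \<oplus> \<ominus> ey"
  define cz where "cz = ident C Z \<oplus> \<ominus> ez"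
  define ca where "ca = ident C A \<oplus> \<ominus> ea"
  define cb where "cb = ident C B \<oplus> \<ominus> eb"
  define cd where "cd = ident C D \<oplus> \<ominus> ed"
  define cx1 where "cx1 = ident C (shO C 1 X) \<oplus> \<ominus> ex1"
  define cy1 where "cy1 = ident C (shO C 1 Y) \<oplus> \<ominus> ey1"
  note cdefs = cx_def cy_def cz_def ca_def cb_def cd_def cx1_def cy1_def
  have h1: "ex1 \<in> homs C (shO C 1 X) (shO C 1 X)" "ey1 \<in> homs C (shO C 1 Y) (shO C 1 Y)"
    "f1 \<in> homs C (shO C 1 X) (shO C 1 Y)"
    unfolding ex1_def ey1_def f1_def using h by simp_all
  have idem1: "ex1 \<cdot> ex1 = ex1" "ey1 \<cdot> ey1 = ey1"
    unfolding ex1_def ey1_def using h idem by (simp_all flip: shM_cmp)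
  have cT: "cx \<in> homs C X X" "cy \<in> homs C Y Y" "cz \<in> homs C Z Z"
      "ca \<in> homs C A A" "cb \<in> homs C B B" "cd \<in> homs C D D"
      "cx1 \<in> homs C (shO C 1 X) (shO C 1 X)" "cy1 \<in> homs C (shO C 1 Y) (shO C 1 Y)"
    unfolding cdefs using h h1 by simp_all
  note ty = h h1 cT
  have cx1: "cx1 = shM C 1 cx" unfolding cdefs ex1_def using h by simp
  have orth: "ez \<cdot> cz = zeroarr C Z Z" "cz \<cdot> ez = zeroarr C Z Z" "ea \<cdot> ca = zeroarr C A A"
    "cb \<cdot> eb = zeroarr C B B" "eb \<cdot> cb = zeroarr C B B" "ed \<cdot> cd = zeroarr C D D" "cd \<cdot> ed = zeroarr C D D"
    "ex1 \<cdot> cx1 = zeroarr C (shO C 1 X) (shO C 1 X)" "cx1 \<cdot> ex1 = zeroarr C (shO C 1 X) (shO C 1 X)"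
    "ca \<cdot> ca = ca" "cb \<cdot> cb = cb" "cd \<cdot> cd = cd"
    unfolding cdefs using h h1 by (simp_all add: idem idem1)
  have com1: "ea \<cdot> i = i \<cdot> ey" "ex1 \<cdot> j = j \<cdot> ea" "eb \<cdot> k = k \<cdot> ez" "ey1 \<cdot> l = l \<cdot> eb"
      "ed \<cdot> r = r \<cdot> ez" "ex1 \<cdot> s = s \<cdot> ed"
    using com unfolding ex1_def ey1_def by simp_all
  have com2: "ca \<cdot> i = i \<cdot> cy" "cx1 \<cdot> j = j \<cdot> ca" "cb \<cdot> k = k \<cdot> cz" "cy1 \<cdot> l = l \<cdot> cb"
      "cd \<cdot> r = r \<cdot> cz" "cx1 \<cdot> s = s \<cdot> cd"
    unfolding cdefs using h h1 by (simp_all add: com1)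
  have z: "f \<cdot> cx = zeroarr C X Y" "cy \<cdot> f = zeroarr C X Y" "g \<cdot> cy = zeroarr C Y Z" "cz \<cdot> g = zeroarr C Y Z"
    unfolding cdefs using h by (simp_all add: fe)
  have z1: "cy1 \<cdot> f1 = zeroarr C (shO C 1 X) (shO C 1 Y)"
    unfolding cdefs f1_def ey1_def using h by (simp add: fe flip: shM_cmp)
  have sr: "s \<cdot> r = zeroarr C Z (shO C 1 X)" by (rule cmp23[OF th])
  have ji: "j \<cdot> i = zeroarr C Y (shO C 1 X)" by (rule cmp23[OF tf])
  have lk: "l \<cdot> k = zeroarr C Z (shO C 1 Y)" by (rule cmp23[OF tg])
  have lv: "l \<cdot> v = f1 \<cdot> s" using oct(4) unfolding f1_def .
  note R = com1[THEN cmp_ext] com1 com2[THEN cmp_ext] com2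
  note L = com1[symmetric, THEN cmp_ext] com1[symmetric] com2[symmetric, THEN cmp_ext] com2[symmetric]
  note Z = z z1 orth z[THEN cmp_ext] z1[THEN cmp_ext] orth[THEN cmp_ext]
  note O = oct(1-3) oct(1-3)[THEN cmp_ext]

  \<comment> \<open>Where \<open>f\<close> and \<open>g\<close> vanish, the triangles split: the
    complementary part of \<open>X[1]\<close> lifts to \<open>A\<close> along \<open>j\<close>, and
    that of \<open>Z\<close> is recovered from \<open>D\<close> and from \<open>B\<close>. These
    partial splittings turn factorisations of single blocks into common ones.\<close>
  obtain \<chi> where \<chi>: "\<chi> \<in> homs C (shO C 1 X) A" "j \<cdot> \<chi> = cx1"
    by (rule lift1[OF tf, of cx1 "shO C 1 X"])
      (use ty in \<open>simp_all add: cx1 z flip: shM_cmp\<close>)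
  obtain \<rho>d where \<rho>d: "\<rho>d \<in> homs C D Z" "\<rho>d \<cdot> r = cz"
    by (rule colift2[OF th, of cz Z]) (use ty in \<open>simp_all add: Z\<close>)
  obtain \<rho>b where \<rho>b: "\<rho>b \<in> homs C B Z" "\<rho>b \<cdot> k = cz"
    by (rule colift2[OF tg, of cz Z]) (use ty in \<open>simp_all add: Z\<close>)

  \<comment> \<open>The off-diagonal blocks of \<open>u\<close>. After \<open>i\<close> they become
    blocks of \<open>r \<cdot> g\<close>, and followed by \<open>s\<close> blocks of
    \<open>j\<close>; both are diagonal, so each block factors over \<open>j\<close> as well as
    through \<open>r\<close>.\<close>
  define u12 where "u12 = ed \<cdot> (u \<cdot> ca)"
  define u21 where "u21 = cd \<cdot> (u \<cdot> ea)"
  have uT: "u12 \<in> homs C A D" "u21 \<in> homs C A D" unfolding u12_def u21_def using ty by simp_all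
  have "u12 \<cdot> i = zeroarr C Y D" unfolding u12_def using ty by (simp add: R O Z)
  then obtain \<mu> where \<mu>: "\<mu> \<in> homs C (shO C 1 X) D" "\<mu> \<cdot> j = u12" using colift3[OF tf uT(1)] by blast
  have "s \<cdot> u12 = zeroarr C A (shO C 1 X)" unfolding u12_def using ty by (simp add: L O Z)
  then obtain \<nu> where \<nu>: "\<nu> \<in> homs C A Z" "r \<cdot> \<nu> = u12" using lift3[OF th uT(1)] by blast
  have l1: "r \<cdot> (\<nu> \<cdot> (\<chi> \<cdot> j)) = u12"
  proof -
    have "r \<cdot> (\<nu> \<cdot> (\<chi> \<cdot> j)) = u12 \<cdot> (\<chi> \<cdot> j)" using ty \<nu>(1) \<chi>(1) by (simp add: cmp_ext[OF \<nu>(2)])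
    also have "\<dots> = (\<mu> \<cdot> j) \<cdot> (\<chi> \<cdot> j)" by (simp only: \<mu>(2))
    also have "\<dots> = \<mu> \<cdot> (j \<cdot> ca)" using ty \<mu>(1) \<chi>(1) by (simp add: cmp_ext[OF \<chi>(2)] R)
    also have "\<dots> = u12 \<cdot> ca" using ty \<mu>(1) by (simp add: cmp_ext[OF \<mu>(2)])
    also have "\<dots> = u12" unfolding u12_def using ty by (simp add: Z)
    finally show ?thesis .
  qed
  have "u21 \<cdot> i = zeroarr C Y D" unfolding u21_def using ty by (simp add: R O Z)
  then obtain \<mu>' where \<mu>': "\<mu>' \<in> homs C (shO C 1 X) D" "\<mu>' \<cdot> j = u21" using colift3[OF tf uT(2)] by blast
  have "s \<cdot> u21 = zeroarr C A (shO C 1 X)" unfolding u21_def using ty by (simp add: L O Z)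
  then obtain \<nu>' where \<nu>': "\<nu>' \<in> homs C A Z" "r \<cdot> \<nu>' = u21" using lift3[OF th uT(2)] by blast
  have l2: "r \<cdot> (\<rho>d \<cdot> (\<mu>' \<cdot> j)) = u21"
  proof -
    have "r \<cdot> (\<rho>d \<cdot> (\<mu>' \<cdot> j)) = r \<cdot> (\<rho>d \<cdot> (r \<cdot> \<nu>'))" by (simp only: \<nu>'(2) \<mu>'(2))
    also have "\<dots> = cd \<cdot> (r \<cdot> \<nu>')" using ty \<rho>d(1) \<nu>'(1) by (simp add: cmp_ext[OF \<rho>d(2)] R)
    also have "\<dots> = cd \<cdot> u21" by (simp only: \<nu>'(2))
    also have "\<dots> = u21" unfolding u21_def using ty by (simp add: Z)
    finally show ?thesis .
  qed
  \<comment> \<open>A single arrow \<open>X[1] -> Z\<close> accounts for both blocks. Since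
    \<open>s \<cdot> u = j\<close>, the automorphism \<open>1 - r \<cdot> lam \<cdot> s\<close> of
    \<open>D\<close> subtracts them from \<open>u\<close>; the term added in \<open>v1\<close>
    compensates for the same automorphism on the side of \<open>v\<close>.\<close>
  define lam where "lam = \<nu> \<cdot> \<chi> \<oplus> \<rho>d \<cdot> \<mu>'"
  have lamT: "lam \<in> homs C (shO C 1 X) Z" unfolding lam_def using \<nu> \<chi> \<rho>d \<mu>' by simp
  have lam: "r \<cdot> (lam \<cdot> j) = u12 \<oplus> u21"
    unfolding lam_def using ty \<nu>(1) \<chi>(1) \<rho>d(1) \<mu>'(1) by (simp add: l1 l2)
  define u1 where "u1 = u \<oplus> \<ominus> (u12 \<oplus> u21)"
  define v1 where "v1 = v \<oplus> k \<cdot> (lam \<cdot> s)"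
  have T1: "u1 \<in> homs C A D" "v1 \<in> homs C D B" unfolding u1_def v1_def using ty uT lamT by simp_all
  have u1': "u1 = u \<oplus> \<ominus> (r \<cdot> (lam \<cdot> j))" unfolding u1_def lam ..
  have srx: "s \<cdot> (r \<cdot> x) = zeroarr C (src C x) (shO C 1 X)" if "x \<in> Arr C" "tgt C x = Z" for x
    using ty that by (simp add: cmp_ext[OF sr])
  have lkx: "l \<cdot> (k \<cdot> x) = zeroarr C (src C x) (shO C 1 Y)" if "x \<in> Arr C" "tgt C x = Z" for x
    using ty that by (simp add: cmp_ext[OF lk])
  have "iso_arr C D D (ident C D \<oplus> \<ominus> (r \<cdot> (lam \<cdot> s)))"
    by (rule iso_unipotent) (use ty lamT in \<open>simp_all add: srx\<close>)
  then have to1: "dtri C A D B u1 v1 (shM C 1 i \<cdot> l)"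
    by (intro dtri_iso[OF to, where a = "ident C A" and c = "ident C B"
          and b = "ident C D \<oplus> \<ominus> (r \<cdot> (lam \<cdot> s))"] iso_arr_ident)
      (use ty T1 lamT in \<open>simp_all add: u1' v1_def O srx\<close>)
  have oct1: "u1 \<cdot> i = r \<cdot> g" "s \<cdot> u1 = j" "v1 \<cdot> r = k" "l \<cdot> v1 = f1 \<cdot> s"
    unfolding u1' v1_def using ty lamT by (simp_all add: O srx lkx ji sr lv)
  note O1 = oct1 oct1[THEN cmp_ext]
  have edu1: "ed \<cdot> u1 = u1 \<cdot> ea"
    unfolding u1_def u12_def u21_def cdefs using ty
    by (simp add: idem idem[THEN cmp_ext] add_comm add_lcomm)
  have cdu1: "cd \<cdot> u1 = u1 \<cdot> ca" unfolding cdefs using ty T1 by (simp add: edu1)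
  have v1u1: "v1 \<cdot> u1 = zeroarr C A B" by (rule cmp12[OF to1])

  \<comment> \<open>This block vanishes by itself: it equals \<open>\<kappa> \<cdot> s\<close>, and
    \<open>\<kappa>\<close> is zero on the complementary part of \<open>X[1]\<close>, because that
    part is reached through \<open>s \<cdot> u1\<close> while \<open>u1\<close> is already diagonal
    and \<open>v1 \<cdot> u1 = 0\<close>.\<close>
  define v12 where "v12 = eb \<cdot> (v1 \<cdot> cd)"
  define v21 where "v21 = cb \<cdot> (v1 \<cdot> ed)"
  have vT: "v12 \<in> homs C D B" "v21 \<in> homs C D B" unfolding v12_def v21_def using ty T1 by simp_all
  have "v12 \<cdot> r = zeroarr C Z B" unfolding v12_def using ty T1 by (simp add: R O1 Z)
  then obtain \<kappa> where \<kappa>: "\<kappa> \<in> homs C (shO C 1 X) B" "\<kappa> \<cdot> s = v12" using colift3[OF th vT(1)] by blast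
  have "\<kappa> \<cdot> cx1 = \<kappa> \<cdot> (s \<cdot> (u1 \<cdot> \<chi>))" using ty T1 \<kappa>(1) \<chi>(1) by (simp add: O1 \<chi>(2))
  also have "\<dots> = v12 \<cdot> (u1 \<cdot> \<chi>)" using ty T1 \<kappa>(1) \<chi>(1) by (simp add: cmp_ext[OF \<kappa>(2)])
  also have "\<dots> = zeroarr C (shO C 1 X) B"
    unfolding v12_def using ty T1 \<chi>(1) by (simp add: cmp_ext[OF cdu1] cmp_ext[OF v1u1])
  finally have \<kappa>c: "\<kappa> \<cdot> cx1 = zeroarr C (shO C 1 X) B" .
  have "v12 = v12 \<cdot> cd" unfolding v12_def using ty T1 by (simp add: Z)
  also have "\<dots> = (\<kappa> \<cdot> s) \<cdot> cd" by (simp only: \<kappa>(2))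
  also have "\<dots> = zeroarr C D B" using ty \<kappa>(1) by (simp add: L cmp_ext[OF \<kappa>c])
  finally have v12: "v12 = zeroarr C D B" .

  \<comment> \<open>The other block has to be removed. It factors over \<open>s\<close>, and since
    it kills \<open>u1\<close>, further over \<open>f[1] \<cdot> s = l \<cdot> v1\<close>.\<close>
  have "v21 \<cdot> r = zeroarr C Z B" unfolding v21_def using ty T1 by (simp add: R O1 Z)
  then obtain \<kappa>2 where \<kappa>2: "\<kappa>2 \<in> homs C (shO C 1 X) B" "\<kappa>2 \<cdot> s = v21" using colift3[OF th vT(2)] by blast
  have "\<kappa>2 \<cdot> j = (\<kappa>2 \<cdot> s) \<cdot> u1" using ty T1 \<kappa>2(1) by (simp add: O1)
  also have "\<dots> = v21 \<cdot> u1" by (simp only: \<kappa>2(2))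
  also have "\<dots> = zeroarr C A B"
    unfolding v21_def using ty T1 by (simp add: edu1 cmp_ext[OF v1u1])
  finally obtain \<kappa>3 where \<kappa>3: "\<kappa>3 \<in> homs C (shO C 1 Y) B" "\<kappa>3 \<cdot> f1 = \<kappa>2"
    using colift1[OF tf \<kappa>2(1)] unfolding f1_def by blast
  have \<kappa>3v: "\<kappa>3 \<cdot> (l \<cdot> v1) = v21"
    using ty T1 \<kappa>3(1) by (simp add: O1 cmp_ext[OF \<kappa>3(2)] \<kappa>2(2))
  have lv21: "l \<cdot> v21 = zeroarr C D (shO C 1 Y)"
    unfolding v21_def using ty T1 by (simp add: L O1 Z)
  then obtain \<nu>2 where \<nu>2: "\<nu>2 \<in> homs C D Z" "k \<cdot> \<nu>2 = v21" using lift3[OF tg vT(2)] by blast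
  \<comment> \<open>The block also factors through \<open>k\<close>, and on its image in
    \<open>B\<close> the partial splitting \<open>\<rho>b\<close> is a section. So
    \<open>k \<cdot> \<tau> \<cdot> l \<cdot> v1\<close> is the block itself, and
    \<open>1 - k \<cdot> \<tau> \<cdot> l\<close> subtracts it from \<open>v1\<close>.\<close>
  define \<tau> where "\<tau> = \<rho>b \<cdot> \<kappa>3"
  have \<tau>T: "\<tau> \<in> homs C (shO C 1 Y) Z" unfolding \<tau>_def using \<rho>b \<kappa>3 by simp
  have k\<tau>: "k \<cdot> (\<tau> \<cdot> (l \<cdot> v1)) = v21"
  proof -
    have "k \<cdot> (\<tau> \<cdot> (l \<cdot> v1)) = k \<cdot> (\<rho>b \<cdot> (\<kappa>3 \<cdot> (l \<cdot> v1)))"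
      unfolding \<tau>_def using ty T1 \<rho>b(1) \<kappa>3(1) by simp
    also have "\<dots> = k \<cdot> (\<rho>b \<cdot> (k \<cdot> \<nu>2))" by (simp only: \<kappa>3v \<nu>2(2))
    also have "\<dots> = cb \<cdot> (k \<cdot> \<nu>2)" using ty \<rho>b(1) \<nu>2(1) by (simp add: cmp_ext[OF \<rho>b(2)] R)
    also have "\<dots> = cb \<cdot> v21" by (simp only: \<nu>2(2))
    also have "\<dots> = v21" unfolding v21_def using ty T1 by (simp add: Z)
    finally show ?thesis .
  qed
  define v2 where "v2 = v1 \<oplus> \<ominus> v21"
  have v2T: "v2 \<in> homs C D B" unfolding v2_def using T1 vT by simp
  have "iso_arr C B B (ident C B \<oplus> \<ominus> (k \<cdot> (\<tau> \<cdot> l)))"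
    by (rule iso_unipotent) (use ty \<tau>T in \<open>simp_all add: lkx\<close>)
  then have "dtri C A D B u1 v2 (shM C 1 i \<cdot> l)"
    by (intro dtri_iso[OF to1, where a = "ident C A" and b = "ident C D"
          and c = "ident C B \<oplus> \<ominus> (k \<cdot> (\<tau> \<cdot> l))"] iso_arr_ident)
      (use ty T1 v2T \<tau>T in \<open>simp_all add: v2_def k\<tau> lkx\<close>)
  moreover have "v2 \<cdot> r = k" "l \<cdot> v2 = f1 \<cdot> s"
    unfolding v2_def using ty T1 vT lv21 \<open>v21 \<cdot> r = zeroarr C Z B\<close> by (simp_all add: O1)
  moreover have "eb \<cdot> v2 = v2 \<cdot> ed"
  proof -
    have "eb \<cdot> v2 = eb \<cdot> v1" unfolding v2_def v21_def using ty T1 by (simp add: Z)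
    also have "\<dots> = v12 \<oplus> eb \<cdot> (v1 \<cdot> ed)" unfolding v12_def cd_def using ty T1 by (simp add: add_comm add_lcomm)
    also have "\<dots> = eb \<cdot> (v1 \<cdot> ed)" unfolding v12 using ty T1 by simp
    also have "\<dots> = v2 \<cdot> ed" unfolding v2_def v21_def cb_def using ty T1
      by (simp add: idem idem[THEN cmp_ext] add_comm add_lcomm)
    finally show ?thesis .
  qed
  ultimately show thesis using that[of u1 v2] oct1(1,2) edu1 unfolding f1_def by blast
qed


text \<open>An octahedron on the extensions by zero \<open>f0\<close>, \<open>g0\<close> is made
  diagonal and restricted to the summands. The hypothesis \<open>ret\<close> makes the restricted
  triangle distinguished; in the idempotent completion it is a consequence of how triangles are
  defined there.\<close>

lemma octahedron_retract:
  assumes ret: "\<And>X Y Z f g h X0 Y0 Z0 f0 g0 h0 a b c a' b' c'.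
      \<lbrakk>dtri C X0 Y0 Z0 f0 g0 h0; f \<in> homs C X Y; g \<in> homs C Y Z; h \<in> homs C Z (shO C 1 X);
       triangle_map C (f, g, h) (f0, g0, h0) (a, b, c); triangle_map C (f0, g0, h0) (f, g, h) (a', b', c');
       a' \<cdot> a = ident C X; b' \<cdot> b = ident C Y; c' \<cdot> c = ident C Z\<rbrakk> \<Longrightarrow> dtri C X Y Z f g h"
    and tf: "dtri C X Y A f i j" and tg: "dtri C Y Z B g k l" and th: "dtri C X Z D (g \<cdot> f) r s"
    and tf0: "dtri C X0 Y0 A0 f0 i0 j0" and tg0: "dtri C Y0 Z0 B0 g0 k0 l0"
    and th0: "dtri C X0 Z0 D0 (g0 \<cdot> f0) r0 s0"
    and to0: "dtri C A0 D0 B0 u0 v0 (shM C 1 i0 \<cdot> l0)"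
    and oct0: "u0 \<cdot> i0 = r0 \<cdot> g0" "s0 \<cdot> u0 = j0" "v0 \<cdot> r0 = k0" "l0 \<cdot> v0 = shM C 1 f0 \<cdot> s0"
    and x: "\<iota>x \<in> homs C X X0" "\<pi>x \<in> homs C X0 X" "\<pi>x \<cdot> \<iota>x = ident C X"
    and y: "\<iota>y \<in> homs C Y Y0" "\<pi>y \<in> homs C Y0 Y" "\<pi>y \<cdot> \<iota>y = ident C Y"
    and z: "\<iota>z \<in> homs C Z Z0" "\<pi>z \<in> homs C Z0 Z" "\<pi>z \<cdot> \<iota>z = ident C Z"
    and f0: "f0 = \<iota>y \<cdot> (f \<cdot> \<pi>x)" and g0: "g0 = \<iota>z \<cdot> (g \<cdot> \<pi>y)"
  obtains u v where "dtri C A D B u v (shM C 1 i \<cdot> l)"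
    "u \<cdot> i = r \<cdot> g" "s \<cdot> u = j" "v \<cdot> r = k" "l \<cdot> v = shM C 1 f \<cdot> s"
proof -
  note h = dtri_homs(1-3)[OF tf] dtri_homs(1-3)[OF tg] dtri_homs(1-3)[OF th]
    dtri_Obj[OF tf] dtri_Obj[OF tg] dtri_Obj[OF th] x(1,2) y(1,2) z(1,2)
  note h0 = dtri_homs(1-3)[OF tf0] dtri_homs(1-3)[OF tg0] dtri_homs(1-3)[OF th0] dtri_homs(1-2)[OF to0]
    dtri_Obj[OF tf0] dtri_Obj[OF tg0] dtri_Obj[OF th0]
  note ids = x(3) y(3) z(3) x(3)[THEN cmp_ext] y(3)[THEN cmp_ext] z(3)[THEN cmp_ext]
  obtain \<iota>a \<pi>a where a: "\<iota>a \<in> homs C A A0" "\<pi>a \<in> homs C A0 A" "\<pi>a \<cdot> \<iota>a = ident C A"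
    "\<iota>a \<cdot> i = i0 \<cdot> \<iota>y" "\<pi>a \<cdot> i0 = i \<cdot> \<pi>y" "shM C 1 \<iota>x \<cdot> j = j0 \<cdot> \<iota>a" "shM C 1 \<pi>x \<cdot> j0 = j \<cdot> \<pi>a"
    by (rule triangle_retract[OF tf tf0 x y]) (use h in \<open>simp_all add: f0 ids\<close>)
  obtain \<iota>b \<pi>b where b: "\<iota>b \<in> homs C B B0" "\<pi>b \<in> homs C B0 B" "\<pi>b \<cdot> \<iota>b = ident C B"
    "\<iota>b \<cdot> k = k0 \<cdot> \<iota>z" "\<pi>b \<cdot> k0 = k \<cdot> \<pi>z" "shM C 1 \<iota>y \<cdot> l = l0 \<cdot> \<iota>b" "shM C 1 \<pi>y \<cdot> l0 = l \<cdot> \<pi>b"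
    by (rule triangle_retract[OF tg tg0 y z]) (use h in \<open>simp_all add: g0 ids\<close>)
  obtain \<iota>d \<pi>d where d: "\<iota>d \<in> homs C D D0" "\<pi>d \<in> homs C D0 D" "\<pi>d \<cdot> \<iota>d = ident C D"
    "\<iota>d \<cdot> r = r0 \<cdot> \<iota>z" "\<pi>d \<cdot> r0 = r \<cdot> \<pi>z" "shM C 1 \<iota>x \<cdot> s = s0 \<cdot> \<iota>d" "shM C 1 \<pi>x \<cdot> s0 = s \<cdot> \<pi>d"
    by (rule triangle_retract[OF th th0 x z]) (use h in \<open>simp_all add: f0 g0 ids\<close>)
  note ty = h h0 a(1,2) b(1,2) d(1,2)
  note ids' = ids a(3) b(3) d(3) a(3)[THEN cmp_ext] b(3)[THEN cmp_ext] d(3)[THEN cmp_ext]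
  note P = a(5,7) b(5,7) d(5,7) a(5,7)[THEN cmp_ext] b(5,7)[THEN cmp_ext] d(5,7)[THEN cmp_ext]
  note I = a(4,6) b(4,6) d(4,6) a(4,6)[THEN cmp_ext] b(4,6)[THEN cmp_ext] d(4,6)[THEN cmp_ext]
  have com: "(\<iota>a \<cdot> \<pi>a) \<cdot> i0 = i0 \<cdot> (\<iota>y \<cdot> \<pi>y)" "shM C 1 (\<iota>x \<cdot> \<pi>x) \<cdot> j0 = j0 \<cdot> (\<iota>a \<cdot> \<pi>a)"
      "(\<iota>b \<cdot> \<pi>b) \<cdot> k0 = k0 \<cdot> (\<iota>z \<cdot> \<pi>z)" "shM C 1 (\<iota>y \<cdot> \<pi>y) \<cdot> l0 = l0 \<cdot> (\<iota>b \<cdot> \<pi>b)"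
      "(\<iota>d \<cdot> \<pi>d) \<cdot> r0 = r0 \<cdot> (\<iota>z \<cdot> \<pi>z)" "shM C 1 (\<iota>x \<cdot> \<pi>x) \<cdot> s0 = s0 \<cdot> (\<iota>d \<cdot> \<pi>d)"
    using ty by (simp_all add: P I)
  have eT: "\<iota>x \<cdot> \<pi>x \<in> homs C X0 X0" "\<iota>y \<cdot> \<pi>y \<in> homs C Y0 Y0" "\<iota>z \<cdot> \<pi>z \<in> homs C Z0 Z0"
    "\<iota>a \<cdot> \<pi>a \<in> homs C A0 A0" "\<iota>b \<cdot> \<pi>b \<in> homs C B0 B0" "\<iota>d \<cdot> \<pi>d \<in> homs C D0 D0"
    using ty by simp_all
  have idem: "(\<iota>x \<cdot> \<pi>x) \<cdot> (\<iota>x \<cdot> \<pi>x) = \<iota>x \<cdot> \<pi>x" "(\<iota>y \<cdot> \<pi>y) \<cdot> (\<iota>y \<cdot> \<pi>y) = \<iota>y \<cdot> \<pi>y"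
    "(\<iota>z \<cdot> \<pi>z) \<cdot> (\<iota>z \<cdot> \<pi>z) = \<iota>z \<cdot> \<pi>z" "(\<iota>a \<cdot> \<pi>a) \<cdot> (\<iota>a \<cdot> \<pi>a) = \<iota>a \<cdot> \<pi>a"
    "(\<iota>b \<cdot> \<pi>b) \<cdot> (\<iota>b \<cdot> \<pi>b) = \<iota>b \<cdot> \<pi>b" "(\<iota>d \<cdot> \<pi>d) \<cdot> (\<iota>d \<cdot> \<pi>d) = \<iota>d \<cdot> \<pi>d"
    using ty by (simp_all add: ids')
  have fe: "f0 \<cdot> (\<iota>x \<cdot> \<pi>x) = f0" "(\<iota>y \<cdot> \<pi>y) \<cdot> f0 = f0" "g0 \<cdot> (\<iota>y \<cdot> \<pi>y) = g0" "(\<iota>z \<cdot> \<pi>z) \<cdot> g0 = g0"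
    unfolding f0 g0 using h by (simp_all add: ids)
  obtain u1 v1 where t1: "dtri C A0 D0 B0 u1 v1 (shM C 1 i0 \<cdot> l0)"
    and o1: "u1 \<cdot> i0 = r0 \<cdot> g0" "s0 \<cdot> u1 = j0" "v1 \<cdot> r0 = k0" "l0 \<cdot> v1 = shM C 1 f0 \<cdot> s0"
    and c1: "(\<iota>d \<cdot> \<pi>d) \<cdot> u1 = u1 \<cdot> (\<iota>a \<cdot> \<pi>a)" "(\<iota>b \<cdot> \<pi>b) \<cdot> v1 = v1 \<cdot> (\<iota>d \<cdot> \<pi>d)"
    by (rule octahedron_diagonal[OF tf0 tg0 th0 to0 oct0 eT idem com fe])
  note uv = dtri_homs(1,2)[OF t1]
  have c1': "\<iota>d \<cdot> (\<pi>d \<cdot> u1) = u1 \<cdot> (\<iota>a \<cdot> \<pi>a)" "\<iota>b \<cdot> (\<pi>b \<cdot> v1) = v1 \<cdot> (\<iota>d \<cdot> \<pi>d)"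
    using c1 ty uv by simp_all
  have c2: "\<pi>d \<cdot> (u1 \<cdot> (\<iota>a \<cdot> \<pi>a)) = \<pi>d \<cdot> u1" "\<pi>b \<cdot> (v1 \<cdot> (\<iota>d \<cdot> \<pi>d)) = \<pi>b \<cdot> v1"
    using ty uv by (simp_all add: c1'[symmetric] ids')
  have c3: "\<iota>d \<cdot> (\<pi>d \<cdot> (u1 \<cdot> \<iota>a)) = u1 \<cdot> \<iota>a" "\<iota>b \<cdot> (\<pi>b \<cdot> (v1 \<cdot> \<iota>d)) = v1 \<cdot> \<iota>d"
    using ty uv cmp_ext[OF c1(1), of \<iota>a] cmp_ext[OF c1(2), of \<iota>d] by (simp_all add: ids')
  \<comment> \<open>The diagonal blocks of \<open>u1\<close> and \<open>v1\<close>. Because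
    \<open>u1\<close> and \<open>v1\<close> commute with the idempotents, the inclusions and the
    projections of the summands are both maps of triangles.\<close>
  define u where "u = \<pi>d \<cdot> (u1 \<cdot> \<iota>a)"
  define v where "v = \<pi>b \<cdot> (v1 \<cdot> \<iota>d)"
  have T: "u \<in> homs C A D" "v \<in> homs C D B" "shM C 1 i \<cdot> l \<in> homs C B (shO C 1 A)"
    unfolding u_def v_def using ty uv by simp_all
  have s1: "shM C 1 \<iota>a \<cdot> shM C 1 i = shM C 1 i0 \<cdot> shM C 1 \<iota>y"
    "shM C 1 \<pi>a \<cdot> shM C 1 i0 = shM C 1 i \<cdot> shM C 1 \<pi>y"
    using ty by (simp_all add: a(4,5) flip: shM_cmp)
  have "dtri C A D B u v (shM C 1 i \<cdot> l)"
  proof (rule ret[OF t1 T, of \<iota>a \<iota>d \<iota>b \<pi>a \<pi>d \<pi>b])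
    show "triangle_map C (u, v, shM C 1 i \<cdot> l) (u1, v1, shM C 1 i0 \<cdot> l0) (\<iota>a, \<iota>d, \<iota>b)"
      unfolding triangle_map_def using ty uv T
      by (simp add: u_def v_def c3 s1(1)[THEN cmp_ext] I)
    show "triangle_map C (u1, v1, shM C 1 i0 \<cdot> l0) (u, v, shM C 1 i \<cdot> l) (\<pi>a, \<pi>d, \<pi>b)"
      unfolding triangle_map_def using ty uv T
      by (simp add: u_def v_def c2 s1(2)[THEN cmp_ext] P)
  qed (rule a(3) d(3) b(3))+
  moreover have "u \<cdot> i = r \<cdot> g"
    unfolding u_def using ty uv by (simp add: I o1 o1[THEN cmp_ext] P ids) (simp add: g0 ids ty)
  moreover have "s \<cdot> u = j"
    unfolding u_def using ty uv by (simp add: d(7)[symmetric, THEN cmp_ext] o1[THEN cmp_ext]) (simp add: P ids' ty)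
  moreover have "v \<cdot> r = k"
    unfolding v_def using ty uv by (simp add: I o1 o1[THEN cmp_ext]) (simp add: P ids ty)
  moreover have "l \<cdot> v = shM C 1 f \<cdot> s"
  proof -
    have sx: "shM C 1 \<pi>x \<cdot> shM C 1 \<iota>x = ident C (shO C 1 X)" "shM C 1 \<pi>y \<cdot> shM C 1 \<iota>y = ident C (shO C 1 Y)"
      using ty x(3) y(3) by (simp_all flip: shM_cmp)
    have "l \<cdot> v = shM C 1 \<pi>y \<cdot> (shM C 1 f0 \<cdot> (s0 \<cdot> \<iota>d))"
      unfolding v_def using ty uv by (simp add: b(7)[symmetric, THEN cmp_ext] o1[THEN cmp_ext])
    also have "\<dots> = shM C 1 f \<cdot> (shM C 1 \<pi>x \<cdot> (s0 \<cdot> \<iota>d))"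
      unfolding f0 using h h0(9,11,12) ty by (simp add: sx[THEN cmp_ext])
    also have "\<dots> = shM C 1 f \<cdot> s" using ty by (simp add: P ids')
    finally show ?thesis .
  qed
  ultimately show thesis by (rule that)
qed

end

text \<open>The condition hidden in the triangles of \<open>tri_kar\<close>. As a relation of its
  own it can be shown to be transitive and invariant under rotation, which is what the axioms of the
  completion come down to.\<close>

definition triangle_retract_of ::
  "('o, 'm, 'z) scat_scheme \<Rightarrow> 'm \<times> 'm \<times> 'm \<Rightarrow> 'm \<times> 'm \<times> 'm \<Rightarrow> bool" where
  "triangle_retract_of C T T' \<longleftrightarrow> (\<exists>a b c a' b' c'.
     triangle_map C T T' (a, b, c) \<and> triangle_map C T' T (a', b', c')
     \<and> a' \<cdot>\<^bsub>C\<^esub> a = ident C (src C a) \<and> b' \<cdot>\<^bsub>C\<^esub> b = ident C (src C b) \<and> c' \<cdot>\<^bsub>C\<^esub> c = ident C (src C c))"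

context shift_category
begin

lemma triangle_retract_of_refl:
  assumes "candidate_triangle C T" shows "triangle_retract_of C T T"
proof -
  obtain f g h where T: "T = (f, g, h)" by (metis prod_cases3)
  have "triangle_map C T T (ident C (src C f), ident C (src C g), ident C (src C h))"
    using assms unfolding T candidate_triangle_def triangle_map_def by simp
  moreover have "f \<in> Arr C" "g \<in> Arr C" "h \<in> Arr C"
    using assms unfolding T candidate_triangle_def by auto
  ultimately show ?thesis
    unfolding triangle_retract_of_def
    by (intro exI[of _ "ident C (src C f)"] exI[of _ "ident C (src C g)"] exI[of _ "ident C (src C h)"]) simp
qed

lemma triangle_retract_of_trans:
  assumes c: "candidate_triangle C T" "candidate_triangle C T'" "candidate_triangle C T''"
    and r1: "triangle_retract_of C T T'" and r2: "triangle_retract_of C T' T''"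
  shows "triangle_retract_of C T T''"
proof -
  obtain i1 i2 i3 r1 r2 r3 where 1: "triangle_map C T T' (i1, i2, i3)" "triangle_map C T' T (r1, r2, r3)"
    "r1 \<cdot> i1 = ident C (src C i1)" "r2 \<cdot> i2 = ident C (src C i2)" "r3 \<cdot> i3 = ident C (src C i3)"
    using r1 unfolding triangle_retract_of_def by blast
  obtain j1 j2 j3 s1 s2 s3 where 2: "triangle_map C T' T'' (j1, j2, j3)" "triangle_map C T'' T' (s1, s2, s3)"
    "s1 \<cdot> j1 = ident C (src C j1)" "s2 \<cdot> j2 = ident C (src C j2)" "s3 \<cdot> j3 = ident C (src C j3)"
    using r2 unfolding triangle_retract_of_def by blast
  obtain f g h where T: "T = (f, g, h)" by (metis prod_cases3)
  obtain f' g' h' where T': "T' = (f', g', h')" by (metis prod_cases3)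
  obtain f'' g'' h'' where T'': "T'' = (f'', g'', h'')" by (metis prod_cases3)
  have ty: "i1 \<in> homs C (src C f) (src C f')" "i2 \<in> homs C (src C g) (src C g')" "i3 \<in> homs C (src C h) (src C h')"
    "r1 \<in> homs C (src C f') (src C f)" "r2 \<in> homs C (src C g') (src C g)" "r3 \<in> homs C (src C h') (src C h)"
    "j1 \<in> homs C (src C f') (src C f'')" "j2 \<in> homs C (src C g') (src C g'')" "j3 \<in> homs C (src C h') (src C h'')"
    "s1 \<in> homs C (src C f'') (src C f')" "s2 \<in> homs C (src C g'') (src C g')" "s3 \<in> homs C (src C h'') (src C h')"
    using 1(1,2) 2(1,2) unfolding T T' T'' triangle_map_def by auto
  note c1 = triangle_map_cmp[OF c 1(1) 2(1)]
  note c2 = triangle_map_cmp[OF c(3,2,1) 2(2) 1(2)]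
  note e = 1(3-5) 2(3-5)[THEN cmp_ext]
  show ?thesis unfolding triangle_retract_of_def
    by (rule exI[of _ "j1 \<cdot> i1"], rule exI[of _ "j2 \<cdot> i2"], rule exI[of _ "j3 \<cdot> i3"],
        rule exI[of _ "r1 \<cdot> s1"], rule exI[of _ "r2 \<cdot> s2"], rule exI[of _ "r3 \<cdot> s3"])
      (use c1 c2 ty in \<open>simp add: e\<close>)
qed

text \<open>Going forward, the first components are translated. Going back, the components on
  \<open>X[1]\<close> are translates of arrows on \<open>X\<close>, since translation by -1 undoes
  translation by 1.\<close>

lemma triangle_retract_of_rot:
  assumes c: "candidate_triangle C (f, g, h)" "candidate_triangle C (f', g', h')"
  shows "triangle_retract_of C (g, h, \<ominus> shM C 1 f) (g', h', \<ominus> shM C 1 f')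
    \<longleftrightarrow> triangle_retract_of C (f, g, h) (f', g', h')"
proof
  have cc: "f \<in> Arr C" "g \<in> Arr C" "h \<in> Arr C" "src C g = tgt C f" "src C h = tgt C g" "tgt C h = shO C 1 (src C f)"
    "f' \<in> Arr C" "g' \<in> Arr C" "h' \<in> Arr C" "src C g' = tgt C f'" "src C h' = tgt C g'" "tgt C h' = shO C 1 (src C f')"
    using assms unfolding candidate_triangle_def by auto
  show "triangle_retract_of C (g, h, \<ominus> shM C 1 f) (g', h', \<ominus> shM C 1 f')"
    if r: "triangle_retract_of C (f, g, h) (f', g', h')"
  proof -
    obtain i1 i2 i3 r1 r2 r3 where 1: "triangle_map C (f, g, h) (f', g', h') (i1, i2, i3)"
      "triangle_map C (f', g', h') (f, g, h) (r1, r2, r3)"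
      "r1 \<cdot> i1 = ident C (src C i1)" "r2 \<cdot> i2 = ident C (src C i2)" "r3 \<cdot> i3 = ident C (src C i3)"
      using r unfolding triangle_retract_of_def by blast
    have ty: "i1 \<in> homs C (src C f) (src C f')" "r1 \<in> homs C (src C f') (src C f)"
      using 1(1,2) unfolding triangle_map_def by auto
    have "shM C 1 r1 \<cdot> shM C 1 i1 = ident C (src C (shM C 1 i1))"
      using ty cc 1(3) by (simp flip: shM_cmp)
    moreover have "triangle_map C (g, h, \<ominus> shM C 1 f) (g', h', \<ominus> shM C 1 f') (i2, i3, shM C 1 i1)"
      using 1(1) triangle_map_rot[OF c ty(1)] by blast
    moreover have "triangle_map C (g', h', \<ominus> shM C 1 f') (g, h, \<ominus> shM C 1 f) (r2, r3, shM C 1 r1)"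
      using 1(2) triangle_map_rot[OF c(2,1) ty(2)] by blast
    ultimately show ?thesis using 1(4,5) unfolding triangle_retract_of_def by blast
  qed
  show "triangle_retract_of C (f, g, h) (f', g', h')"
    if r: "triangle_retract_of C (g, h, \<ominus> shM C 1 f) (g', h', \<ominus> shM C 1 f')"
  proof -
    obtain i1 i2 i3 r1 r2 r3 where 1: "triangle_map C (g, h, \<ominus> shM C 1 f) (g', h', \<ominus> shM C 1 f') (i2, i3, i1)"
      "triangle_map C (g', h', \<ominus> shM C 1 f') (g, h, \<ominus> shM C 1 f) (r2, r3, r1)"
      "r1 \<cdot> i1 = ident C (src C i1)" "r2 \<cdot> i2 = ident C (src C i2)" "r3 \<cdot> i3 = ident C (src C i3)"
      using r unfolding triangle_retract_of_def by blast
    have ty: "i1 \<in> homs C (shO C 1 (src C f)) (shO C 1 (src C f'))"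
      "r1 \<in> homs C (shO C 1 (src C f')) (shO C 1 (src C f))"
      using 1(1,2) cc unfolding triangle_map_def by auto
    define i0 where "i0 = shM C (- 1) i1"
    define r0 where "r0 = shM C (- 1) r1"
    have eq: "i1 = shM C 1 i0" "r1 = shM C 1 r0" unfolding i0_def r0_def using ty by simp_all
    have ty0: "i0 \<in> homs C (src C f) (src C f')" "r0 \<in> homs C (src C f') (src C f)"
      unfolding i0_def r0_def using ty cc by simp_all
    have "r0 \<cdot> i0 = shM C (- 1) (r1 \<cdot> i1)" unfolding i0_def r0_def using ty by simp
    also have "\<dots> = ident C (src C i0)" unfolding 1(3) using ty ty0 cc by simp
    finally have "r0 \<cdot> i0 = ident C (src C i0)" .
    moreover have "triangle_map C (f, g, h) (f', g', h') (i0, i2, i3)"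
      using 1(1) triangle_map_rot[OF c ty0(1)] unfolding eq by blast
    moreover have "triangle_map C (f', g', h') (f, g, h) (r0, r2, r3)"
      using 1(2) triangle_map_rot[OF c(2,1) ty0(2)] unfolding eq by blast
    ultimately show ?thesis using 1(4,5) unfolding triangle_retract_of_def by blast
  qed
qed

end

context pretriangulated
begin

text \<open>
  An endomorphism \<open>e\<close> of the cone which lifts two idempotents satisfies \<open>(e - e\<cdot>e)\<cdot>(e - e\<cdot>e) = 0\<close>,
  thus it can be replaced by the idempotent polynomial \<open>3 e^2 - 2 e^3\<close>.
\<close>

lemma cone_idempotent:
  assumes t: "dtri C X Y Z f g h"
    and p: "p \<in> homs C X X" "p \<cdot> p = p" and q: "q \<in> homs C Y Y" "q \<cdot> q = q" and pq: "q \<cdot> f = f \<cdot> p"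
  obtains z where "z \<in> homs C Z Z" "z \<cdot> z = z" "z \<cdot> g = g \<cdot> q" "shM C 1 p \<cdot> h = h \<cdot> z"
proof -
  note ty = dtri_homs(1-3)[OF t] dtri_Obj[OF t] p(1) q(1)
  obtain e where e: "e \<in> homs C Z Z" "e \<cdot> g = g \<cdot> q" "shM C 1 p \<cdot> h = h \<cdot> e"
    using fill[OF t t p(1) q(1) pq] by blast
  have p1: "shM C 1 p \<cdot> shM C 1 p = shM C 1 p" using ty p(2) by (simp flip: shM_cmp)
  have he: "h \<cdot> (e \<cdot> e) = h \<cdot> e"
  proof -
    have "h \<cdot> (e \<cdot> e) = (h \<cdot> e) \<cdot> e" using ty e(1) by simp
    also have "\<dots> = (shM C 1 p \<cdot> h) \<cdot> e" by (simp only: e(3))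
    also have "\<dots> = shM C 1 p \<cdot> (h \<cdot> e)" using ty e(1) by simp
    also have "\<dots> = shM C 1 p \<cdot> (shM C 1 p \<cdot> h)" by (simp only: e(3))
    also have "\<dots> = shM C 1 p \<cdot> h" using ty by (simp add: cmp_ext[OF p1])
    also have "\<dots> = h \<cdot> e" by (rule e(3))
    finally show ?thesis .
  qed
  \<comment> \<open>Since \<open>p\<close> and \<open>q\<close> are idempotent, \<open>e\<close> and
    \<open>e \<cdot> e\<close> induce the same arrows on the neighbouring vertices. So
    \<open>n\<close> vanishes after \<open>g\<close> and before \<open>h\<close>, and therefore
    squares to zero.\<close>
  define n where "n = e \<oplus> \<ominus> (e \<cdot> e)"
  have n: "n \<in> homs C Z Z" "n \<cdot> g = zeroarr C Y Z" "h \<cdot> n = zeroarr C Z (shO C 1 X)"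
    unfolding n_def using ty e(1) by (simp_all add: e(2) cmp_ext[OF e(2)] q(2) he)
  obtain m where m: "m \<in> homs C (shO C 1 X) Z" "m \<cdot> h = n" using colift3[OF t n(1,2)] by blast
  have "n \<cdot> n = (m \<cdot> h) \<cdot> n" by (simp only: m(2))
  also have "\<dots> = zeroarr C Z Z" using ty m(1) n by simp
  finally have nn: "n \<cdot> n = zeroarr C Z Z" .
  have ee: "e \<cdot> e = e \<oplus> \<ominus> n" unfolding n_def using e(1) by (simp add: add_comm add_lcomm)
  have ne: "n \<cdot> e = e \<cdot> n" unfolding n_def using e(1) by simp
  define w where "w = e \<cdot> n"
  have w: "w \<in> homs C Z Z" unfolding w_def using e n by simp
  have nw: "n \<cdot> w = zeroarr C Z Z" unfolding w_def using e(1) n(1) ty by (simp add: cmp_ext[OF ne] nn)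
  have wn: "w \<cdot> n = zeroarr C Z Z" unfolding w_def using e(1) n(1) ty by (simp add: nn)
  have ew: "e \<cdot> w = w" unfolding w_def using e(1) n(1) ty by (simp add: cmp_ext[OF ee] nn)
  have we: "w \<cdot> e = w" unfolding w_def using e(1) n(1) ty by (simp add: ne cmp_ext[OF ee] nn)
  \<comment> \<open>With \<open>e - n = e^2\<close> and \<open>w = e^2 - e^3\<close> this is the
    polynomial \<open>3 e^2 - 2 e^3\<close>. The products with \<open>n\<close> and \<open>w\<close>
    are known from \<open>n \<cdot> n = 0\<close>, which makes the square computable.\<close>
  define z where "z = (e \<oplus> \<ominus> n) \<oplus> (w \<oplus> w)"
  have z: "z \<in> homs C Z Z" unfolding z_def using e n w by simp
  have ze: "z \<cdot> e = (e \<oplus> \<ominus> n) \<oplus> w"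
    unfolding z_def using e(1) n(1) w by (simp add: ee ne we w_def[symmetric])
  have zn: "z \<cdot> n = w"
    unfolding z_def using e(1) n(1) w ty by (simp add: nn wn w_def[symmetric])
  have zw: "z \<cdot> w = w"
    unfolding w_def using z e(1) n(1) ty w by (simp add: ze[THEN cmp_ext] nn wn)
  have "z \<cdot> z = z \<cdot> ((e \<oplus> \<ominus> n) \<oplus> (w \<oplus> w))" by (simp only: z_def)
  also have "\<dots> = z" using z e(1) n(1) w by (simp add: ze zn zw) (simp add: z_def e n w)
  finally have zz: "z \<cdot> z = z" .
  have wg: "w \<cdot> g = zeroarr C Y Z" unfolding w_def using ty e(1) n by simp
  have hw: "h \<cdot> w = zeroarr C Z (shO C 1 X)"
    using ty e(1) n by (simp add: w_def cmp_ext[OF e(3)[symmetric]] )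
  have zg: "z \<cdot> g = g \<cdot> q" unfolding z_def using ty e(1) n w by (simp add: e(2) wg)
  have hz: "h \<cdot> z = shM C 1 p \<cdot> h" unfolding z_def using ty e(1) n w by (simp add: e(3) hw)
  show thesis by (rule that[OF z zz zg hz[symmetric]])
qed

end

section \<open>The triangulated structure of the idempotent completion\<close>

lemma kar_simps [simp]:
  "src (kar C) (A, f, B) = A" "tgt (kar C) (A, f, B) = B"
  "ident (kar C) (X, p) = ((X, p), p, (X, p))"
  "cmp (kar C) (B', g, D) (A, f, B) = (A, g \<cdot>\<^bsub>C\<^esub> f, D)"
  "zeroarr (kar C) (X, p) (Y, q) = ((X, p), zeroarr C X Y, (Y, q))"
  "addarr (kar C) (A, f, B) (A', f', B') = (A, addarr C f f', B)"
  by (simp_all add: kar_def Let_def)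

lemma kar_Obj: "(X, p) \<in> Obj (kar C) \<longleftrightarrow> X \<in> Obj C \<and> p \<in> homs C X X \<and> p \<cdot>\<^bsub>C\<^esub> p = p"
  by (simp add: kar_def Let_def)

lemma kar_Arr: "(A, f, B) \<in> Arr (kar C) \<longleftrightarrow> A \<in> Obj (kar C) \<and> B \<in> Obj (kar C) \<and> f \<in> homs C (fst A) (fst B)
     \<and> snd B \<cdot>\<^bsub>C\<^esub> f \<cdot>\<^bsub>C\<^esub> snd A = f"
  by (simp add: kar_def Let_def)

lemma truncate_tri_kar: "acat.truncate (tri_kar C) = kar C"
  by (simp add: tri_kar_def kar_shift_def kar_def Let_def acat.defs scat.defs tcat.defs)

lemma tri_kar_eq_kar:
  "src (tri_kar C) = src (kar C)" "tgt (tri_kar C) = tgt (kar C)" "ident (tri_kar C) = ident (kar C)"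
  "cmp (tri_kar C) = cmp (kar C)" "zeroarr (tri_kar C) = zeroarr (kar C)" "addarr (tri_kar C) = addarr (kar C)"
  by (simp_all add: tri_kar_def kar_shift_def kar_def Let_def acat.defs scat.defs tcat.defs)

lemma tri_kar_simps [simp]:
  "Obj (tri_kar C) = Obj (kar C)" "Arr (tri_kar C) = Arr (kar C)"
  "src (tri_kar C) (A, f, B) = A" "tgt (tri_kar C) (A, f, B) = B"
  "ident (tri_kar C) (X, p) = ((X, p), p, (X, p))"
  "cmp (tri_kar C) (B', g, D) (A, f, B) = (A, g \<cdot>\<^bsub>C\<^esub> f, D)"
  "zeroarr (tri_kar C) (X, p) (Y, q) = ((X, p), zeroarr C X Y, (Y, q))"
  "addarr (tri_kar C) (A, f, B) (A', f', B') = (A, addarr C f f', B)"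
  "shO (tri_kar C) n (X, p) = (shO C n X, shM C n p)"
  "shM (tri_kar C) n ((X, p), f, (Y, q)) = ((shO C n X, shM C n p), shM C n f, (shO C n Y, shM C n q))"
  by (simp_all add: tri_kar_eq_kar)
    (simp_all add: tri_kar_def kar_shift_def kar_def Let_def acat.defs scat.defs tcat.defs)

lemma triangle_map_cong:
  assumes "Arr K = Arr K'" "src K = src K'" "tgt K = tgt K'" "cmp K = cmp K'" "shM K = shM K'"
  shows "triangle_map K = triangle_map K'"
  unfolding triangle_map_def homs_def assms ..

lemma candidate_triangle_cong:
  assumes "Arr K = Arr K'" "src K = src K'" "tgt K = tgt K'" "shO K = shO K'"
  shows "candidate_triangle K = candidate_triangle K'"
  unfolding candidate_triangle_def assms ..

text \<open>The definition speaks about \<open>kar_shift C\<close>, the record before triangles are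
  attached; candidate triangles and their maps do not read the field \<open>Dist\<close>, so
  \<open>tri_kar C\<close> may stand there instead.\<close>

lemma tri_kar_Dist:
  "T \<in> Dist (tri_kar C) \<longleftrightarrow> candidate_triangle (tri_kar C) T \<and>
     (\<exists>(f, g, h) \<in> Dist C. triangle_retract_of (tri_kar C) T
        (fmor (kar_emb C) f, fmor (kar_emb C) g, fmor (kar_emb C) h))"
proof -
  have eq: "candidate_triangle (kar_shift C) = candidate_triangle (tri_kar C)"
    "triangle_map (kar_shift C) = triangle_map (tri_kar C)"
    "cmp (kar_shift C) = cmp (tri_kar C)" "ident (kar_shift C) = ident (tri_kar C)"
    "src (kar_shift C) = src (tri_kar C)"
    by (intro candidate_triangle_cong triangle_map_cong;
        simp add: tri_kar_def kar_shift_def kar_def Let_def acat.defs scat.defs tcat.defs)+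
      (simp_all add: tri_kar_def kar_shift_def kar_def Let_def acat.defs scat.defs tcat.defs)
  have "Dist (tri_kar C) = {T. candidate_triangle (kar_shift C) T \<and>
          (\<exists>(f, g, h) \<in> Dist C. \<exists>i i' i'' r r' r''.
              triangle_map (kar_shift C) T (fmor (kar_emb C) f, fmor (kar_emb C) g, fmor (kar_emb C) h) (i, i', i'')
            \<and> triangle_map (kar_shift C) (fmor (kar_emb C) f, fmor (kar_emb C) g, fmor (kar_emb C) h) T (r, r', r'')
            \<and> r \<cdot>\<^bsub>kar_shift C\<^esub> i = ident (kar_shift C) (src (kar_shift C) i)
            \<and> r' \<cdot>\<^bsub>kar_shift C\<^esub> i' = ident (kar_shift C) (src (kar_shift C) i')
            \<and> r'' \<cdot>\<^bsub>kar_shift C\<^esub> i'' = ident (kar_shift C) (src (kar_shift C) i''))}"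
    unfolding tri_kar_def Let_def by (simp add: scat.defs tcat.defs)
  then show ?thesis unfolding eq triangle_retract_of_def by simp
qed

context category
begin

lemma absorb_left:
  assumes "e \<cdot> g = g" "e \<in> Arr C" "g \<in> Arr C" "f \<in> Arr C" "src C e = tgt C g" "src C g = tgt C f"
  shows "e \<cdot> (g \<cdot> f) = g \<cdot> f"
  by (rule cmp_ext[OF assms(1)]) (use assms in auto)

lemma kar_Obj' [simp]: "(X, p) \<in> Obj (kar C) \<longleftrightarrow> p \<in> Arr C \<and> src C p = X \<and> tgt C p = X \<and> p \<cdot> p = p"
  by (auto simp: kar_Obj)

text \<open>Multiplying \<open>q \<cdot> f \<cdot> p = f\<close> by the idempotents separates it
  into two one-sided absorption laws, which, unlike the two-sided condition, are usable as rewrite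
  rules.\<close>

lemma kar_Arr' [simp]: "((X, p), f, (Y, q)) \<in> Arr (kar C) \<longleftrightarrow> (X, p) \<in> Obj (kar C) \<and> (Y, q) \<in> Obj (kar C)
    \<and> f \<in> Arr C \<and> src C f = X \<and> tgt C f = Y \<and> q \<cdot> f = f \<and> f \<cdot> p = f"
proof -
  have "(q \<cdot> f) \<cdot> p = f \<longleftrightarrow> q \<cdot> f = f \<and> f \<cdot> p = f"
    if h: "p \<in> homs C X X" "p \<cdot> p = p" "q \<in> homs C Y Y" "q \<cdot> q = q" "f \<in> homs C X Y"
  proof
    assume e: "(q \<cdot> f) \<cdot> p = f"
    then have e': "q \<cdot> (f \<cdot> p) = f" using h by simp
    have "q \<cdot> f = q \<cdot> (q \<cdot> (f \<cdot> p))" by (simp only: e')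
    also have "\<dots> = q \<cdot> (f \<cdot> p)" using h(1,3,5) by (simp add: cmp_ext[OF h(4)])
    finally have "q \<cdot> f = f" by (simp only: e')
    moreover have "f \<cdot> p = (q \<cdot> (f \<cdot> p)) \<cdot> p" by (simp only: e')
    then have "f \<cdot> p = q \<cdot> (f \<cdot> p)" using h(1,3,5) by (simp add: h(2))
    then have "f \<cdot> p = f" by (simp only: e')
    ultimately show "q \<cdot> f = f \<and> f \<cdot> p = f" ..
  qed (use h in simp)
  then show ?thesis by (auto simp: kar_Arr kar_Obj)
qed

lemma kar_arrE:
  assumes "\<phi> \<in> Arr (kar C)"
  obtains X p f Y q where "\<phi> = ((X, p), f, (Y, q))" "f \<in> Arr C" "src C f = X" "tgt C f = Y"
    "p \<in> Arr C" "src C p = X" "tgt C p = X" "p \<cdot> p = p"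
    "q \<in> Arr C" "src C q = Y" "tgt C q = Y" "q \<cdot> q = q" "q \<cdot> f = f" "f \<cdot> p = f"
proof -
  obtain X p f Y q where "\<phi> = ((X, p), f, (Y, q))" by (metis prod.exhaust)
  then show thesis using that assms by auto
qed

lemma kar_category: "category (kar C)"
proof (intro category.intro)
  fix f assume "f \<in> Arr (kar C)"
  then show "src (kar C) f \<in> Obj (kar C)" "tgt (kar C) f \<in> Obj (kar C)"
    by (auto elim!: kar_arrE)
next
  fix X assume "X \<in> Obj (kar C)"
  then show "ident (kar C) X \<in> homs (kar C) X X" by (cases X) auto
next
  fix X Y Z f g assume "f \<in> homs (kar C) X Y" "g \<in> homs (kar C) Y Z"
  then show "g \<cdot>\<^bsub>kar C\<^esub> f \<in> homs (kar C) X Z"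
    by (auto elim!: kar_arrE simp: absorb_left)
next
  fix X Y f assume "f \<in> homs (kar C) X Y"
  then show "ident (kar C) Y \<cdot>\<^bsub>kar C\<^esub> f = f" "f \<cdot>\<^bsub>kar C\<^esub> ident (kar C) X = f"
    by (auto elim!: kar_arrE)
next
  fix W X Y Z f g h assume "f \<in> homs (kar C) W X" "g \<in> homs (kar C) X Y" "h \<in> homs (kar C) Y Z"
  then show "h \<cdot>\<^bsub>kar C\<^esub> (g \<cdot>\<^bsub>kar C\<^esub> f) = (h \<cdot>\<^bsub>kar C\<^esub> g) \<cdot>\<^bsub>kar C\<^esub> f"
    by (auto elim!: kar_arrE)
qed

end

context additive_category
begin

lemma kar_additive: "additive_category (kar C)"
proof -
  interpret K: category "kar C" by (rule kar_category)
  show ?thesis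
  proof (intro additive_category.intro kar_category additive_category_axioms.intro)
    fix A B assume AB: "A \<in> Obj (kar C)" "B \<in> Obj (kar C)"
    obtain X p Y q where [simp]: "A = (X, p)" "B = (Y, q)" by (metis prod.exhaust)
    have hyp: "p \<in> homs C X X" "q \<in> homs C Y Y" "X \<in> Obj C" "Y \<in> Obj C" "p \<cdot> p = p" "q \<cdot> q = q"
      using AB by auto
    show "comm_group (hom_group (kar C) A B)"
    proof (rule comm_groupI)
      fix x assume "x \<in> carrier (hom_group (kar C) A B)"
      then obtain f where "x = (A, f, B)" "((X, p), f, (Y, q)) \<in> Arr (kar C)"
        by (auto simp: hom_group_def elim!: kar_arrE)
      then show "\<exists>y\<in>carrier (hom_group (kar C) A B).
              y \<otimes>\<^bsub>hom_group (kar C) A B\<^esub> x = \<one>\<^bsub>hom_group (kar C) A B\<^esub>"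
        by (intro bexI[of _ "(A, \<ominus> f, B)"]) (auto simp: hom_group_def)
    qed (use hyp in \<open>auto simp: hom_group_def add_comm add_lcomm elim!: kar_arrE\<close>)
  next
    fix X Y Z f g g' assume "f \<in> homs (kar C) X Y" "g \<in> homs (kar C) Y Z" "g' \<in> homs (kar C) Y Z"
    then show "addarr (kar C) g g' \<cdot>\<^bsub>kar C\<^esub> f = addarr (kar C) (g \<cdot>\<^bsub>kar C\<^esub> f) (g' \<cdot>\<^bsub>kar C\<^esub> f)"
      by (auto elim!: kar_arrE)
  next
    fix X Y Z f f' g assume "f \<in> homs (kar C) X Y" "f' \<in> homs (kar C) X Y" "g \<in> homs (kar C) Y Z"
    then show "g \<cdot>\<^bsub>kar C\<^esub> addarr (kar C) f f' = addarr (kar C) (g \<cdot>\<^bsub>kar C\<^esub> f) (g \<cdot>\<^bsub>kar C\<^esub> f')"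
      by (auto elim!: kar_arrE)
  next
    obtain Z where "zero_object C Z" using zero_object_exists by blast
    then have "zero_object (kar C) (Z, ident C Z)" unfolding zero_object_def by simp
    then show "\<exists>Z. zero_object (kar C) Z" by blast
  next
    fix A B assume AB: "A \<in> Obj (kar C)" "B \<in> Obj (kar C)"
    obtain X p Y q where [simp]: "A = (X, p)" "B = (Y, q)" by (metis prod.exhaust)
    have h: "p \<in> homs C X X" "q \<in> homs C Y Y" "X \<in> Obj C" "Y \<in> Obj C" "p \<cdot> p = p" "q \<cdot> q = q"
      using AB by auto
    obtain S i j r s where S: "S \<in> Obj C" "i \<in> homs C X S" "j \<in> homs C Y S" "r \<in> homs C S X" "s \<in> homs C S Y"
      and e: "r \<cdot> i = ident C X" "s \<cdot> j = ident C Y" "r \<cdot> j = zeroarr C Y X" "s \<cdot> i = zeroarr C X Y"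
      using biproduct_exists[OF h(3,4)] by blast
    \<comment> \<open>The idempotent that is \<open>p\<close> on the first summand and
      \<open>q\<close> on the second.\<close>
    define P where "P = i \<cdot> (p \<cdot> r) \<oplus> j \<cdot> (q \<cdot> s)"
    note e' = e e[THEN cmp_ext] h(5,6) h(5,6)[THEN cmp_ext]
    note ty = h(1-4) S
    have P: "P \<in> homs C S S" "P \<cdot> P = P" unfolding P_def using ty by (simp_all add: e')
    have Pe: "P \<cdot> (i \<cdot> p) = i \<cdot> p" "P \<cdot> (j \<cdot> q) = j \<cdot> q" "(p \<cdot> r) \<cdot> P = p \<cdot> r" "(q \<cdot> s) \<cdot> P = q \<cdot> s"
      unfolding P_def using ty by (simp_all add: e')
    have Pe': "p \<cdot> (r \<cdot> P) = p \<cdot> r" "q \<cdot> (s \<cdot> P) = q \<cdot> s" using Pe(3,4) ty P(1) by simp_all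
    let ?S = "(S, P)"
    show "\<exists>S\<in>Obj (kar C). \<exists>i\<in>homs (kar C) A S. \<exists>j\<in>homs (kar C) B S. \<exists>p\<in>homs (kar C) S A. \<exists>q\<in>homs (kar C) S B.
        p \<cdot>\<^bsub>kar C\<^esub> i = ident (kar C) A \<and> q \<cdot>\<^bsub>kar C\<^esub> j = ident (kar C) B
        \<and> p \<cdot>\<^bsub>kar C\<^esub> j = zeroarr (kar C) B A \<and> q \<cdot>\<^bsub>kar C\<^esub> i = zeroarr (kar C) A B
        \<and> addarr (kar C) (i \<cdot>\<^bsub>kar C\<^esub> p) (j \<cdot>\<^bsub>kar C\<^esub> q) = ident (kar C) S"
      by (rule bexI[of _ ?S], rule bexI[of _ "(A, i \<cdot> p, ?S)"], rule bexI[of _ "(B, j \<cdot> q, ?S)"],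
          rule bexI[of _ "(?S, p \<cdot> r, A)"], rule bexI[of _ "(?S, q \<cdot> s, B)"])
        (use ty P Pe Pe' in \<open>simp_all add: e' P_def[symmetric]\<close>)
  qed
qed

end

context shift_category
begin

text \<open>Reduces closure under isomorphism of triangles to closure under retracts; the inverse
  components commute with the arrows of the triangles automatically.\<close>

lemma triangle_iso_retract:
  assumes c: "candidate_triangle C T" "candidate_triangle C T'"
    and m: "triangle_map C T T' (a, b, c)"
    and i: "iso_arr C (src C a) (tgt C a) a" "iso_arr C (src C b) (tgt C b) b" "iso_arr C (src C c) (tgt C c) c"
  shows "triangle_retract_of C T' T"
proof -
  obtain f g h where T: "T = (f, g, h)" by (metis prod_cases3)
  obtain f' g' h' where T': "T' = (f', g', h')" by (metis prod_cases3)
  have cc: "f \<in> Arr C" "g \<in> Arr C" "h \<in> Arr C" "src C g = tgt C f" "src C h = tgt C g" "tgt C h = shO C 1 (src C f)"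
    "f' \<in> Arr C" "g' \<in> Arr C" "h' \<in> Arr C" "src C g' = tgt C f'" "src C h' = tgt C g'" "tgt C h' = shO C 1 (src C f')"
    using c unfolding T T' candidate_triangle_def by auto
  have ty: "a \<in> homs C (src C f) (src C f')" "b \<in> homs C (src C g) (src C g')" "c \<in> homs C (src C h) (src C h')"
    and e: "b \<cdot> f = f' \<cdot> a" "c \<cdot> g = g' \<cdot> b" "shM C 1 a \<cdot> h = h' \<cdot> c"
    using m unfolding T T' triangle_map_def by auto
  obtain a' where a': "a' \<in> homs C (tgt C a) (src C a)" "a' \<cdot> a = ident C (src C a)" "a \<cdot> a' = ident C (tgt C a)"
    using i(1) unfolding iso_arr_def by blast
  obtain b' where b': "b' \<in> homs C (tgt C b) (src C b)" "b' \<cdot> b = ident C (src C b)" "b \<cdot> b' = ident C (tgt C b)"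
    using i(2) unfolding iso_arr_def by blast
  obtain c' where c': "c' \<in> homs C (tgt C c) (src C c)" "c' \<cdot> c = ident C (src C c)" "c \<cdot> c' = ident C (tgt C c)"
    using i(3) unfolding iso_arr_def by blast
  have a1: "shM C 1 a' \<cdot> shM C 1 a = ident C (shO C 1 (src C a))" using a' ty cc by (simp flip: shM_cmp)
  have "b' \<cdot> f' = f \<cdot> a'"
  proof -
    have "b' \<cdot> f' = b' \<cdot> ((f' \<cdot> a) \<cdot> a')" using a' ty cc b'(1) by simp
    also have "\<dots> = b' \<cdot> ((b \<cdot> f) \<cdot> a')" by (simp only: e)
    also have "\<dots> = f \<cdot> a'" using a'(1) ty cc b'(1) by (simp add: cmp_ext[OF b'(2)])
    finally show ?thesis .
  qed
  moreover have "c' \<cdot> g' = g \<cdot> b'"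
  proof -
    have "c' \<cdot> g' = c' \<cdot> ((g' \<cdot> b) \<cdot> b')" using b' ty cc c'(1) by simp
    also have "\<dots> = c' \<cdot> ((c \<cdot> g) \<cdot> b')" by (simp only: e)
    also have "\<dots> = g \<cdot> b'" using b'(1) ty cc c'(1) by (simp add: cmp_ext[OF c'(2)])
    finally show ?thesis .
  qed
  moreover have "shM C 1 a' \<cdot> h' = h \<cdot> c'"
  proof -
    have "shM C 1 a' \<cdot> h' = shM C 1 a' \<cdot> ((h' \<cdot> c) \<cdot> c')" using c' ty cc a'(1) by simp
    also have "\<dots> = shM C 1 a' \<cdot> ((shM C 1 a \<cdot> h) \<cdot> c')" by (simp only: e)
    also have "\<dots> = h \<cdot> c'" using a'(1) ty cc c'(1) by (simp add: cmp_ext[OF a1])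
    finally show ?thesis .
  qed
  ultimately have "triangle_map C T' T (a', b', c')"
    unfolding T T' triangle_map_def using a'(1) b'(1) c'(1) ty cc by simp
  then show ?thesis unfolding triangle_retract_of_def
    using m a' b' c' by (intro exI[of _ a'] exI[of _ b'] exI[of _ c'] exI[of _ a] exI[of _ b] exI[of _ c]) simp
qed

end

lemma kar_emb_simps [simp]:
  "fobj (kar_emb C) X = (X, ident C X)"
  "fmor (kar_emb C) f = ((src C f, ident C (src C f)), f, (tgt C f, ident C (tgt C f)))"
  by (simp_all add: kar_emb_def)

context pretriangulated
begin

lemma tri_kar_additive: "additive_category (tri_kar C)"
  using kar_additive additive_category_truncate[of "tri_kar C"] by (simp add: truncate_tri_kar)

lemma tri_kar_shift_category: "shift_category (tri_kar C)"
proof (intro shift_category.intro tri_kar_additive shift_category_axioms.intro)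
  fix n
  have p: "shM C n g \<cdot> shM C n f = shM C n h" if "g \<cdot> f = h" "f \<in> Arr C" "g \<in> Arr C" "src C g = tgt C f"
    for f g h using that by (metis shM_cmp)
  show "additive_functor (tri_kar C) (tri_kar C) (shift_func (tri_kar C) n)"
    unfolding additive_functor_def
  proof (intro conjI ballI)
    fix X assume "X \<in> Obj (tri_kar C)"
    then show "fobj (shift_func (tri_kar C) n) X \<in> Obj (tri_kar C)"
      "fmor (shift_func (tri_kar C) n) (ident (tri_kar C) X) = ident (tri_kar C) (fobj (shift_func (tri_kar C) n) X)"
      by (cases X; simp add: shift_func_def p)+
  next
    fix X Y f assume "f \<in> homs (tri_kar C) X Y"
    then show "fmor (shift_func (tri_kar C) n) f
        \<in> homs (tri_kar C) (fobj (shift_func (tri_kar C) n) X) (fobj (shift_func (tri_kar C) n) Y)"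
      by (auto elim!: kar_arrE simp: shift_func_def p)
  next
    fix X Y Z f g assume "f \<in> homs (tri_kar C) X Y" "g \<in> homs (tri_kar C) Y Z"
    then show "fmor (shift_func (tri_kar C) n) (g \<cdot>\<^bsub>tri_kar C\<^esub> f)
        = fmor (shift_func (tri_kar C) n) g \<cdot>\<^bsub>tri_kar C\<^esub> fmor (shift_func (tri_kar C) n) f"
      by (auto elim!: kar_arrE simp: shift_func_def)
  next
    fix X Y f g assume "f \<in> homs (tri_kar C) X Y" "g \<in> homs (tri_kar C) X Y"
    then show "fmor (shift_func (tri_kar C) n) (addarr (tri_kar C) f g)
        = addarr (tri_kar C) (fmor (shift_func (tri_kar C) n) f) (fmor (shift_func (tri_kar C) n) g)"
      by (auto elim!: kar_arrE simp: shift_func_def)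
  qed
qed (auto elim!: kar_arrE)

lemma kar_emb_additive: "additive_functor C (tri_kar C) (kar_emb C)"
  unfolding additive_functor_def by auto

lemma kar_emb_fully_faithful: "fully_faithful C (tri_kar C) (kar_emb C)"
  unfolding fully_faithful_def
proof (intro ballI bij_betwI')
  fix X Y \<phi> assume XY: "X \<in> Obj C" "Y \<in> Obj C"
    and \<phi>: "\<phi> \<in> homs (tri_kar C) (fobj (kar_emb C) X) (fobj (kar_emb C) Y)"
  then show "\<exists>f\<in>homs C X Y. \<phi> = fmor (kar_emb C) f"
    by (auto elim!: kar_arrE intro!: bexI)
qed auto

lemma kar_emb_Dist:
  assumes "(f, g, h) \<in> Dist C"
  shows "candidate_triangle (tri_kar C) (fmor (kar_emb C) f, fmor (kar_emb C) g, fmor (kar_emb C) h)"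
    and "(fmor (kar_emb C) f, fmor (kar_emb C) g, fmor (kar_emb C) h) \<in> Dist (tri_kar C)"
proof -
  interpret K: shift_category "tri_kar C" by (rule tri_kar_shift_category)
  show c: "candidate_triangle (tri_kar C) (fmor (kar_emb C) f, fmor (kar_emb C) g, fmor (kar_emb C) h)"
    using dtri_homs[OF dist_dtri[OF assms]] unfolding candidate_triangle_def by auto
  show "(fmor (kar_emb C) f, fmor (kar_emb C) g, fmor (kar_emb C) h) \<in> Dist (tri_kar C)"
    unfolding tri_kar_Dist using assms c K.triangle_retract_of_refl[OF c] by blast
qed

text \<open>Each axiom is traced back to triangles of \<open>C\<close> of which the given ones are
  retracts; \<open>ret\<close> provides closure under retracts by transitivity.\<close>

lemma tri_kar_pretriangulated: "pretriangulated (tri_kar C)"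
proof -
  interpret K: shift_category "tri_kar C" by (rule tri_kar_shift_category)
  let ?K = "tri_kar C" and ?J = "fmor (kar_emb C)"
  interpret J: add_functor C ?K "kar_emb C" by unfold_locales (rule kar_emb_additive)
  have neg: "negarr ?K ((X, p), f, (Y, q)) = ((X, p), \<ominus> f, (Y, q))"
    if "((X, p), f, (Y, q)) \<in> Arr ?K" for X p f Y q
    using that by (intro K.neg_unique) auto
  note J_cand = kar_emb_Dist(1) and J_dist = kar_emb_Dist(2)
  have ret: "T \<in> Dist ?K" if T: "candidate_triangle ?K T" "T' \<in> Dist ?K" "triangle_retract_of ?K T T'" for T T'
  proof -
    obtain f g h where t: "(f, g, h) \<in> Dist C" "triangle_retract_of ?K T' (?J f, ?J g, ?J h)"
      "candidate_triangle ?K T'" using T(2) unfolding tri_kar_Dist by blast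
    then show ?thesis unfolding tri_kar_Dist
      using K.triangle_retract_of_trans[OF T(1) t(3) J_cand[OF t(1)] T(3) t(2)] T(1) by blast
  qed
  have J_rot: "?J (\<ominus> shM C 1 f) = negarr ?K (shM ?K 1 (?J f))" if "f \<in> Arr C" for f
    using that by (simp add: neg)
  show ?thesis
  proof (intro pretriangulated.intro tri_kar_shift_category pretriangulated_axioms.intro)
    show "candidate_triangle ?K T" if "T \<in> Dist ?K" for T
      using that unfolding tri_kar_Dist by blast
    show "T' \<in> Dist ?K" if T: "T \<in> Dist ?K" "candidate_triangle ?K T'" "triangle_map ?K T T' (a, b, c)"
      "iso_arr ?K (src ?K a) (tgt ?K a) a" "iso_arr ?K (src ?K b) (tgt ?K b) b" "iso_arr ?K (src ?K c) (tgt ?K c) c"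
      for T T' a b c
    proof -
      have c: "candidate_triangle ?K T" using T(1) unfolding tri_kar_Dist by blast
      show ?thesis by (rule ret[OF T(2,1) K.triangle_iso_retract[OF c T(2-)]])
    qed
  next
    fix A Z assume A: "A \<in> Obj ?K" and Z: "zero_object ?K Z"
    obtain X p where [simp]: "A = (X, p)" by (metis prod.exhaust)
    obtain U z where [simp]: "Z = (U, z)" by (metis prod.exhaust)
    have p: "p \<in> homs C X X" "p \<cdot> p = p" "X \<in> Obj C" using A by auto
    have z: "z = zeroarr C U U" "U \<in> Obj C" using Z unfolding zero_object_def by auto
    \<comment> \<open>The triangle on the identity of \<open>(X, p)\<close> is a retract, by means
      of \<open>p\<close>, of the image of the one on the identity of \<open>X\<close>. The zero
      object of the completion may be any \<open>(U, z)\<close> with \<open>z = 0\<close>, so its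
      components are zero arrows to and from \<open>W\<close>.\<close>
    obtain W where W: "zero_object C W" using zero_object_exists by blast
    note W' = zero_object_Obj[OF W]
    have "(ident C X, zeroarr C X W, zeroarr C W (shO C 1 X)) \<in> Dist C" by (rule TR1_ident[OF homs_Obj(1)[OF p(1)] W])
    note d = J_dist[OF this]
    show "(ident ?K A, zeroarr ?K A Z, zeroarr ?K Z (shO ?K 1 A)) \<in> Dist ?K"
    proof (rule ret[OF _ d])
      show "candidate_triangle ?K (ident ?K A, zeroarr ?K A Z, zeroarr ?K Z (shO ?K 1 A))"
        using p z unfolding candidate_triangle_def by (simp flip: shM_cmp)
      show "triangle_retract_of ?K (ident ?K A, zeroarr ?K A Z, zeroarr ?K Z (shO ?K 1 A))
        (?J (ident C X), ?J (zeroarr C X W), ?J (zeroarr C W (shO C 1 X)))"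
        unfolding triangle_retract_of_def
        by (rule exI[of _ "((X, p), p, (X, ident C X))"], rule exI[of _ "((X, p), p, (X, ident C X))"],
            rule exI[of _ "((U, z), zeroarr C U W, (W, ident C W))"],
            rule exI[of _ "((X, ident C X), p, (X, p))"], rule exI[of _ "((X, ident C X), p, (X, p))"],
            rule exI[of _ "((W, ident C W), zeroarr C W U, (U, z))"])
          (use p z W' in \<open>simp add: triangle_map_def flip: shM_cmp\<close>)
    qed
  next
    fix \<phi> assume "\<phi> \<in> Arr ?K"
    then obtain X p f Y q where \<phi>: "\<phi> = ((X, p), f, (Y, q))" and f: "f \<in> homs C X Y"
      and p: "p \<in> homs C X X" "p \<cdot> p = p" and q: "q \<in> homs C Y Y" "q \<cdot> q = q" and pq: "q \<cdot> f = f" "f \<cdot> p = f"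
      by (auto elim!: kar_arrE)
    \<comment> \<open>A cone for the underlying arrow in \<open>C\<close>; an idempotent
      \<open>z\<close> on it lifting \<open>p\<close> and \<open>q\<close> cuts out the cone
      \<open>(Z, z)\<close> of the given arrow.\<close>
    obtain Z g h where t: "dtri C X Y Z f g h" using cone[OF f] by blast
    obtain z where z: "z \<in> homs C Z Z" "z \<cdot> z = z" "z \<cdot> g = g \<cdot> q" "shM C 1 p \<cdot> h = h \<cdot> z"
      using cone_idempotent[OF t p q] pq by auto
    note ty = dtri_homs[OF t] dtri_Obj[OF t] p(1) q(1) z(1)
    have p1: "shM C 1 p \<cdot> shM C 1 p = shM C 1 p" using p by (simp flip: shM_cmp)
    note e = p(2) q(2) z(2) p1 pq z(3) z(4)[symmetric]
    note e' = e e[THEN cmp_ext]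
    let ?T = "(\<phi>, ((Y, q), g \<cdot> q, (Z, z)), ((Z, z), h \<cdot> z, shO ?K 1 (X, p)))"
    have "?T \<in> Dist ?K"
    proof (rule ret[OF _ J_dist[OF ty(4)]])
      show "candidate_triangle ?K ?T" unfolding candidate_triangle_def \<phi> using ty by (simp add: e')
      show "triangle_retract_of ?K ?T (?J f, ?J g, ?J h)"
        unfolding triangle_retract_of_def \<phi>
        by (rule exI[of _ "((X, p), p, (X, ident C X))"], rule exI[of _ "((Y, q), q, (Y, ident C Y))"],
            rule exI[of _ "((Z, z), z, (Z, ident C Z))"],
            rule exI[of _ "((X, ident C X), p, (X, p))"], rule exI[of _ "((Y, ident C Y), q, (Y, q))"],
            rule exI[of _ "((Z, ident C Z), z, (Z, z))"])
          (use ty in \<open>simp add: triangle_map_def e'\<close>)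
    qed
    then show "\<exists>g h. (\<phi>, g, h) \<in> Dist ?K" by blast
  next
    fix F G H assume c: "candidate_triangle ?K (F, G, H)"
    have F: "F \<in> Arr ?K" "G \<in> Arr ?K" "H \<in> Arr ?K" "src ?K G = tgt ?K F" "src ?K H = tgt ?K G"
      "tgt ?K H = shO ?K 1 (src ?K F)" using c unfolding candidate_triangle_def by auto
    have c': "candidate_triangle ?K (G, H, negarr ?K (shM ?K 1 F))"
      using F unfolding candidate_triangle_def by (simp del: tri_kar_simps)
    show "((F, G, H) \<in> Dist ?K) = ((G, H, negarr ?K (shM ?K 1 F)) \<in> Dist ?K)"
    proof
      assume "(F, G, H) \<in> Dist ?K"
      then obtain f g h where t: "(f, g, h) \<in> Dist C" "triangle_retract_of ?K (F, G, H) (?J f, ?J g, ?J h)"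
        unfolding tri_kar_Dist by blast
      have "(g, h, \<ominus> shM C 1 f) \<in> Dist C" using rot[OF dist_dtri[OF t(1)]] dtri_homs(4) by blast
      moreover have "f \<in> Arr C" using dtri_homs[OF dist_dtri[OF t(1)]] by simp
      then have "triangle_retract_of ?K (G, H, negarr ?K (shM ?K 1 F)) (?J g, ?J h, ?J (\<ominus> shM C 1 f))"
        unfolding J_rot[OF \<open>f \<in> Arr C\<close>] using t(2) K.triangle_retract_of_rot[OF c J_cand[OF t(1)]] by blast
      ultimately show "(G, H, negarr ?K (shM ?K 1 F)) \<in> Dist ?K" using c' unfolding tri_kar_Dist by blast
    next
      assume "(G, H, negarr ?K (shM ?K 1 F)) \<in> Dist ?K"
      then obtain f g h where t: "(f, g, h) \<in> Dist C"
        "triangle_retract_of ?K (G, H, negarr ?K (shM ?K 1 F)) (?J f, ?J g, ?J h)"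
        unfolding tri_kar_Dist by blast
      let ?h = "\<ominus> shM C (- 1) h"
      have h: "h \<in> Arr C" using dtri_homs[OF dist_dtri[OF t(1)]] by simp
      have t': "(?h, f, g) \<in> Dist C" using rot_back[OF dist_dtri[OF t(1)]] dtri_homs(4) by blast
      have "\<ominus> shM C 1 ?h = h" using h by simp
      then have "?J h = negarr ?K (shM ?K 1 (?J ?h))" using J_rot[of ?h] h by simp
      then have "triangle_retract_of ?K (F, G, H) (?J ?h, ?J f, ?J g)"
        using t(2) K.triangle_retract_of_rot[OF c J_cand[OF t']] by simp
      then show "(F, G, H) \<in> Dist ?K" using c t' unfolding tri_kar_Dist by blast
    qed
  next
    fix F G H F' G' H' a b
    assume T: "(F, G, H) \<in> Dist ?K" and T': "(F', G', H') \<in> Dist ?K"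
      and a: "a \<in> homs ?K (src ?K F) (src ?K F')" and b: "b \<in> homs ?K (tgt ?K F) (tgt ?K F')"
      and ab: "b \<cdot>\<^bsub>?K\<^esub> F = F' \<cdot>\<^bsub>?K\<^esub> a"
    obtain f g h i1 i2 i3 r1 r2 r3 where t: "(f, g, h) \<in> Dist C"
      and m: "triangle_map ?K (F, G, H) (?J f, ?J g, ?J h) (i1, i2, i3)"
      "triangle_map ?K (?J f, ?J g, ?J h) (F, G, H) (r1, r2, r3)"
      and ri: "r1 \<cdot>\<^bsub>?K\<^esub> i1 = ident ?K (src ?K i1)" "r2 \<cdot>\<^bsub>?K\<^esub> i2 = ident ?K (src ?K i2)"
        "r3 \<cdot>\<^bsub>?K\<^esub> i3 = ident ?K (src ?K i3)"
      using T unfolding tri_kar_Dist triangle_retract_of_def by blast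
    obtain f' g' h' i1' i2' i3' r1' r2' r3' where t': "(f', g', h') \<in> Dist C"
      and m': "triangle_map ?K (F', G', H') (?J f', ?J g', ?J h') (i1', i2', i3')"
      "triangle_map ?K (?J f', ?J g', ?J h') (F', G', H') (r1', r2', r3')"
      and ri': "r1' \<cdot>\<^bsub>?K\<^esub> i1' = ident ?K (src ?K i1')" "r2' \<cdot>\<^bsub>?K\<^esub> i2' = ident ?K (src ?K i2')"
        "r3' \<cdot>\<^bsub>?K\<^esub> i3' = ident ?K (src ?K i3')"
      using T' unfolding tri_kar_Dist triangle_retract_of_def by blast
    have c: "candidate_triangle ?K (F, G, H)" "candidate_triangle ?K (F', G', H')"
      using T T' unfolding tri_kar_Dist by blast+
    note cJ = J_cand[OF t] J_cand[OF t']
    have full: "\<exists>\<alpha>\<in>homs C X Y. \<phi> = ?J \<alpha>"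
      if "\<phi> \<in> homs ?K (fobj (kar_emb C) X) (fobj (kar_emb C) Y)" "X \<in> Obj C" "Y \<in> Obj C" for \<phi> X Y
      using kar_emb_fully_faithful that unfolding fully_faithful_def bij_betw_def by (metis imageE)
    note d = dtri_homs[OF dist_dtri[OF t]] dtri_homs[OF dist_dtri[OF t']]
    have F: "F \<in> Arr ?K" "G \<in> Arr ?K" "H \<in> Arr ?K" "src ?K G = tgt ?K F" "src ?K H = tgt ?K G"
      "tgt ?K H = shO ?K 1 (src ?K F)" "F' \<in> Arr ?K" "G' \<in> Arr ?K" "H' \<in> Arr ?K" "src ?K G' = tgt ?K F'"
      "src ?K H' = tgt ?K G'" "tgt ?K H' = shO ?K 1 (src ?K F')"
      using c unfolding candidate_triangle_def by auto
    have Jf: "?J f \<in> homs ?K (fobj (kar_emb C) (src C f)) (fobj (kar_emb C) (src C g))"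
      "?J f' \<in> homs ?K (fobj (kar_emb C) (src C f')) (fobj (kar_emb C) (src C g'))"
      "src ?K (?J g) = fobj (kar_emb C) (src C g)" "src ?K (?J g') = fobj (kar_emb C) (src C g')"
      using d by auto
    have mt: "r1 \<in> homs ?K (fobj (kar_emb C) (src C f)) (src ?K F)" "i1' \<in> homs ?K (src ?K F') (fobj (kar_emb C) (src C f'))"
      "r2 \<in> homs ?K (fobj (kar_emb C) (src C g)) (tgt ?K F)" "i2' \<in> homs ?K (tgt ?K F') (fobj (kar_emb C) (src C g'))"
      "i1 \<in> homs ?K (src ?K F) (fobj (kar_emb C) (src C f))" "r1' \<in> homs ?K (fobj (kar_emb C) (src C f')) (src ?K F')"
      "i2 \<in> homs ?K (tgt ?K F) (fobj (kar_emb C) (src C g))" "r2' \<in> homs ?K (fobj (kar_emb C) (src C g')) (tgt ?K F')"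
      using m m' Jf F unfolding triangle_map_def by (auto simp del: tri_kar_simps kar_emb_simps)
    have me: "r2 \<cdot>\<^bsub>?K\<^esub> ?J f = F \<cdot>\<^bsub>?K\<^esub> r1" "i2' \<cdot>\<^bsub>?K\<^esub> F' = ?J f' \<cdot>\<^bsub>?K\<^esub> i1'"
      using m(2) m'(1) unfolding triangle_map_def by auto
    \<comment> \<open>The given square is transported to \<open>C\<close>: projecting, applying
      \<open>a\<close> and including again is an arrow between images of objects of
      \<open>C\<close>, hence comes from \<open>C\<close> by fullness. Sandwiching it between the
      inclusion and the projection returns \<open>a\<close>, and likewise for
      \<open>b\<close>.\<close>
    obtain \<alpha> where \<alpha>: "\<alpha> \<in> homs C (src C f) (src C f')" "i1' \<cdot>\<^bsub>?K\<^esub> (a \<cdot>\<^bsub>?K\<^esub> r1) = ?J \<alpha>"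
      using full[of "i1' \<cdot>\<^bsub>?K\<^esub> (a \<cdot>\<^bsub>?K\<^esub> r1)" "src C f" "src C f'"] mt a d by (auto simp del: tri_kar_simps kar_emb_simps)
    obtain \<beta> where \<beta>: "\<beta> \<in> homs C (src C g) (src C g')" "i2' \<cdot>\<^bsub>?K\<^esub> (b \<cdot>\<^bsub>?K\<^esub> r2) = ?J \<beta>"
      using full[of "i2' \<cdot>\<^bsub>?K\<^esub> (b \<cdot>\<^bsub>?K\<^esub> r2)" "src C g" "src C g'"] mt b d by (auto simp del: tri_kar_simps kar_emb_simps)
    have "?J (\<beta> \<cdot> f) = ?J (f' \<cdot> \<alpha>)"
    proof -
      have "?J (\<beta> \<cdot> f) = (i2' \<cdot>\<^bsub>?K\<^esub> (b \<cdot>\<^bsub>?K\<^esub> r2)) \<cdot>\<^bsub>?K\<^esub> ?J f" unfolding \<beta>(2) using \<beta>(1) d by (intro J.fmor_cmp) auto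
      also have "\<dots> = i2' \<cdot>\<^bsub>?K\<^esub> (b \<cdot>\<^bsub>?K\<^esub> (F \<cdot>\<^bsub>?K\<^esub> r1))"
        using mt b Jf F by (simp add: me del: tri_kar_simps kar_emb_simps)
      also have "\<dots> = ?J f' \<cdot>\<^bsub>?K\<^esub> (i1' \<cdot>\<^bsub>?K\<^esub> (a \<cdot>\<^bsub>?K\<^esub> r1))"
        using mt a b Jf F by (simp add: K.cmp_ext[OF ab] K.cmp_ext[OF me(2)] del: tri_kar_simps kar_emb_simps)
      also have "\<dots> = ?J (f' \<cdot> \<alpha>)" unfolding \<alpha>(2) using \<alpha>(1) d by (intro J.fmor_cmp[symmetric]) auto
      finally show ?thesis .
    qed
    then have "\<beta> \<cdot> f = f' \<cdot> \<alpha>" by simp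
    then obtain \<gamma> where \<gamma>: "triangle_map C (f, g, h) (f', g', h') (\<alpha>, \<beta>, \<gamma>)"
      using TR3[OF t t' \<alpha>(1)] \<beta>(1) d by auto
    have Jm: "triangle_map ?K (?J f, ?J g, ?J h) (?J f', ?J g', ?J h') (?J \<alpha>, ?J \<beta>, ?J \<gamma>)"
      using \<gamma> d unfolding triangle_map_def by auto
    note m1 = K.triangle_map_cmp[OF cJ(1,2) c(2) Jm m'(2)]
    note m2 = K.triangle_map_cmp[OF c(1) cJ(1) c(2) m(1) m1]
    have ab': "(r1' \<cdot>\<^bsub>?K\<^esub> ?J \<alpha>) \<cdot>\<^bsub>?K\<^esub> i1 = a" "(r2' \<cdot>\<^bsub>?K\<^esub> ?J \<beta>) \<cdot>\<^bsub>?K\<^esub> i2 = b"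
      unfolding \<alpha>(2)[symmetric] \<beta>(2)[symmetric] using mt a b F
      by (simp_all add: ri ri' K.cmp_ext[OF ri'(1)] K.cmp_ext[OF ri'(2)] del: tri_kar_simps kar_emb_simps)
    show "\<exists>c. triangle_map ?K (F, G, H) (F', G', H') (a, b, c)" using m2[unfolded ab'] by (rule exI)
  qed
qed

end

context triangulated_category
begin

text \<open>Only TR4 remains. An arrow \<open>(X, p) -> (Y, q)\<close> of the completion is an arrow
  \<open>f : X -> Y\<close> absorbing \<open>p\<close> and \<open>q\<close>, so \<open>f\<close>
  itself is its extension by zero to the ambient objects, and \<open>C\<close> has an octahedron
  over it.\<close>

lemma tri_kar_triangulated: "triangulated_category (tri_kar C)"
proof -
  interpret K: pretriangulated "tri_kar C" by (rule tri_kar_pretriangulated)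
  let ?K = "tri_kar C" and ?J = "fmor (kar_emb C)" and ?E = "fobj (kar_emb C)"
  have J_dtri: "dtri ?K (?E X) (?E Y) (?E Z) (?J f) (?J g) (?J h)" if t: "dtri C X Y Z f g h" for X Y Z f g h
    using kar_emb_Dist(2)[OF dtri_homs(4)[OF t]] dtri_homs[OF t] unfolding dtri_def by auto
  have ret: "dtri ?K X Y Z f g h"
    if t0: "dtri ?K X0 Y0 Z0 f0 g0 h0" and ty: "f \<in> homs ?K X Y" "g \<in> homs ?K Y Z" "h \<in> homs ?K Z (shO ?K 1 X)"
      and m: "triangle_map ?K (f, g, h) (f0, g0, h0) (a, b, c)" "triangle_map ?K (f0, g0, h0) (f, g, h) (a', b', c')"
      and e: "a' \<cdot>\<^bsub>?K\<^esub> a = ident ?K X" "b' \<cdot>\<^bsub>?K\<^esub> b = ident ?K Y" "c' \<cdot>\<^bsub>?K\<^esub> c = ident ?K Z"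
    for X Y Z f g h X0 Y0 Z0 f0 g0 h0 a b c a' b' c'
  proof -
    have c: "candidate_triangle ?K (f, g, h)" using ty unfolding candidate_triangle_def by auto
    have "src ?K a = X" "src ?K b = Y" "src ?K c = Z" using m(1) ty unfolding triangle_map_def by auto
    then have r: "triangle_retract_of ?K (f, g, h) (f0, g0, h0)"
      unfolding triangle_retract_of_def using m e by metis
    obtain f1 g1 h1 where t1: "(f1, g1, h1) \<in> Dist C" "triangle_retract_of ?K (f0, g0, h0) (?J f1, ?J g1, ?J h1)"
      using K.dtri_homs(4)[OF t0] unfolding tri_kar_Dist by blast
    have "triangle_retract_of ?K (f, g, h) (?J f1, ?J g1, ?J h1)"
      by (rule K.triangle_retract_of_trans[OF c dtri_candidate[OF t0] dtri_candidate[OF J_dtri[OF dist_dtri[OF t1(1)]]] r t1(2)])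
    then have "(f, g, h) \<in> Dist ?K" unfolding tri_kar_Dist using c t1(1) by blast
    then show ?thesis unfolding dtri_def using ty by simp
  qed
  show ?thesis
  proof (intro triangulated_category.intro K.additive_category_axioms triangulated_category_axioms.intro)
    fix \<phi> I J' \<psi> k l r s
    assume T: "(\<phi>, I, J') \<in> Dist ?K" "(\<psi>, k, l) \<in> Dist ?K" "src ?K \<psi> = tgt ?K \<phi>" "(\<psi> \<cdot>\<^bsub>?K\<^esub> \<phi>, r, s) \<in> Dist ?K"
    note d = K.dtri_homs[OF K.dist_dtri[OF T(1)]] K.dtri_homs[OF K.dist_dtri[OF T(2)]]
    obtain X p f Y q where \<phi>: "\<phi> = ((X, p), f, (Y, q))" and f: "f \<in> homs C X Y"
      and p: "p \<in> homs C X X" "p \<cdot> p = p" and q: "q \<in> homs C Y Y" "q \<cdot> q = q" and pq: "q \<cdot> f = f" "f \<cdot> p = f"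
      using d(1) by (auto elim!: kar_arrE)
    obtain g Z z where \<psi>: "\<psi> = ((Y, q), g, (Z, z))" and g: "g \<in> homs C Y Z"
      and z: "z \<in> homs C Z Z" "z \<cdot> z = z" and qz: "z \<cdot> g = g" "g \<cdot> q = g"
      using d(5) T(3) unfolding \<phi> by (auto elim!: kar_arrE)
    obtain A0 i0 j0 where t1: "dtri C X Y A0 f i0 j0" using cone[OF f] by blast
    obtain B0 k0 l0 where t2: "dtri C Y Z B0 g k0 l0" using cone[OF g] by blast
    have "g \<cdot> f \<in> homs C X Z" using f g by simp
    then obtain D0 r0 s0 where t3: "dtri C X Z D0 (g \<cdot> f) r0 s0" using cone by blast
    obtain u0 v0 where o: "dtri C A0 D0 B0 u0 v0 (shM C 1 i0 \<cdot> l0)"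
      "u0 \<cdot> i0 = r0 \<cdot> g" "s0 \<cdot> u0 = j0" "v0 \<cdot> r0 = k0" "l0 \<cdot> v0 = shM C 1 f \<cdot> s0"
      using octahedron[OF t1 t2 t3] by blast
    note ty = dtri_homs[OF t1] dtri_homs[OF t2] dtri_homs[OF t3] dtri_homs[OF o(1)] dtri_Obj[OF t1] dtri_Obj[OF t2]
    have Jgf: "?J (g \<cdot> f) = ?J g \<cdot>\<^bsub>?K\<^esub> ?J f" using f g by simp
    have Jil: "?J (shM C 1 i0 \<cdot> l0) = shM ?K 1 (?J i0) \<cdot>\<^bsub>?K\<^esub> ?J l0" using ty by simp
    have oK: "?J u0 \<cdot>\<^bsub>?K\<^esub> ?J i0 = ?J r0 \<cdot>\<^bsub>?K\<^esub> ?J g" "?J s0 \<cdot>\<^bsub>?K\<^esub> ?J u0 = ?J j0"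
      "?J v0 \<cdot>\<^bsub>?K\<^esub> ?J r0 = ?J k0" "?J l0 \<cdot>\<^bsub>?K\<^esub> ?J v0 = shM ?K 1 (?J f) \<cdot>\<^bsub>?K\<^esub> ?J s0"
      using ty o(2-) by auto
    have tt: "dtri ?K (X, p) (Y, q) (tgt ?K I) \<phi> I J'" "dtri ?K (Y, q) (Z, z) (tgt ?K k) \<psi> k l"
      "dtri ?K (X, p) (Z, z) (tgt ?K r) (\<psi> \<cdot>\<^bsub>?K\<^esub> \<phi>) r s"
      using K.dist_dtri[OF T(1)] K.dist_dtri[OF T(2)] K.dist_dtri[OF T(4)] by (simp_all add: \<phi> \<psi>)
    have X: "((X, p), p, (X, ident C X)) \<in> homs ?K (X, p) (?E X)" "((X, ident C X), p, (X, p)) \<in> homs ?K (?E X) (X, p)"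
      "((X, ident C X), p, (X, p)) \<cdot>\<^bsub>?K\<^esub> ((X, p), p, (X, ident C X)) = ident ?K (X, p)"
      using p by auto
    have Y: "((Y, q), q, (Y, ident C Y)) \<in> homs ?K (Y, q) (?E Y)" "((Y, ident C Y), q, (Y, q)) \<in> homs ?K (?E Y) (Y, q)"
      "((Y, ident C Y), q, (Y, q)) \<cdot>\<^bsub>?K\<^esub> ((Y, q), q, (Y, ident C Y)) = ident ?K (Y, q)"
      using q by auto
    have Z: "((Z, z), z, (Z, ident C Z)) \<in> homs ?K (Z, z) (?E Z)" "((Z, ident C Z), z, (Z, z)) \<in> homs ?K (?E Z) (Z, z)"
      "((Z, ident C Z), z, (Z, z)) \<cdot>\<^bsub>?K\<^esub> ((Z, z), z, (Z, ident C Z)) = ident ?K (Z, z)"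
      using z by auto
    \<comment> \<open>The underlying arrows, seen between the ambient objects, factor through the
      summands; this is the form in which \<open>octahedron_retract\<close> expects extensions by
      zero.\<close>
    have f0: "?J f = ((Y, q), q, (Y, ident C Y)) \<cdot>\<^bsub>?K\<^esub> (\<phi> \<cdot>\<^bsub>?K\<^esub> ((X, ident C X), p, (X, p)))"
      "?J g = ((Z, z), z, (Z, ident C Z)) \<cdot>\<^bsub>?K\<^esub> (\<psi> \<cdot>\<^bsub>?K\<^esub> ((Y, ident C Y), q, (Y, q)))"
      unfolding \<phi> \<psi> using f g pq qz by simp_all
    obtain u v where uv: "dtri ?K (tgt ?K I) (tgt ?K r) (tgt ?K k) u v (shM ?K 1 I \<cdot>\<^bsub>?K\<^esub> l)"
      "u \<cdot>\<^bsub>?K\<^esub> I = r \<cdot>\<^bsub>?K\<^esub> \<psi>" "s \<cdot>\<^bsub>?K\<^esub> u = J'" "v \<cdot>\<^bsub>?K\<^esub> r = k" "l \<cdot>\<^bsub>?K\<^esub> v = shM ?K 1 \<phi> \<cdot>\<^bsub>?K\<^esub> s"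
      by (rule K.octahedron_retract[OF ret tt J_dtri[OF t1] J_dtri[OF t2] J_dtri[OF t3, unfolded Jgf]
            J_dtri[OF o(1), unfolded Jil] oK X Y Z f0])
    show "\<exists>u\<in>homs ?K (tgt ?K I) (tgt ?K r). \<exists>v\<in>homs ?K (tgt ?K r) (tgt ?K k).
              (u, v, shM ?K 1 I \<cdot>\<^bsub>?K\<^esub> l) \<in> Dist ?K
            \<and> u \<cdot>\<^bsub>?K\<^esub> I = r \<cdot>\<^bsub>?K\<^esub> \<psi> \<and> s \<cdot>\<^bsub>?K\<^esub> u = J' \<and> v \<cdot>\<^bsub>?K\<^esub> r = k \<and> l \<cdot>\<^bsub>?K\<^esub> v = shM ?K 1 \<phi> \<cdot>\<^bsub>?K\<^esub> s"
      using uv K.dtri_homs[OF uv(1)] by blast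
  qed (fact K.shift_functor K.shO_0 K.shM_0 K.shO_add K.shM_add K.dist_candidate K.TR1_iso K.TR1_ident
      K.TR1_cone K.TR2 K.TR3)+
qed

end

definition hom_zero :: "('o, 'm, 'z) acat_scheme \<Rightarrow> 'o \<Rightarrow> 'o \<Rightarrow> bool" where
  "hom_zero C X Y \<longleftrightarrow> (\<forall>f \<in> homs C X Y. f = zeroarr C X Y)"

lemma (in additive_category) hom_zero_retract:
  assumes "hom_zero C X Y" "retract C X' X" "retract C Y' Y"
  shows "hom_zero C X' Y'"
  unfolding hom_zero_def
proof
  fix f assume f: "f \<in> homs C X' Y'"
  obtain i r where x: "i \<in> homs C X' X" "r \<in> homs C X X'" "r \<cdot> i = ident C X'"
    using assms(2) by (rule retractE)
  obtain j s where y: "j \<in> homs C Y' Y" "s \<in> homs C Y Y'" "s \<cdot> j = ident C Y'"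
    using assms(3) by (rule retractE)
  have z: "j \<cdot> (f \<cdot> r) = zeroarr C X Y"
    using assms(1) f x(1,2) y(1,2) unfolding hom_zero_def by (metis cmp_in)
  note o = homs_Obj[OF x(1)] homs_Obj[OF y(1)]
  have "f = s \<cdot> ((j \<cdot> (f \<cdot> r)) \<cdot> i)"
    using f x(1,2) y(1,2) by (simp add: x(3) cmp_ext[OF y(3)])
  also have "\<dots> = zeroarr C X' Y'" unfolding z using x(1,2) y(1,2) o by simp
  finally show "f = zeroarr C X' Y'" .
qed

section \<open>Exact embeddings\<close>

locale ff_functor = add_functor +
  assumes ff: "fully_faithful A B F"
begin

lemma full:
  assumes "\<phi> \<in> homs B (fobj F X) (fobj F Y)" "X \<in> Obj A" "Y \<in> Obj A"
  obtains f where "f \<in> homs A X Y" "\<phi> = fmor F f"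
proof -
  have "fmor F ` homs A X Y = homs B (fobj F X) (fobj F Y)"
    using ff assms(2,3) unfolding fully_faithful_def bij_betw_def by blast
  then show thesis using that assms(1) by blast
qed

lemma faithful:
  assumes "fmor F f = fmor F g" "f \<in> homs A X Y" "g \<in> homs A X Y"
  shows "f = g"
proof -
  have "inj_on (fmor F) (homs A X Y)"
    using ff A.homs_Obj[OF assms(2)] unfolding fully_faithful_def bij_betw_def by blast
  then show ?thesis using assms unfolding inj_on_def by blast
qed

lemma reflect_retract:
  assumes "retract B (fobj F X) (fobj F Y)" "X \<in> Obj A" "Y \<in> Obj A"
  shows "retract A X Y"
proof -
  obtain i' r' where ir': "i' \<in> homs B (fobj F X) (fobj F Y)" "r' \<in> homs B (fobj F Y) (fobj F X)"
    "r' \<cdot>\<^bsub>B\<^esub> i' = ident B (fobj F X)" using assms(1) by (rule B.retractE)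
  obtain i where i: "i \<in> homs A X Y" "i' = fmor F i" using full[OF ir'(1)] assms by blast
  obtain r where r: "r \<in> homs A Y X" "r' = fmor F r" using full[OF ir'(2)] assms by blast
  have "fmor F (r \<cdot>\<^bsub>A\<^esub> i) = fmor F (ident A X)" using ir'(3) i r assms by simp
  then have "r \<cdot>\<^bsub>A\<^esub> i = ident A X" by (rule faithful) (use i r assms in auto)
  then show ?thesis using i r A.retractI by blast
qed

lemma reflect_iso:
  assumes "iso_arr B (fobj F X) (fobj F Y) (fmor F f)" "f \<in> homs A X Y"
  shows "iso_arr A X Y f"
proof -
  note XY = A.homs_Obj[OF assms(2)]
  obtain g' where g': "g' \<in> homs B (fobj F Y) (fobj F X)" "g' \<cdot>\<^bsub>B\<^esub> fmor F f = ident B (fobj F X)"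
    "fmor F f \<cdot>\<^bsub>B\<^esub> g' = ident B (fobj F Y)" using assms(1) unfolding iso_arr_def by blast
  obtain g where g: "g \<in> homs A Y X" "g' = fmor F g" using full[OF g'(1)] XY by blast
  have e: "fmor F (g \<cdot>\<^bsub>A\<^esub> f) = fmor F (ident A X)" "fmor F (f \<cdot>\<^bsub>A\<^esub> g) = fmor F (ident A Y)"
    using g' g assms(2) XY by simp_all
  have "g \<cdot>\<^bsub>A\<^esub> f = ident A X" "f \<cdot>\<^bsub>A\<^esub> g = ident A Y"
    using faithful[OF e(1), of X X] faithful[OF e(2), of Y Y] g(1) assms(2) XY by simp_all
  then show ?thesis using A.iso_arrI assms(2) g(1) by blast
qed

lemma reflect_isomorphic:
  assumes "isomorphic B (fobj F X) (fobj F Y)" "X \<in> Obj A" "Y \<in> Obj A"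
  shows "isomorphic A X Y"
  using assms full reflect_iso B.iso_arr_homs unfolding isomorphic_def by metis

end

context pretriangulated
begin

lemma hom_zero_shift: "hom_zero C X Y \<Longrightarrow> hom_zero C (shO C n X) (shO C n Y)" if "X \<in> Obj C" "Y \<in> Obj C"
  unfolding hom_zero_def
proof
  fix f assume z: "\<forall>f\<in>homs C X Y. f = zeroarr C X Y" and f: "f \<in> homs C (shO C n X) (shO C n Y)"
  then have "shM C (- n) f = zeroarr C X Y" using that by simp
  then have "shM C n (shM C (- n) f) = shM C n (zeroarr C X Y)" by simp
  then show "f = zeroarr C (shO C n X) (shO C n Y)" using f that by simp
qed

lemma ext_hom_zero:
  assumes "ext C A B D"
  shows "hom_zero C A W \<Longrightarrow> hom_zero C D W \<Longrightarrow> hom_zero C B W"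
    and "hom_zero C W A \<Longrightarrow> hom_zero C W D \<Longrightarrow> hom_zero C W B"
  unfolding hom_zero_def using ext_hom_zero_left[OF assms] ext_hom_zero_right[OF assms] by blast+

lemma ext_iso_left:
  assumes "ext C A B D" "isomorphic C A A'" shows "ext C A' B D"
proof -
  have "ext C B D (shO C 1 A')"
    by (rule ext_iso_right[OF ext_rot[OF assms(1)]]) (intro isomorphic_shift assms)
  then show ?thesis using ext_rot_back isomorphic_Obj(2)[OF assms(2)] by fastforce
qed

text \<open>The inclusion of \<open>X\<close> dies in \<open>B\<close>, so it lifts to
  \<open>A\<close>, and the projection restricted to \<open>A\<close> is still a left inverse. In
  this way a retract of a decomposed object becomes a retract of one of the two pieces;
  \<open>retract_colift\<close> is dual.\<close>

lemma retract_lift: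
  assumes t: "dtri C A N B f g h" and i: "i \<in> homs C X N" and r: "r \<in> homs C N X" and ri: "r \<cdot> i = ident C X"
    and z: "hom_zero C X B"
  shows "retract C X A"
proof -
  note ty = dtri_homs[OF t] i r
  have "g \<cdot> i = zeroarr C X B" using z ty unfolding hom_zero_def by auto
  then obtain y where y: "y \<in> homs C X A" "f \<cdot> y = i" using lift2[OF t i] by blast
  show ?thesis by (rule retractI[OF y(1), of "r \<cdot> f"]) (use ty y ri in auto)
qed

lemma retract_colift:
  assumes t: "dtri C A N B f g h" and i: "i \<in> homs C X N" and r: "r \<in> homs C N X" and ri: "r \<cdot> i = ident C X"
    and z: "hom_zero C A X"
  shows "retract C X B"
proof -
  note ty = dtri_homs[OF t] i r
  have "r \<cdot> f = zeroarr C A X" using z ty unfolding hom_zero_def by auto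
  then obtain y where y: "y \<in> homs C B X" "y \<cdot> g = r" using colift2[OF t r] by blast
  show ?thesis
    by (rule retractI[OF _ y(1), of "g \<cdot> i"]) (use ty y(1) in \<open>simp_all add: cmp_ext[OF y(2)] ri\<close>)
qed

end

locale exact_between = A: triangulated_category A + B: triangulated_category B
  for A :: "('o, 'm) tcat" and B :: "('p, 'n) tcat" +
  fixes F :: "('o, 'm, 'p, 'n) func"
  assumes exact: "exact_functor A B F"

sublocale exact_between \<subseteq> add_functor A B F
  using exact unfolding exact_functor_def by unfold_locales blast

context exact_between
begin

lemma exactE:
  obtains \<phi> where "\<And>X. X \<in> Obj A \<Longrightarrow> iso_arr B (fobj F (shO A 1 X)) (shO B 1 (fobj F X)) (\<phi> X)"
    "\<And>X Y f. f \<in> homs A X Y \<Longrightarrow> \<phi> Y \<cdot>\<^bsub>B\<^esub> fmor F (shM A 1 f) = shM B 1 (fmor F f) \<cdot>\<^bsub>B\<^esub> \<phi> X"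
    "\<And>X Y Z f g h. dtri A X Y Z f g h \<Longrightarrow>
      dtri B (fobj F X) (fobj F Y) (fobj F Z) (fmor F f) (fmor F g) (\<phi> X \<cdot>\<^bsub>B\<^esub> fmor F h)"
proof -
  obtain \<phi> where n: "natural_iso A B (comp_func F (shift_func A 1)) (comp_func (shift_func B 1) F) \<phi>"
    and d: "\<forall>(f, g, h) \<in> Dist A. (fmor F f, fmor F g, \<phi> (src A f) \<cdot>\<^bsub>B\<^esub> fmor F h) \<in> Dist B"
    using exact unfolding exact_functor_def by blast
  have i: "iso_arr B (fobj F (shO A 1 X)) (shO B 1 (fobj F X)) (\<phi> X)" if "X \<in> Obj A" for X
    using n that unfolding natural_iso_def comp_func_def shift_func_def by simp
  have nat: "\<phi> Y \<cdot>\<^bsub>B\<^esub> fmor F (shM A 1 f) = shM B 1 (fmor F f) \<cdot>\<^bsub>B\<^esub> \<phi> X" if f: "f \<in> homs A X Y" for X Y f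
  proof -
    have "\<forall>X\<in>Obj A. \<forall>Y\<in>Obj A. \<forall>f\<in>homs A X Y.
        \<phi> Y \<cdot>\<^bsub>B\<^esub> fmor F (shM A 1 f) = shM B 1 (fmor F f) \<cdot>\<^bsub>B\<^esub> \<phi> X"
      using n unfolding natural_iso_def comp_func_def shift_func_def by simp
    then show ?thesis using f A.homs_Obj[OF f] by blast
  qed
  have "dtri B (fobj F X) (fobj F Y) (fobj F Z) (fmor F f) (fmor F g) (\<phi> X \<cdot>\<^bsub>B\<^esub> fmor F h)"
    if t: "dtri A X Y Z f g h" for X Y Z f g h
  proof -
    note ty = A.dtri_homs[OF t] A.dtri_Obj[OF t]
    have "\<phi> (src A f) \<cdot>\<^bsub>B\<^esub> fmor F h = \<phi> X \<cdot>\<^bsub>B\<^esub> fmor F h" using ty by simp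
    then have "(fmor F f, fmor F g, \<phi> X \<cdot>\<^bsub>B\<^esub> fmor F h) \<in> Dist B" using d ty(4) by auto
    then show ?thesis unfolding dtri_def using ty B.iso_arr_homs[OF i[OF ty(5)]] by simp
  qed
  with i nat show thesis by (rule that)
qed

lemma ext: "ext A X Y Z \<Longrightarrow> ext B (fobj F X) (fobj F Y) (fobj F Z)"
  unfolding ext_def by (metis exactE)

text \<open>Exactness provides the isomorphism for \<open>n = 1\<close> only; other translations are
  reached by induction in both directions, the negative ones by translating the isomorphism
  back.\<close>

lemma shift_iso: "X \<in> Obj A \<Longrightarrow> isomorphic B (fobj F (shO A n X)) (shO B n (fobj F X))"
proof (induction n arbitrary: X rule: int_induct[where k = 0])
  case base
  then show ?case using B.isomorphic_refl by simp
next
  case (step1 i)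
  have 1: "isomorphic B (fobj F (shO A 1 (shO A i X))) (shO B 1 (fobj F (shO A i X)))"
    using step1.prems exactE unfolding isomorphic_def by (metis A.shO_Obj)
  have 2: "isomorphic B (shO B 1 (fobj F (shO A i X))) (shO B 1 (shO B i (fobj F X)))"
    by (intro B.isomorphic_shift step1.IH step1.prems)
  show ?case using B.isomorphic_trans[OF 1 2] step1.prems by (simp add: add.commute)
next
  case (step2 i)
  let ?Y = "shO A (i - 1) X"
  have 1: "isomorphic B (fobj F (shO A 1 ?Y)) (shO B 1 (fobj F ?Y))"
    using step2.prems exactE unfolding isomorphic_def by (metis A.shO_Obj)
  have "isomorphic B (shO B (- 1) (fobj F (shO A i X))) (fobj F ?Y)"
    using B.isomorphic_shift[OF 1, of "- 1"] step2.prems by simp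
  moreover have "isomorphic B (shO B (- 1) (fobj F (shO A i X))) (shO B (- 1) (shO B i (fobj F X)))"
    by (intro B.isomorphic_shift step2.IH step2.prems)
  ultimately have "isomorphic B (fobj F ?Y) (shO B (- 1) (shO B i (fobj F X)))"
    using B.isomorphic_sym B.isomorphic_trans by blast
  then show ?case using step2.prems by simp
qed

lemma shift_retract:
  assumes "retract B M (fobj F N)" "N \<in> Obj A"
  shows "retract B (shO B n M) (fobj F (shO A n N))"
  using B.retract_trans[OF B.retract_shift[OF assms(1)] B.isomorphic_retract[OF B.isomorphic_sym[OF shift_iso[OF assms(2)]]]] .

end

locale exact_embedding = exact_between A B F + ff_functor A B F
  for A :: "('o, 'm) tcat" and B :: "('p, 'n) tcat" and F :: "('o, 'm, 'p, 'n) func"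
begin

lemma hom_zero_iff:
  assumes "X \<in> Obj A" "Y \<in> Obj A"
  shows "hom_zero B (fobj F X) (fobj F Y) \<longleftrightarrow> hom_zero A X Y"
proof
  assume z: "hom_zero B (fobj F X) (fobj F Y)"
  show "hom_zero A X Y" unfolding hom_zero_def
  proof
    fix f assume f: "f \<in> homs A X Y"
    then have "fmor F f \<in> homs B (fobj F X) (fobj F Y)" by simp
    then have "fmor F f = fmor F (zeroarr A X Y)"
      using z assms unfolding hom_zero_def by (simp only: fmor_zero)
    then show "f = zeroarr A X Y" by (rule faithful) (use f assms in auto)
  qed
next
  assume "hom_zero A X Y"
  then show "hom_zero B (fobj F X) (fobj F Y)"
    unfolding hom_zero_def using full assms fmor_zero by metis
qed

text \<open>A cone of \<open>f\<close> taken in \<open>A\<close> and the given triangle have images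
  which are cones of the same arrow. The isomorphism between these cones comes from \<open>A\<close>
  by fullness and identifies the two triangles there. The isomorphism \<open>\<phi>\<close> is a
  parameter since the image triangle must use the one under which \<open>F\<close> preserves
  triangles.\<close>

lemma reflect_dtri:
  assumes \<phi>: "iso_arr B (fobj F (shO A 1 X)) (shO B 1 (fobj F X)) \<phi>"
    and pres: "\<And>Z g h. dtri A X Y Z f g h \<Longrightarrow>
      dtri B (fobj F X) (fobj F Y) (fobj F Z) (fmor F f) (fmor F g) (\<phi> \<cdot>\<^bsub>B\<^esub> fmor F h)"
    and t: "dtri B (fobj F X) (fobj F Y) (fobj F Z) (fmor F f) (fmor F g) (\<phi> \<cdot>\<^bsub>B\<^esub> fmor F h)"
    and ty: "f \<in> homs A X Y" "g \<in> homs A Y Z" "h \<in> homs A Z (shO A 1 X)"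
  shows "dtri A X Y Z f g h"
proof -
  obtain Z' g' h' where t': "dtri A X Y Z' f g' h'" using A.cone[OF ty(1)] by blast
  note ty' = A.dtri_homs[OF t'] A.dtri_Obj[OF t'] A.homs_Obj[OF ty(2)] B.iso_arr_homs[OF \<phi>]
  obtain c where c: "iso_arr B (fobj F Z') (fobj F Z) c" "c \<cdot>\<^bsub>B\<^esub> fmor F g' = fmor F g"
    "(\<phi> \<cdot>\<^bsub>B\<^esub> fmor F h) \<cdot>\<^bsub>B\<^esub> c = \<phi> \<cdot>\<^bsub>B\<^esub> fmor F h'"
    using B.cone_unique[OF pres[OF t'] t] by blast
  obtain \<gamma> where \<gamma>: "\<gamma> \<in> homs A Z' Z" "c = fmor F \<gamma>" using full[OF B.iso_arr_homs[OF c(1)]] ty' by blast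
  have \<gamma>i: "iso_arr A Z' Z \<gamma>" using reflect_iso c(1) \<gamma> by blast
  have "fmor F (\<gamma> \<cdot>\<^bsub>A\<^esub> g') = fmor F g" using c(2) \<gamma> ty' by simp
  then have 1: "\<gamma> \<cdot>\<^bsub>A\<^esub> g' = g" by (rule faithful) (use \<gamma> ty ty' in auto)
  obtain \<psi> where \<psi>: "\<psi> \<in> homs B (shO B 1 (fobj F X)) (fobj F (shO A 1 X))"
    "\<psi> \<cdot>\<^bsub>B\<^esub> \<phi> = ident B (fobj F (shO A 1 X))" using \<phi> unfolding iso_arr_def by blast
  have "\<psi> \<cdot>\<^bsub>B\<^esub> ((\<phi> \<cdot>\<^bsub>B\<^esub> fmor F h) \<cdot>\<^bsub>B\<^esub> c) = \<psi> \<cdot>\<^bsub>B\<^esub> (\<phi> \<cdot>\<^bsub>B\<^esub> fmor F h')" by (simp only: c(3))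
  then have "fmor F (h \<cdot>\<^bsub>A\<^esub> \<gamma>) = fmor F h'"
    using \<psi>(1) \<gamma> ty ty' by (simp add: B.cmp_ext[OF \<psi>(2)])
  then have 2: "h \<cdot>\<^bsub>A\<^esub> \<gamma> = h'" by (rule faithful) (use \<gamma> ty ty' in auto)
  show ?thesis
    by (rule A.dtri_iso[OF t' ty A.iso_arr_ident A.iso_arr_ident \<gamma>i]) (use ty ty' \<gamma> 1 2 in auto)
qed

text \<open>For extensions: \<open>L\<close> is the cone of an arrow \<open>M[-1] -> K\<close>
  between objects of the essential image. That arrow comes from \<open>A\<close> by fullness, and
  the image of its cone in \<open>A\<close> is isomorphic to \<open>L\<close>.\<close>

lemma essential_image_strict:
  "strict_triangulated_subclass B {K. \<exists>X \<in> Obj A. isomorphic B (fobj F X) K}"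
proof (rule B.strict_subclassI)
  show "{K. \<exists>X \<in> Obj A. isomorphic B (fobj F X) K} \<subseteq> Obj B" using B.isomorphic_Obj(2) by blast
  show "Z \<in> {K. \<exists>X \<in> Obj A. isomorphic B (fobj F X) K}" if Z: "zero_object B Z" for Z
  proof -
    obtain O' where O': "zero_object A O'" using A.zero_object_exists by blast
    then have "isomorphic B (fobj F O') Z"
      using B.zero_object_iso[OF zero_object[OF O'] Z] unfolding isomorphic_def by blast
    then show ?thesis using A.zero_object_Obj[OF O'] by blast
  qed
  show "Y \<in> {K. \<exists>X \<in> Obj A. isomorphic B (fobj F X) K}"
    if "X \<in> {K. \<exists>X \<in> Obj A. isomorphic B (fobj F X) K}" "isomorphic B X Y" for X Y
    using that B.isomorphic_trans by blast
  show "shO B n X \<in> {K. \<exists>X \<in> Obj A. isomorphic B (fobj F X) K}"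
    if X: "X \<in> {K. \<exists>X \<in> Obj A. isomorphic B (fobj F X) K}" for X n
  proof -
    obtain U where U: "U \<in> Obj A" "isomorphic B (fobj F U) X" using X by blast
    have "isomorphic B (fobj F (shO A n U)) (shO B n X)"
      by (rule B.isomorphic_trans[OF shift_iso[OF U(1)] B.isomorphic_shift[OF U(2)]])
    then show ?thesis using U(1) A.shO_Obj by blast
  qed
  fix K L M assume e: "ext B K L M" and K: "K \<in> {K. \<exists>X \<in> Obj A. isomorphic B (fobj F X) K}"
    and M: "M \<in> {K. \<exists>X \<in> Obj A. isomorphic B (fobj F X) K}"
  obtain U where U: "U \<in> Obj A" "isomorphic B (fobj F U) K" using K by blast
  obtain V where V: "V \<in> Obj A" "isomorphic B (fobj F V) M" using M by blast
  let ?V = "shO A (- 1) V"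
  have "isomorphic B (shO B (- 1) M) (fobj F ?V)"
    using B.isomorphic_trans[OF shift_iso[OF V(1)] B.isomorphic_shift[OF V(2)]] B.isomorphic_sym by blast
  then have "ext B (fobj F ?V) (fobj F U) L"
    by (rule B.ext_iso_mid[OF B.ext_iso_left[OF B.ext_rot_back[OF e]] B.isomorphic_sym[OF U(2)]])
  then obtain f g h where t: "dtri B (fobj F ?V) (fobj F U) L f g h" unfolding ext_def by blast
  obtain \<alpha> where \<alpha>: "\<alpha> \<in> homs A ?V U" "f = fmor F \<alpha>"
    using full[OF B.dtri_homs(1)[OF t]] U(1) V(1) by (metis A.shO_Obj)
  obtain Z b c where z: "dtri A ?V U Z \<alpha> b c" using A.cone[OF \<alpha>(1)] by blast
  obtain g' h' where "dtri B (fobj F ?V) (fobj F U) (fobj F Z) f g' h'"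
    using exactE z \<alpha>(2) by metis
  then have "isomorphic B (fobj F Z) L" using B.cone_unique[OF _ t] unfolding isomorphic_def by metis
  then show "L \<in> {K. \<exists>X \<in> Obj A. isomorphic B (fobj F X) K}" using A.dtri_Obj(3)[OF z] by blast
qed

end

lemma exact_embeddingI:
  assumes "triangulated_category A" "triangulated_category B" "exact_functor A B F" "fully_faithful A B F"
  shows "exact_embedding A B F"
proof -
  interpret A: triangulated_category A by (rule assms)
  interpret B: triangulated_category B by (rule assms)
  interpret exact_between A B F by unfold_locales (rule assms)
  show ?thesis by unfold_locales (rule assms)
qed

text \<open>The consequence of being an idempotent extension on which the study of extended weights
  rests; the comparison functor itself returns only in \<open>kar_comparison\<close>.\<close>

locale idempotent_embedding = exact_embedding +
  assumes retract_of_image: "M \<in> Obj B \<Longrightarrow> \<exists>N \<in> Obj A. retract B M (fobj F N)"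

text \<open>The object \<open>G M\<close> is some pair \<open>(N, p)\<close>, a retract of the image
  of \<open>N\<close> in the completion. That image is isomorphic to \<open>G (J N)\<close>, and a
  fully faithful \<open>G\<close> reflects retracts.\<close>

lemma idempotent_extension_embedding:
  assumes "idempotent_extension C C' J"
  shows "idempotent_embedding C C' J"
proof -
  interpret C: triangulated_category C using assms unfolding idempotent_extension_def by blast
  interpret C': triangulated_category C' using assms unfolding idempotent_extension_def by blast
  interpret K: triangulated_category "tri_kar C" by (rule C.tri_kar_triangulated)
  interpret J: exact_embedding C C' J
    by (rule exact_embeddingI) (use assms in \<open>simp_all add: idempotent_extension_def\<close>)
  obtain G where G: "exact_functor C' (tri_kar C) G" "fully_faithful C' (tri_kar C) G"
    "naturally_isomorphic C (tri_kar C) (comp_func G J) (kar_emb C)"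
    using assms unfolding idempotent_extension_def by blast
  interpret G: exact_embedding C' "tri_kar C" G
    by (rule exact_embeddingI[OF C'.triangulated_category_axioms K.triangulated_category_axioms G(1,2)])
  have GJ: "isomorphic (tri_kar C) (fobj G (fobj J N)) (N, ident C N)" if "N \<in> Obj C" for N
  proof -
    obtain \<eta> where "natural_iso C (tri_kar C) (comp_func G J) (kar_emb C) \<eta>"
      using G(3) unfolding naturally_isomorphic_def by blast
    then have "iso_arr (tri_kar C) (fobj G (fobj J N)) (N, ident C N) (\<eta> N)"
      using that unfolding natural_iso_def comp_func_def by simp
    then show ?thesis unfolding isomorphic_def by blast
  qed
  show ?thesis
  proof unfold_locales
    fix M assume M: "M \<in> Obj C'"
    obtain N p where Np: "fobj G M = (N, p)" by (metis prod.exhaust)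
    have o: "(N, p) \<in> Obj (kar C)" using G.fobj_Obj[OF M] Np by simp
    then have N: "N \<in> Obj C" by auto
    have "retract (tri_kar C) (N, p) (N, ident C N)"
      by (rule K.retractI[of "((N, p), p, (N, ident C N))" _ _ "((N, ident C N), p, (N, p))"]) (use o in auto)
    then have "retract (tri_kar C) (fobj G M) (fobj G (fobj J N))"
      unfolding Np using K.retract_trans K.isomorphic_retract K.isomorphic_sym GJ[OF N] by blast
    then have "retract C' M (fobj J N)" using G.reflect_retract M N by simp
    then show "\<exists>N\<in>Obj C. retract C' M (fobj J N)" using N by blast
  qed
qed

section \<open>Extending weight structures\<close>

locale weighted_category = triangulated_category C for C :: "('o, 'm) tcat" (structure) +
  fixes w :: "'o weight"
  assumes weight: "weight_structure C w"
begin

lemma wle_Obj: "X \<in> wle0 w \<Longrightarrow> X \<in> Obj C"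
  and wge_Obj: "X \<in> wge0 w \<Longrightarrow> X \<in> Obj C"
  using weight unfolding weight_structure_def by auto

lemma wle_retract: "X \<in> wle0 w \<Longrightarrow> retract C X' X \<Longrightarrow> X' \<in> wle0 w"
  and wge_retract: "X \<in> wge0 w \<Longrightarrow> retract C X' X \<Longrightarrow> X' \<in> wge0 w"
proof -
  have "retraction_closed C (wle0 w)" "retraction_closed C (wge0 w)"
    using weight unfolding weight_structure_def by auto
  then show "X \<in> wle0 w \<Longrightarrow> retract C X' X \<Longrightarrow> X' \<in> wle0 w" "X \<in> wge0 w \<Longrightarrow> retract C X' X \<Longrightarrow> X' \<in> wge0 w"
    using retract_Obj(1) unfolding retraction_closed_def by blast+
qed

lemma wle_shift:
  assumes "X \<in> wle0 w" "n \<le> 0" shows "shO C n X \<in> wle0 w"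
  using assms(2)
proof (induction n rule: int_le_induct)
  case base
  then show ?case using assms(1) wle_Obj by simp
next
  case (step i)
  then obtain Y where Y: "Y \<in> wle0 w" "shO C i X = shO C 1 Y"
    using weight unfolding weight_structure_def by blast
  then have "shO C (- 1) (shO C i X) = shO C (- 1) (shO C 1 Y)" by simp
  then have "shO C (i - 1) X = Y" using Y(1) wle_Obj assms(1) by simp
  then show ?case using Y(1) by simp
qed

lemma wge_shift:
  assumes "X \<in> wge0 w" "0 \<le> n" shows "shO C n X \<in> wge0 w"
  using assms(2)
proof (induction n rule: int_ge_induct)
  case base
  then show ?case using assms(1) wge_Obj by simp
next
  case (step i)
  then have "shO C 1 (shO C i X) \<in> wge0 w" using weight unfolding weight_structure_def by blast
  then show ?case using assms(1) wge_Obj by (simp add: add.commute)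
qed

lemma weight_orthogonal: "X \<in> wle0 w \<Longrightarrow> Y \<in> wge0 w \<Longrightarrow> hom_zero C X (shO C 1 Y)"
  using weight unfolding weight_structure_def orthogonal_def hom_zero_def by blast

lemma weight_decomposition:
  assumes "M \<in> Obj C"
  obtains X Y where "X \<in> wle0 w" "Y \<in> wge0 w" "ext C X M (shO C 1 Y)"
proof -
  have "\<forall>M \<in> Obj C. \<exists>(f, g, h) \<in> Dist C.
        tgt C f = M \<and> src C f \<in> wle0 w \<and> tgt C g \<in> shO C 1 ` wge0 w"
    using weight unfolding weight_structure_def by blast
  then obtain f g h where t: "(f, g, h) \<in> Dist C" "tgt C f = M" "src C f \<in> wle0 w" "tgt C g \<in> shO C 1 ` wge0 w"
    using assms by blast
  obtain Y where Y: "Y \<in> wge0 w" "tgt C g = shO C 1 Y" using t(4) by blast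
  show thesis by (rule that[OF t(3) Y(1)]) (use extI[OF dist_dtri[OF t(1)]] t(2) Y(2) in simp)
qed

text \<open>If \<open>X\<close> is orthogonal to all of \<open>wge0 w\<close> translated by 1, then
  the second arrow in a weight decomposition of \<open>X\<close> is zero, and \<open>X\<close> is a
  retract of the first term. So each class determines the other one, and closure under extensions
  becomes a statement about vanishing of arrows.\<close>

lemma wle_iff: "X \<in> wle0 w \<longleftrightarrow> X \<in> Obj C \<and> (\<forall>Y \<in> wge0 w. hom_zero C X (shO C 1 Y))"
proof
  assume X: "X \<in> Obj C \<and> (\<forall>Y \<in> wge0 w. hom_zero C X (shO C 1 Y))"
  then obtain A B where AB: "A \<in> wle0 w" "B \<in> wge0 w" "ext C A X (shO C 1 B)"
    using weight_decomposition by blast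
  then obtain f g h where t: "dtri C A X (shO C 1 B) f g h" unfolding ext_def by blast
  have "retract C X A"
    by (rule retract_lift[OF t, of "ident C X" _ "ident C X"]) (use X AB(2) in auto)
  then show "X \<in> wle0 w" using AB(1) wle_retract by blast
qed (use weight_orthogonal wle_Obj in blast)

lemma wge_iff: "Y \<in> wge0 w \<longleftrightarrow> Y \<in> Obj C \<and> (\<forall>X \<in> wle0 w. hom_zero C X (shO C 1 Y))"
proof
  assume Y: "Y \<in> Obj C \<and> (\<forall>X \<in> wle0 w. hom_zero C X (shO C 1 Y))"
  then obtain A B where AB: "A \<in> wle0 w" "B \<in> wge0 w" "ext C A (shO C 1 Y) (shO C 1 B)"
    using weight_decomposition by (metis shO_Obj)
  then obtain f g h where t: "dtri C A (shO C 1 Y) (shO C 1 B) f g h" unfolding ext_def by blast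
  have "retract C (shO C 1 Y) (shO C 1 B)"
    by (rule retract_colift[OF t, of "ident C (shO C 1 Y)" _ "ident C (shO C 1 Y)"]) (use Y AB(1) in auto)
  from retract_shift[OF this, of "- 1"] have "retract C Y B" using Y AB(2) wge_Obj by simp
  then show "Y \<in> wge0 w" using AB(2) wge_retract by blast
qed (use weight_orthogonal wge_Obj in blast)

lemma wle_ext: "ext C A B D \<Longrightarrow> A \<in> wle0 w \<Longrightarrow> D \<in> wle0 w \<Longrightarrow> B \<in> wle0 w"
  unfolding wle_iff[of B] using ext_Obj(2) ext_hom_zero(1) weight_orthogonal by blast

lemma wge_ext: "ext C A B D \<Longrightarrow> A \<in> wge0 w \<Longrightarrow> D \<in> wge0 w \<Longrightarrow> B \<in> wge0 w"
  unfolding wge_iff[of B] using ext_Obj(2) ext_hom_zero(2)[OF ext_shift] weight_orthogonal by blast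

lemma zero_in_weights:
  assumes "zero_object C Z" shows "Z \<in> wle0 w" "Z \<in> wge0 w"
  unfolding wle_iff wge_iff hom_zero_def
  using zero_object_hom(1)[OF assms] zero_object_hom(2)[OF zero_object_shift[OF assms]] zero_object_Obj[OF assms]
  by blast+

text \<open>Decomposing \<open>N[1]\<close> instead of \<open>N\<close> leaves a second term
  \<open>B\<close> of weight at least 0. It is also an extension of \<open>A\<close> by
  \<open>N\<close>, both of weight at most 0, and therefore lies in the heart.\<close>

lemma weq_decomposition:
  assumes "N \<in> wle0 w"
  obtains A B where "A \<in> wle0 w" "B \<in> weq0 w" "ext C (shO C (- 1) A) N B"
proof -
  note N = wle_Obj[OF assms]
  obtain A B where AB: "A \<in> wle0 w" "B \<in> wge0 w" "ext C A (shO C 1 N) (shO C 1 B)"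
    using weight_decomposition[of "shO C 1 N"] N by auto
  have e: "ext C (shO C (- 1) A) N B"
    using ext_shift[OF AB(3), of "- 1"] N wge_Obj[OF AB(2)] by simp
  have "ext C N B A" using ext_rot[OF e] wle_Obj[OF AB(1)] by simp
  then have "B \<in> wle0 w" using wle_ext assms AB(1) by blast
  then show thesis using that AB e unfolding weq0_def by blast
qed

lemma Obj_cat_plus: "Obj (cat_plus C w) = {X \<in> Obj C. \<exists>i. shO C i X \<in> wge0 w}"
proof -
  have "X \<in> (\<Union>i. wge C w i) \<longleftrightarrow> X \<in> Obj C \<and> (\<exists>i. shO C i X \<in> wge0 w)" for X
  proof
    assume "X \<in> (\<Union>i. wge C w i)"
    then obtain i Y where Y: "Y \<in> wge0 w" "X = shO C i Y" unfolding wge_def by blast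
    then have "shO C (- i) X = Y" using wge_Obj by simp
    then show "X \<in> Obj C \<and> (\<exists>i. shO C i X \<in> wge0 w)" using Y wge_Obj by (metis shO_Obj)
  next
    assume "X \<in> Obj C \<and> (\<exists>i. shO C i X \<in> wge0 w)"
    then obtain i where i: "X \<in> Obj C" "shO C i X \<in> wge0 w" by blast
    then have "X = shO C (- i) (shO C i X)" by simp
    then show "X \<in> (\<Union>i. wge C w i)" using i(2) unfolding wge_def by blast
  qed
  then show ?thesis by (simp add: cat_plus_def tri_sub_def Let_def set_eq_iff)
qed

lemma Obj_cat_minus: "Obj (cat_minus C w) = {X \<in> Obj C. \<exists>i. shO C i X \<in> wle0 w}"
proof -
  have "X \<in> (\<Union>i. wle C w i) \<longleftrightarrow> X \<in> Obj C \<and> (\<exists>i. shO C i X \<in> wle0 w)" for X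
  proof
    assume "X \<in> (\<Union>i. wle C w i)"
    then obtain i Y where Y: "Y \<in> wle0 w" "X = shO C i Y" unfolding wle_def by blast
    then have "shO C (- i) X = Y" using wle_Obj by simp
    then show "X \<in> Obj C \<and> (\<exists>i. shO C i X \<in> wle0 w)" using Y wle_Obj by (metis shO_Obj)
  next
    assume "X \<in> Obj C \<and> (\<exists>i. shO C i X \<in> wle0 w)"
    then obtain i where i: "X \<in> Obj C" "shO C i X \<in> wle0 w" by blast
    then have "X = shO C (- i) (shO C i X)" by simp
    then show "X \<in> (\<Union>i. wle C w i)" using i(2) unfolding wle_def by blast
  qed
  then show ?thesis by (simp add: cat_minus_def tri_sub_def Let_def set_eq_iff)
qed

lemma bounded_below_iff: "bounded_below C w \<longleftrightarrow> (\<forall>X \<in> Obj C. \<exists>i. shO C i X \<in> wge0 w)"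
  unfolding bounded_below_def Obj_cat_plus by blast

lemma bounded_above_iff: "bounded_above C w \<longleftrightarrow> (\<forall>X \<in> Obj C. \<exists>i. shO C i X \<in> wle0 w)"
  unfolding bounded_above_def Obj_cat_minus by blast

end

section \<open>Weight classes in an idempotent extension\<close>

locale weighted_embedding = idempotent_embedding A B F + W: weighted_category A w
  for A :: "('o, 'm) tcat" and B :: "('p, 'n) tcat" and F :: "('o, 'm, 'p, 'n) func"
    and w :: "'o weight"
begin

definition lower where "lower = {X. \<exists>Y \<in> wle0 w. retract B X (fobj F Y)}"
definition upper where "upper = {X. \<exists>Y \<in> wge0 w. retract B X (fobj F Y)}"

lemma lower_iff: "X \<in> lower \<longleftrightarrow> (\<exists>Y \<in> wle0 w. retract B X (fobj F Y))"
  and upper_iff: "X \<in> upper \<longleftrightarrow> (\<exists>Y \<in> wge0 w. retract B X (fobj F Y))"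
  by (simp_all add: lower_def upper_def)

lemma lower_Obj: "X \<in> lower \<Longrightarrow> X \<in> Obj B" and upper_Obj: "X \<in> upper \<Longrightarrow> X \<in> Obj B"
  unfolding lower_iff upper_iff using B.retract_Obj(1) by blast+

lemma image_lower: "X \<in> wle0 w \<Longrightarrow> fobj F X \<in> lower" and image_upper: "X \<in> wge0 w \<Longrightarrow> fobj F X \<in> upper"
  unfolding lower_iff upper_iff using B.retract_refl W.wle_Obj W.wge_Obj fobj_Obj by blast+

lemma lower_retract: "X \<in> lower \<Longrightarrow> retract B X' X \<Longrightarrow> X' \<in> lower"
  and upper_retract: "X \<in> upper \<Longrightarrow> retract B X' X \<Longrightarrow> X' \<in> upper"
  unfolding lower_iff upper_iff using B.retract_trans by blast+

lemma lower_shift: "X \<in> lower \<Longrightarrow> n \<le> 0 \<Longrightarrow> shO B n X \<in> lower"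
  and upper_shift: "X \<in> upper \<Longrightarrow> 0 \<le> n \<Longrightarrow> shO B n X \<in> upper"
  unfolding lower_iff upper_iff using shift_retract W.wle_shift W.wge_shift W.wle_Obj W.wge_Obj by blast+

lemma hom_zero_image:
  assumes "X \<in> wle0 w" "Y \<in> wge0 w"
  shows "hom_zero B (fobj F X) (shO B 1 (fobj F Y))"
proof -
  note XY = W.wle_Obj[OF assms(1)] W.wge_Obj[OF assms(2)]
  have "hom_zero B (fobj F X) (fobj F (shO A 1 Y))"
    using W.weight_orthogonal[OF assms] hom_zero_iff XY by simp
  then show ?thesis
    by (rule B.hom_zero_retract)
      (use XY shift_iso B.retract_refl B.isomorphic_retract B.isomorphic_sym in auto)
qed

lemma lower_upper_orthogonal:
  assumes "X \<in> lower" "Y \<in> upper" shows "hom_zero B X (shO B 1 Y)"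
proof -
  obtain U V where "U \<in> wle0 w" "V \<in> wge0 w" "retract B X (fobj F U)" "retract B Y (fobj F V)"
    using assms unfolding lower_iff upper_iff by blast
  then show ?thesis using B.hom_zero_retract[OF hom_zero_image _ B.retract_shift] by blast
qed

lemma image_decomposition:
  assumes "N \<in> Obj A"
  obtains X Y where "X \<in> wle0 w" "Y \<in> wge0 w" "ext B (fobj F X) (fobj F N) (shO B 1 (fobj F Y))"
proof -
  obtain X Y where "X \<in> wle0 w" "Y \<in> wge0 w" "ext A X N (shO A 1 Y)"
    using W.weight_decomposition[OF assms] by blast
  then show thesis using that B.ext_iso_right[OF ext shift_iso[of _ 1]] W.wge_Obj by blast
qed

text \<open>The decomposition is taken in \<open>A\<close>, for an object of whose image
  \<open>X\<close> is a retract; hence the orthogonality characterisation holds in \<open>B\<close>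
  before any weight structure on \<open>B\<close> is known.\<close>

lemma lowerI:
  assumes "X \<in> Obj B" "\<And>Y. Y \<in> wge0 w \<Longrightarrow> hom_zero B X (shO B 1 (fobj F Y))"
  shows "X \<in> lower"
proof -
  obtain N where N: "N \<in> Obj A" "retract B X (fobj F N)" using retract_of_image assms(1) by blast
  obtain i r where ir: "i \<in> homs B X (fobj F N)" "r \<in> homs B (fobj F N) X" "r \<cdot>\<^bsub>B\<^esub> i = ident B X"
    using N(2) by (rule B.retractE)
  obtain U V where UV: "U \<in> wle0 w" "V \<in> wge0 w" "ext B (fobj F U) (fobj F N) (shO B 1 (fobj F V))"
    using image_decomposition[OF N(1)] by blast
  then obtain f g h where "dtri B (fobj F U) (fobj F N) (shO B 1 (fobj F V)) f g h" unfolding ext_def by blast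
  then have "retract B X (fobj F U)" using B.retract_lift[OF _ ir] assms(2) UV(2) by blast
  then show ?thesis using UV(1) unfolding lower_iff by blast
qed

lemma upperI:
  assumes "Y \<in> Obj B" "\<And>X. X \<in> wle0 w \<Longrightarrow> hom_zero B (fobj F X) (shO B 1 Y)"
  shows "Y \<in> upper"
proof -
  obtain N where N: "N \<in> Obj A" "retract B Y (fobj F N)" using retract_of_image assms(1) by blast
  have "retract B (shO B 1 Y) (fobj F (shO A 1 N))" by (rule shift_retract[OF N(2,1)])
  then obtain i r where ir: "i \<in> homs B (shO B 1 Y) (fobj F (shO A 1 N))"
    "r \<in> homs B (fobj F (shO A 1 N)) (shO B 1 Y)" "r \<cdot>\<^bsub>B\<^esub> i = ident B (shO B 1 Y)"
    by (rule B.retractE)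
  obtain U V where UV: "U \<in> wle0 w" "V \<in> wge0 w"
    "ext B (fobj F U) (fobj F (shO A 1 N)) (shO B 1 (fobj F V))"
    using image_decomposition[of "shO A 1 N"] N(1) by auto
  then obtain f g h where "dtri B (fobj F U) (fobj F (shO A 1 N)) (shO B 1 (fobj F V)) f g h"
    unfolding ext_def by blast
  then have "retract B (shO B 1 Y) (shO B 1 (fobj F V))" using B.retract_colift[OF _ ir] assms(2) UV(1) by blast
  from B.retract_shift[OF this, of "- 1"] have "retract B Y (fobj F V)"
    using assms(1) W.wge_Obj[OF UV(2)] by simp
  then show ?thesis using UV(2) unfolding upper_iff by blast
qed

lemma lower_ext:
  assumes "ext B X Y Z" "X \<in> lower" "Z \<in> lower" shows "Y \<in> lower"
  using B.ext_Obj(2)[OF assms(1)] B.ext_hom_zero(1)[OF assms(1)] lower_upper_orthogonal assms(2,3) image_upper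
  by (intro lowerI) blast+

lemma upper_ext:
  assumes "ext B X Y Z" "X \<in> upper" "Z \<in> upper" shows "Y \<in> upper"
  using B.ext_Obj(2)[OF assms(1)] B.ext_hom_zero(2)[OF B.ext_shift[OF assms(1)]] lower_upper_orthogonal
    assms(2,3) image_lower
  by (intro upperI) blast+

text \<open>Objects of \<open>wle0 w'\<close> are orthogonal to translated images of
  \<open>wge0 w\<close>, because these images have weights at least 0 for \<open>w'\<close>; so
  \<open>lowerI\<close> applies, and dually \<open>upperI\<close>. The reverse inclusions use that
  the classes of \<open>w'\<close> are closed under retracts.\<close>

lemma extension_weights:
  assumes "weight_extension A w B w' F"
  shows "wle0 w' = lower" "wge0 w' = upper" "weq0 w' = {X. \<exists>Y \<in> weq0 w. retract B X (fobj F Y)}"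
proof -
  interpret W': weighted_category B w'
    by unfold_locales (use assms in \<open>simp add: weight_extension_def\<close>)
  have im: "fobj F X \<in> wle0 w'" if "X \<in> wle0 w" for X
    using assms that unfolding weight_extension_def weight_exact_def by blast
  have im': "fobj F X \<in> wge0 w'" if "X \<in> wge0 w" for X
    using assms that unfolding weight_extension_def weight_exact_def by blast
  show 1: "wle0 w' = lower"
  proof
    show "wle0 w' \<subseteq> lower" using lowerI W'.wle_Obj W'.weight_orthogonal im' by blast
    show "lower \<subseteq> wle0 w'" using W'.wle_retract im unfolding lower_def by blast
  qed
  show 2: "wge0 w' = upper"
  proof
    show "wge0 w' \<subseteq> upper" using upperI W'.wge_Obj W'.weight_orthogonal im by blast
    show "upper \<subseteq> wge0 w'" using W'.wge_retract im' unfolding upper_def by blast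
  qed
  show "weq0 w' = {X. \<exists>Y \<in> weq0 w. retract B X (fobj F Y)}"
  proof
    show "{X. \<exists>Y \<in> weq0 w. retract B X (fobj F Y)} \<subseteq> weq0 w'"
      unfolding weq0_def 1 2 lower_def upper_def by blast
    show "weq0 w' \<subseteq> {X. \<exists>Y \<in> weq0 w. retract B X (fobj F Y)}"
    proof
      fix M assume "M \<in> weq0 w'"
      then have M: "M \<in> lower" "M \<in> upper" unfolding weq0_def 1 2 by blast+
      obtain N where N: "N \<in> wle0 w" "retract B M (fobj F N)" using M(1) unfolding lower_iff by blast
      obtain i r where ir: "i \<in> homs B M (fobj F N)" "r \<in> homs B (fobj F N) M" "r \<cdot>\<^bsub>B\<^esub> i = ident B M"
        using N(2) by (rule B.retractE)
      \<comment> \<open>Knowing \<open>M\<close> as a retract of \<open>N\<close>, the lower part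
        \<open>U[-1]\<close> of \<open>N\<close> is split off. Since \<open>M\<close> is in
        \<open>upper\<close>, there are no arrows from the image of \<open>U[-1]\<close> to
        \<open>M\<close>, so the projection onto \<open>M\<close> factors over the image of the
        heart object \<open>V\<close>.\<close>
      obtain U V where UV: "U \<in> wle0 w" "V \<in> weq0 w" "ext A (shO A (- 1) U) N V"
        using W.weq_decomposition[OF N(1)] by blast
      note U = W.wle_Obj[OF UV(1)]
      obtain f g h where t: "dtri B (fobj F (shO A (- 1) U)) (fobj F N) (fobj F V) f g h"
        using ext[OF UV(3)] unfolding ext_def by blast
      have "hom_zero B (shO B (- 1) (fobj F U)) (shO B (- 1) (shO B 1 M))"
        by (rule B.hom_zero_shift)
          (use lower_upper_orthogonal[OF image_lower[OF UV(1)] M(2)] U upper_Obj[OF M(2)] in auto)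
      then have "hom_zero B (shO B (- 1) (fobj F U)) M" using upper_Obj[OF M(2)] by simp
      then have "hom_zero B (fobj F (shO A (- 1) U)) M"
        by (rule B.hom_zero_retract)
          (use shift_iso[OF U] B.isomorphic_retract B.retract_refl[OF upper_Obj[OF M(2)]] in auto)
      then have "retract B M (fobj F V)" using B.retract_colift[OF t ir] by blast
      then show "M \<in> {X. \<exists>Y \<in> weq0 w. retract B X (fobj F Y)}" using UV(2) by blast
    qed
  qed
qed

text \<open>The decomposition is asked for with respect to \<open>lower\<close> and
  \<open>upper\<close>, which are available whether or not they form a weight structure.\<close>

definition decomposable :: "'p set" where
  "decomposable = {M. \<exists>X \<in> lower. \<exists>Y \<in> shO B 1 ` upper. ext B X M Y}"

lemma decomposable_closed:
  assumes "ext B M1 M M2" "M1 \<in> decomposable" "M2 \<in> decomposable"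
  shows "M \<in> decomposable"
proof -
  have Q: "D \<in> shO B 1 ` upper"
    if X: "X \<in> shO B 1 ` upper" "Y \<in> shO B 1 ` upper" "ext B X D Y" for X D Y
  proof -
    obtain X' Y' where XY: "X' \<in> upper" "X = shO B 1 X'" "Y' \<in> upper" "Y = shO B 1 Y'" using X(1,2) by blast
    note o = upper_Obj[OF XY(1)] upper_Obj[OF XY(3)] B.ext_Obj(2)[OF X(3)]
    have "ext B X' (shO B (- 1) D) Y'" using B.ext_shift[OF X(3), of "- 1"] o unfolding XY by simp
    then have "shO B (- 1) D \<in> upper" using upper_ext XY by blast
    moreover have "D = shO B 1 (shO B (- 1) D)" using o by simp
    ultimately show ?thesis by blast
  qed
  have "\<exists>X\<in>lower. \<exists>Y\<in>shO B 1 ` upper. ext B X M Y"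
  proof (rule B.decomposable_ext[of lower "shO B 1 ` upper", OF _ _ _ assms(1)])
    \<comment> \<open>Here \<open>Y\<close> lies in \<open>upper\<close> translated by 1, so the
      target is \<open>upper\<close> translated by 2; orthogonality still applies because
      \<open>upper\<close> is stable under positive translations.\<close>
    show "f = zeroarr B X (shO B 1 Y)"
      if f: "X \<in> lower" "Y \<in> shO B 1 ` upper" "f \<in> homs B X (shO B 1 Y)" for X Y f
    proof -
      have "Y \<in> upper" using f(2) upper_shift[of _ 1] by auto
      then show ?thesis using lower_upper_orthogonal f(1,3) unfolding hom_zero_def by blast
    qed
    show "Y \<in> lower" if "X \<in> lower" "Z \<in> lower" "ext B X Y Z" for X Y Z
      by (rule lower_ext[OF that(3,1,2)])
    show "Y \<in> shO B 1 ` upper" if "X \<in> shO B 1 ` upper" "Z \<in> shO B 1 ` upper" "ext B X Y Z" for X Y Z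
      by (rule Q[OF that])
  qed (use assms(2,3) in \<open>simp_all only: decomposable_def mem_Collect_eq\<close>)
  then show ?thesis unfolding decomposable_def by (rule CollectI)
qed

lemma image_decomposable:
  assumes "N \<in> Obj A" shows "fobj F N \<in> decomposable"
proof -
  obtain X Y where XY: "X \<in> wle0 w" "Y \<in> wge0 w" "ext B (fobj F X) (fobj F N) (shO B 1 (fobj F Y))"
    using image_decomposition[OF assms] by blast
  show ?thesis unfolding decomposable_def
    using XY(3) image_lower[OF XY(1)] image_upper[OF XY(2)] by blast
qed

lemma decomposable_iso: "M \<in> decomposable \<Longrightarrow> isomorphic B M M' \<Longrightarrow> M' \<in> decomposable"
  unfolding decomposable_def using B.ext_iso_mid by blast

lemma image_shift_decomposable:
  "N \<in> Obj A \<Longrightarrow> shO B n (fobj F N) \<in> decomposable"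
  using decomposable_iso[OF image_decomposable shift_iso] by simp

lemma lower_decomposable:
  assumes "M \<in> lower" shows "M \<in> decomposable"
proof -
  obtain Z where Z: "zero_object A Z" using A.zero_object_exists by blast
  then have "fobj F Z \<in> upper" "zero_object B (fobj F Z)"
    using image_upper W.zero_in_weights(2) zero_object by blast+
  then show ?thesis unfolding decomposable_def
    using B.ext_zero_right[OF lower_Obj[OF assms] B.zero_object_shift] assms by blast
qed

lemma upper_decomposable:
  assumes "shO B (- 1) M \<in> upper" "M \<in> Obj B" shows "M \<in> decomposable"
proof -
  obtain Z where Z: "zero_object A Z" using A.zero_object_exists by blast
  then have Z': "fobj F Z \<in> lower" "zero_object B (fobj F Z)"
    using image_lower W.zero_in_weights(1) zero_object by blast+
  have "M = shO B 1 (shO B (- 1) M)" using assms(2) by simp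
  then have "M \<in> shO B 1 ` upper" using assms(1) by blast
  then show ?thesis unfolding decomposable_def using B.ext_zero_left[OF assms(2) Z'(2)] Z'(1) by blast
qed

text \<open>By fullness the idempotent \<open>i \<cdot> r\<close> of the image of \<open>N\<close>
  comes from \<open>A\<close>. The complementary idempotent then has a cone \<open>Q\<close> in
  \<open>A\<close>, even if \<open>M\<close> itself is not isomorphic to an image of an object of
  \<open>A\<close>.\<close>

lemma retract_of_image_ext:
  assumes "retract B M (fobj F N)" "N \<in> Obj A"
  obtains Q where "Q \<in> Obj A" "ext B (fobj F Q) M (shO B 2 M)" "ext B (shO B (- 2) M) M (shO B (- 1) (fobj F Q))"
proof -
  obtain i r where ir: "i \<in> homs B M (fobj F N)" "r \<in> homs B (fobj F N) M" "r \<cdot>\<^bsub>B\<^esub> i = ident B M"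
    using assms(1) by (rule B.retractE)
  obtain e where e: "e \<in> homs A N N" "i \<cdot>\<^bsub>B\<^esub> r = fmor F e"
    using full[of "i \<cdot>\<^bsub>B\<^esub> r" N N] ir assms(2) by auto
  let ?e = "addarr A (ident A N) (negarr A e)"
  have "?e \<in> homs A N N" using e(1) assms(2) by simp
  then obtain Q a b where t: "dtri A N N Q ?e a b" using A.cone by blast
  have e': "fmor F ?e = addarr B (ident B (fobj F N)) (negarr B (i \<cdot>\<^bsub>B\<^esub> r))" using e assms(2) by simp
  obtain a' b' where t': "dtri B (fobj F N) (fobj F N) (fobj F Q) (fmor F ?e) a' b'"
    using exactE t by metis
  show thesis
    by (rule that[OF A.dtri_Obj(3)[OF t] B.retract_ext_of_cone[OF ir t'[unfolded e']]])
qed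

text \<open>
  By \<open>retract_of_image_ext\<close>, \<open>M\<close> is an extension of \<open>M[2]\<close> by the image of an object of \<open>A\<close>.
  Iterating this, it suffices to consider \<open>M[2k]\<close>, which is so far to the right for large \<open>k\<close>
  that it is its own weight decomposition. The other case is dual.
\<close>

lemma retract_of_upper_decomposable:
  assumes "shO A i N \<in> wge0 w" "N \<in> Obj A" "retract B M (fobj F N)"
  shows "M \<in> decomposable"
  using assms
\<comment> \<open>Replacing \<open>N\<close> by \<open>N[2]\<close> lowers \<open>i\<close> by 2.
  The induction stops at \<open>i \<le> -1\<close> rather than at 0, because the upper term of a
  decomposition lies in \<open>upper\<close> translated by 1.\<close>
proof (induction "nat (i + 1)" arbitrary: i N M rule: less_induct)
  case less
  show ?case
  proof (cases "i \<le> - 1")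
    case True
    have "shO A (- 1 - i) (shO A i N) \<in> wge0 w" using W.wge_shift less.prems(1) True by simp
    then have "shO A (- 1) N \<in> wge0 w" using less.prems(2) by simp
    then have "shO B (- 1) M \<in> upper"
      using shift_retract[OF less.prems(3,2), of "- 1"] unfolding upper_iff by blast
    then show ?thesis using upper_decomposable B.retract_Obj(1)[OF less.prems(3)] by blast
  next
    case False
    obtain Q where Q: "Q \<in> Obj A" "ext B (fobj F Q) M (shO B 2 M)"
      using retract_of_image_ext[OF less.prems(3,2)] by blast
    have "shO B 2 M \<in> decomposable"
    proof (rule less.hyps[of "i - 2"])
      show "shO A (i - 2) (shO A 2 N) \<in> wge0 w" using less.prems(1,2) by simp
    qed (use False less.prems(2) shift_retract[OF less.prems(3,2)] in auto)
    then show ?thesis using decomposable_closed[OF Q(2) image_decomposable[OF Q(1)]] by blast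
  qed
qed

lemma retract_of_lower_decomposable:
  assumes "shO A i N \<in> wle0 w" "N \<in> Obj A" "retract B M (fobj F N)"
  shows "M \<in> decomposable"
  using assms
\<comment> \<open>Here \<open>N\<close> is replaced by \<open>N[-2]\<close>, which raises
  \<open>i\<close> by 2. The lower term of a decomposition carries no translation, so
  \<open>i \<ge> 0\<close> already suffices.\<close>
proof (induction "nat (- i)" arbitrary: i N M rule: less_induct)
  case less
  show ?case
  proof (cases "0 \<le> i")
    case True
    have "shO A (- i) (shO A i N) \<in> wle0 w" using W.wle_shift less.prems(1) True by simp
    then have "N \<in> wle0 w" using less.prems(2) by simp
    then show ?thesis using lower_decomposable less.prems(3) unfolding lower_iff by blast
  next
    case False
    obtain Q where Q: "Q \<in> Obj A" "ext B (shO B (- 2) M) M (shO B (- 1) (fobj F Q))"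
      using retract_of_image_ext[OF less.prems(3,2)] by blast
    have "shO B (- 2) M \<in> decomposable"
    proof (rule less.hyps[of "i + 2"])
      show "shO A (i + 2) (shO A (- 2) N) \<in> wle0 w" using less.prems(1,2) by simp
    qed (use False less.prems(2) shift_retract[OF less.prems(3,2)] in auto)
    then show ?thesis using decomposable_closed[OF Q(2) _ image_shift_decomposable[OF Q(1)]] by blast
  qed
qed

lemma retract_of_bounded_decomposable:
  assumes "N \<in> Obj (cat_plus A w) \<union> Obj (cat_minus A w)" "retract B M (fobj F N)"
  shows "shO B n M \<in> decomposable"
proof -
  have N: "N \<in> Obj A" and d: "(\<exists>i. shO A i N \<in> wge0 w) \<or> (\<exists>i. shO A i N \<in> wle0 w)"
    using assms(1) unfolding W.Obj_cat_plus W.Obj_cat_minus by blast+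
  have r: "retract B (shO B n M) (fobj F (shO A n N))" by (rule shift_retract[OF assms(2) N])
  from d show ?thesis
  proof (elim disjE exE)
    fix i assume "shO A i N \<in> wge0 w"
    then have "shO A (i - n) (shO A n N) \<in> wge0 w" using N by simp
    then show ?thesis by (rule retract_of_upper_decomposable[OF _ _ r]) (use N in simp)
  next
    fix i assume "shO A i N \<in> wle0 w"
    then have "shO A (i - n) (shO A n N) \<in> wle0 w" using N by simp
    then show ?thesis by (rule retract_of_lower_decomposable[OF _ _ r]) (use N in simp)
  qed
qed

lemma extension_if_decomposable:
  assumes "Obj B \<subseteq> decomposable"
  shows "weight_extension A w B \<lparr>wle0 = lower, wge0 = upper\<rparr> F"
  unfolding weight_extension_def weight_exact_def weight_structure_def weight.simps
proof (intro conjI ballI)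
  show "lower \<subseteq> shO B 1 ` lower"
  proof
    fix X assume X: "X \<in> lower"
    have "X = shO B 1 (shO B (- 1) X)" using lower_Obj[OF X] by simp
    then show "X \<in> shO B 1 ` lower" by (rule image_eqI) (rule lower_shift[OF X], simp)
  qed
  show "shO B 1 ` upper \<subseteq> upper" using upper_shift[of _ 1] by auto
  show "orthogonal B lower (shO B 1 ` upper)"
    using lower_upper_orthogonal unfolding orthogonal_def hom_zero_def by blast
  show "\<exists>(f, g, h)\<in>Dist B. tgt B f = M \<and> src B f \<in> lower \<and> tgt B g \<in> shO B 1 ` upper" if "M \<in> Obj B" for M
  proof -
    obtain X Y where XY: "X \<in> lower" "Y \<in> shO B 1 ` upper" "ext B X M Y"
      using assms \<open>M \<in> Obj B\<close> unfolding decomposable_def by blast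
    then obtain f g h where "dtri B X M Y f g h" unfolding ext_def by blast
    note t = B.dtri_homs[OF this]
    show ?thesis by (rule bexI[OF _ t(4)]) (use t XY(1,2) in simp)
  qed
qed (use lower_Obj upper_Obj lower_retract upper_retract exact image_lower image_upper in
    \<open>auto simp: retraction_closed_def\<close>)

lemma extension_if_generated:
  assumes C1: "C1 \<subseteq> {X \<in> Obj B. \<exists>Y \<in> Obj (cat_plus A w). retract B X (fobj F Y)}"
    and C2: "C2 \<subseteq> {X \<in> Obj B. \<exists>Y \<in> Obj (cat_minus A w). retract B X (fobj F Y)}"
    and gen: "Obj B \<subseteq> strongly_generated B (fobj F ` Obj A \<union> C1 \<union> C2)"
  shows "\<exists>w'. weight_extension A w B w' F"
proof -
  \<comment> \<open>All translates are required since \<open>lower\<close> is known to be stable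
    under nonpositive translations and \<open>upper\<close> under nonnegative ones; a decomposition
    of \<open>M\<close> does not simply translate to one of \<open>M[n]\<close>.\<close>
  let ?S = "{M \<in> Obj B. \<forall>n. shO B n M \<in> decomposable}"
  have "strict_triangulated_subclass B ?S"
  proof (rule B.strict_subclassI)
    show "Z \<in> ?S" if Z: "zero_object B Z" for Z
    proof -
      obtain U where U: "zero_object A U" using A.zero_object_exists by blast
      have "isomorphic B (shO B n (fobj F U)) (shO B n Z)" for n
        using B.zero_object_iso[OF zero_object[OF U] Z] B.isomorphic_shift unfolding isomorphic_def by blast
      then show ?thesis
        using decomposable_iso image_shift_decomposable A.zero_object_Obj[OF U] B.zero_object_Obj[OF Z] by blast
    qed
    show "Y \<in> ?S" if "X \<in> ?S" "isomorphic B X Y" for X Y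
      using that decomposable_iso B.isomorphic_shift B.isomorphic_Obj(2) by blast
    show "Y \<in> ?S" if "ext B X Y Z" "X \<in> ?S" "Z \<in> ?S" for X Y Z
      using that decomposable_closed B.ext_shift B.ext_Obj(2) by blast
  qed auto
  moreover have "fobj F ` Obj A \<union> C1 \<union> C2 \<subseteq> ?S"
  proof -
    have "fobj F ` Obj A \<subseteq> ?S" using image_shift_decomposable by auto
    moreover have "C1 \<subseteq> ?S" "C2 \<subseteq> ?S" using C1 C2 retract_of_bounded_decomposable by blast+
    ultimately show ?thesis by blast
  qed
  ultimately have "Obj B \<subseteq> ?S" using gen B.strongly_generated_least by blast
  then have "Obj B \<subseteq> decomposable" using B.shO_zero by (metis (no_types, lifting) mem_Collect_eq subset_iff)
  then show ?thesis using extension_if_decomposable by blast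
qed

text \<open>A weight decomposition for \<open>w'\<close> has a retract of an image from
  \<open>C^-\<close> as first term and a translate of a retract of an image from \<open>C^+\<close>
  as last term. All such retracts are thrown in as generators.\<close>

lemma generated_if_extension:
  assumes "weight_extension A w B w' F"
  shows "strongly_generated B (fobj F ` Obj A
      \<union> {X \<in> Obj B. \<exists>Y \<in> Obj (cat_plus A w). retract B X (fobj F Y)}
      \<union> {X \<in> Obj B. \<exists>Y \<in> Obj (cat_minus A w). retract B X (fobj F Y)}) = Obj B" (is "strongly_generated B ?D = _")
proof
  have D: "?D \<subseteq> Obj B" by auto
  show "strongly_generated B ?D \<subseteq> Obj B" by (rule B.strongly_generated_least[OF B.strict_UNIV D])
  note st = B.strongly_generated_subclass[OF D]
  interpret S: triangulated_subclass B "strongly_generated B ?D" by unfold_locales (rule st(1))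
  interpret W': weighted_category B w'
    by unfold_locales (use assms in \<open>simp add: weight_extension_def\<close>)
  show "Obj B \<subseteq> strongly_generated B ?D"
  proof
    fix M assume "M \<in> Obj B"
    then obtain X Y where XY: "X \<in> wle0 w'" "Y \<in> wge0 w'" "ext B X M (shO B 1 Y)"
      using W'.weight_decomposition by blast
    have "X \<in> lower" "Y \<in> upper" using XY(1,2) extension_weights[OF assms] by blast+
    then obtain U V where UV: "U \<in> wle0 w" "retract B X (fobj F U)" "V \<in> wge0 w" "retract B Y (fobj F V)"
      unfolding lower_iff upper_iff by blast
    have o: "U \<in> Obj A" "V \<in> Obj A" using UV(1,3) W.wle_Obj W.wge_Obj by blast+
    have "U \<in> Obj (cat_minus A w)"
      unfolding W.Obj_cat_minus by (rule CollectI, rule conjI[OF o(1) exI[of _ 0]]) (simp add: o UV(1))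
    then have "X \<in> ?D" using UV(2) B.retract_Obj(1)[OF UV(2)] by (intro UnI2 CollectI conjI bexI) 
    moreover have "V \<in> Obj (cat_plus A w)"
      unfolding W.Obj_cat_plus by (rule CollectI, rule conjI[OF o(2) exI[of _ 0]]) (simp add: o UV(3))
    then have "Y \<in> ?D" using UV(4) B.retract_Obj(1)[OF UV(4)] by (intro UnI1[OF UnI2] CollectI conjI bexI)
    ultimately have "X \<in> strongly_generated B ?D" "shO B 1 Y \<in> strongly_generated B ?D"
      using st(2) S.S_shift by blast+
    then show "M \<in> strongly_generated B ?D" using S.S_ext[OF XY(3)] by blast
  qed
qed

text \<open>Boundedness of an object passes to its retracts, which gives one direction because each
  object of \<open>B\<close> is a retract of an image. The other direction holds since a fully
  faithful functor reflects retracts and the classes of \<open>w\<close> are closed under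
  them.\<close>

lemma extension_bounded:
  assumes "weight_extension A w B w' F"
  shows "bounded_below B w' \<longleftrightarrow> bounded_below A w" "bounded_above B w' \<longleftrightarrow> bounded_above A w"
proof -
  interpret W': weighted_category B w'
    by unfold_locales (use assms in \<open>simp add: weight_extension_def\<close>)
  have up: "(\<exists>i. shO B i (fobj F N) \<in> upper) \<longleftrightarrow> (\<exists>i. shO A i N \<in> wge0 w)" if N: "N \<in> Obj A" for N
  proof
    assume "\<exists>i. shO B i (fobj F N) \<in> upper"
    then obtain i V where V: "V \<in> wge0 w" "retract B (shO B i (fobj F N)) (fobj F V)"
      unfolding upper_iff by blast
    then have "retract B (fobj F (shO A i N)) (fobj F V)"
      using B.retract_trans B.isomorphic_retract shift_iso[OF N] by blast
    then show "\<exists>i. shO A i N \<in> wge0 w"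
      using reflect_retract N V(1) W.wge_Obj W.wge_retract by (metis A.shO_Obj)
  next
    assume "\<exists>i. shO A i N \<in> wge0 w"
    then show "\<exists>i. shO B i (fobj F N) \<in> upper"
      using shift_retract[OF B.retract_refl N] N unfolding upper_iff by (meson fobj_Obj)
  qed
  have low: "(\<exists>i. shO B i (fobj F N) \<in> lower) \<longleftrightarrow> (\<exists>i. shO A i N \<in> wle0 w)" if N: "N \<in> Obj A" for N
  proof
    assume "\<exists>i. shO B i (fobj F N) \<in> lower"
    then obtain i V where V: "V \<in> wle0 w" "retract B (shO B i (fobj F N)) (fobj F V)"
      unfolding lower_iff by blast
    then have "retract B (fobj F (shO A i N)) (fobj F V)"
      using B.retract_trans B.isomorphic_retract shift_iso[OF N] by blast
    then show "\<exists>i. shO A i N \<in> wle0 w"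
      using reflect_retract N V(1) W.wle_Obj W.wle_retract by (metis A.shO_Obj)
  next
    assume "\<exists>i. shO A i N \<in> wle0 w"
    then show "\<exists>i. shO B i (fobj F N) \<in> lower"
      using shift_retract[OF B.retract_refl N] N unfolding lower_iff by (meson fobj_Obj)
  qed
  show "bounded_below B w' \<longleftrightarrow> bounded_below A w"
    unfolding W'.bounded_below_iff W.bounded_below_iff extension_weights[OF assms]
  proof
    assume "\<forall>X\<in>Obj B. \<exists>i. shO B i X \<in> upper"
    then show "\<forall>X\<in>Obj A. \<exists>i. shO A i X \<in> wge0 w" using up fobj_Obj by blast
  next
    assume b: "\<forall>X\<in>Obj A. \<exists>i. shO A i X \<in> wge0 w"
    show "\<forall>X\<in>Obj B. \<exists>i. shO B i X \<in> upper"
    proof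
      fix X assume "X \<in> Obj B"
      then obtain N where N: "N \<in> Obj A" "retract B X (fobj F N)" using retract_of_image by blast
      then obtain i where "shO B i (fobj F N) \<in> upper" using b up by blast
      then show "\<exists>i. shO B i X \<in> upper" using upper_retract B.retract_shift[OF N(2)] by blast
    qed
  qed
  show "bounded_above B w' \<longleftrightarrow> bounded_above A w"
    unfolding W'.bounded_above_iff W.bounded_above_iff extension_weights[OF assms]
  proof
    assume "\<forall>X\<in>Obj B. \<exists>i. shO B i X \<in> lower"
    then show "\<forall>X\<in>Obj A. \<exists>i. shO A i X \<in> wle0 w" using low fobj_Obj by blast
  next
    assume b: "\<forall>X\<in>Obj A. \<exists>i. shO A i X \<in> wle0 w"
    show "\<forall>X\<in>Obj B. \<exists>i. shO B i X \<in> lower"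
    proof
      fix X assume "X \<in> Obj B"
      then obtain N where N: "N \<in> Obj A" "retract B X (fobj F N)" using retract_of_image by blast
      then obtain i where "shO B i (fobj F N) \<in> lower" using b low by blast
      then show "\<exists>i. shO B i X \<in> lower" using lower_retract B.retract_shift[OF N(2)] by blast
    qed
  qed
qed

text \<open>If \<open>w\<close> is bounded on one side, then \<open>C^+\<close> or
  \<open>C^-\<close> is everything, so every object of \<open>B\<close> may serve as a generator in
  \<open>C1\<close> or in \<open>C2\<close>.\<close>

lemma extension_if_bounded:
  assumes "bounded_below A w \<or> bounded_above A w"
  shows "\<exists>w'. weight_extension A w B w' F"
proof -
  have D: "fobj F ` Obj A \<union> Obj B \<subseteq> Obj B" by auto
  have gen: "Obj B \<subseteq> strongly_generated B (fobj F ` Obj A \<union> Obj B)"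
    using B.strongly_generated_subclass(2)[OF D] by blast
  have r: "Obj B \<subseteq> {X \<in> Obj B. \<exists>Y \<in> Obj A. retract B X (fobj F Y)}" using retract_of_image by blast
  from assms show ?thesis
  proof
    assume "bounded_below A w"
    then have "Obj (cat_plus A w) = Obj A" unfolding bounded_below_def .
    then show ?thesis using extension_if_generated[of "Obj B" "{}"] gen r by (simp only: Un_empty_right empty_subsetI)
  next
    assume "bounded_above A w"
    then have "Obj (cat_minus A w) = Obj A" unfolding bounded_above_def .
    then show ?thesis using extension_if_generated[of "{}" "Obj B"] gen r by (simp only: Un_empty_right empty_subsetI)
  qed
qed

end

section \<open>Inverting fully faithful functors\<close>

lemma additive_functor_cong:
  assumes "Obj C = Obj C'" "Arr C = Arr C'" "src C = src C'" "tgt C = tgt C'" "ident C = ident C'"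
    "cmp C = cmp C'" "addarr C = addarr C'"
  shows "additive_functor C D F \<longleftrightarrow> additive_functor C' D F"
    and "fully_faithful C D F \<longleftrightarrow> fully_faithful C' D F"
  unfolding additive_functor_def fully_faithful_def homs_def assms by auto

context ff_functor
begin

text \<open>Preimages \<open>u K\<close> and isomorphisms \<open>\<eta> K\<close> are chosen; an
  arrow of \<open>B\<close>, conjugated by these, has exactly one preimage in \<open>A\<close>. The
  functor is defined on a class \<open>S\<close> within the essential image, as this is what occurs
  for the heart and for \<open>kar_w_min\<close>.\<close>

lemma inverse_functor:
  assumes S: "S \<subseteq> Obj B" and ess: "\<And>K. K \<in> S \<Longrightarrow> \<exists>X \<in> Obj A. isomorphic B (fobj F X) K"
  obtains H \<eta> where "additive_functor (full_sub B S) A H" "fully_faithful (full_sub B S) A H"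
    "\<And>K. K \<in> S \<Longrightarrow> fobj H K \<in> Obj A" "\<And>K. K \<in> S \<Longrightarrow> iso_arr B (fobj F (fobj H K)) K (\<eta> K)"
    "\<And>K L f. K \<in> S \<Longrightarrow> L \<in> S \<Longrightarrow> f \<in> homs B K L \<Longrightarrow> \<eta> L \<cdot>\<^bsub>B\<^esub> fmor F (fmor H f) = f \<cdot>\<^bsub>B\<^esub> \<eta> K"
proof -
  have "\<forall>K. \<exists>X. K \<in> S \<longrightarrow> X \<in> Obj A \<and> isomorphic B (fobj F X) K" using ess by blast
  then obtain u where u: "\<And>K. K \<in> S \<Longrightarrow> u K \<in> Obj A" "\<And>K. K \<in> S \<Longrightarrow> isomorphic B (fobj F (u K)) K" by metis
  obtain \<eta> where \<eta>: "\<And>K. K \<in> S \<Longrightarrow> iso_arr B (fobj F (u K)) K (\<eta> K)"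
    using u(2) unfolding isomorphic_def by metis
  obtain \<eta>' where \<eta>'i: "\<And>K. K \<in> S \<Longrightarrow> iso_arr B K (fobj F (u K)) (\<eta>' K)"
    and \<eta>'e: "\<And>K. K \<in> S \<Longrightarrow> \<eta>' K \<cdot>\<^bsub>B\<^esub> \<eta> K = ident B (fobj F (u K))" "\<And>K. K \<in> S \<Longrightarrow> \<eta> K \<cdot>\<^bsub>B\<^esub> \<eta>' K = ident B K"
    using B.iso_arr_inverses[of S "\<lambda>K. fobj F (u K)" "\<lambda>K. K" \<eta>, OF \<eta>] by blast
  note \<eta>' = B.iso_arr_homs[OF \<eta>'i] \<eta>'e
  note \<eta>h = \<eta>[THEN B.iso_arr_homs]
  have ex: "\<exists>m. m \<in> homs A (u K) (u L) \<and> fmor F m = \<eta>' L \<cdot>\<^bsub>B\<^esub> (f \<cdot>\<^bsub>B\<^esub> \<eta> K)"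
    if c: "f \<in> homs B K L" "K \<in> S" "L \<in> S" for f K L
  proof -
    have "\<eta>' L \<cdot>\<^bsub>B\<^esub> (f \<cdot>\<^bsub>B\<^esub> \<eta> K) \<in> homs B (fobj F (u K)) (fobj F (u L))"
      using c(1) \<eta>h[OF c(2)] \<eta>'(1)[OF c(3)] by simp
    then obtain m where "m \<in> homs A (u K) (u L)" "\<eta>' L \<cdot>\<^bsub>B\<^esub> (f \<cdot>\<^bsub>B\<^esub> \<eta> K) = fmor F m"
      by (rule full[OF _ u(1)[OF c(2)] u(1)[OF c(3)]])
    then show ?thesis by metis
  qed
  define m where "m K L f = (SOME m. m \<in> homs A (u K) (u L) \<and> fmor F m = \<eta>' L \<cdot>\<^bsub>B\<^esub> (f \<cdot>\<^bsub>B\<^esub> \<eta> K))" for K L f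
  have m: "m K L f \<in> homs A (u K) (u L) \<and> fmor F (m K L f) = \<eta>' L \<cdot>\<^bsub>B\<^esub> (f \<cdot>\<^bsub>B\<^esub> \<eta> K)"
    if "f \<in> homs B K L" "K \<in> S" "L \<in> S" for f K L
    unfolding m_def using someI_ex[OF ex[OF that]] .
  define H where "H = \<lparr>fobj = u, fmor = \<lambda>f. m (src B f) (tgt B f) f\<rparr>"
  have H [simp]: "fobj H = u" unfolding H_def by simp
  have Hm: "fmor H f \<in> homs A (u K) (u L)" "fmor F (fmor H f) = \<eta>' L \<cdot>\<^bsub>B\<^esub> (f \<cdot>\<^bsub>B\<^esub> \<eta> K)"
    if "f \<in> homs B K L" "K \<in> S" "L \<in> S" for f K L
    using m[OF that] that unfolding H_def by auto
  have nat: "\<eta> L \<cdot>\<^bsub>B\<^esub> fmor F (fmor H f) = f \<cdot>\<^bsub>B\<^esub> \<eta> K" if f: "f \<in> homs B K L" "K \<in> S" "L \<in> S" for f K L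
    unfolding Hm(2)[OF f] using f(1) \<eta>h[OF f(2)] \<eta>h[OF f(3)] \<eta>'(1)[OF f(3)]
    by (simp add: B.cmp_ext[OF \<eta>'(3)[OF f(3)]])
  \<comment> \<open>The functor laws follow from this uniqueness: it is enough that the other side
    of the law is mapped by \<open>F\<close> to the same conjugated arrow.\<close>
  have uniq: "h = fmor H f" if f: "f \<in> homs B K L" "K \<in> S" "L \<in> S" and h: "h \<in> homs A (u K) (u L)"
    "fmor F h = \<eta>' L \<cdot>\<^bsub>B\<^esub> (f \<cdot>\<^bsub>B\<^esub> \<eta> K)" for f K L h
    by (rule faithful[OF _ h(1) Hm(1)[OF f]]) (simp only: h(2) Hm(2)[OF f])
  have add: "additive_functor (full_sub B S) A H"
    unfolding additive_functor_def
  proof (intro conjI ballI)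
    fix X assume X: "X \<in> Obj (full_sub B S)"
    then have X': "X \<in> S" "X \<in> Obj B" using S by auto
    show "fobj H X \<in> Obj A" using u(1) X' by simp
    show "fmor H (ident (full_sub B S) X) = ident A (fobj H X)"
      unfolding full_sub_simps H
      by (rule uniq[symmetric, of _ X X]) (use X' u(1) \<eta>h[OF X'(1)] \<eta>'[OF X'(1)] in simp_all)
  next
    fix X Y f assume "X \<in> Obj (full_sub B S)" "Y \<in> Obj (full_sub B S)" "f \<in> homs (full_sub B S) X Y"
    then show "fmor H f \<in> homs A (fobj H X) (fobj H Y)" using Hm(1)[of f X Y] by (simp add: homs_full_sub)
  next
    fix X Y Z f g assume o: "X \<in> Obj (full_sub B S)" "Y \<in> Obj (full_sub B S)" "Z \<in> Obj (full_sub B S)"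
      and "f \<in> homs (full_sub B S) X Y" "g \<in> homs (full_sub B S) Y Z"
    then have fg: "f \<in> homs B X Y" "g \<in> homs B Y Z" by auto
    have o: "X \<in> S" "Y \<in> S" "Z \<in> S" using o by auto
    note h = Hm[OF fg(1) o(1,2)] Hm[OF fg(2) o(2,3)]
    show "fmor H (g \<cdot>\<^bsub>full_sub B S\<^esub> f) = fmor H g \<cdot>\<^bsub>A\<^esub> fmor H f"
      unfolding full_sub_simps
      by (rule uniq[symmetric, of _ X Z])
        (use fg o h(1,3) \<eta>h[OF o(1)] \<eta>h[OF o(2)] \<eta>'(1)[OF o(2)] \<eta>'(1)[OF o(3)] in
          \<open>simp_all add: h(2,4) B.cmp_ext[OF \<eta>'(3)[OF o(2)]]\<close>)
  next
    fix X Y f g assume o: "X \<in> Obj (full_sub B S)" "Y \<in> Obj (full_sub B S)"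
      and "f \<in> homs (full_sub B S) X Y" "g \<in> homs (full_sub B S) X Y"
    then have fg: "f \<in> homs B X Y" "g \<in> homs B X Y" by auto
    have o: "X \<in> S" "Y \<in> S" using o by auto
    note h = Hm[OF fg(1) o(1,2)] Hm[OF fg(2) o(1,2)]
    show "fmor H (addarr (full_sub B S) f g) = addarr A (fmor H f) (fmor H g)"
      unfolding full_sub_simps
      by (rule uniq[symmetric, of _ X Y])
        (use fg o h(1,3) \<eta>h[OF o(1)] \<eta>'(1)[OF o(2)] in \<open>simp_all add: h(2,4)\<close>)
  qed
  have ffH: "fully_faithful (full_sub B S) A H"
    unfolding fully_faithful_def
  proof (intro ballI bij_betwI')
    fix K L assume "K \<in> Obj (full_sub B S)" "L \<in> Obj (full_sub B S)"
    then have o: "K \<in> S" "L \<in> S" by auto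
    note ty = \<eta>h[OF o(1)] \<eta>h[OF o(2)] \<eta>'(1)[OF o(1)] \<eta>'(1)[OF o(2)]
    show "(fmor H f = fmor H g) = (f = g)"
      if "f \<in> homs (full_sub B S) K L" "g \<in> homs (full_sub B S) K L" for f g
    proof
      assume e: "fmor H f = fmor H g"
      have fg: "f \<in> homs B K L" "g \<in> homs B K L" using that by auto
      have e': "f \<cdot>\<^bsub>B\<^esub> \<eta> K = g \<cdot>\<^bsub>B\<^esub> \<eta> K"
        unfolding nat[OF fg(1) o, symmetric] nat[OF fg(2) o, symmetric] e ..
      have "f = (f \<cdot>\<^bsub>B\<^esub> \<eta> K) \<cdot>\<^bsub>B\<^esub> \<eta>' K" using fg ty by (simp add: \<eta>'(3)[OF o(1)])
      also have "\<dots> = g" unfolding e' using fg ty by (simp add: \<eta>'(3)[OF o(1)])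
      finally show "f = g" .
    qed simp
    show "fmor H f \<in> homs A (fobj H K) (fobj H L)" if "f \<in> homs (full_sub B S) K L" for f
      using Hm(1)[of f K L] that o by simp
    show "\<exists>f \<in> homs (full_sub B S) K L. h = fmor H f" if h: "h \<in> homs A (fobj H K) (fobj H L)" for h
    proof -
      have f: "\<eta> L \<cdot>\<^bsub>B\<^esub> (fmor F h \<cdot>\<^bsub>B\<^esub> \<eta>' K) \<in> homs B K L" using h ty by simp
      have "h = fmor H (\<eta> L \<cdot>\<^bsub>B\<^esub> (fmor F h \<cdot>\<^bsub>B\<^esub> \<eta>' K))"
        by (rule uniq[OF f o]) (use h ty in \<open>simp_all add: \<eta>'(2)[OF o(1)] B.cmp_ext[OF \<eta>'(2)[OF o(2)]]\<close>)
      then show ?thesis using f o by (metis homs_full_sub)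
    qed
  qed
  show thesis by (rule that[OF add ffH]) (use u(1) \<eta> nat in auto)
qed

lemma equivalent_categories_if_essentially_surjective:
  assumes "\<And>K. K \<in> Obj B \<Longrightarrow> \<exists>X \<in> Obj A. isomorphic B (fobj F X) K"
  shows "equivalent_categories A B" "equivalent_categories B A"
proof -
  obtain H \<eta> where H: "additive_functor (full_sub B (Obj B)) A H"
    and H_Obj: "\<And>K. K \<in> Obj B \<Longrightarrow> fobj H K \<in> Obj A"
    and iso': "\<And>K. K \<in> Obj B \<Longrightarrow> iso_arr B (fobj F (fobj H K)) K (\<eta> K)"
    and nat: "\<And>K L f. K \<in> Obj B \<Longrightarrow> L \<in> Obj B \<Longrightarrow> f \<in> homs B K L \<Longrightarrow> \<eta> L \<cdot>\<^bsub>B\<^esub> fmor F (fmor H f) = f \<cdot>\<^bsub>B\<^esub> \<eta> K"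
    by (rule inverse_functor[OF subset_refl assms]) (assumption, rule that, assumption+)
  have HB: "additive_functor B A H"
    using H by (subst (asm) additive_functor_cong(1)[of _ B]) auto
  interpret H: add_functor B A H by unfold_locales (rule HB)
  have 1: "naturally_isomorphic B B (comp_func F H) id_func"
    unfolding naturally_isomorphic_def natural_iso_def comp_func_def id_func_def using iso' nat
    by (intro exI[of _ \<eta>] conjI ballI) simp_all
  have "\<exists>\<epsilon>. X \<in> Obj A \<longrightarrow> \<epsilon> \<in> homs A (fobj H (fobj F X)) X \<and> fmor F \<epsilon> = \<eta> (fobj F X)" for X
  proof (cases "X \<in> Obj A")
    case True
    have "\<eta> (fobj F X) \<in> homs B (fobj F (fobj H (fobj F X))) (fobj F X)"
      using B.iso_arr_homs[OF iso'] True by simp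
    then show ?thesis by (rule full) (use True H_Obj in auto)
  qed blast
  then obtain \<epsilon> where \<epsilon>: "\<And>X. X \<in> Obj A \<Longrightarrow> \<epsilon> X \<in> homs A (fobj H (fobj F X)) X"
    "\<And>X. X \<in> Obj A \<Longrightarrow> fmor F (\<epsilon> X) = \<eta> (fobj F X)" by metis
  have "iso_arr A (fobj H (fobj F X)) X (\<epsilon> X)" if "X \<in> Obj A" for X
    using reflect_iso[OF _ \<epsilon>(1)[OF that]] iso'[of "fobj F X"] \<epsilon>(2)[OF that] that by simp
  moreover have "\<epsilon> Y \<cdot>\<^bsub>A\<^esub> fmor H (fmor F f) = f \<cdot>\<^bsub>A\<^esub> \<epsilon> X" if f: "f \<in> homs A X Y" for X Y f
  proof -
    note o = A.homs_Obj[OF f]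
    have "fmor F (\<epsilon> Y \<cdot>\<^bsub>A\<^esub> fmor H (fmor F f)) = fmor F (f \<cdot>\<^bsub>A\<^esub> \<epsilon> X)"
      using f o \<epsilon>(1)[OF o(1)] \<epsilon>(1)[OF o(2)] nat[of "fobj F X" "fobj F Y" "fmor F f"]
      by (simp add: \<epsilon>(2))
    then show ?thesis by (rule faithful) (use f o \<epsilon>(1)[OF o(1)] \<epsilon>(1)[OF o(2)] in simp_all)
  qed
  ultimately have 2: "naturally_isomorphic A A (comp_func H F) id_func"
    unfolding naturally_isomorphic_def natural_iso_def comp_func_def id_func_def
    by (intro exI[of _ \<epsilon>] conjI ballI) simp_all
  show "equivalent_categories A B" "equivalent_categories B A"
    unfolding equivalent_categories_def using additive HB 1 2 by blast+
qed

end

text \<open>Beyond the plain inverse, a natural isomorphism \<open>H (K[1]) \<cong> (H K)[1]\<close>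
  has to be found for which triangles are preserved. It is obtained by fullness from the one of
  \<open>F\<close>, and its naturality is checked after applying the faithful
  \<open>F\<close>.\<close>

lemma (in exact_embedding) inverse_exact_functor:
  assumes strict: "strict_triangulated_subclass B S"
    and ess: "\<And>K. K \<in> S \<Longrightarrow> \<exists>X \<in> Obj A. isomorphic B (fobj F X) K"
  obtains H where "exact_functor (tri_sub B S) A H" "fully_faithful (tri_sub B S) A H"
    "\<And>K. K \<in> S \<Longrightarrow> fobj H K \<in> Obj A" "\<And>K. K \<in> S \<Longrightarrow> isomorphic B (fobj F (fobj H K)) K"
proof -
  interpret S: triangulated_subclass B S by unfold_locales (rule strict)
  have SO: "S \<subseteq> Obj B" using S.S_Obj by blast
  obtain H \<eta> where H: "additive_functor (full_sub B S) A H" "fully_faithful (full_sub B S) A H"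
    and H_Obj: "\<And>K. K \<in> S \<Longrightarrow> fobj H K \<in> Obj A" and iso': "\<And>K. K \<in> S \<Longrightarrow> iso_arr B (fobj F (fobj H K)) K (\<eta> K)"
    and nat: "\<And>K L f. K \<in> S \<Longrightarrow> L \<in> S \<Longrightarrow> f \<in> homs B K L \<Longrightarrow> \<eta> L \<cdot>\<^bsub>B\<^esub> fmor F (fmor H f) = f \<cdot>\<^bsub>B\<^esub> \<eta> K"
    by (rule inverse_functor[OF SO ess]) (assumption, rule that, assumption+)
  have HT: "additive_functor (tri_sub B S) A H" "fully_faithful (tri_sub B S) A H"
    using H additive_functor_cong[of "tri_sub B S" "full_sub B S" A H] by simp_all
  interpret T: triangulated_category "tri_sub B S" by (rule S.T_triangulated)
  interpret H: add_functor "tri_sub B S" A H by unfold_locales (rule HT(1))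
  obtain \<phi> where \<phi>: "\<And>X. X \<in> Obj A \<Longrightarrow> iso_arr B (fobj F (shO A 1 X)) (shO B 1 (fobj F X)) (\<phi> X)"
    "\<And>X Y f. f \<in> homs A X Y \<Longrightarrow> \<phi> Y \<cdot>\<^bsub>B\<^esub> fmor F (shM A 1 f) = shM B 1 (fmor F f) \<cdot>\<^bsub>B\<^esub> \<phi> X"
    "\<And>X Y Z f g h. dtri A X Y Z f g h \<Longrightarrow>
      dtri B (fobj F X) (fobj F Y) (fobj F Z) (fmor F f) (fmor F g) (\<phi> X \<cdot>\<^bsub>B\<^esub> fmor F h)"
    using exactE by blast
  obtain \<eta>' where \<eta>'i: "\<And>K. K \<in> S \<Longrightarrow> iso_arr B K (fobj F (fobj H K)) (\<eta>' K)"
    and \<eta>'e: "\<And>K. K \<in> S \<Longrightarrow> \<eta>' K \<cdot>\<^bsub>B\<^esub> \<eta> K = ident B (fobj F (fobj H K))" "\<And>K. K \<in> S \<Longrightarrow> \<eta> K \<cdot>\<^bsub>B\<^esub> \<eta>' K = ident B K"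
    using B.iso_arr_inverses[of S "\<lambda>K. fobj F (fobj H K)" "\<lambda>K. K" \<eta>, OF iso'] by blast
  note \<eta>' = B.iso_arr_homs[OF \<eta>'i] \<eta>'e \<eta>'i
  note \<eta>h = iso'[THEN B.iso_arr_homs]
  \<comment> \<open>Both \<open>F (H (K[1]))\<close> and \<open>F ((H K)[1])\<close> are identified
    with \<open>K[1]\<close>, the former by \<open>\<eta>\<close> and the latter by this composite.
    Comparing the two identifications forces the choice of \<open>\<psi>\<close>.\<close>
  define \<theta> where "\<theta> K = shM B 1 (\<eta> K) \<cdot>\<^bsub>B\<^esub> \<phi> (fobj H K)" for K
  have \<theta>: "iso_arr B (fobj F (shO A 1 (fobj H K))) (shO B 1 K) (\<theta> K)" if "K \<in> S" for K
    unfolding \<theta>_def by (rule B.iso_arr_cmp[OF \<phi>(1)[OF H_Obj[OF that]] B.iso_shift[OF iso'[OF that]]])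
  obtain \<theta>' where \<theta>': "\<And>K. K \<in> S \<Longrightarrow> iso_arr B (shO B 1 K) (fobj F (shO A 1 (fobj H K))) (\<theta>' K)"
    "\<And>K. K \<in> S \<Longrightarrow> \<theta>' K \<cdot>\<^bsub>B\<^esub> \<theta> K = ident B (fobj F (shO A 1 (fobj H K)))"
    "\<And>K. K \<in> S \<Longrightarrow> \<theta> K \<cdot>\<^bsub>B\<^esub> \<theta>' K = ident B (shO B 1 K)"
    using B.iso_arr_inverses[of S "\<lambda>K. fobj F (shO A 1 (fobj H K))" "\<lambda>K. shO B 1 K" \<theta>, OF \<theta>] by blast
  note \<theta>h = \<theta>[THEN B.iso_arr_homs] and \<theta>'h = \<theta>'(1)[THEN B.iso_arr_homs]
  have "\<exists>\<psi>. K \<in> S \<longrightarrow> iso_arr A (fobj H (shO B 1 K)) (shO A 1 (fobj H K)) \<psi> \<and> \<theta> K \<cdot>\<^bsub>B\<^esub> fmor F \<psi> = \<eta> (shO B 1 K)" for K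
  proof (cases "K \<in> S")
    case True
    let ?a = "\<theta>' K \<cdot>\<^bsub>B\<^esub> \<eta> (shO B 1 K)"
    have K1: "shO B 1 K \<in> S" using True by simp
    have a: "iso_arr B (fobj F (fobj H (shO B 1 K))) (fobj F (shO A 1 (fobj H K))) ?a"
      by (rule B.iso_arr_cmp[OF iso'[OF K1] \<theta>'(1)[OF True]])
    obtain \<psi> where \<psi>: "\<psi> \<in> homs A (fobj H (shO B 1 K)) (shO A 1 (fobj H K))" "?a = fmor F \<psi>"
      by (rule full[OF B.iso_arr_homs[OF a]]) (use True K1 H_Obj in simp_all)
    have "iso_arr A (fobj H (shO B 1 K)) (shO A 1 (fobj H K)) \<psi>"
      by (rule reflect_iso[OF _ \<psi>(1)]) (use a \<psi>(2) in simp)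
    moreover have "\<theta> K \<cdot>\<^bsub>B\<^esub> fmor F \<psi> = \<eta> (shO B 1 K)"
      unfolding \<psi>(2)[symmetric] using \<theta>h[OF True] \<theta>'h[OF True] \<eta>h[OF K1]
      by (simp add: B.cmp_ext[OF \<theta>'(3)[OF True]])
    ultimately show ?thesis by blast
  qed blast
  then obtain \<psi> where \<psi>: "\<And>K. K \<in> S \<Longrightarrow> iso_arr A (fobj H (shO B 1 K)) (shO A 1 (fobj H K)) (\<psi> K)"
    "\<And>K. K \<in> S \<Longrightarrow> \<theta> K \<cdot>\<^bsub>B\<^esub> fmor F (\<psi> K) = \<eta> (shO B 1 K)" by metis
  note \<psi>h = \<psi>(1)[THEN A.iso_arr_homs]
  have nat\<psi>: "\<psi> L \<cdot>\<^bsub>A\<^esub> fmor H (shM B 1 f) = shM A 1 (fmor H f) \<cdot>\<^bsub>A\<^esub> \<psi> K"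
    if f: "f \<in> homs B K L" "K \<in> S" "L \<in> S" for K L f
  proof -
    have K1: "shO B 1 K \<in> S" "shO B 1 L \<in> S" using f by simp_all
    note o = H_Obj[OF f(2)] H_Obj[OF f(3)]
    have Hf: "fmor H f \<in> homs A (fobj H K) (fobj H L)" "fmor H (shM B 1 f) \<in> homs A (fobj H (shO B 1 K)) (fobj H (shO B 1 L))"
      using H.fmor_simps[of f] H.fmor_simps[of "shM B 1 f"] f by simp_all
    note ty = f(1) \<eta>h[OF f(2)] \<eta>h[OF f(3)] \<eta>h[OF K1(1)] \<eta>h[OF K1(2)] \<theta>h[OF f(2)] \<theta>h[OF f(3)] \<theta>'h[OF f(3)]
      \<psi>h[OF f(2)] \<psi>h[OF f(3)] Hf B.iso_arr_homs[OF \<phi>(1)[OF o(1)]] B.iso_arr_homs[OF \<phi>(1)[OF o(2)]]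
    have nf: "shM B 1 (\<eta> L) \<cdot>\<^bsub>B\<^esub> shM B 1 (fmor F (fmor H f)) = shM B 1 f \<cdot>\<^bsub>B\<^esub> shM B 1 (\<eta> K)"
      using nat[OF f(2,3,1)] ty by (simp flip: B.shM_cmp)
    have 1: "\<theta> L \<cdot>\<^bsub>B\<^esub> fmor F (shM A 1 (fmor H f)) = shM B 1 f \<cdot>\<^bsub>B\<^esub> \<theta> K"
      unfolding \<theta>_def using ty \<phi>(2)[OF Hf(1)] by (simp add: B.cmp_ext[OF nf])
    have "\<theta> L \<cdot>\<^bsub>B\<^esub> fmor F (shM A 1 (fmor H f) \<cdot>\<^bsub>A\<^esub> \<psi> K) = shM B 1 f \<cdot>\<^bsub>B\<^esub> \<eta> (shO B 1 K)"
      using ty by (simp add: B.cmp_ext[OF 1] \<psi>(2)[OF f(2)])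
    also have "\<dots> = \<theta> L \<cdot>\<^bsub>B\<^esub> fmor F (\<psi> L \<cdot>\<^bsub>A\<^esub> fmor H (shM B 1 f))"
      using ty nat[OF K1, of "shM B 1 f"] by (simp add: B.cmp_ext[OF \<psi>(2)[OF f(3)]])
    finally have "\<theta>' L \<cdot>\<^bsub>B\<^esub> (\<theta> L \<cdot>\<^bsub>B\<^esub> fmor F (shM A 1 (fmor H f) \<cdot>\<^bsub>A\<^esub> \<psi> K))
        = \<theta>' L \<cdot>\<^bsub>B\<^esub> (\<theta> L \<cdot>\<^bsub>B\<^esub> fmor F (\<psi> L \<cdot>\<^bsub>A\<^esub> fmor H (shM B 1 f)))" by simp
    then have "fmor F (shM A 1 (fmor H f) \<cdot>\<^bsub>A\<^esub> \<psi> K) = fmor F (\<psi> L \<cdot>\<^bsub>A\<^esub> fmor H (shM B 1 f))"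
      using ty by (simp add: B.cmp_ext[OF \<theta>'(2)[OF f(3)]] del: fmor_cmp)
    then show ?thesis by (rule faithful[symmetric]) (use ty o in simp_all)
  qed
  have dist: "dtri A (fobj H X) (fobj H Y) (fobj H Z) (fmor H f) (fmor H g) (\<psi> X \<cdot>\<^bsub>A\<^esub> fmor H h)"
    if t: "dtri (tri_sub B S) X Y Z f g h" for X Y Z f g h
  proof -
    have S: "X \<in> S" "Y \<in> S" "Z \<in> S" "shO B 1 X \<in> S" using T.dtri_Obj[OF t] by simp_all
    have tB: "dtri B X Y Z f g h" using t S.T_dtri by blast
    note h = B.dtri_homs(1-3)[OF tB]
    have Hf: "fmor H f \<in> homs A (fobj H X) (fobj H Y)" "fmor H g \<in> homs A (fobj H Y) (fobj H Z)"
      "fmor H h \<in> homs A (fobj H Z) (fobj H (shO B 1 X))"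
      using H.fmor_simps[of f] H.fmor_simps[of g] H.fmor_simps[of h] h S by simp_all
    note ty = h Hf \<eta>h[OF S(1)] \<eta>h[OF S(2)] \<eta>h[OF S(3)] \<eta>h[OF S(4)] \<eta>'(1)[OF S(1)] \<eta>'(1)[OF S(2)] \<eta>'(1)[OF S(3)]
      \<eta>'(1)[OF S(4)] \<psi>h[OF S(1)] B.iso_arr_homs[OF \<phi>(1)[OF H_Obj[OF S(1)]]]
    have n: "\<eta>' L \<cdot>\<^bsub>B\<^esub> a = fmor F (fmor H a) \<cdot>\<^bsub>B\<^esub> \<eta>' K" if a: "a \<in> homs B K L" "K \<in> S" "L \<in> S" for K L a
    proof -
      have Ha: "fmor H a \<in> homs A (fobj H K) (fobj H L)" using H.fmor_simps[of a] a by simp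
      note ty = a(1) \<eta>h[OF a(2)] \<eta>h[OF a(3)] \<eta>'(1)[OF a(2)] \<eta>'(1)[OF a(3)] Ha
      have "\<eta>' L \<cdot>\<^bsub>B\<^esub> a = \<eta>' L \<cdot>\<^bsub>B\<^esub> ((a \<cdot>\<^bsub>B\<^esub> \<eta> K) \<cdot>\<^bsub>B\<^esub> \<eta>' K)" using ty by (simp add: \<eta>'(3)[OF a(2)])
      also have "\<dots> = \<eta>' L \<cdot>\<^bsub>B\<^esub> ((\<eta> L \<cdot>\<^bsub>B\<^esub> fmor F (fmor H a)) \<cdot>\<^bsub>B\<^esub> \<eta>' K)" by (simp only: nat[OF a(2,3,1)])
      also have "\<dots> = fmor F (fmor H a) \<cdot>\<^bsub>B\<^esub> \<eta>' K" using ty by (simp add: B.cmp_ext[OF \<eta>'(2)[OF a(3)]])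
      finally show ?thesis .
    qed
    have \<eta>'1: "shM B 1 (\<eta>' X) \<cdot>\<^bsub>B\<^esub> shM B 1 (\<eta> X) = ident B (shO B 1 (fobj F (fobj H X)))"
      using ty \<eta>'(2)[OF S(1)] H_Obj[OF S(1)] by (simp flip: B.shM_cmp)
    have \<phi>\<psi>: "\<phi> (fobj H X) \<cdot>\<^bsub>B\<^esub> fmor F (\<psi> X) = shM B 1 (\<eta>' X) \<cdot>\<^bsub>B\<^esub> \<eta> (shO B 1 X)"
      unfolding \<psi>(2)[OF S(1), symmetric] \<theta>_def using ty by (simp add: B.cmp_ext[OF \<eta>'1])
    \<comment> \<open>Applied to the alleged triangle of \<open>A\<close>, \<open>F\<close> gives a
      triangle isomorphic to the original one of \<open>B\<close> by means of
      \<open>\<eta>'\<close>; \<open>reflect_dtri\<close> then returns to \<open>A\<close>.\<close>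
    have tF: "dtri B (fobj F (fobj H X)) (fobj F (fobj H Y)) (fobj F (fobj H Z))
        (fmor F (fmor H f)) (fmor F (fmor H g)) (\<phi> (fobj H X) \<cdot>\<^bsub>B\<^esub> fmor F (\<psi> X \<cdot>\<^bsub>A\<^esub> fmor H h))"
    proof (rule B.dtri_iso[OF tB _ _ _ \<eta>'(4)[OF S(1)] \<eta>'(4)[OF S(2)] \<eta>'(4)[OF S(3)]])
      have "(\<phi> (fobj H X) \<cdot>\<^bsub>B\<^esub> fmor F (\<psi> X \<cdot>\<^bsub>A\<^esub> fmor H h)) \<cdot>\<^bsub>B\<^esub> \<eta>' Z
          = \<phi> (fobj H X) \<cdot>\<^bsub>B\<^esub> (fmor F (\<psi> X) \<cdot>\<^bsub>B\<^esub> (\<eta>' (shO B 1 X) \<cdot>\<^bsub>B\<^esub> h))"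
        using ty by (simp add: n[OF h(3) S(3,4)])
      also have "\<dots> = shM B 1 (\<eta>' X) \<cdot>\<^bsub>B\<^esub> h"
        using ty by (simp add: B.cmp_ext[OF \<phi>\<psi>] B.cmp_ext[OF \<eta>'(3)[OF S(4)]])
      finally show "shM B 1 (\<eta>' X) \<cdot>\<^bsub>B\<^esub> h = (\<phi> (fobj H X) \<cdot>\<^bsub>B\<^esub> fmor F (\<psi> X \<cdot>\<^bsub>A\<^esub> fmor H h)) \<cdot>\<^bsub>B\<^esub> \<eta>' Z" ..
    qed (use ty n[OF h(1) S(1,2)] n[OF h(2) S(2,3)] in simp_all)
    show ?thesis
      by (rule reflect_dtri[OF \<phi>(1)[OF H_Obj[OF S(1)]] \<phi>(3) tF]) (use ty in simp_all)
  qed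
  have "exact_functor (tri_sub B S) A H"
    unfolding exact_functor_def natural_iso_def comp_func_def shift_func_def
  proof (intro conjI HT(1) exI[of _ \<psi>])
    show "\<forall>(f, g, h)\<in>Dist (tri_sub B S). (fmor H f, fmor H g, \<psi> (src (tri_sub B S) f) \<cdot>\<^bsub>A\<^esub> fmor H h) \<in> Dist A"
    proof clarify
      fix f g h assume "(f, g, h) \<in> Dist (tri_sub B S)"
      then show "(fmor H f, fmor H g, \<psi> (src (tri_sub B S) f) \<cdot>\<^bsub>A\<^esub> fmor H h) \<in> Dist A"
        using A.dtri_homs(4)[OF dist[OF T.dist_dtri]] by blast
    qed
  qed (use \<psi>(1) nat\<psi> in \<open>simp_all add: S.T_homs del: homs_iff S.T_simps(2)\<close>)
  moreover have "isomorphic B (fobj F (fobj H K)) K" if "K \<in> S" for K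
    unfolding isomorphic_def using iso'[OF that] by (rule exI)
  ultimately show thesis using that HT(2) H_Obj by blast
qed

section \<open>Weight-Karoubian extensions\<close>

context triangulated_subclass
begin

lemma inclusion: "exact_functor T C id_func" "fully_faithful T C id_func"
proof -
  interpret T: triangulated_category T by (rule T_triangulated)
  have "exact_functor T C id_func"
    unfolding exact_functor_def natural_iso_def
  proof (intro conjI exI[of _ "\<lambda>X. ident C (shO C 1 X)"] ballI)
    show "additive_functor T C id_func" unfolding additive_functor_def id_func_def by simp
    fix t assume t: "t \<in> Dist T"
    obtain f g h where [simp]: "t = (f, g, h)" by (metis prod_cases3)
    have "tgt C h = shO C 1 (src C f)" using t T.dtri_homs[OF T.dist_dtri, of f g h] by simp
    then show "case t of (f, g, h) \<Rightarrow> (fmor id_func f, fmor id_func g, ident C (shO C 1 (src T f)) \<cdot> fmor id_func h) \<in> Dist C"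
      using t by (simp add: id_func_def)
  qed (auto simp: comp_func_def shift_func_def id_func_def intro!: iso_arr_ident)
  then show "exact_functor T C id_func" .
  show "fully_faithful T C id_func"
    unfolding fully_faithful_def id_func_def by (simp add: T_homs bij_betw_def)
qed

lemma corestriction:
  fixes A :: "('p, 'n) tcat"
  assumes "triangulated_category A" "exact_functor A C F" "\<And>X. X \<in> Obj A \<Longrightarrow> fobj F X \<in> S"
  shows "exact_functor A T F" "fully_faithful A C F \<Longrightarrow> fully_faithful A T F"
proof -
  interpret A: triangulated_category A by (rule assms)
  interpret F: exact_between A C F by unfold_locales (rule assms)
  obtain \<phi> where \<phi>: "\<And>X. X \<in> Obj A \<Longrightarrow> iso_arr C (fobj F (shO A 1 X)) (shO C 1 (fobj F X)) (\<phi> X)"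
    "\<And>X Y f. f \<in> homs A X Y \<Longrightarrow> \<phi> Y \<cdot> fmor F (shM A 1 f) = shM C 1 (fmor F f) \<cdot> \<phi> X"
    "\<And>X Y Z f g h. dtri A X Y Z f g h \<Longrightarrow>
      dtri C (fobj F X) (fobj F Y) (fobj F Z) (fmor F f) (fmor F g) (\<phi> X \<cdot> fmor F h)"
    using F.exactE by blast
  show "exact_functor A T F"
    unfolding exact_functor_def natural_iso_def
  proof (intro conjI exI[of _ \<phi>] ballI)
    show "additive_functor A T F"
      unfolding additive_functor_def
      by (intro conjI ballI) (use assms(3) in \<open>simp_all add: T_homs del: T_simps(2)\<close>)
    show "iso_arr T (fobj (comp_func F (shift_func A 1)) X) (fobj (comp_func (shift_func T 1) F) X) (\<phi> X)"
      if "X \<in> Obj A" for X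
      using \<phi>(1)[OF that] that assms(3) by (simp add: T_iso comp_func_def shift_func_def)
    show "\<phi> Y \<cdot>\<^bsub>T\<^esub> fmor (comp_func F (shift_func A 1)) f = fmor (comp_func (shift_func T 1) F) f \<cdot>\<^bsub>T\<^esub> \<phi> X"
      if "f \<in> homs A X Y" for X Y f
      using \<phi>(2)[OF that] by (simp add: comp_func_def shift_func_def)
    fix t assume t: "t \<in> Dist A"
    obtain f g h where [simp]: "t = (f, g, h)" by (metis prod_cases3)
    have d: "dtri A (src A f) (tgt A f) (tgt A g) f g h" using t A.dist_dtri by simp
    have "dtri T (fobj F (src A f)) (fobj F (tgt A f)) (fobj F (tgt A g)) (fmor F f) (fmor F g) (\<phi> (src A f) \<cdot> fmor F h)"
      unfolding T_dtri using \<phi>(3)[OF d] assms(3) A.dtri_Obj[OF d] by blast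
    then have "(fmor F f, fmor F g, \<phi> (src A f) \<cdot> fmor F h) \<in> Dist T" unfolding dtri_def by blast
    then show "case t of (f, g, h) \<Rightarrow> (fmor F f, fmor F g, \<phi> (src A f) \<cdot>\<^bsub>T\<^esub> fmor F h) \<in> Dist T"
      by (simp only: \<open>t = (f, g, h)\<close> case_prod_conv T_simps(6))
  qed
  show "fully_faithful A T F" if "fully_faithful A C F"
    using that assms(3) unfolding fully_faithful_def by (simp add: T_homs)
qed

end

context triangulated_category
begin

lemma kar_emb_exact: "exact_functor C (tri_kar C) (kar_emb C)"
proof -
  interpret K: triangulated_category "tri_kar C" by (rule tri_kar_triangulated)
  let ?K = "tri_kar C" and ?J = "fmor (kar_emb C)" and ?E = "fobj (kar_emb C)"
  show ?thesis
    unfolding exact_functor_def natural_iso_def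
  proof (intro conjI exI[of _ "\<lambda>X. ident ?K (?E (shO C 1 X))"] ballI kar_emb_additive)
    show "iso_arr ?K (fobj (comp_func (kar_emb C) (shift_func C 1)) X)
        (fobj (comp_func (shift_func ?K 1) (kar_emb C)) X) (ident ?K (?E (shO C 1 X)))" if "X \<in> Obj C" for X
      using that K.iso_arr_ident[of "?E (shO C 1 X)"] by (simp add: comp_func_def shift_func_def)
    fix t assume t: "t \<in> Dist C"
    obtain f g h where [simp]: "t = (f, g, h)" by (metis prod_cases3)
    note ty = dtri_homs[OF dist_dtri, of f g h]
    have "(?J f, ?J g, ?J h) \<in> Dist ?K" using kar_emb_Dist(2) t by simp
    then show "case t of (f, g, h) \<Rightarrow> (?J f, ?J g, ident ?K (?E (shO C 1 (src C f))) \<cdot>\<^bsub>?K\<^esub> ?J h) \<in> Dist ?K"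
      using ty t by simp
  qed (auto simp: comp_func_def shift_func_def)
qed

end

text \<open>The comparison functor is the inclusion of the subclass, which composes with the
  corestricted embedding to \<open>kar_emb C\<close> itself; identities serve as the natural
  isomorphism.\<close>

lemma idempotent_extension_tri_sub:
  fixes C :: "('o, 'm) tcat"
  assumes C: "triangulated_category C" and S: "strict_triangulated_subclass (tri_kar C) S" and E: "\<And>X. X \<in> Obj C \<Longrightarrow> fobj (kar_emb C) X \<in> S"
  shows "idempotent_extension C (tri_sub (tri_kar C) S) (kar_emb C)"
proof -
  interpret triangulated_category C by (rule C)
  interpret K: triangulated_category "tri_kar C" by (rule tri_kar_triangulated)
  interpret S: triangulated_subclass "tri_kar C" S by unfold_locales (rule S)
  have "naturally_isomorphic C (tri_kar C) (comp_func id_func (kar_emb C)) (kar_emb C)"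
    unfolding naturally_isomorphic_def natural_iso_def
  proof (rule exI[of _ "\<lambda>X. ident (tri_kar C) (fobj (kar_emb C) X)"], intro conjI ballI)
    show "iso_arr (tri_kar C) (fobj (comp_func id_func (kar_emb C)) X) (fobj (kar_emb C) X)
        (ident (tri_kar C) (fobj (kar_emb C) X))" if "X \<in> Obj C" for X
      using K.iso_arr_ident[of "fobj (kar_emb C) X"] that by (simp add: comp_func_def id_func_def)
  qed (auto simp: comp_func_def id_func_def)
  then show ?thesis
    unfolding idempotent_extension_def
    using triangulated_category_axioms S.T_triangulated S.inclusion
      S.corestriction[OF triangulated_category_axioms kar_emb_exact E] kar_emb_fully_faithful by blast
qed

lemma retract_kar_emb:
  assumes "category C" "(X, p) \<in> Obj (kar C)"
  shows "retract (tri_kar C) (X, p) (fobj (kar_emb C) X)"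
proof -
  interpret category C by (rule assms)
  show ?thesis unfolding retract_def
    by (rule bexI[of _ "((X, p), p, (X, ident C X))"], rule bexI[of _ "((X, ident C X), p, (X, p))"])
      (use assms(2) in auto)
qed

lemma Obj_kar_full_sub: "S \<subseteq> Obj C \<Longrightarrow> (X, p) \<in> Obj (kar (full_sub C S)) \<longleftrightarrow> (X, p) \<in> Obj (kar C) \<and> X \<in> S"
  by (auto simp: kar_Obj)

lemma Obj_kar_tri_sub: "S \<subseteq> Obj C \<Longrightarrow> (X, p) \<in> Obj (kar (tri_sub C S)) \<longleftrightarrow> (X, p) \<in> Obj (kar C) \<and> X \<in> S"
  by (auto simp: kar_Obj tri_sub_def Let_def)

section \<open>The minimal and the maximal weight-Karoubian extension\<close>

context weighted_category
begin

lemma heart_Obj: "Obj (heart C w) = weq0 w" "weq0 w \<subseteq> Obj C"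
  unfolding heart_def weq0_def using wle_Obj by auto

lemma heart_additive: "additive_category (heart C w)"
  unfolding heart_def
proof (rule full_sub_additive[OF heart_Obj(2)])
  show "\<exists>Z\<in>weq0 w. zero_object C Z" using zero_object_exists zero_in_weights unfolding weq0_def by blast
  fix X Y U i j p q assume "X \<in> weq0 w" "Y \<in> weq0 w" "biprod C U X Y i j p q"
  then show "U \<in> weq0 w" using wle_ext wge_ext extI[OF dtri_biprod] unfolding weq0_def by blast
qed

lemma Obj_kar_heart: "(X, p) \<in> Obj (kar (heart C w)) \<longleftrightarrow> (X, p) \<in> Obj (kar C) \<and> X \<in> weq0 w"
  unfolding heart_def using Obj_kar_full_sub[OF heart_Obj(2)] .

lemma Obj_kar_plus: "(X, p) \<in> Obj (kar (cat_plus C w)) \<longleftrightarrow> (X, p) \<in> Obj (kar C) \<and> X \<in> Obj (cat_plus C w)"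
proof -
  have "(\<Union>i. wge C w i) = Obj (cat_plus C w)" by (simp add: cat_plus_def tri_sub_def Let_def)
  then show ?thesis using Obj_kar_tri_sub[of "\<Union>i. wge C w i" C X p] Obj_cat_plus unfolding cat_plus_def by auto
qed

lemma Obj_kar_minus: "(X, p) \<in> Obj (kar (cat_minus C w)) \<longleftrightarrow> (X, p) \<in> Obj (kar C) \<and> X \<in> Obj (cat_minus C w)"
proof -
  have "(\<Union>i. wle C w i) = Obj (cat_minus C w)" by (simp add: cat_minus_def tri_sub_def Let_def)
  then show ?thesis using Obj_kar_tri_sub[of "\<Union>i. wle C w i" C X p] Obj_cat_minus unfolding cat_minus_def by auto
qed

lemma weights_bounded:
  "X \<in> wle0 w \<Longrightarrow> X \<in> Obj (cat_minus C w)" "X \<in> wge0 w \<Longrightarrow> X \<in> Obj (cat_plus C w)"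
  unfolding Obj_cat_minus Obj_cat_plus using wle_Obj wge_Obj by (auto intro!: exI[of _ 0])

definition gen_min where "gen_min = fobj (kar_emb C) ` Obj C \<union> Obj (kar (heart C w))"
definition gen_max where "gen_max = Obj (kar (cat_minus C w)) \<union> Obj (kar (cat_plus C w))"

lemma gen_min_Obj: "gen_min \<subseteq> Obj (tri_kar C)" and gen_max_Obj: "gen_max \<subseteq> Obj (tri_kar C)"
  unfolding gen_min_def gen_max_def using Obj_kar_heart Obj_kar_plus Obj_kar_minus by auto

lemma kar_w_eq:
  "kar_w_min C w = tri_sub (tri_kar C) (strongly_generated (tri_kar C) gen_min)"
  "kar_w_max C w = tri_sub (tri_kar C) (strongly_generated (tri_kar C) gen_max)"
  unfolding kar_w_min_def kar_w_max_def gen_min_def gen_max_def by simp_all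

lemma strict_min: "strict_triangulated_subclass (tri_kar C) (strongly_generated (tri_kar C) gen_min)"
  and min_gen: "gen_min \<subseteq> strongly_generated (tri_kar C) gen_min"
  and strict_max: "strict_triangulated_subclass (tri_kar C) (strongly_generated (tri_kar C) gen_max)"
  and max_gen: "gen_max \<subseteq> strongly_generated (tri_kar C) gen_max"
proof -
  interpret K: triangulated_category "tri_kar C" by (rule tri_kar_triangulated)
  show "strict_triangulated_subclass (tri_kar C) (strongly_generated (tri_kar C) gen_min)"
    "gen_min \<subseteq> strongly_generated (tri_kar C) gen_min"
    "strict_triangulated_subclass (tri_kar C) (strongly_generated (tri_kar C) gen_max)"
    "gen_max \<subseteq> strongly_generated (tri_kar C) gen_max"
    by (rule K.strongly_generated_subclass gen_min_Obj gen_max_Obj)+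
qed

lemma emb_min: "X \<in> Obj C \<Longrightarrow> fobj (kar_emb C) X \<in> strongly_generated (tri_kar C) gen_min"
  using min_gen unfolding gen_min_def by blast

text \<open>The generators of \<open>kar_w_max\<close> come from bounded objects, so an arbitrary
  object of \<open>C\<close> has to be built from them: its weight decomposition exhibits it as an
  extension of an object of \<open>C^+\<close> by one of \<open>C^-\<close>.\<close>

lemma emb_max:
  assumes X: "X \<in> Obj C" shows "fobj (kar_emb C) X \<in> strongly_generated (tri_kar C) gen_max"
proof -
  interpret K: triangulated_category "tri_kar C" by (rule tri_kar_triangulated)
  interpret S: triangulated_subclass "tri_kar C" "strongly_generated (tri_kar C) gen_max"
    by unfold_locales (rule strict_max)
  interpret E: exact_between C "tri_kar C" "kar_emb C" by unfold_locales (rule kar_emb_exact)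
  obtain U V where UV: "U \<in> wle0 w" "V \<in> wge0 w" "ext C U X (shO C 1 V)" using weight_decomposition[OF X] by blast
  have "fobj (kar_emb C) U \<in> gen_max" "fobj (kar_emb C) (shO C 1 V) \<in> gen_max"
    unfolding gen_max_def using weights_bounded(1)[OF UV(1)] weights_bounded(2)[OF wge_shift[OF UV(2), of 1]]
      wle_Obj[OF UV(1)] wge_Obj[OF UV(2)] by (simp_all add: Obj_kar_plus Obj_kar_minus)
  then show ?thesis using S.S_ext[OF E.ext[OF UV(3)]] max_gen by blast
qed

lemma kar_min_subset_max: "strongly_generated (tri_kar C) gen_min \<subseteq> strongly_generated (tri_kar C) gen_max"
proof -
  interpret K: triangulated_category "tri_kar C" by (rule tri_kar_triangulated)
  have "Obj (kar (heart C w)) \<subseteq> gen_max"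
    unfolding gen_max_def using weights_bounded(1) by (auto simp: Obj_kar_heart Obj_kar_minus weq0_def)
  then have "gen_min \<subseteq> strongly_generated (tri_kar C) gen_max"
    using emb_max max_gen unfolding gen_min_def by blast
  then show ?thesis by (rule K.strongly_generated_least[OF strict_max])
qed

lemma tri_kar_subclass_embedding:
  assumes "strict_triangulated_subclass (tri_kar C) S" "\<And>X. X \<in> Obj C \<Longrightarrow> fobj (kar_emb C) X \<in> S"
  shows "weighted_embedding C (tri_sub (tri_kar C) S) (kar_emb C) w"
  using idempotent_extension_embedding[OF idempotent_extension_tri_sub[OF triangulated_category_axioms assms]] weighted_category_axioms
  by (rule weighted_embedding.intro)

text \<open>Brings both constructions into the scope of the generation criterion: the generators not
  coming from \<open>C\<close> are retracts of bounded objects in \<open>tri_kar C\<close>, hence in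
  the full subcategory on \<open>S\<close>, and generating \<open>S\<close> in
  \<open>tri_kar C\<close> is the same as generating it in itself.\<close>

lemma extension_exists:
  assumes D: "D \<subseteq> Obj (tri_kar C)" and S: "S = strongly_generated (tri_kar C) D"
    and E: "\<And>X. X \<in> Obj C \<Longrightarrow> fobj (kar_emb C) X \<in> S"
    and ret: "\<And>K. K \<in> D \<Longrightarrow> K \<in> fobj (kar_emb C) ` Obj C
      \<or> (\<exists>Y \<in> Obj (cat_plus C w) \<union> Obj (cat_minus C w). retract (tri_kar C) K (fobj (kar_emb C) Y))"
  shows "\<exists>w'. weight_extension C w (tri_sub (tri_kar C) S) w' (kar_emb C)"
proof -
  interpret K: triangulated_category "tri_kar C" by (rule tri_kar_triangulated)
  note st = K.strongly_generated_subclass[OF D, folded S]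
  interpret S: triangulated_subclass "tri_kar C" S by unfold_locales (rule st(1))
  interpret T: triangulated_category "tri_sub (tri_kar C) S" by (rule S.T_triangulated)
  interpret W: weighted_embedding C "tri_sub (tri_kar C) S" "kar_emb C" w
    by (rule tri_kar_subclass_embedding[OF st(1) E])
  let ?T = "tri_sub (tri_kar C) S" and ?E = "fobj (kar_emb C)"
  let ?C1 = "{X \<in> Obj ?T. \<exists>Y \<in> Obj (cat_plus C w). retract ?T X (?E Y)}"
  let ?C2 = "{X \<in> Obj ?T. \<exists>Y \<in> Obj (cat_minus C w). retract ?T X (?E Y)}"
  have sub: "D \<subseteq> ?E ` Obj C \<union> ?C1 \<union> ?C2"
  proof
    fix K assume K: "K \<in> D"
    have KS: "K \<in> S" using st(2) K by blast
    have ES: "?E Y \<in> S" if "Y \<in> Obj (cat_plus C w) \<union> Obj (cat_minus C w)" for Y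
      using that Obj_cat_plus Obj_cat_minus by (intro E) blast
    show "K \<in> ?E ` Obj C \<union> ?C1 \<union> ?C2"
      using ret[OF K] S.T_retract[OF KS ES] KS unfolding S.T_simps(1) by blast
  qed
  have "?E ` Obj C \<union> ?C1 \<union> ?C2 \<subseteq> Obj ?T" using E by auto
  note st' = T.strongly_generated_subclass[OF this]
  have "strongly_generated ?T D \<subseteq> strongly_generated ?T (?E ` Obj C \<union> ?C1 \<union> ?C2)"
    by (rule T.strongly_generated_least[OF st'(1)]) (rule subset_trans[OF sub st'(2)])
  then have "Obj ?T \<subseteq> strongly_generated ?T (?E ` Obj C \<union> ?C1 \<union> ?C2)"
    using S.T_generated[OF S D] by simp
  then show ?thesis by (rule W.extension_if_generated[OF subset_refl subset_refl])
qed

lemma extension_unique: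
  assumes "weighted_embedding C B F w" "weight_extension C w B w1 F" "weight_extension C w B w2 F"
  shows "w1 = w2"
proof -
  interpret weighted_embedding C B F w by (rule assms)
  show ?thesis using extension_weights[OF assms(2)] extension_weights[OF assms(3)] by (intro weight.equality) simp_all
qed

text \<open>An idempotent \<open>e\<close> on \<open>M\<close>, where \<open>M\<close> is a retract
  of a heart object \<open>Y\<close>, gives the idempotent \<open>i \<cdot> e \<cdot> r\<close> on
  \<open>Y\<close>. This splits through \<open>(Y, p)\<close> in the completion of the heart, which
  lies in \<open>S\<close> by \<open>H\<close>, and the splitting is carried over to
  \<open>M\<close>.\<close>

lemma weight_karoubian_tri_sub:
  assumes S: "strict_triangulated_subclass (tri_kar C) S" and E: "\<And>X. X \<in> Obj C \<Longrightarrow> fobj (kar_emb C) X \<in> S"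
    and H: "Obj (kar (heart C w)) \<subseteq> S" and w': "weight_extension C w (tri_sub (tri_kar C) S) w' (kar_emb C)"
  shows "weight_karoubian (tri_sub (tri_kar C) S) w'"
proof -
  interpret K: triangulated_category "tri_kar C" by (rule tri_kar_triangulated)
  interpret S: triangulated_subclass "tri_kar C" S by unfold_locales (rule S)
  interpret W: weighted_embedding C "tri_sub (tri_kar C) S" "kar_emb C" w
    by (rule tri_kar_subclass_embedding[OF S E])
  interpret Emb: exact_embedding C "tri_kar C" "kar_emb C"
    by (rule exact_embeddingI[OF triangulated_category_axioms K.triangulated_category_axioms
          kar_emb_exact kar_emb_fully_faithful])
  let ?T = "tri_sub (tri_kar C) S" and ?K = "tri_kar C" and ?E = "fobj (kar_emb C)"
  interpret W': weighted_category ?T w'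
    by unfold_locales (use w' in \<open>simp add: weight_extension_def\<close>)
  note weq = W.extension_weights(3)[OF w']
  show ?thesis unfolding weight_karoubian_def idempotent_complete_def
  proof (intro ballI impI)
    fix M e assume "M \<in> Obj (heart ?T w')" "e \<in> homs (heart ?T w') M M" and "e \<cdot>\<^bsub>heart ?T w'\<^esub> e = e"
    then have M: "M \<in> weq0 w'" and e: "e \<in> homs ?K M M" "e \<cdot>\<^bsub>?K\<^esub> e = e"
      unfolding heart_def by auto
    have MS: "M \<in> S" using M W'.heart_Obj(2) by auto
    obtain Y where Y: "Y \<in> weq0 w" "retract ?T M (?E Y)" using M unfolding weq by blast
    have YO: "Y \<in> Obj C" using Y(1) heart_Obj(2) by blast
    have "retract ?K M (?E Y)" using Y(2) S.T_retract[OF MS E[OF YO]] by simp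
    then obtain i r where ir: "i \<in> homs ?K M (?E Y)" "r \<in> homs ?K (?E Y) M" "r \<cdot>\<^bsub>?K\<^esub> i = ident ?K M"
      by (rule K.retractE)
    note MO = K.homs_Obj(1)[OF e(1)]
    have "i \<cdot>\<^bsub>?K\<^esub> (e \<cdot>\<^bsub>?K\<^esub> r) \<in> homs ?K (?E Y) (?E Y)"
      using ir(1,2) e(1) by (simp del: tri_kar_simps)
    then obtain p where p: "p \<in> homs C Y Y" "i \<cdot>\<^bsub>?K\<^esub> (e \<cdot>\<^bsub>?K\<^esub> r) = fmor (kar_emb C) p"
      by (rule Emb.full[OF _ YO YO])
    have "fmor (kar_emb C) (p \<cdot> p) = (i \<cdot>\<^bsub>?K\<^esub> (e \<cdot>\<^bsub>?K\<^esub> r)) \<cdot>\<^bsub>?K\<^esub> (i \<cdot>\<^bsub>?K\<^esub> (e \<cdot>\<^bsub>?K\<^esub> r))"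
      unfolding p(2) using p(1) by (intro Emb.fmor_cmp) simp_all
    also have "\<dots> = fmor (kar_emb C) p"
      unfolding p(2)[symmetric] using ir(1,2) e(1)
      by (simp add: K.cmp_ext[OF ir(3)] K.cmp_ext[OF e(2)] del: tri_kar_simps)
    finally have pp: "p \<cdot> p = p" by (rule Emb.faithful) (use p in simp_all)
    let ?N = "(Y, p)"
    have N: "?N \<in> Obj (kar (heart C w))" "?N \<in> Obj (kar C)"
      unfolding Obj_kar_heart using p(1) pp Y(1) by auto
    then have NS: "?N \<in> S" using H by blast
    have "retract ?T ?N (?E Y)"
      using retract_kar_emb[OF category_axioms N(2)] S.T_retract[OF NS E[OF YO]] by simp
    then have NW: "?N \<in> weq0 w'" unfolding weq using Y(1) by blast
    define j where "j = ((Y, p), p, (Y, ident C Y))"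
    define s where "s = ((Y, ident C Y), p, (Y, p))"
    have js: "j \<in> homs ?K ?N (?E Y)" "s \<in> homs ?K (?E Y) ?N" "s \<cdot>\<^bsub>?K\<^esub> j = ident ?K ?N"
      "j \<cdot>\<^bsub>?K\<^esub> s = i \<cdot>\<^bsub>?K\<^esub> (e \<cdot>\<^bsub>?K\<^esub> r)"
      unfolding p(2) j_def s_def using p(1) pp YO by simp_all
    have sj': "s \<cdot>\<^bsub>?K\<^esub> (i \<cdot>\<^bsub>?K\<^esub> (e \<cdot>\<^bsub>?K\<^esub> (r \<cdot>\<^bsub>?K\<^esub> j))) = ident ?K ?N"
    proof -
      have "s \<cdot>\<^bsub>?K\<^esub> (i \<cdot>\<^bsub>?K\<^esub> (e \<cdot>\<^bsub>?K\<^esub> (r \<cdot>\<^bsub>?K\<^esub> j))) = s \<cdot>\<^bsub>?K\<^esub> ((i \<cdot>\<^bsub>?K\<^esub> (e \<cdot>\<^bsub>?K\<^esub> r)) \<cdot>\<^bsub>?K\<^esub> j)"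
        using ir(1,2) e(1) js(1,2) by (simp del: tri_kar_simps)
      also have "\<dots> = (s \<cdot>\<^bsub>?K\<^esub> j) \<cdot>\<^bsub>?K\<^esub> (s \<cdot>\<^bsub>?K\<^esub> j)"
        unfolding js(4)[symmetric] using js(1,2) by (simp del: tri_kar_simps)
      also have "\<dots> = ident ?K ?N" unfolding js(3) using N(2) by simp
      finally show ?thesis .
    qed
    have 1: "(s \<cdot>\<^bsub>?K\<^esub> (i \<cdot>\<^bsub>?K\<^esub> e)) \<cdot>\<^bsub>?K\<^esub> (e \<cdot>\<^bsub>?K\<^esub> (r \<cdot>\<^bsub>?K\<^esub> j)) = ident ?K ?N"
      using ir(1,2) e(1) js(1,2) sj' by (simp add: K.cmp_ext[OF e(2)] del: tri_kar_simps)
    have 2: "(e \<cdot>\<^bsub>?K\<^esub> (r \<cdot>\<^bsub>?K\<^esub> j)) \<cdot>\<^bsub>?K\<^esub> (s \<cdot>\<^bsub>?K\<^esub> (i \<cdot>\<^bsub>?K\<^esub> e)) = e"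
      using ir(1,2) e(1) js(1,2)
      by (simp add: K.cmp_ext[OF js(4)] K.cmp_ext[OF ir(3)] K.cmp_ext[OF e(2)] e(2) del: tri_kar_simps)
    have ty: "e \<cdot>\<^bsub>?K\<^esub> (r \<cdot>\<^bsub>?K\<^esub> j) \<in> homs ?K ?N M" "s \<cdot>\<^bsub>?K\<^esub> (i \<cdot>\<^bsub>?K\<^esub> e) \<in> homs ?K M ?N"
      using ir(1,2) e(1) js(1,2) by (simp_all del: tri_kar_simps)
    show "\<exists>N\<in>Obj (heart ?T w'). \<exists>i\<in>homs (heart ?T w') N M. \<exists>r\<in>homs (heart ?T w') M N.
        r \<cdot>\<^bsub>heart ?T w'\<^esub> i = ident (heart ?T w') N \<and> i \<cdot>\<^bsub>heart ?T w'\<^esub> r = e"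
      by (rule bexI[of _ ?N], rule bexI[of _ "e \<cdot>\<^bsub>?K\<^esub> (r \<cdot>\<^bsub>?K\<^esub> j)"], rule bexI[of _ "s \<cdot>\<^bsub>?K\<^esub> (i \<cdot>\<^bsub>?K\<^esub> e)"])
        (use 1 2 ty M NW MS NS in \<open>simp_all add: heart_def homs_full_sub S.T_homs del: homs_iff tri_kar_simps\<close>)
  qed
qed

lemma weight_karoubian_extension_tri_sub:
  assumes S: "strict_triangulated_subclass (tri_kar C) S" and E: "\<And>X. X \<in> Obj C \<Longrightarrow> fobj (kar_emb C) X \<in> S"
    and H: "Obj (kar (heart C w)) \<subseteq> S" and w': "weight_extension C w (tri_sub (tri_kar C) S) w' (kar_emb C)"
  shows "weight_karoubian_extension C w (tri_sub (tri_kar C) S) w' (kar_emb C)"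
  unfolding weight_karoubian_extension_def
  using weight_karoubian_tri_sub[OF assms] idempotent_extension_tri_sub[OF triangulated_category_axioms S E] w' by blast

lemma kar_w_min_extension:
  "\<exists>!w'. weight_extension C w (kar_w_min C w) w' (kar_emb C)"
  "weight_extension C w (kar_w_min C w) w' (kar_emb C) \<Longrightarrow>
    weight_karoubian_extension C w (kar_w_min C w) w' (kar_emb C)"
proof -
  have "\<exists>w'. weight_extension C w (kar_w_min C w) w' (kar_emb C)"
    unfolding kar_w_eq
  proof (rule extension_exists[OF gen_min_Obj refl emb_min])
    fix K assume K: "K \<in> gen_min"
    obtain X p where [simp]: "K = (X, p)" by (metis prod.exhaust)
    show "K \<in> fobj (kar_emb C) ` Obj C
      \<or> (\<exists>Y \<in> Obj (cat_plus C w) \<union> Obj (cat_minus C w). retract (tri_kar C) K (fobj (kar_emb C) Y))"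
    proof (cases "K \<in> Obj (kar (heart C w))")
      case True
      then have "(X, p) \<in> Obj (kar C)" "X \<in> Obj (cat_plus C w)"
        using weights_bounded(2) by (auto simp: Obj_kar_heart weq0_def)
      then show ?thesis using retract_kar_emb[OF category_axioms] by auto
    qed (use K in \<open>auto simp: gen_min_def\<close>)
  qed
  then show "\<exists>!w'. weight_extension C w (kar_w_min C w) w' (kar_emb C)"
    using extension_unique[OF tri_kar_subclass_embedding[OF strict_min emb_min]] unfolding kar_w_eq by blast
  have H: "Obj (kar (heart C w)) \<subseteq> strongly_generated (tri_kar C) gen_min"
    using min_gen unfolding gen_min_def by blast
  show "weight_extension C w (kar_w_min C w) w' (kar_emb C) \<Longrightarrow>
    weight_karoubian_extension C w (kar_w_min C w) w' (kar_emb C)"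
    unfolding kar_w_eq by (rule weight_karoubian_extension_tri_sub[OF strict_min emb_min H])
qed

lemma kar_w_max_extension:
  "\<exists>!w'. weight_extension C w (kar_w_max C w) w' (kar_emb C)"
  "weight_extension C w (kar_w_max C w) w' (kar_emb C) \<Longrightarrow>
    weight_karoubian_extension C w (kar_w_max C w) w' (kar_emb C)"
proof -
  have "\<exists>w'. weight_extension C w (kar_w_max C w) w' (kar_emb C)"
    unfolding kar_w_eq
  proof (rule extension_exists[OF gen_max_Obj refl emb_max])
    fix K assume K: "K \<in> gen_max"
    obtain X p where [simp]: "K = (X, p)" by (metis prod.exhaust)
    have "(X, p) \<in> Obj (kar C)" "X \<in> Obj (cat_plus C w) \<union> Obj (cat_minus C w)"
      using K unfolding gen_max_def by (auto simp: Obj_kar_plus Obj_kar_minus)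
    then show "K \<in> fobj (kar_emb C) ` Obj C
      \<or> (\<exists>Y \<in> Obj (cat_plus C w) \<union> Obj (cat_minus C w). retract (tri_kar C) K (fobj (kar_emb C) Y))"
      using retract_kar_emb[OF category_axioms] by auto
  qed
  then show "\<exists>!w'. weight_extension C w (kar_w_max C w) w' (kar_emb C)"
    using extension_unique[OF tri_kar_subclass_embedding[OF strict_max emb_max]] unfolding kar_w_eq by blast
  have H: "Obj (kar (heart C w)) \<subseteq> strongly_generated (tri_kar C) gen_max"
    using min_gen kar_min_subset_max unfolding gen_min_def by blast
  show "weight_extension C w (kar_w_max C w) w' (kar_emb C) \<Longrightarrow>
    weight_karoubian_extension C w (kar_w_max C w) w' (kar_emb C)"
    unfolding kar_w_eq by (rule weight_karoubian_extension_tri_sub[OF strict_max emb_max H])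
qed

end

text \<open>An equality of records and not just an equivalence: the idempotents and the absorption
  laws between objects of \<open>S\<close> involve the same arrows in \<open>C\<close> as in
  \<open>full_sub C S\<close>.\<close>

lemma full_sub_tri_kar:
  assumes "S \<subseteq> Obj C"
  shows "full_sub (tri_kar C) (Obj (kar (full_sub C S))) = kar (full_sub C S)"
proof -
  have 1: "(A, f, B) \<in> Arr (full_sub (tri_kar C) (Obj (kar (full_sub C S)))) \<longleftrightarrow> (A, f, B) \<in> Arr (kar (full_sub C S))"
    for A f B
    using assms by (cases A; cases B) (auto simp: kar_Arr Obj_kar_full_sub kar_Obj)
  have "Arr (full_sub (tri_kar C) (Obj (kar (full_sub C S)))) = Arr (kar (full_sub C S))"
    using 1 by (auto simp del: full_sub_simps)
  then show ?thesis
    by (intro acat.equality)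
      (simp_all only: full_sub_simps tri_kar_eq_kar, simp_all add: kar_def Let_def)
qed

section \<open>Comparison of an extension with the idempotent completion\<close>

locale kar_comparison = weighted_embedding A B F w
  for A :: "('o, 'm) tcat" and B :: "('p, 'n) tcat" and F :: "('o, 'm, 'p, 'n) func" and w :: "'o weight" +
  fixes G :: "('p, 'n, 'o \<times> 'm, ('o \<times> 'm) \<times> 'm \<times> ('o \<times> 'm)) func" and \<eta>
  assumes G_exact: "exact_functor B (tri_kar A) G" and G_ff: "fully_faithful B (tri_kar A) G"
    and \<eta>: "natural_iso A (tri_kar A) (comp_func G F) (kar_emb A) \<eta>"
begin

interpretation K: triangulated_category "tri_kar A" by (rule A.tri_kar_triangulated)

interpretation G: exact_embedding B "tri_kar A" G
  by (rule exact_embeddingI[OF B.triangulated_category_axioms K.triangulated_category_axioms G_exact G_ff])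

lemma \<eta>_iso: "Y \<in> Obj A \<Longrightarrow> iso_arr (tri_kar A) (fobj G (fobj F Y)) (fobj (kar_emb A) Y) (\<eta> Y)"
  using \<eta> unfolding natural_iso_def comp_func_def by simp

lemma GF_iso: "Y \<in> Obj A \<Longrightarrow> isomorphic (tri_kar A) (fobj G (fobj F Y)) (fobj (kar_emb A) Y)"
  using \<eta>_iso unfolding isomorphic_def by blast

text \<open>Up to the identification \<open>\<eta>\<close>, both \<open>G M\<close> and
  \<open>(Y, p)\<close> split the same idempotent in the completion, and splittings are unique up to
  isomorphism: include one, project to the other.\<close>

lemma splitting_iso:
  assumes i: "i \<in> homs B M (fobj F Y)" and r: "r \<in> homs B (fobj F Y) M" and ri: "r \<cdot>\<^bsub>B\<^esub> i = ident B M"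
    and p: "p \<in> homs A Y Y" and ir: "i \<cdot>\<^bsub>B\<^esub> r = fmor F p"
  shows "(Y, p) \<in> Obj (kar A)" "isomorphic (tri_kar A) (fobj G M) (Y, p)"
proof -
  let ?K = "tri_kar A" and ?E = "fobj (kar_emb A)" and ?N = "(Y, p)"
  note o = A.homs_Obj(1)[OF p] B.homs_Obj[OF i]
  have "fmor F (p \<cdot>\<^bsub>A\<^esub> p) = (i \<cdot>\<^bsub>B\<^esub> r) \<cdot>\<^bsub>B\<^esub> (i \<cdot>\<^bsub>B\<^esub> r)" unfolding ir using p by simp
  also have "\<dots> = i \<cdot>\<^bsub>B\<^esub> r" using i r by (simp add: B.cmp_ext[OF ri])
  also have "\<dots> = fmor F p" by (rule ir)
  finally have pp: "p \<cdot>\<^bsub>A\<^esub> p = p" by (rule faithful) (use p in simp_all)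
  show N: "?N \<in> Obj (kar A)" using p pp by simp
  obtain \<eta>' where \<eta>': "\<eta>' \<in> homs ?K (?E Y) (fobj G (fobj F Y))" "\<eta>' \<cdot>\<^bsub>?K\<^esub> \<eta> Y = ident ?K (fobj G (fobj F Y))"
    "\<eta> Y \<cdot>\<^bsub>?K\<^esub> \<eta>' = ident ?K (?E Y)"
    using \<eta>_iso[OF o(1)] unfolding iso_arr_def by blast
  note \<eta>h = K.iso_arr_homs[OF \<eta>_iso[OF o(1)]]
  define j where "j = (?N, p, ?E Y)"
  define s where "s = (?E Y, p, ?N)"
  define e where "e = fmor (kar_emb A) p"
  have js: "j \<in> homs ?K ?N (?E Y)" "s \<in> homs ?K (?E Y) ?N" "e \<in> homs ?K (?E Y) (?E Y)"
    "s \<cdot>\<^bsub>?K\<^esub> (e \<cdot>\<^bsub>?K\<^esub> j) = ident ?K ?N" "j \<cdot>\<^bsub>?K\<^esub> s = e"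
    unfolding j_def s_def e_def using p pp o by simp_all
  have nat: "\<eta> Y \<cdot>\<^bsub>?K\<^esub> fmor G (fmor F p) = e \<cdot>\<^bsub>?K\<^esub> \<eta> Y"
    using \<eta> p o(1) unfolding natural_iso_def comp_func_def e_def by fastforce
  have Gi: "fmor G i \<in> homs ?K (fobj G M) (fobj G (fobj F Y))" "fmor G r \<in> homs ?K (fobj G (fobj F Y)) (fobj G M)"
    "fmor G (fmor F p) \<in> homs ?K (fobj G (fobj F Y)) (fobj G (fobj F Y))"
    using G.fmor_simps i r p by (simp_all del: tri_kar_simps)
  have Gir: "fmor G i \<cdot>\<^bsub>?K\<^esub> fmor G r = fmor G (fmor F p)"
    unfolding ir[symmetric] using i r by (intro G.fmor_cmp[symmetric]) simp_all
  have Gri: "fmor G r \<cdot>\<^bsub>?K\<^esub> fmor G i = ident ?K (fobj G M)"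
    using i r o by (simp add: ri del: tri_kar_simps flip: G.fmor_cmp)
  have "iso_arr ?K (fobj G M) ?N (s \<cdot>\<^bsub>?K\<^esub> (\<eta> Y \<cdot>\<^bsub>?K\<^esub> fmor G i))"
  proof (rule K.iso_arrI[where g = "fmor G r \<cdot>\<^bsub>?K\<^esub> (\<eta>' \<cdot>\<^bsub>?K\<^esub> j)"])
    show "(fmor G r \<cdot>\<^bsub>?K\<^esub> (\<eta>' \<cdot>\<^bsub>?K\<^esub> j)) \<cdot>\<^bsub>?K\<^esub> (s \<cdot>\<^bsub>?K\<^esub> (\<eta> Y \<cdot>\<^bsub>?K\<^esub> fmor G i)) = ident ?K (fobj G M)"
    proof -
      have "(fmor G r \<cdot>\<^bsub>?K\<^esub> (\<eta>' \<cdot>\<^bsub>?K\<^esub> j)) \<cdot>\<^bsub>?K\<^esub> (s \<cdot>\<^bsub>?K\<^esub> (\<eta> Y \<cdot>\<^bsub>?K\<^esub> fmor G i))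
          = fmor G r \<cdot>\<^bsub>?K\<^esub> (\<eta>' \<cdot>\<^bsub>?K\<^esub> (e \<cdot>\<^bsub>?K\<^esub> (\<eta> Y \<cdot>\<^bsub>?K\<^esub> fmor G i)))"
        using Gi js(1,2) \<eta>'(1) \<eta>h by (simp add: K.cmp_ext[OF js(5)] del: tri_kar_simps kar_emb_simps)
      also have "\<dots> = fmor G r \<cdot>\<^bsub>?K\<^esub> (\<eta>' \<cdot>\<^bsub>?K\<^esub> (\<eta> Y \<cdot>\<^bsub>?K\<^esub> (fmor G i \<cdot>\<^bsub>?K\<^esub> (fmor G r \<cdot>\<^bsub>?K\<^esub> fmor G i))))"
        using Gi js(3) \<eta>'(1) \<eta>h
        by (simp add: K.cmp_ext[OF Gir] K.cmp_ext[OF nat] del: tri_kar_simps kar_emb_simps)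
      also have "\<dots> = ident ?K (fobj G M)"
        using Gi \<eta>'(1) \<eta>h o by (simp add: K.cmp_ext[OF \<eta>'(2)] Gri del: tri_kar_simps kar_emb_simps)
      finally show ?thesis .
    qed
    show "(s \<cdot>\<^bsub>?K\<^esub> (\<eta> Y \<cdot>\<^bsub>?K\<^esub> fmor G i)) \<cdot>\<^bsub>?K\<^esub> (fmor G r \<cdot>\<^bsub>?K\<^esub> (\<eta>' \<cdot>\<^bsub>?K\<^esub> j)) = ident ?K ?N"
      using Gi js(1-3) \<eta>'(1) \<eta>h K.homs_Obj[OF js(1)]
      by (simp add: K.cmp_ext[OF Gir] K.cmp_ext[OF nat] K.cmp_ext[OF \<eta>'(3)] js(4) del: tri_kar_simps kar_emb_simps)
  qed (use Gi js(1,2) \<eta>'(1) \<eta>h in \<open>simp_all del: tri_kar_simps kar_emb_simps\<close>)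
  then show "isomorphic ?K (fobj G M) ?N" unfolding isomorphic_def by blast
qed

lemma retract_splitting:
  assumes "retract B M (fobj F Y)" "Y \<in> Obj A"
  obtains p where "p \<in> homs A Y Y" "(Y, p) \<in> Obj (kar A)" "isomorphic (tri_kar A) (fobj G M) (Y, p)"
proof -
  obtain i r where ir: "i \<in> homs B M (fobj F Y)" "r \<in> homs B (fobj F Y) M" "r \<cdot>\<^bsub>B\<^esub> i = ident B M"
    using assms(1) by (rule B.retractE)
  have "i \<cdot>\<^bsub>B\<^esub> r \<in> homs B (fobj F Y) (fobj F Y)" using ir by simp
  then obtain p where p: "p \<in> homs A Y Y" "i \<cdot>\<^bsub>B\<^esub> r = fmor F p" by (rule full[OF _ assms(2,2)])
  show thesis by (rule that[OF p(1) splitting_iso[OF ir p]])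
qed

lemma retract_transfer:
  assumes "retract B M (fobj F Y)" "Y \<in> Obj A"
  shows "retract (tri_kar A) (fobj G M) (fobj (kar_emb A) Y)"
  using K.retract_trans[OF G.retract[OF assms(1)] K.isomorphic_retract[OF GF_iso[OF assms(2)]]] .

text \<open>The idempotent \<open>p\<close> acts on the image of \<open>Y\<close>, which belongs to
  the heart of \<open>w'\<close>. There it splits because \<open>w'\<close> is weight-Karoubian, and
  the object obtained corresponds to \<open>(Y, p)\<close>.\<close>

lemma heart_objects_split:
  assumes w': "weight_extension A w B w' F" and wk: "weight_karoubian B w'"
    and N: "(Y, p) \<in> Obj (kar (heart A w))"
  obtains M where "M \<in> weq0 w'" "isomorphic (tri_kar A) (fobj G M) (Y, p)"
proof -
  have Y: "Y \<in> weq0 w" and Np: "(Y, p) \<in> Obj (kar A)" using N W.Obj_kar_heart by blast+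
  then have p: "p \<in> homs A Y Y" "p \<cdot>\<^bsub>A\<^esub> p = p" and YO: "Y \<in> Obj A" by auto
  have FY: "fobj F Y \<in> weq0 w'"
    unfolding extension_weights(3)[OF w'] using Y B.retract_refl[OF fobj_Obj[OF YO]] by blast
  let ?e = "fmor F p"
  have "?e \<in> homs (heart B w') (fobj F Y) (fobj F Y)" "?e \<cdot>\<^bsub>heart B w'\<^esub> ?e = ?e"
    unfolding heart_def using FY p by (simp_all flip: fmor_cmp)
  then obtain M i r where "M \<in> Obj (heart B w')" "i \<in> homs (heart B w') M (fobj F Y)"
    "r \<in> homs (heart B w') (fobj F Y) M" "r \<cdot>\<^bsub>heart B w'\<^esub> i = ident (heart B w') M" "i \<cdot>\<^bsub>heart B w'\<^esub> r = ?e"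
    using wk FY unfolding weight_karoubian_def idempotent_complete_def heart_def by (metis full_sub_simps(1))
  then have M: "M \<in> weq0 w'" "i \<in> homs B M (fobj F Y)" "r \<in> homs B (fobj F Y) M"
    "r \<cdot>\<^bsub>B\<^esub> i = ident B M" "i \<cdot>\<^bsub>B\<^esub> r = ?e" unfolding heart_def by auto
  show thesis by (rule that[OF M(1) splitting_iso(2)[OF M(2-4) p(1) M(5)]])
qed

text \<open>Objects \<open>G M\<close> are in general only isomorphic to pairs \<open>(Y, p)\<close>
  over the heart of \<open>w\<close>. Hence the functor is constructed in the opposite direction,
  inverting \<open>G\<close> on these pairs; it is essentially surjective because each object of the
  heart of \<open>w'\<close> is a retract of an image from the heart of \<open>w\<close>.\<close>

lemma heart_equivalence:
  assumes w': "weight_extension A w B w' F" and wk: "weight_karoubian B w'"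
  shows "equivalent_categories (heart B w') (kar (heart A w))"
proof -
  let ?K = "tri_kar A"
  interpret W': weighted_category B w'
    by unfold_locales (use w' in \<open>simp add: weight_extension_def\<close>)
  let ?H = "heart B w'" and ?S = "Obj (kar (heart A w))"
  note H_def = heart_def[of B w']
  interpret H: additive_category ?H by (rule W'.heart_additive)
  interpret KH: additive_category "kar (heart A w)"
    by (rule additive_category.kar_additive[OF W.heart_additive])
  have WO: "M \<in> weq0 w' \<Longrightarrow> M \<in> Obj B" for M using W'.heart_Obj(2) by blast
  have "additive_functor ?H ?K G"
    unfolding additive_functor_def H_def
    by (intro conjI ballI) (simp_all add: homs_full_sub WO G.fmor_simps del: tri_kar_simps)
  moreover have "fully_faithful ?H ?K G"
    using G_ff WO unfolding fully_faithful_def H_def by (simp add: homs_full_sub)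
  ultimately interpret GH: ff_functor ?H ?K G by unfold_locales
  have sub: "?S \<subseteq> Obj ?K" using W.Obj_kar_heart by auto
  have eq: "full_sub ?K ?S = kar (heart A w)" unfolding heart_def by (rule full_sub_tri_kar[OF W.heart_Obj(2)])
  have ess: "\<exists>M \<in> Obj ?H. isomorphic ?K (fobj G M) N" if "N \<in> ?S" for N
    using heart_objects_split[OF w' wk, of "fst N" "snd N"] that W'.heart_Obj(1) by (metis prod.collapse)
  obtain H \<epsilon> where H: "additive_functor (full_sub ?K ?S) ?H H" "fully_faithful (full_sub ?K ?S) ?H H"
    "\<And>N. N \<in> ?S \<Longrightarrow> fobj H N \<in> Obj ?H" "\<And>N. N \<in> ?S \<Longrightarrow> iso_arr ?K (fobj G (fobj H N)) N (\<epsilon> N)"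
    by (rule GH.inverse_functor[OF sub ess]) (assumption, rule that, assumption+)
  interpret Hf: ff_functor "kar (heart A w)" ?H H
    by unfold_locales (use H(1,2) in \<open>simp_all only: eq\<close>)
  show ?thesis
  proof (rule Hf.equivalent_categories_if_essentially_surjective(2))
    fix M assume "M \<in> Obj ?H"
    then have M: "M \<in> weq0 w'" using W'.heart_Obj(1) by simp
    then obtain Y where Y: "Y \<in> weq0 w" "retract B M (fobj F Y)" unfolding extension_weights(3)[OF w'] by blast
    have YO: "Y \<in> Obj A" using Y(1) W.heart_Obj(2) by blast
    obtain p where p: "(Y, p) \<in> Obj (kar A)" "isomorphic ?K (fobj G M) (Y, p)"
      using retract_splitting[OF Y(2) YO] by blast
    have N: "(Y, p) \<in> ?S" using W.Obj_kar_heart p(1) Y(1) by blast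
    have HN: "fobj H (Y, p) \<in> weq0 w'" using H(3)[OF N] W'.heart_Obj(1) by simp
    have "isomorphic ?K (fobj G (fobj H (Y, p))) (fobj G M)"
      by (rule K.isomorphic_trans[OF _ K.isomorphic_sym[OF p(2)]])
        (unfold isomorphic_def, rule exI[of _ "\<epsilon> (Y, p)"], rule H(4)[OF N])
    then have "isomorphic B (fobj H (Y, p)) M" by (rule G.reflect_isomorphic) (use HN M WO in auto)
    then have "isomorphic ?H (fobj H (Y, p)) M"
      using HN M unfolding isomorphic_def iso_arr_def H_def by (auto simp: homs_full_sub)
    then show "\<exists>N \<in> ?S. isomorphic ?H (fobj H N) M" using N by blast
  qed
qed

text \<open>The two terms of a decomposition for \<open>w'\<close> are, up to a translation,
  retracts of images of objects of \<open>C^-\<close> and \<open>C^+\<close>. In the completion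
  these correspond to generators of \<open>kar_w_max\<close>, and extensions stay inside.\<close>

lemma G_in_kar_w_max:
  assumes w': "weight_extension A w B w' F" and M: "M \<in> Obj B"
  shows "fobj G M \<in> strongly_generated (tri_kar A) W.gen_max"
proof -
  interpret W': weighted_category B w'
    by unfold_locales (use w' in \<open>simp add: weight_extension_def\<close>)
  interpret S: triangulated_subclass "tri_kar A" "strongly_generated (tri_kar A) W.gen_max"
    by unfold_locales (rule W.strict_max)
  have im: "fobj G X \<in> strongly_generated (tri_kar A) W.gen_max"
    if Y: "Y \<in> Obj (cat_minus A w) \<union> Obj (cat_plus A w)" and r: "retract B X (fobj F Y)" for X Y
  proof -
    have "Y \<in> Obj A" using Y W.Obj_cat_plus W.Obj_cat_minus by blast
    then obtain p where p: "(Y, p) \<in> Obj (kar A)" "isomorphic (tri_kar A) (fobj G X) (Y, p)"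
      using retract_splitting[OF r] by blast
    then have "(Y, p) \<in> W.gen_max" unfolding W.gen_max_def using Y W.Obj_kar_minus W.Obj_kar_plus by blast
    then show ?thesis using W.max_gen S.S_iso K.isomorphic_sym[OF p(2)] by blast
  qed
  obtain X Y where XY: "X \<in> wle0 w'" "Y \<in> wge0 w'" "ext B X M (shO B 1 Y)"
    using W'.weight_decomposition[OF M] by blast
  have "X \<in> lower" "Y \<in> upper" using XY(1,2) extension_weights[OF w'] by blast+
  then obtain U V where UV: "U \<in> wle0 w" "retract B X (fobj F U)" "V \<in> wge0 w" "retract B Y (fobj F V)"
    unfolding lower_iff upper_iff by blast
  have GX: "fobj G X \<in> strongly_generated (tri_kar A) W.gen_max" "fobj G Y \<in> strongly_generated (tri_kar A) W.gen_max"
    using im[OF _ UV(2)] im[OF _ UV(4)] W.weights_bounded UV(1,3) by blast+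
  have "fobj G (shO B 1 Y) \<in> strongly_generated (tri_kar A) W.gen_max"
    using S.S_iso[OF S.S_shift[OF GX(2)] K.isomorphic_sym[OF G.shift_iso[OF W'.wge_Obj[OF XY(2)]]]] .
  then show ?thesis using S.S_ext[OF G.ext[OF XY(3)] GX(1)] by blast
qed

lemma embedding_into_kar_w_max:
  assumes "weight_extension A w B w' F"
  shows "fully_faithful B (kar_w_max A w) G" "exact_functor B (kar_w_max A w) G"
    "weight_extension A w (kar_w_max A w) wmax (kar_emb A) \<Longrightarrow> weight_exact B w' (kar_w_max A w) wmax G"
proof -
  let ?S = "strongly_generated (tri_kar A) W.gen_max"
  interpret S: triangulated_subclass "tri_kar A" ?S by unfold_locales (rule W.strict_max)
  note GS = G_in_kar_w_max[OF assms]
  show ff': "fully_faithful B (kar_w_max A w) G" and ex': "exact_functor B (kar_w_max A w) G"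
    using S.corestriction[OF B.triangulated_category_axioms G_exact GS] G_ff unfolding W.kar_w_eq by blast+
  assume wmax: "weight_extension A w (kar_w_max A w) wmax (kar_emb A)"
  interpret Em: weighted_embedding A "tri_sub (tri_kar A) ?S" "kar_emb A" w
    by (rule W.tri_kar_subclass_embedding[OF W.strict_max W.emb_max])
  have tr: "retract (tri_sub (tri_kar A) ?S) (fobj G M) (fobj (kar_emb A) Y)"
    if "retract B M (fobj F Y)" "Y \<in> Obj A" for M Y
    using retract_transfer[OF that] S.T_retract[OF GS W.emb_max[OF that(2)]] B.retract_Obj(1)[OF that(1)] by blast
  have "fobj G ` wle0 w' \<subseteq> wle0 wmax" "fobj G ` wge0 w' \<subseteq> wge0 wmax"
    unfolding extension_weights[OF assms] Em.extension_weights[OF wmax[unfolded W.kar_w_eq]]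
      lower_def upper_def Em.lower_def Em.upper_def
    using tr W.wle_Obj W.wge_Obj by blast+
  then show "weight_exact B w' (kar_w_max A w) wmax G" unfolding weight_exact_def using ex' by blast
qed

text \<open>The essential image of \<open>G\<close> is a strict triangulated subclass. It contains
  the image of \<open>C\<close>, and for a weight-Karoubian \<open>w'\<close> also the pairs over
  the heart; so it contains all of \<open>kar_w_min\<close>, where \<open>G\<close> can be inverted.
  Weight-exactness holds since retracts of images are transferred and then reflected by
  \<open>G\<close>.\<close>

lemma kar_w_min_embedding:
  assumes w': "weight_extension A w B w' F" and wk: "weight_karoubian B w'"
  obtains H where "fully_faithful (kar_w_min A w) B H" "exact_functor (kar_w_min A w) B H"
    "\<And>wmin. weight_extension A w (kar_w_min A w) wmin (kar_emb A) \<Longrightarrow> weight_exact (kar_w_min A w) wmin B w' H"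
proof -
  interpret W': weighted_category B w'
    by unfold_locales (use w' in \<open>simp add: weight_extension_def\<close>)
  let ?S = "strongly_generated (tri_kar A) W.gen_min"
  interpret S: triangulated_subclass "tri_kar A" ?S by unfold_locales (rule W.strict_min)
  have "W.gen_min \<subseteq> {K. \<exists>X \<in> Obj B. isomorphic (tri_kar A) (fobj G X) K}"
  proof
    fix K assume K: "K \<in> W.gen_min"
    obtain Y p where [simp]: "K = (Y, p)" by (metis prod.exhaust)
    show "K \<in> {K. \<exists>X \<in> Obj B. isomorphic (tri_kar A) (fobj G X) K}"
    proof (cases "K \<in> Obj (kar (heart A w))")
      case True
      then show ?thesis using heart_objects_split[OF w' wk, of Y p] W'.heart_Obj(2) by auto
    next
      case False
      then obtain X where "X \<in> Obj A" "K = fobj (kar_emb A) X" using K unfolding W.gen_min_def by blast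
      then show ?thesis using GF_iso fobj_Obj by blast
    qed
  qed
  then have ess: "\<exists>X \<in> Obj B. isomorphic (tri_kar A) (fobj G X) K" if "K \<in> ?S" for K
    using K.strongly_generated_least[OF G.essential_image_strict] that by blast
  obtain H where H: "exact_functor (tri_sub (tri_kar A) ?S) B H" "fully_faithful (tri_sub (tri_kar A) ?S) B H"
    "\<And>K. K \<in> ?S \<Longrightarrow> fobj H K \<in> Obj B" "\<And>K. K \<in> ?S \<Longrightarrow> isomorphic (tri_kar A) (fobj G (fobj H K)) K"
    using G.inverse_exact_functor[OF W.strict_min ess] by blast
  interpret Em: weighted_embedding A "tri_sub (tri_kar A) ?S" "kar_emb A" w
    by (rule W.tri_kar_subclass_embedding[OF W.strict_min W.emb_min])
  have tr: "retract B (fobj H K) (fobj F Y)"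
    if r: "retract (tri_sub (tri_kar A) ?S) K (fobj (kar_emb A) Y)" and Y: "Y \<in> Obj A" for K Y
  proof -
    have KS: "K \<in> ?S" using Em.B.retract_Obj(1)[OF r] by simp
    have "retract (tri_kar A) K (fobj (kar_emb A) Y)" using r S.T_retract[OF KS W.emb_min[OF Y]] by simp
    then have "retract (tri_kar A) (fobj G (fobj H K)) (fobj G (fobj F Y))"
      using K.retract_trans K.isomorphic_retract H(4)[OF KS] K.isomorphic_sym[OF GF_iso[OF Y]] by blast
    then show ?thesis using G.reflect_retract H(3)[OF KS] fobj_Obj[OF Y] by blast
  qed
  have "weight_exact (kar_w_min A w) wmin B w' H"
    if wmin: "weight_extension A w (kar_w_min A w) wmin (kar_emb A)" for wmin
  proof -
    have "fobj H ` wle0 wmin \<subseteq> wle0 w'" "fobj H ` wge0 wmin \<subseteq> wge0 w'"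
      unfolding extension_weights[OF w'] Em.extension_weights[OF wmin[unfolded W.kar_w_eq]]
        lower_def upper_def Em.lower_def Em.upper_def
      using tr W.wle_Obj W.wge_Obj by blast+
    then show ?thesis unfolding weight_exact_def W.kar_w_eq using H(1) by blast
  qed
  then show thesis using that H(1,2) unfolding W.kar_w_eq by blast
qed

end

theorem theorem2p2p2:
  fixes C :: "('o, 'm) tcat" and w :: "'o weight"
    and C' :: "('p, 'n) tcat" and J :: "('o, 'm, 'p, 'n) func"
  assumes "triangulated_category C"
    and "weight_structure C w"
    and "idempotent_extension C C' J"
  shows "
      (\<forall>w'. weight_extension C w C' w' J \<longrightarrow>
           wle0 w' = retraction_closure C' (fobj J ` wle0 w)
         \<and> wge0 w' = retraction_closure C' (fobj J ` wge0 w)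
         \<and> weq0 w' = retraction_closure C' (fobj J ` weq0 w))
    \<and> ((\<exists>w'. weight_extension C w C' w' J) \<longleftrightarrow>
         (\<exists>C1 C2.
             C1 \<subseteq> {X \<in> Obj C'. \<exists>Y \<in> Obj (cat_plus C w). retract C' X (fobj J Y)}
           \<and> C2 \<subseteq> {X \<in> Obj C'. \<exists>Y \<in> Obj (cat_minus C w). retract C' X (fobj J Y)}
           \<and> strongly_generated C' (fobj J ` Obj C \<union> C1 \<union> C2) = Obj C'))
    \<and> (\<forall>w'. weight_extension C w C' w' J \<longrightarrow>
           (bounded_below C' w' \<longleftrightarrow> bounded_below C w)
         \<and> (bounded_above C' w' \<longleftrightarrow> bounded_above C w))
    \<and> (bounded_below C w \<or> bounded_above C w \<longrightarrow> (\<exists>w'. weight_extension C w C' w' J))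
    \<and> (Obj (kar_w_min C w) \<subseteq> Obj (kar_w_max C w)
         \<and> (\<exists>!w'. weight_extension C w (kar_w_min C w) w' (kar_emb C))
         \<and> (\<forall>w'. weight_extension C w (kar_w_min C w) w' (kar_emb C)
               \<longrightarrow> weight_karoubian_extension C w (kar_w_min C w) w' (kar_emb C))
         \<and> (\<exists>!w'. weight_extension C w (kar_w_max C w) w' (kar_emb C))
         \<and> (\<forall>w'. weight_extension C w (kar_w_max C w) w' (kar_emb C)
               \<longrightarrow> weight_karoubian_extension C w (kar_w_max C w) w' (kar_emb C)))
    \<and> (\<forall>w'. weight_karoubian_extension C w C' w' J \<longrightarrow>
           equivalent_categories (heart C' w') (kar (heart C w)))
    \<and> ((\<exists>w'. weight_extension C w C' w' J) \<longrightarrow>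
         (\<exists>F. fully_faithful C' (kar_w_max C w) F \<and> exact_functor C' (kar_w_max C w) F
           \<and> (\<forall>w' wmax. weight_extension C w C' w' J
                 \<and> weight_extension C w (kar_w_max C w) wmax (kar_emb C)
                 \<longrightarrow> weight_exact C' w' (kar_w_max C w) wmax F)))
    \<and> (\<forall>w'. weight_karoubian_extension C w C' w' J \<longrightarrow>
         (\<exists>F. fully_faithful (kar_w_min C w) C' F \<and> exact_functor (kar_w_min C w) C' F
           \<and> (\<forall>wmin. weight_extension C w (kar_w_min C w) wmin (kar_emb C)
                 \<longrightarrow> weight_exact (kar_w_min C w) wmin C' w' F)))"
proof -
  interpret W: weighted_category C w
    by (intro weighted_category.intro weighted_category_axioms.intro assms)
  obtain G \<eta> where G: "exact_functor C' (tri_kar C) G" "fully_faithful C' (tri_kar C) G"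
    "natural_iso C (tri_kar C) (comp_func G J) (kar_emb C) \<eta>"
    using assms(3) unfolding idempotent_extension_def naturally_isomorphic_def by blast
  interpret J: weighted_embedding C C' J w
    by (rule weighted_embedding.intro[OF idempotent_extension_embedding[OF assms(3)] W.weighted_category_axioms])
  interpret kar_comparison C C' J w G \<eta>
    by (intro kar_comparison.intro kar_comparison_axioms.intro J.weighted_embedding_axioms G)
  have rc: "retraction_closure C' (fobj J ` D) = {X. \<exists>Y \<in> D. retract C' X (fobj J Y)}" if "D \<subseteq> Obj C" for D
  proof -
    have "fobj J ` D \<subseteq> Obj C'" using that J.fobj_Obj by blast
    then show ?thesis using J.B.retraction_closure_eq[of "fobj J ` D"] by simp
  qed
  have sub: "wle0 w \<subseteq> Obj C" "wge0 w \<subseteq> Obj C" "weq0 w \<subseteq> Obj C"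
    using W.wle_Obj W.wge_Obj W.heart_Obj(2) by blast+
  show ?thesis
  proof (intro conjI allI impI)
    fix w' assume w': "weight_extension C w C' w' J"
    show "wle0 w' = retraction_closure C' (fobj J ` wle0 w)" "wge0 w' = retraction_closure C' (fobj J ` wge0 w)"
      "weq0 w' = retraction_closure C' (fobj J ` weq0 w)"
      using J.extension_weights[OF w'] unfolding rc[OF sub(1)] rc[OF sub(2)] rc[OF sub(3)] J.lower_def J.upper_def .
    show "bounded_below C' w' \<longleftrightarrow> bounded_below C w" "bounded_above C' w' \<longleftrightarrow> bounded_above C w"
      by (rule J.extension_bounded[OF w'])+
  next
    show "(\<exists>w'. weight_extension C w C' w' J) \<longleftrightarrow>
         (\<exists>C1 C2.
             C1 \<subseteq> {X \<in> Obj C'. \<exists>Y \<in> Obj (cat_plus C w). retract C' X (fobj J Y)}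
           \<and> C2 \<subseteq> {X \<in> Obj C'. \<exists>Y \<in> Obj (cat_minus C w). retract C' X (fobj J Y)}
           \<and> strongly_generated C' (fobj J ` Obj C \<union> C1 \<union> C2) = Obj C')"
    proof
      \<comment> \<open>The witnesses for \<open>C1\<close> and \<open>C2\<close> are the largest
        admissible classes, consisting of all retracts.\<close>
      assume "\<exists>w'. weight_extension C w C' w' J"
      then show "\<exists>C1 C2.
             C1 \<subseteq> {X \<in> Obj C'. \<exists>Y \<in> Obj (cat_plus C w). retract C' X (fobj J Y)}
           \<and> C2 \<subseteq> {X \<in> Obj C'. \<exists>Y \<in> Obj (cat_minus C w). retract C' X (fobj J Y)}
           \<and> strongly_generated C' (fobj J ` Obj C \<union> C1 \<union> C2) = Obj C'"
        using J.generated_if_extension by (elim exE) (intro exI conjI, rule subset_refl, rule subset_refl)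
    next
      assume "\<exists>C1 C2.
             C1 \<subseteq> {X \<in> Obj C'. \<exists>Y \<in> Obj (cat_plus C w). retract C' X (fobj J Y)}
           \<and> C2 \<subseteq> {X \<in> Obj C'. \<exists>Y \<in> Obj (cat_minus C w). retract C' X (fobj J Y)}
           \<and> strongly_generated C' (fobj J ` Obj C \<union> C1 \<union> C2) = Obj C'"
      then show "\<exists>w'. weight_extension C w C' w' J"
        by (elim exE conjE) (rule J.extension_if_generated, assumption+, simp)
    qed
  next
    show "\<exists>w'. weight_extension C w C' w' J" if "bounded_below C w \<or> bounded_above C w"
      by (rule J.extension_if_bounded[OF that])
    show "Obj (kar_w_min C w) \<subseteq> Obj (kar_w_max C w)"
      using W.kar_min_subset_max unfolding W.kar_w_eq by (simp add: tri_sub_def Let_def)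
  next
    show "\<exists>!w'. weight_extension C w (kar_w_min C w) w' (kar_emb C)"
      "\<exists>!w'. weight_extension C w (kar_w_max C w) w' (kar_emb C)"
      by (rule W.kar_w_min_extension(1), rule W.kar_w_max_extension(1))
    show "weight_karoubian_extension C w (kar_w_min C w) w' (kar_emb C)"
      if "weight_extension C w (kar_w_min C w) w' (kar_emb C)" for w'
      by (rule W.kar_w_min_extension(2)[OF that])
    show "weight_karoubian_extension C w (kar_w_max C w) w' (kar_emb C)"
      if "weight_extension C w (kar_w_max C w) w' (kar_emb C)" for w'
      by (rule W.kar_w_max_extension(2)[OF that])
  next
    fix w' assume "weight_karoubian_extension C w C' w' J"
    then have w': "weight_extension C w C' w' J" "weight_karoubian C' w'"
      unfolding weight_karoubian_extension_def by blast+
    show "equivalent_categories (heart C' w') (kar (heart C w))" by (rule heart_equivalence[OF w'])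
    show "\<exists>F. fully_faithful (kar_w_min C w) C' F \<and> exact_functor (kar_w_min C w) C' F
           \<and> (\<forall>wmin. weight_extension C w (kar_w_min C w) wmin (kar_emb C)
                 \<longrightarrow> weight_exact (kar_w_min C w) wmin C' w' F)"
      using kar_w_min_embedding[OF w'] by metis
  next
    assume "\<exists>w'. weight_extension C w C' w' J"
    then show "\<exists>F. fully_faithful C' (kar_w_max C w) F \<and> exact_functor C' (kar_w_max C w) F
           \<and> (\<forall>w' wmax. weight_extension C w C' w' J
                 \<and> weight_extension C w (kar_w_max C w) wmax (kar_emb C)
                 \<longrightarrow> weight_exact C' w' (kar_w_max C w) wmax F)"
      using embedding_into_kar_w_max by metis
  qed
qed

end
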